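(* Let $K$ be a number field, and let $\mathbf{C}=(C_v)_v$ be a tuple of real numbers indexed by all places $v$ of $K$ such that $C_v>0$ for all $v$ and $C_v=1$ for all but finitely many $v$. Let $S$ denote the finite set of places of $K$ consisting of all archimedean places and all finite places $v$ with $C_v>1$. Then there exists $\epsilon>0$ such that no element $\alpha\in K^{\mathrm{cycl}}$ simultaneously satisfies the following three conditions: (i) for some $v_0\in S$, $C_{v_0}<\sup_{w_0\mid v_0}|\alpha|_{w_0}<C_{v_0}+\epsilon$; (ii) for all $v\in S$ and all $w\mid v$, $|\alpha|_w<C_v+\epsilon$; (iii) for all places $v\notin S$ of $K$ and all $w\mid v$, $|\alpha|_w\le 1$.
   Context: For a number field $K$, $K^{\mathrm{cycl}}$ denotes the compositum of $K$ with the maximal abelian extension of $\mathbb{Q}$, i.e. the field generated over $K$ by all roots of unity. Here $w$ and $w_0$ range over places of $K^{\mathrm{cycl}}$ above the indicated places of $K$. The absolute value at a place is normalized so that its restriction to $\mathbb{Q}$ is the usual archimedean or $p$-adic absolute value, so that for $w$ above $v$, $|\cdot|_w$ extends $|\cdot|_v$. *)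

theory Defs
  imports
    Complex_Main
    "HOL-Library.FuncSet"
    "HOL-Computational_Algebra.Computational_Algebra"
begin

text \<open>
  All fields are subfields of one ambient algebraically closed field of characteristic 0,
  such as the complex numbers or an algebraic closure of a given number field.
\<close>

definition is_subfield :: "'a :: field set \<Rightarrow> bool" where
  "is_subfield L \<longleftrightarrow> 0 \<in> L \<and> 1 \<in> L \<and> (\<forall>x\<in>L. \<forall>y\<in>L. x - y \<in> L) \<and>
     (\<forall>x\<in>L. \<forall>y\<in>L. x * y \<in> L) \<and> (\<forall>x\<in>L. inverse x \<in> L)"

definition number_field :: "'a :: field_char_0 set \<Rightarrow> bool" where
  "number_field K \<longleftrightarrow> is_subfield K \<and>
     (\<exists>B. finite B \<and> K = module.span (\<lambda>(q::rat) x. of_rat q * x) B)"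

definition cyclotomic_closure :: "'a :: field set \<Rightarrow> 'a set" where
  "cyclotomic_closure K = is_subfield hull (K \<union> {\<zeta>. \<exists>n>0. \<zeta> ^ n = 1})"

text \<open>
  Absolute values on \<open>L\<close> are made \<open>undefined\<close> outside \<open>L\<close>, so that equality of functions
  is equality of absolute values on \<open>L\<close>.
\<close>

definition absolute_values :: "'a :: field set \<Rightarrow> ('a \<Rightarrow> real) set" where
  "absolute_values L = {f \<in> extensional L.
     (\<forall>x\<in>L. 0 \<le> f x) \<and> (\<forall>x\<in>L. f x = 0 \<longleftrightarrow> x = 0) \<and>
     (\<forall>x\<in>L. \<forall>y\<in>L. f (x * y) = f x * f y) \<and>
     (\<forall>x\<in>L. \<forall>y\<in>L. f (x + y) \<le> f x + f y)}"

definition nontrivial_absolute_values :: "'a :: field set \<Rightarrow> ('a \<Rightarrow> real) set" where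
  "nontrivial_absolute_values L =
     {f \<in> absolute_values L. \<exists>x\<in>L. x \<noteq> 0 \<and> f x \<noteq> 1}"

definition absolute_value_equiv :: "'a :: field set \<Rightarrow> (('a \<Rightarrow> real) \<times> ('a \<Rightarrow> real)) set" where
  "absolute_value_equiv L = {(f, g).
     f \<in> nontrivial_absolute_values L \<and> g \<in> nontrivial_absolute_values L \<and>
     (\<exists>s>0. \<forall>x\<in>L. g x = f x powr s)}"

type_synonym 'a place = "('a \<Rightarrow> real) set"

definition places :: "'a :: field set \<Rightarrow> 'a place set" where
  "places L = nontrivial_absolute_values L // absolute_value_equiv L"

definition archimedean_place :: "'a :: field set \<Rightarrow> 'a place \<Rightarrow> bool" where
  "archimedean_place L v \<longleftrightarrow> (\<exists>f\<in>v. \<exists>x\<in>L. \<exists>y\<in>L. f (x + y) > max (f x) (f y))"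

definition places_above :: "'a :: field set \<Rightarrow> 'a set \<Rightarrow> 'a place \<Rightarrow> 'a place set" where
  "places_above K L v = {w \<in> places L. (\<lambda>f. restrict f K) ` w \<subseteq> v}"

definition padic_abs :: "nat \<Rightarrow> rat \<Rightarrow> real" where
  "padic_abs p q = (if q = 0 then 0 else
     real p powi (int (multiplicity (int p) (snd (quotient_of q)))
                  - int (multiplicity (int p) (fst (quotient_of q)))))"

definition normalized_abs :: "('a :: field_char_0 \<Rightarrow> real) \<Rightarrow> bool" where
  "normalized_abs f \<longleftrightarrow>
     (\<forall>q::rat. f (of_rat q) = \<bar>real_of_rat q\<bar>) \<or>
     (\<exists>p. prime p \<and> (\<forall>q::rat. f (of_rat q) = padic_abs p q))"

text \<open>
  For a subfield \<open>L\<close> algebraic over the rationals, every place of \<open>L\<close> contains exactly one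
  normalized absolute value, by Ostrowski's theorem.
\<close>

definition place_abs :: "'a :: field_char_0 place \<Rightarrow> 'a \<Rightarrow> real" where
  "place_abs v = (THE f. f \<in> v \<and> normalized_abs f)"

end

(*
Suppose that for every n some xs n violates the statement with epsilon = 1/(n+1). All conjugates of the xs n
are bounded and they have a bounded denominator, so by the method of Cassels and Loxton each xs n is a sum of a
bounded number of roots of unity with coefficients in a fixed finite set; on a subsequence the
coefficients are constant. Automorphisms of K^cycl over K permute the places above v0, and they raise the roots
of unity to almost arbitrary powers s that are 1 modulo a fixed M. After reducing to roots of unity without
relations of bounded order, these powers equidistribute. At an archimedean place the mean values of |xs n|^(2k)
over s bound the supremum of the limiting trigonometric polynomial by C; at a nonarchimedean place a
Vandermonde argument bounds the absolute value of every coefficient by C. Either way |xs n| <= C at places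
where it should exceed C.
*)
theory Submission
  imports Defs "HOL-Number_Theory.Cong"
begin

section \<open>Polynomials over a subfield and extension of homomorphisms\<close>

text \<open>Everything ends in a clash between a fixed gap and 1/(n+1), and finiteness supplies the
  gap. For a fixed prime p an algebraic number takes only finitely many values under the p-adic
  absolute values of the field, so a coefficient larger than C is larger by a uniform amount. At
  archimedean places the embedded coefficients can be made constant, so in the limit one
  trigonometric polynomial is bounded by C on the whole torus, in particular at a point that comes
  from some \<open>xs n\<close>. Square means say nothing about a nonarchimedean maximum; there
  finitely many exponents in arithmetic progression suffice, and the ratios of the roots of unity
  only have to avoid bounded order. The method of Cassels and Loxton needs integral combinations of
  roots of unity, hence the ring of integers of a cyclotomic field. It concerns the field of all
  roots of unity; K is reached by adjoining generators and recovering coefficients by Lagrange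
  interpolation. The ambient field need not be the complex one, so conjugates enter through
  embeddings, and archimedean absolute values have to be shown to come from them.\<close>

definition hom_on :: "'a::field set \<Rightarrow> ('a \<Rightarrow> 'b::field) \<Rightarrow> bool" where
  "hom_on L t \<longleftrightarrow> t 1 = 1 \<and> (\<forall>x\<in>L. \<forall>y\<in>L. t (x + y) = t x + t y \<and> t (x * y) = t x * t y)"

definition pol :: "'a::zero set \<Rightarrow> 'a poly set" where
  "pol L = {p. \<forall>i. coeff p i \<in> L}"

definition minpol :: "'a::field set \<Rightarrow> 'a \<Rightarrow> 'a poly \<Rightarrow> bool" where
  "minpol L x P \<longleftrightarrow> P \<in> pol L \<and> lead_coeff P = 1 \<and> poly P x = 0 \<and>
     (\<forall>Q\<in>pol L. Q \<noteq> 0 \<longrightarrow> poly Q x = 0 \<longrightarrow> degree P \<le> degree Q)"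

definition alg_over :: "'a::field set \<Rightarrow> 'a \<Rightarrow> bool" where
  "alg_over L x \<longleftrightarrow> (\<exists>Q\<in>pol L. Q \<noteq> 0 \<and> poly Q x = 0)"

definition adj :: "'a::field set \<Rightarrow> 'a \<Rightarrow> 'a set" where
  "adj L x = is_subfield hull (insert x L)"

lemma polD: "p \<in> pol L \<Longrightarrow> coeff p i \<in> L" by (simp add: pol_def)

lemma pol_mono: "L \<subseteq> L' \<Longrightarrow> pol L \<subseteq> pol L'" by (auto simp: pol_def)

lemma alg_over_mono: "L \<subseteq> L' \<Longrightarrow> alg_over L x \<Longrightarrow> alg_over L' x"
  using pol_mono unfolding alg_over_def by blast

section \<open>Arithmetic of polynomials with coefficients in a subfield\<close>

locale subfield_of =
  fixes L :: "'a::field set"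
  assumes sf: "is_subfield L"
begin

lemma zero [simp, intro]: "0 \<in> L" and one [simp, intro]: "1 \<in> L"
  using sf by (auto simp: is_subfield_def)

lemma diff [intro]: "x \<in> L \<Longrightarrow> y \<in> L \<Longrightarrow> x - y \<in> L"
  and mult [intro]: "x \<in> L \<Longrightarrow> y \<in> L \<Longrightarrow> x * y \<in> L"
  and inv [intro]: "x \<in> L \<Longrightarrow> inverse x \<in> L"
  using sf by (auto simp: is_subfield_def)

lemma uminus [intro]: "x \<in> L \<Longrightarrow> - x \<in> L"
  using diff[of 0 x] by simp

lemma add [intro]: "x \<in> L \<Longrightarrow> y \<in> L \<Longrightarrow> x + y \<in> L"
  using diff[of x "- y"] uminus by simp

lemma divide [intro]: "x \<in> L \<Longrightarrow> y \<in> L \<Longrightarrow> x / y \<in> L"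
  by (auto simp: divide_inverse)

lemma power [intro]: "x \<in> L \<Longrightarrow> x ^ n \<in> L"
  by (induction n) auto

lemma powi [intro]: "x \<in> L \<Longrightarrow> x powi n \<in> L"
  by (auto simp: power_int_def)

lemma sum [intro]: "(\<And>i. i \<in> A \<Longrightarrow> f i \<in> L) \<Longrightarrow> sum f A \<in> L"
  by (induction A rule: infinite_finite_induct) auto

lemma prod [intro]: "(\<And>i. i \<in> A \<Longrightarrow> f i \<in> L) \<Longrightarrow> prod f A \<in> L"
  by (induction A rule: infinite_finite_induct) auto

lemma of_nat [simp, intro]: "of_nat n \<in> L"
  by (induction n) auto

lemma of_int [simp, intro]: "of_int n \<in> L"
  by (cases n rule: int_cases2) auto

lemma pol_0 [simp, intro]: "0 \<in> pol L" and pol_1 [simp, intro]: "1 \<in> pol L"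
  by (auto simp: pol_def coeff_1)

lemma pol_const [intro]: "c \<in> L \<Longrightarrow> [:c:] \<in> pol L"
  by (auto simp: pol_def coeff_pCons split: nat.split)

lemma pol_add [intro]: "p \<in> pol L \<Longrightarrow> q \<in> pol L \<Longrightarrow> p + q \<in> pol L"
  and pol_diff [intro]: "p \<in> pol L \<Longrightarrow> q \<in> pol L \<Longrightarrow> p - q \<in> pol L"
  and pol_mult [intro]: "p \<in> pol L \<Longrightarrow> q \<in> pol L \<Longrightarrow> p * q \<in> pol L"
  and pol_smult [intro]: "c \<in> L \<Longrightarrow> p \<in> pol L \<Longrightarrow> smult c p \<in> pol L"
  and pol_monom [intro]: "c \<in> L \<Longrightarrow> monom c n \<in> pol L"
  and pol_pderiv [intro]: "p \<in> pol L \<Longrightarrow> pderiv p \<in> pol L"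
  by (auto simp: pol_def coeff_mult coeff_pderiv)

lemma pol_X: "[:0, 1:] \<in> pol L"
  by (auto simp: pol_def coeff_pCons split: nat.split)

lemma poly_in [intro]: "p \<in> pol L \<Longrightarrow> x \<in> L \<Longrightarrow> poly p x \<in> L"
  by (auto simp: poly_altdef pol_def)

text \<open>Quotient and remainder must again have coefficients in \<open>L\<close>, so long
  division is carried out by hand: subtracting \<open>q * m\<close>, with \<open>m\<close> the
  quotient of the leading monomials, cancels the top term of \<open>p\<close>.\<close>

lemma pol_division:
  assumes "p \<in> pol L" "q \<in> pol L" "q \<noteq> 0"
  shows "\<exists>s\<in>pol L. \<exists>r\<in>pol L. p = q * s + r \<and> (r = 0 \<or> degree r < degree q)"
  using assms(1)
proof (induction "degree p" arbitrary: p rule: less_induct)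
  case less
  show ?case
  proof (cases "p = 0 \<or> degree p < degree q")
    case True
    then show ?thesis using less.prems by (intro bexI[of _ 0, OF bexI[of _ p]]) auto
  next
    case False
    define m where "m = monom (lead_coeff p / lead_coeff q) (degree p - degree q)"
    have m: "m \<in> pol L" unfolding m_def using less.prems assms by (auto simp: pol_def)
    have mq: "m \<noteq> 0" using False assms by (auto simp: m_def)
    have "lead_coeff p / lead_coeff q \<noteq> 0" using False assms by auto
    then have mdeg: "degree m = degree p - degree q" by (simp add: m_def degree_monom_eq)
    have dm: "degree (q * m) = degree p"
      using False assms mq mdeg by (simp add: degree_mult_eq)
    have lm: "lead_coeff (q * m) = lead_coeff p"
      using assms mdeg by (simp add: lead_coeff_mult) (simp add: m_def)
    define p' where "p' = p - q * m"
    have p': "p' \<in> pol L" using less.prems m assms by (auto simp: p'_def)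
    have "\<exists>s\<in>pol L. \<exists>r\<in>pol L. p' = q * s + r \<and> (r = 0 \<or> degree r < degree q)"
    proof (cases "degree p' < degree p")
      case True then show ?thesis using less.hyps p' by blast
    next
      case False
      \<comment> \<open>If the degree does not drop, the cancelled top coefficient is the leading
        one, so \<open>p'\<close> is zero; this covers constants.\<close>
      have "degree p' \<le> degree p" unfolding p'_def using dm by (metis degree_diff_le order_refl)
      with False have "degree p' = degree p" by simp
      moreover have "coeff p' (degree p) = 0" using lm dm by (simp add: p'_def)
      ultimately have "p' = 0" by (metis leading_coeff_0_iff)
      then have "p' = q * 0 + 0" by simp
      then show ?thesis using pol_0 by blast
    qed
    then obtain s r where "s \<in> pol L" "r \<in> pol L" "p' = q * s + r" "r = 0 \<or> degree r < degree q" by blast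
    then have "p = q * (s + m) + r" by (simp add: p'_def algebra_simps)
    then show ?thesis using m \<open>s \<in> pol L\<close> \<open>r \<in> pol L\<close> \<open>r = 0 \<or> degree r < degree q\<close> by blast
  qed
qed

text \<open>Extended Euclidean algorithm, with induction on a bound \<open>n\<close> for the degree
  of the second argument. The cofactors \<open>s\<close> and \<open>r\<close> are recorded because
  divisibility has to hold inside \<open>pol L\<close>.\<close>

lemma pol_bezout:
  assumes "p \<in> pol L" "q \<in> pol L" "p \<noteq> 0 \<or> q \<noteq> 0"
  shows "\<exists>g\<in>pol L. \<exists>u\<in>pol L. \<exists>v\<in>pol L. \<exists>s\<in>pol L. \<exists>r\<in>pol L.
           g \<noteq> 0 \<and> g = u * p + v * q \<and> p = g * s \<and> q = g * r"
proof -
  have *: "\<exists>g\<in>pol L. \<exists>u\<in>pol L. \<exists>v\<in>pol L. \<exists>s\<in>pol L. \<exists>r\<in>pol L.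
           g \<noteq> 0 \<and> g = u * p + v * q \<and> p = g * s \<and> q = g * r"
    if "q = 0 \<or> degree q < n" "p \<in> pol L" "q \<in> pol L" "p \<noteq> 0 \<or> q \<noteq> 0" for n p q
    using that
  proof (induction n arbitrary: p q)
    case 0
    then have "p \<noteq> 0" "p = 1 * p + 0 * q" "p = p * 1" "q = p * 0" by auto
    then show ?case using 0 pol_0 pol_1 by blast
  next
    case (Suc n)
    show ?case
    proof (cases "q = 0")
      case True
      then have "p \<noteq> 0" "p = 1 * p + 0 * q" "p = p * 1" "q = p * 0" using Suc by auto
      then show ?thesis using Suc.prems pol_0 pol_1 by blast
    next
      case False
      obtain s r where sr: "s \<in> pol L" "r \<in> pol L" "p = q * s + r" "r = 0 \<or> degree r < degree q"
        using pol_division[OF Suc.prems(2,3) False] by blast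
      then have "r = 0 \<or> degree r < n" using Suc.prems(1) False by auto
      from Suc.IH[OF this Suc.prems(3) sr(2)] False
      obtain g u v s' r' where g: "g \<in> pol L" "u \<in> pol L" "v \<in> pol L" "s' \<in> pol L" "r' \<in> pol L"
        "g \<noteq> 0" "g = u * q + v * r" "q = g * s'" "r = g * r'" by blast
      have e: "g = v * p + (u - v * s) * q" using g(7) sr(3) by (simp add: algebra_simps)
      have "g * (s' * s + r') = (g * s') * s + g * r'" by (simp add: algebra_simps)
      then have e2: "p = g * (s' * s + r')" using sr(3) g(8,9) by metis
      have uv: "u - v * s \<in> pol L" "s' * s + r' \<in> pol L" using g(1-5) sr(1,2) by auto
      show ?thesis using e e2 g(1,3,4,6,8) uv by blast
    qed
  qed
  show ?thesis using *[of q "Suc (degree q)" p] assms by auto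
qed

lemma minpol_exists:
  assumes "alg_over L x"
  shows "\<exists>P. minpol L x P"
proof -
  define A where "A = {Q \<in> pol L. Q \<noteq> 0 \<and> poly Q x = 0}"
  have "\<exists>Q. Q \<in> A" using assms by (auto simp: A_def alg_over_def)
  then obtain Q where Q: "Q \<in> A" "\<And>Q'. Q' \<in> A \<Longrightarrow> degree Q \<le> degree Q'"
    using ex_has_least_nat[of "\<lambda>Q. Q \<in> A" _ degree] by blast
  define P where "P = smult (inverse (lead_coeff Q)) Q"
  have "minpol L x P"
    unfolding minpol_def using Q by (auto simp: P_def A_def intro!: pol_smult inv polD)
  then show ?thesis ..
qed

lemma minpol_dvd:
  assumes "minpol L x P" "Q \<in> pol L" "poly Q x = 0"
  shows "\<exists>S\<in>pol L. Q = P * S"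
proof -
  have P: "P \<in> pol L" "P \<noteq> 0" using assms(1) by (auto simp: minpol_def)
  obtain s r where sr: "s \<in> pol L" "r \<in> pol L" "Q = P * s + r" "r = 0 \<or> degree r < degree P"
    using pol_division[OF assms(2) P] by blast
  have "poly r x = 0" using sr(3) assms by (simp add: minpol_def)
  then have "r = 0" using sr assms(1) by (force simp: minpol_def)
  then show ?thesis using sr by auto
qed

lemma minpol_degree_pos:
  assumes "minpol L x P" shows "degree P > 0"
proof (rule ccontr)
  assume "\<not> degree P > 0"
  then obtain c where "P = [:c:]" by (auto elim!: degree_eq_zeroE)
  then have "P = 1" using assms by (simp add: minpol_def)
  then show False using assms by (simp add: minpol_def)
qed

text \<open>One of the two factors vanishes at \<open>x\<close> and so has at least the degree of
  \<open>P\<close> by minimality; the degrees add up to that of \<open>P\<close>.\<close>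

lemma minpol_irreducible:
  assumes P: "minpol L x P" and Q: "Q \<in> pol L" "R \<in> pol L" "P = Q * R"
  shows "degree Q = 0 \<or> degree Q = degree P"
proof -
  have nz: "P \<noteq> 0" using P by (auto simp: minpol_def)
  then have nz': "Q \<noteq> 0" "R \<noteq> 0" using Q by auto
  have d: "degree P = degree Q + degree R" using nz' Q by (simp add: degree_mult_eq)
  have "poly Q x = 0 \<or> poly R x = 0" using P Q by (auto simp: minpol_def)
  then have "degree P \<le> degree Q \<or> degree P \<le> degree R" using P Q nz' by (auto simp: minpol_def)
  then show ?thesis using d by auto
qed

lemma adj_subfield: "is_subfield (adj L x)"
  and adj_base: "L \<subseteq> adj L x" and adj_elem: "x \<in> adj L x"
proof -
  show "is_subfield (adj L x)" unfolding adj_def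
    by (rule hull_in) (auto simp: is_subfield_def)
  show "L \<subseteq> adj L x" "x \<in> adj L x" unfolding adj_def using hull_subset by fast+
qed

lemma adj_least: "is_subfield M \<Longrightarrow> L \<subseteq> M \<Longrightarrow> x \<in> M \<Longrightarrow> adj L x \<subseteq> M"
  unfolding adj_def by (rule hull_minimal) auto

text \<open>The values at an algebraic element already form a field: if \<open>poly h x\<close> is
  nonzero, the gcd of \<open>P\<close> and \<open>h\<close> is constant, and its Bezout identity
  read at \<open>x\<close> gives the inverse.\<close>

lemma adj_eq:
  assumes P: "minpol L x P"
  shows "adj L x = (\<lambda>h. poly h x) ` pol L"
proof
  let ?A = "(\<lambda>h. poly h x) ` pol L"
  have PL: "P \<in> pol L" "P \<noteq> 0" using P by (auto simp: minpol_def)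
  have "inverse y \<in> ?A" if "y \<in> ?A" for y
  proof (cases "y = 0")
    case True then show ?thesis using that by simp
  next
    case False
    obtain h where h: "h \<in> pol L" "y = poly h x" using \<open>y \<in> ?A\<close> by (elim imageE) auto
    obtain g u v s r where g: "g \<in> pol L" "u \<in> pol L" "v \<in> pol L" "s \<in> pol L" "r \<in> pol L"
        "g \<noteq> 0" "g = u * P + v * h" "P = g * s" "h = g * r"
      using pol_bezout[OF PL(1) h(1)] PL(2) by blast
    have "poly g x \<noteq> 0" using False h(2) g(9) by (metis mult_zero_left poly_mult)
    then have sx: "poly s x = 0" using P g(8) by (auto simp: minpol_def)
    have "s \<noteq> 0" using g(8) PL(2) by (metis mult_zero_right)
    then have "degree P \<le> degree s" using sx g(4) P by (auto simp: minpol_def)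
    moreover have "degree P = degree g + degree s" using g(6,8) \<open>s \<noteq> 0\<close> degree_mult_eq by metis
    ultimately have "degree g = 0" by simp
    then obtain c where c: "g = [:c:]" by (rule degree_eq_zeroE)
    have "c \<noteq> 0" using c g(6) by auto
    have cL: "c \<in> L" using g(1) c polD[of g L 0] by simp
    have "poly (u * P + v * h) x = c" using g(7) c by (metis poly_pCons poly_0 mult_zero_right add.right_neutral)
    then have "poly v x * y = c" using h(2) P by (simp add: minpol_def)
    then have "inverse y = poly (smult (inverse c) v) x" using False \<open>c \<noteq> 0\<close> by (simp add: field_simps)
    moreover have "smult (inverse c) v \<in> pol L" using cL g(3) by auto
    ultimately show ?thesis by blast
  qed
  moreover have "x1 - y1 \<in> ?A \<and> x1 * y1 \<in> ?A" if xy: "x1 \<in> ?A" "y1 \<in> ?A" for x1 y1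
  proof -
    obtain h k where hk: "h \<in> pol L" "k \<in> pol L" "x1 = poly h x" "y1 = poly k x" using xy by blast
    have "x1 - y1 = poly (h - k) x" "x1 * y1 = poly (h * k) x" using hk by auto
    moreover have "h - k \<in> pol L" "h * k \<in> pol L" using hk by auto
    ultimately show ?thesis by blast
  qed
  moreover have "0 \<in> ?A" "1 \<in> ?A" by (force intro: image_eqI[of _ _ 0] image_eqI[of _ _ 1])+
  ultimately have "is_subfield ?A" unfolding is_subfield_def by blast
  moreover have "L \<subseteq> ?A"
  proof
    fix c assume "c \<in> L"
    then show "c \<in> ?A" by (intro image_eqI[of _ _ "[:c:]"]) auto
  qed
  moreover have "x \<in> ?A" using pol_X by (intro image_eqI[of _ _ "[:0,1:]"]) auto
  ultimately show "adj L x \<subseteq> ?A" by (rule adj_least)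
  show "?A \<subseteq> adj L x"
  proof
    fix y assume "y \<in> ?A"
    then obtain h where h: "h \<in> pol L" "y = poly h x" by blast
    interpret A: subfield_of "adj L x" using adj_subfield by unfold_locales
    have "h \<in> pol (adj L x)" using h adj_base pol_mono by blast
    then show "y \<in> adj L x" using h adj_elem by auto
  qed
qed

lemma adj_repr:
  assumes P: "minpol L x P" and y: "y \<in> adj L x"
  shows "\<exists>h\<in>pol L. y = poly h x \<and> degree h < degree P"
proof -
  obtain h where h: "h \<in> pol L" "y = poly h x" using y adj_eq[OF P] by blast
  have PL: "P \<in> pol L" "P \<noteq> 0" using P by (auto simp: minpol_def)
  obtain s r where sr: "s \<in> pol L" "r \<in> pol L" "h = P * s + r" "r = 0 \<or> degree r < degree P"
    using pol_division[OF h(1) PL] by blast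
  have "y = poly r x" using h sr P by (simp add: minpol_def)
  then show ?thesis using sr minpol_degree_pos[OF P] by (intro bexI[of _ r]) auto
qed

end

section \<open>Homomorphisms on subfields and their extensions\<close>

locale field_hom = subfield_of L for L :: "'a::field set" +
  fixes t :: "'a \<Rightarrow> 'b::field"
  assumes hom: "hom_on L t"
begin

lemma h_one [simp]: "t 1 = 1"
  and h_add: "x \<in> L \<Longrightarrow> y \<in> L \<Longrightarrow> t (x + y) = t x + t y"
  and h_mult: "x \<in> L \<Longrightarrow> y \<in> L \<Longrightarrow> t (x * y) = t x * t y"
  using hom by (auto simp: hom_on_def)

lemma h_zero [simp]: "t 0 = 0"
  using h_add[OF zero zero] by (metis add_cancel_right_right add.right_neutral)

lemma h_uminus: "x \<in> L \<Longrightarrow> t (- x) = - t x"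
  using h_add[of x "- x"] by (simp add: uminus eq_neg_iff_add_eq_0 add.commute)

lemma h_diff: "x \<in> L \<Longrightarrow> y \<in> L \<Longrightarrow> t (x - y) = t x - t y"
  using h_add[of x "- y"] h_uminus[of y] by (simp add: uminus)

lemma h_nz: "x \<in> L \<Longrightarrow> x \<noteq> 0 \<Longrightarrow> t x \<noteq> 0"
  using h_mult[of x "inverse x"] by (auto simp: inv)

lemma h_eq0_iff: "x \<in> L \<Longrightarrow> t x = 0 \<longleftrightarrow> x = 0"
  using h_nz by auto

lemma h_inj: "inj_on t L"
  using h_diff h_nz diff by (intro inj_onI) (metis eq_iff_diff_eq_0)

lemma h_inverse: "x \<in> L \<Longrightarrow> t (inverse x) = inverse (t x)"
  using h_mult[of x "inverse x"] h_nz[of x] by (cases "x = 0") (auto simp: inv field_simps)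

lemma h_divide: "x \<in> L \<Longrightarrow> y \<in> L \<Longrightarrow> t (x / y) = t x / t y"
  by (simp add: divide_inverse h_mult h_inverse inv)

lemma h_power: "x \<in> L \<Longrightarrow> t (x ^ n) = t x ^ n"
  by (induction n) (auto simp: h_mult power)

lemma h_powi: "x \<in> L \<Longrightarrow> t (x powi n) = t x powi n"
  by (auto simp: power_int_def h_power h_inverse inv)

lemma h_sum: "(\<And>i. i \<in> A \<Longrightarrow> f i \<in> L) \<Longrightarrow> t (sum f A) = (\<Sum>i\<in>A. t (f i))"
  by (induction A rule: infinite_finite_induct) (auto simp: h_add sum)

lemma h_prod: "(\<And>i. i \<in> A \<Longrightarrow> f i \<in> L) \<Longrightarrow> t (prod f A) = (\<Prod>i\<in>A. t (f i))"
  by (induction A rule: infinite_finite_induct) (auto simp: h_mult prod)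

lemma h_of_nat [simp]: "t (of_nat n) = of_nat n"
  by (induction n) (auto simp: h_add)

lemma h_of_int [simp]: "t (of_int n) = of_int n"
  by (cases n rule: int_cases2) (auto simp: h_uminus)

lemma map_add: "p \<in> pol L \<Longrightarrow> q \<in> pol L \<Longrightarrow> map_poly t (p + q) = map_poly t p + map_poly t q"
  by (rule poly_eqI) (simp add: coeff_map_poly h_add polD)

lemma map_mult: "p \<in> pol L \<Longrightarrow> q \<in> pol L \<Longrightarrow> map_poly t (p * q) = map_poly t p * map_poly t q"
  by (rule poly_eqI) (simp add: coeff_map_poly coeff_mult h_sum h_mult polD mult)

lemma map_diff: "p \<in> pol L \<Longrightarrow> q \<in> pol L \<Longrightarrow> map_poly t (p - q) = map_poly t p - map_poly t q"
  by (rule poly_eqI) (simp add: coeff_map_poly h_diff polD)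

lemma map_degree: "p \<in> pol L \<Longrightarrow> degree (map_poly t p) = degree p"
  by (cases "p = 0") (auto simp: polD h_eq0_iff intro!: map_poly_degree_eq)

lemma map_eq0_iff: "p \<in> pol L \<Longrightarrow> map_poly t p = 0 \<longleftrightarrow> p = 0"
  by (auto simp: poly_eq_iff coeff_map_poly polD h_eq0_iff)

lemma map_poly_eval: "p \<in> pol L \<Longrightarrow> x \<in> L \<Longrightarrow> poly (map_poly t p) (t x) = t (poly p x)"
  by (simp add: poly_altdef map_degree coeff_map_poly h_sum h_mult h_power polD mult power)

lemma image_subfield: "is_subfield (t ` L)"
  unfolding is_subfield_def
proof (intro conjI ballI)
  show "0 \<in> t ` L" "1 \<in> t ` L" by (metis h_zero zero image_eqI, metis h_one one image_eqI)
  fix x assume "x \<in> t ` L"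
  then show "inverse x \<in> t ` L" by (auto simp: h_inverse[symmetric])
  fix y assume "y \<in> t ` L"
  then show "x - y \<in> t ` L" "x * y \<in> t ` L" using \<open>x \<in> t ` L\<close>
    by (auto simp: h_diff[symmetric] h_mult[symmetric])
qed

text \<open>The image of \<open>y\<close> is read off from an arbitrarily chosen polynomial that
  represents it. Two choices differ by a multiple of \<open>P\<close>, which vanishes at
  \<open>z\<close> after transport, so nothing depends on the choice.\<close>

lemma extend:
  assumes P: "minpol L x P" and z: "poly (map_poly t P) z = 0"
  shows "\<exists>t'. hom_on (adj L x) t' \<and> (\<forall>h\<in>pol L. t' (poly h x) = poly (map_poly t h) z)"
proof -
  define t' where "t' = (\<lambda>y. poly (map_poly t (SOME h. h \<in> pol L \<and> poly h x = y)) z)"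
  have wd: "t' (poly h x) = poly (map_poly t h) z" if h: "h \<in> pol L" for h
  proof -
    define k where "k = (SOME k. k \<in> pol L \<and> poly k x = poly h x)"
    have k: "k \<in> pol L" "poly k x = poly h x"
      using someI[of "\<lambda>k. k \<in> pol L \<and> poly k x = poly h x" h] h by (auto simp: k_def)
    have "\<exists>S\<in>pol L. k - h = P * S" using k h by (intro minpol_dvd[OF P]) auto
    then obtain S where S: "S \<in> pol L" "k - h = P * S" by blast
    have "map_poly t k - map_poly t h = map_poly t P * map_poly t S"
      using S P k h by (metis map_diff map_mult minpol_def)
    then have "poly (map_poly t k) z - poly (map_poly t h) z = 0"
      using z by (metis mult_zero_left poly_diff poly_mult)
    then show ?thesis by (simp add: t'_def k_def)
  qed
  have "hom_on (adj L x) t'"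
    unfolding hom_on_def adj_eq[OF P]
  proof (intro conjI ballI)
    show "t' 1 = 1" using wd[of 1] by (simp add: map_poly_1')
    fix u v assume "u \<in> (\<lambda>h. poly h x) ` pol L" "v \<in> (\<lambda>h. poly h x) ` pol L"
    then obtain h k where hk: "h \<in> pol L" "k \<in> pol L" "u = poly h x" "v = poly k x" by blast
    show "t' (u + v) = t' u + t' v" using hk wd[of "h + k"] wd[of h] wd[of k] by (simp add: map_add pol_add)
    show "t' (u * v) = t' u * t' v" using hk wd[of "h * k"] wd[of h] wd[of k] by (simp add: map_mult pol_mult)
  qed
  with wd show ?thesis by blast
qed

lemma extend':
  assumes P: "minpol L x P" and z: "poly (map_poly t P) z = 0"
  shows "\<exists>t'. hom_on (adj L x) t' \<and> (\<forall>y\<in>L. t' y = t y) \<and> t' x = z"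
proof -
  obtain t' where t': "hom_on (adj L x) t'" "\<And>h. h \<in> pol L \<Longrightarrow> t' (poly h x) = poly (map_poly t h) z"
    using extend[OF assms] by blast
  have "t' y = t y" if "y \<in> L" for y
    using t'(2)[OF pol_const[OF that]] by (simp add: map_poly_pCons)
  moreover have "t' x = z" using t'(2)[OF pol_X] by (simp add: map_poly_pCons)
  ultimately show ?thesis using t' by blast
qed

text \<open>A polynomial that kills \<open>z\<close> is pulled back along the injective
  \<open>t\<close>. The image of its gcd with \<open>P\<close> vanishes at \<open>z\<close>, hence
  that gcd is not constant and by irreducibility has the degree of \<open>P\<close>.\<close>

lemma image_minpol:
  assumes P: "minpol L x P" and z: "poly (map_poly t P) z = 0"
  shows "minpol (t ` L) z (map_poly t P)"
  unfolding minpol_def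
proof (intro conjI ballI impI)
  have PL: "P \<in> pol L" "lead_coeff P = 1" using P by (auto simp: minpol_def)
  show "map_poly t P \<in> pol (t ` L)" using PL by (auto simp: pol_def coeff_map_poly)
  show "lead_coeff (map_poly t P) = 1" using PL by (simp add: map_degree coeff_map_poly)
  show "poly (map_poly t P) z = 0" by (rule z)
  fix Q assume Q: "Q \<in> pol (t ` L)" "Q \<noteq> 0" "poly Q z = 0"
  define u where "u = inv_into L t"
  have u: "u c \<in> L" "t (u c) = c" if "c \<in> t ` L" for c
    using that by (auto simp: u_def inv_into_into f_inv_into_f)
  have u0: "u 0 = 0" unfolding u_def using inv_into_f_f[OF h_inj zero] by simp
  define R where "R = map_poly u Q"
  have R: "R \<in> pol L" using Q u u0 by (auto simp: R_def pol_def coeff_map_poly)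
  have RQ: "map_poly t R = Q" using Q u u0
    by (intro poly_eqI) (auto simp: R_def coeff_map_poly pol_def)
  have nz: "R \<noteq> 0" using RQ Q by auto
  obtain g p q s r where g: "g \<in> pol L" "p \<in> pol L" "q \<in> pol L" "s \<in> pol L" "r \<in> pol L"
        "g \<noteq> 0" "g = p * P + q * R" "P = g * s" "R = g * r"
    using pol_bezout[OF PL(1) R] nz by blast
  have "map_poly t g = map_poly t p * map_poly t P + map_poly t q * map_poly t R"
    using g PL R by (metis map_add map_mult pol_mult)
  then have "poly (map_poly t g) z = 0" using z RQ Q by simp
  moreover have "map_poly t g \<noteq> 0" using g(1,6) map_eq0_iff by blast
  moreover have "poly p z \<noteq> 0" if "degree p = 0" "p \<noteq> 0" for p :: "'b poly"
    using that by (elim degree_eq_zeroE) auto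
  ultimately have "degree (map_poly t g) \<noteq> 0" by blast
  then have "degree g = degree P" using minpol_irreducible[OF P g(1,4,8)] g(1) map_degree by simp
  moreover have "degree g \<le> degree R" using g(9) nz by (metis degree_mult_right_le mult_zero_right)
  moreover have "degree R = degree Q" using RQ map_degree[OF R] by simp
  ultimately show "degree (map_poly t P) \<le> degree Q" using map_degree[OF PL(1)] by simp
qed

end

text \<open>In characteristic 0 the derivative of \<open>P\<close> is nonzero of smaller degree, so
  its gcd with the irreducible \<open>P\<close> is constant and no root is repeated. The count
  serves Lagrange interpolation over the conjugates.\<close>

lemma minpol_separable:
  fixes L :: "'a::{alg_closed_field,field_char_0} set"
  assumes L: "is_subfield L" and P: "minpol L x P"
  shows "card {z. poly P z = 0} = degree P"
proof -
  interpret subfield_of L by unfold_locales (rule L)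
  have PL: "P \<in> pol L" "P \<noteq> 0" "lead_coeff P = 1" using P by (auto simp: minpol_def)
  have d: "degree P > 0" using minpol_degree_pos P by blast
  then have dn: "pderiv P \<noteq> 0" "degree (pderiv P) < degree P"
    by (auto simp: pderiv_eq_0_iff degree_pderiv)
  obtain g p q s r where g: "g \<in> pol L" "p \<in> pol L" "q \<in> pol L" "s \<in> pol L" "r \<in> pol L"
        "g \<noteq> 0" "g = p * P + q * pderiv P" "P = g * s" "pderiv P = g * r"
    using pol_bezout[OF PL(1), of "pderiv P"] PL by blast
  have "r \<noteq> 0" using g(9) dn(1) by (intro notI) simp
  then have "degree g \<le> degree (pderiv P)" using g(9) by (metis degree_mult_right_le)
  then have "degree g = 0" using minpol_irreducible[OF P g(1,4,8)] dn by auto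
  then obtain c where c: "g = [:c:]" by (rule degree_eq_zeroE)
  have "c \<noteq> 0" using c g(6) by auto
  have "rsquarefree P"
    unfolding rsquarefree_roots
  proof (intro allI notI, elim conjE)
    fix a assume "poly P a = 0" "poly (pderiv P) a = 0"
    then have "poly g a = 0" using g(7) by simp
    then show False using c \<open>c \<noteq> 0\<close> by simp
  qed
  moreover obtain A where A: "size A = degree P" "P = smult (lead_coeff P) (\<Prod>x\<in>#A. [:-x, 1:])"
    using alg_closed_imp_factorization[OF PL(2)] by blast
  ultimately show ?thesis
  proof -
    have sep: "order a P \<le> 1" for a
      using \<open>rsquarefree P\<close> by (metis rsquarefree_def le_less zero_le_one order_refl)
    have "order a P = count A a" for a
    proof -
      have "order a P = order a (\<Prod>x\<in>#A. [:-x, 1:])" using A(2) PL(3) by simp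
      also have "\<dots> = count A a"
      proof (induction A)
        case empty then show ?case by (simp add: order_0I)
      next
        case (add y A)
        have "(\<Prod>x\<in>#A. [:-x, 1:]) \<noteq> 0" by (auto simp: prod_mset_zero_iff)
        then have "order a (\<Prod>x\<in>#add_mset y A. [:-x, 1:]) = order a [:-y, 1:] + order a (\<Prod>x\<in>#A. [:-x, 1:])"
          by (simp add: order_mult del: mult_pCons_left)
        then show ?case using add order_power_n_n[of a 1] by (auto simp: order_0I)
      qed
      finally show ?thesis .
    qed
    then have "count A a \<le> 1" for a using sep by metis
    then have "A = mset_set (set_mset A)"
      by (intro multiset_eqI) (metis count_mset_set(1,3) count_greater_zero_iff finite_set_mset le_antisym not_gr_zero Suc_leI One_nat_def)
    then have "size A = card (set_mset A)" by (metis size_mset_set)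
    moreover have "{z. poly P z = 0} = set_mset A"
      using A(2) PL by (subst A(2)) (auto simp: poly_prod_mset prod_mset_zero_iff)
    ultimately show ?thesis using A(1) by simp
  qed
qed

text \<open>Zorn's lemma is applied to graphs of partial extensions, since inclusion of graphs says
  at once that domains and maps are compatible. A maximal one is total: the transported minimal
  polynomial of a further element has a root in the algebraically closed target.\<close>

lemma hom_extend_alg_closed:
  fixes t :: "'a::field \<Rightarrow> 'b::alg_closed_field"
  assumes D: "is_subfield D" and L: "is_subfield L" and DL: "D \<subseteq> L"
    and alg: "\<And>x. x \<in> L \<Longrightarrow> alg_over D x" and t: "hom_on D t"
  shows "\<exists>t'. hom_on L t' \<and> (\<forall>x\<in>D. t' x = t x)"
proof -
  define G where "G = (\<lambda>(E, u). (\<lambda>x. (x, u x :: 'b)) ` (E :: 'a set))"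
  define AA where "AA = G ` {(E, u). is_subfield E \<and> D \<subseteq> E \<and> E \<subseteq> L \<and> hom_on E u \<and> (\<forall>x\<in>D. u x = t x)}"
  have ne: "AA \<noteq> {}" unfolding AA_def using D DL t by blast
  have "\<Union>\<C> \<in> AA" if C: "\<C> \<noteq> {}" "subset.chain AA \<C>" for \<C>
  proof -
    define g where "g = \<Union>\<C>"
    define E where "E = fst ` g"
    \<comment> \<open>Any two points of the union lie in one member of the chain, which is enough to
      check functionality, the field axioms and the homomorphism laws.\<close>
    have two: "\<exists>E u. is_subfield E \<and> D \<subseteq> E \<and> E \<subseteq> L \<and> hom_on E u \<and> (\<forall>x\<in>D. u x = t x) \<and> G (E, u) \<subseteq> g \<and>
        a \<in> G (E, u) \<and> b \<in> G (E, u)" if ab: "a \<in> g" "b \<in> g" for a b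
    proof -
      obtain X Y where XY: "X \<in> \<C>" "Y \<in> \<C>" "a \<in> X" "b \<in> Y" using ab by (auto simp: g_def)
      have "X \<subseteq> Y \<or> Y \<subseteq> X" using C XY by (auto simp: subset.chain_def)
      then obtain Z where Z: "Z \<in> \<C>" "a \<in> Z" "b \<in> Z" using XY by blast
      then have "Z \<in> AA" using C by (auto simp: subset.chain_def)
      then show ?thesis using Z unfolding AA_def g_def by blast
    qed
    have fn: "v = w" if "(x, v) \<in> g" "(x, w) \<in> g" for x v w
      using two[OF that] by (auto simp: G_def)
    define u where "u = (\<lambda>x. THE v. (x, v) \<in> g)"
    have ug: "u x = v" if "(x, v) \<in> g" for x v
      unfolding u_def using that fn by blast
    have gE: "g = G (E, u)"
      using ug by (force simp: G_def E_def)
    have two': "\<exists>E' u'. is_subfield E' \<and> D \<subseteq> E' \<and> E' \<subseteq> L \<and> hom_on E' u' \<and> (\<forall>x\<in>D. u' x = t x) \<and> E' \<subseteq> E \<and>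
        (\<forall>x\<in>E'. u x = u' x) \<and> a \<in> E' \<and> b \<in> E'" if ab: "a \<in> E" "b \<in> E" for a b
    proof -
      obtain a' b' where "(a, a') \<in> g" "(b, b') \<in> g" using ab by (auto simp: E_def)
      from two[OF this] obtain E' u' where *: "is_subfield E'" "D \<subseteq> E'" "E' \<subseteq> L" "hom_on E' u'" "\<forall>x\<in>D. u' x = t x"
         "G (E', u') \<subseteq> g" "(a, a') \<in> G (E', u')" "(b, b') \<in> G (E', u')" by blast
      have "E' \<subseteq> E"
      proof
        fix x assume "x \<in> E'"
        then have "(x, u' x) \<in> g" using *(6) by (auto simp: G_def)
        then show "x \<in> E" unfolding E_def by (metis fst_conv image_eqI)
      qed
      moreover have "\<forall>x\<in>E'. u x = u' x" using * ug by (force simp: G_def)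
      moreover have "a \<in> E'" "b \<in> E'" using * by (auto simp: G_def)
      ultimately show ?thesis using * by blast
    qed
    obtain e where e: "e \<in> E"
    proof -
      obtain X where "X \<in> \<C>" using C by blast
      then have "X \<in> AA" using C by (auto simp: subset.chain_def)
      then obtain E' u' where "X = G (E', u')" "D \<subseteq> E'" by (auto simp: AA_def)
      moreover have "0 \<in> D" using D by (simp add: is_subfield_def)
      ultimately have "0 \<in> fst ` X" unfolding G_def by (auto simp: image_image)
      then show ?thesis using that \<open>X \<in> \<C>\<close> by (auto simp: E_def g_def)
    qed
    obtain E0 u0 where E0: "is_subfield E0" "D \<subseteq> E0" "\<forall>x\<in>D. u0 x = t x" "E0 \<subseteq> E" "\<forall>x\<in>E0. u x = u0 x"
      using two'[OF e e] by blast
    have DE: "D \<subseteq> E" using E0 by blast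
    have E2: "\<forall>x\<in>D. u x = t x" using E0 by auto
    have EL: "E \<subseteq> L" using two' by blast
    have "is_subfield E"
      unfolding is_subfield_def
    proof (intro conjI ballI)
      show "0 \<in> E" "1 \<in> E" using E0 by (auto simp: is_subfield_def)
      fix x assume x: "x \<in> E"
      show "inverse x \<in> E" using two'[OF x x] by (auto simp: is_subfield_def)
      fix y assume y: "y \<in> E"
      show "x - y \<in> E" "x * y \<in> E" using two'[OF x y] by (auto simp: is_subfield_def)
    qed
    moreover have "hom_on E u"
      unfolding hom_on_def
    proof (intro conjI ballI)
      show "u 1 = 1" using E2 D t by (auto simp: is_subfield_def hom_on_def)
      fix x y assume xy: "x \<in> E" "y \<in> E"
      obtain E' u' where E': "is_subfield E'" "hom_on E' u'" "\<forall>x\<in>E'. u x = u' x" "x \<in> E'" "y \<in> E'"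
        using two'[OF xy] by blast
      interpret E': subfield_of E' using E' by unfold_locales
      show "u (x + y) = u x + u y" "u (x * y) = u x * u y"
        using E' by (auto simp: hom_on_def E'.add E'.mult)
    qed
    ultimately have "G (E, u) \<in> AA" unfolding AA_def using DE EL E2 by blast
    then show ?thesis using gE g_def by simp
  qed
  from subset_Zorn_nonempty[OF ne this] obtain g where g: "g \<in> AA" "\<forall>X\<in>AA. g \<subseteq> X \<longrightarrow> X = g" by blast
  obtain E u where E: "g = G (E, u)" "is_subfield E" "D \<subseteq> E" "E \<subseteq> L" "hom_on E u" "\<forall>x\<in>D. u x = t x"
    using g by (auto simp: AA_def)
  interpret field_hom E u using E by unfold_locales
  have "E = L"
  proof (rule ccontr)
    assume "E \<noteq> L"
    then obtain x where x: "x \<in> L" "x \<notin> E" using E by blast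
    have "alg_over E x" using alg[OF x(1)] E alg_over_mono by blast
    then obtain P where P: "minpol E x P" using minpol_exists by blast
    have PE: "P \<in> pol E" using P by (simp add: minpol_def)
    have "degree (map_poly u P) > 0" using minpol_degree_pos[OF P] map_degree PE by simp
    then obtain z where z: "poly (map_poly u P) z = 0" using alg_closed_imp_poly_has_root by blast
    obtain t' where t': "hom_on (adj E x) t'" "\<forall>y\<in>E. t' y = u y" using extend'[OF P z] by blast
    have "G (adj E x, t') \<in> AA" unfolding AA_def
      using t' E(3,6) adj_subfield adj_base[of x] adj_least[OF L E(4) x(1)] by (intro imageI) auto
    moreover have "g \<subseteq> G (adj E x, t')"
    proof -
      have "(\<lambda>x. (x, u x)) ` E = (\<lambda>x. (x, t' x)) ` E" using t'(2) by (intro image_cong) auto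
      then show ?thesis using E(1) adj_base[of x] by (auto simp: G_def)
    qed
    ultimately have "G (adj E x, t') = g" using g by blast
    moreover have "(x, t' x) \<in> G (adj E x, t')" using adj_elem by (force simp: G_def)
    ultimately show False using x E by (auto simp: G_def)
  qed
  then show ?thesis using E by blast
qed

section \<open>Valuation rings, algebraic integers and non-archimedean absolute values\<close>

definition is_subring :: "'a::field set \<Rightarrow> bool" where
  "is_subring A \<longleftrightarrow> 0 \<in> A \<and> 1 \<in> A \<and> (\<forall>x\<in>A. \<forall>y\<in>A. x - y \<in> A \<and> x * y \<in> A)"

lemma subfield_subring: "is_subfield L \<Longrightarrow> is_subring L"
  by (simp add: is_subfield_def is_subring_def)

locale subring_of =
  fixes A :: "'a::field set"
  assumes sr: "is_subring A"
begin

lemma zero [simp, intro]: "0 \<in> A" and one [simp, intro]: "1 \<in> A"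
  using sr by (auto simp: is_subring_def)

lemma diff [intro]: "x \<in> A \<Longrightarrow> y \<in> A \<Longrightarrow> x - y \<in> A"
  and mult [intro]: "x \<in> A \<Longrightarrow> y \<in> A \<Longrightarrow> x * y \<in> A"
  using sr by (auto simp: is_subring_def)

lemma uminus [intro]: "x \<in> A \<Longrightarrow> - x \<in> A"
  using diff[of 0 x] by simp

lemma add [intro]: "x \<in> A \<Longrightarrow> y \<in> A \<Longrightarrow> x + y \<in> A"
  using diff[of x "- y"] uminus by simp

lemma power [intro]: "x \<in> A \<Longrightarrow> x ^ n \<in> A"
  by (induction n) auto

lemma sum [intro]: "(\<And>i. i \<in> I \<Longrightarrow> f i \<in> A) \<Longrightarrow> sum f I \<in> A"
  by (induction I rule: infinite_finite_induct) auto

lemma prod [intro]: "(\<And>i. i \<in> I \<Longrightarrow> f i \<in> A) \<Longrightarrow> prod f I \<in> A"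
  by (induction I rule: infinite_finite_induct) auto

lemma of_nat [simp, intro]: "of_nat n \<in> A"
  by (induction n) auto

lemma of_int [simp, intro]: "of_int n \<in> A"
  by (cases n rule: int_cases2) auto

definition adjoin :: "'a \<Rightarrow> 'a set" where
  "adjoin x = (\<lambda>p. poly p x) ` pol A"

lemma adjoin_subring: "is_subring (adjoin x)"
  unfolding is_subring_def
proof (intro conjI ballI)
  show "0 \<in> adjoin x" unfolding adjoin_def
    by (rule image_eqI[of _ _ 0]) (auto simp: pol_def)
  show "1 \<in> adjoin x" unfolding adjoin_def
    by (rule image_eqI[of _ _ 1]) (auto simp: pol_def coeff_1)
  fix u v assume "u \<in> adjoin x" "v \<in> adjoin x"
  then obtain p q where pq: "p \<in> pol A" "q \<in> pol A" "u = poly p x" "v = poly q x"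
    unfolding adjoin_def by (elim imageE) auto
  have "p - q \<in> pol A" "p * q \<in> pol A"
    using pq(1,2) by (auto simp: pol_def coeff_mult)
  then show "u - v \<in> adjoin x" "u * v \<in> adjoin x"
    unfolding adjoin_def using pq(3,4) by (metis poly_diff image_eqI, metis poly_mult image_eqI)
qed

lemma adjoin_base: "A \<subseteq> adjoin x" and adjoin_elem: "x \<in> adjoin x"
proof -
  show "A \<subseteq> adjoin x"
  proof
    fix c assume "c \<in> A"
    then show "c \<in> adjoin x" unfolding adjoin_def
      by (intro image_eqI[of _ _ "[:c:]"]) (auto simp: pol_def coeff_pCons split: nat.split)
  qed
  show "x \<in> adjoin x" unfolding adjoin_def
    by (rule image_eqI[of _ _ "[:0,1:]"]) (auto simp: pol_def coeff_pCons split: nat.split)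
qed

lemma adjoinE:
  assumes "y \<in> adjoin x"
  obtains p where "p \<in> pol A" "y = poly p x"
  using assms unfolding adjoin_def by (elim imageE)

end

section \<open>Integrality by means of valuation rings\<close>

definition integral_over :: "'a::field set \<Rightarrow> 'a \<Rightarrow> bool" where
  "integral_over A x \<longleftrightarrow> (\<exists>p\<in>pol A. lead_coeff p = 1 \<and> poly p x = 0)"

definition valuation_ring :: "'a::field set \<Rightarrow> 'a set \<Rightarrow> bool" where
  "valuation_ring L A \<longleftrightarrow> is_subring A \<and> A \<subseteq> L \<and> (\<forall>x\<in>L. x \<in> A \<or> inverse x \<in> A)"

text \<open>Otherwise the inverse of \<open>b\<close> lies in \<open>A\<close>; dividing the
  integral equation by the power of \<open>b\<close> just below the top one writes \<open>b\<close>
  as a polynomial in its inverse.\<close>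

lemma integral_in_valuation_ring:
  assumes "integral_over R b" "R \<subseteq> A" "valuation_ring L A" "b \<in> L"
  shows "b \<in> A"
proof (rule ccontr)
  assume b: "b \<notin> A"
  interpret subring_of A using assms by unfold_locales (simp add: valuation_ring_def)
  have ib: "inverse b \<in> A" using assms b by (auto simp: valuation_ring_def)
  have b0: "b \<noteq> 0" using b by auto
  obtain p where p: "p \<in> pol R" "lead_coeff p = 1" "poly p b = 0"
    using assms by (auto simp: integral_over_def)
  define n where "n = degree p"
  have "n > 0"
  proof (rule ccontr)
    assume "\<not> n > 0"
    then obtain c where "p = [:c:]" by (auto simp: n_def elim!: degree_eq_zeroE)
    then show False using p by simp
  qed
  then obtain m where m: "n = Suc m" by (cases n) auto
  have "0 = (\<Sum>i\<le>n. coeff p i * b ^ i)" using p by (simp add: poly_altdef n_def)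
  also have "\<dots> = (\<Sum>i\<le>m. coeff p i * b ^ i) + b ^ Suc m" using p by (simp add: m n_def[symmetric])
  finally have "b ^ Suc m = - (\<Sum>i\<le>m. coeff p i * b ^ i)" by (simp add: eq_neg_iff_add_eq_0 add.commute)
  then have "b ^ Suc m * inverse b ^ m = - (\<Sum>i\<le>m. coeff p i * (b ^ i * inverse b ^ m))"
    by (simp add: sum_distrib_right mult.assoc)
  also have "(\<Sum>i\<le>m. coeff p i * (b ^ i * inverse b ^ m)) = (\<Sum>i\<le>m. coeff p i * inverse b ^ (m - i))"
  proof (rule sum.cong)
    fix i assume "i \<in> {..m}"
    then have "inverse b ^ m = inverse b ^ i * inverse b ^ (m - i)" by (simp flip: power_add)
    then show "coeff p i * (b ^ i * inverse b ^ m) = coeff p i * inverse b ^ (m - i)"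
      using b0 by (simp add: power_inverse)
  qed simp
  also have "b ^ Suc m * inverse b ^ m = b" using b0 by (simp add: power_inverse)
  finally have "b = - (\<Sum>i\<le>m. coeff p i * inverse b ^ (m - i))" .
  moreover have "coeff p i \<in> A" for i using p(1) assms(2) by (auto simp: pol_def)
  ultimately have "- (\<Sum>i\<le>m. coeff p i * inverse b ^ (m - i)) \<in> A" using ib by (intro uminus sum mult power)
  with \<open>b = _\<close> show False using b by metis
qed

text \<open>Multiplying \<open>b = poly p (inverse b)\<close> by the power of \<open>b\<close> with
  exponent \<open>degree p\<close> clears denominators and leaves a monic equation.\<close>

lemma adjoin_inverse_integral:
  assumes R: "is_subring R" and b: "b \<noteq> 0" "b \<in> subring_of.adjoin R (inverse b)"
  shows "integral_over R b"
proof -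
  interpret subring_of R using R by unfold_locales
  obtain p where p: "p \<in> pol R" "b = poly p (inverse b)" using adjoinE b(2) by blast
  define n where "n = degree p"
  define q where "q = monom 1 (Suc n) - (\<Sum>i\<le>n. monom (coeff p i) (n - i))"
  have c: "coeff q j = (if j = Suc n then 1 else 0) - (\<Sum>i\<le>n. if n - i = j then coeff p i else 0)" for j
    by (auto simp: q_def coeff_sum)
  have qR: "q \<in> pol R" using p(1) unfolding pol_def by (auto simp: c intro!: diff sum)
  have "degree q \<le> Suc n" by (rule degree_le) (auto simp: c intro!: sum.neutral)
  moreover have cS: "coeff q (Suc n) = 1" by (auto simp: c intro!: sum.neutral)
  ultimately have dq: "degree q = Suc n" by (metis le_degree le_antisym zero_neq_one)
  have "poly q b = b ^ Suc n - (\<Sum>i\<le>n. coeff p i * b ^ (n - i))"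
    by (simp add: q_def poly_monom poly_sum)
  also have "(\<Sum>i\<le>n. coeff p i * b ^ (n - i)) = (\<Sum>i\<le>n. b ^ n * (coeff p i * inverse b ^ i))"
    by (rule sum.cong) (auto simp: b(1) power_diff field_simps)
  also have "\<dots> = b ^ n * poly p (inverse b)" by (simp add: poly_altdef n_def sum_distrib_left)
  also have "\<dots> = b ^ n * b" using p(2) by simp
  finally have "poly q b = 0" by simp
  moreover have "lead_coeff q = 1" using cS dq by simp
  ultimately show ?thesis using qR unfolding integral_over_def by blast
qed

text \<open>A ring that is maximal among those containing \<open>R\<close> and the inverse of
  \<open>b\<close> but not \<open>b\<close> is a valuation ring. Integrality thereby becomes
  membership in all valuation rings above \<open>R\<close>, from which closure under sums and
  products is immediate.\<close>

lemma nonintegral_valuation_ring: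
  fixes L :: "'a::field set"
  assumes L: "is_subfield L" and R: "is_subring R" "R \<subseteq> L" and b: "b \<in> L" "\<not> integral_over R b"
  shows "\<exists>A. valuation_ring L A \<and> R \<subseteq> A \<and> b \<notin> A"
proof -
  interpret L: subfield_of L using L by unfold_locales
  interpret R: subring_of R using R by unfold_locales
  have b0: "b \<noteq> 0"
  proof
    assume "b = 0"
    then have "integral_over R b" unfolding integral_over_def
      by (intro bexI[of _ "[:0,1:]"]) (auto simp: pol_def coeff_pCons split: nat.split)
    then show False using b by simp
  qed
  define AA where "AA = {A. is_subring A \<and> A \<subseteq> L \<and> R \<subseteq> A \<and> inverse b \<in> A \<and> b \<notin> A}"
  have sub: "subring_of.adjoin B x \<subseteq> L" if "is_subring B" "B \<subseteq> L" "x \<in> L" for B x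
  proof
    interpret B: subring_of B using that by unfold_locales
    fix y assume "y \<in> B.adjoin x"
    then obtain p where "p \<in> pol B" "y = poly p x" by (rule B.adjoinE)
    then show "y \<in> L" using that pol_mono L.poly_in by blast
  qed
  have "R.adjoin (inverse b) \<in> AA"
    unfolding AA_def using R.adjoin_subring sub[OF R] L.inv[OF b(1)] R.adjoin_base R.adjoin_elem
      adjoin_inverse_integral[OF R(1) b0] b by auto
  then have ne: "AA \<noteq> {}" by auto
  have "\<Union>\<C> \<in> AA" if C: "\<C> \<noteq> {}" "subset.chain AA \<C>" for \<C>
  proof -
    have CA: "B \<in> AA" if "B \<in> \<C>" for B using C that by (auto simp: subset.chain_def)
    obtain B0 where B0: "B0 \<in> \<C>" using C by blast
    have "is_subring (\<Union>\<C>)"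
      unfolding is_subring_def
    proof (intro conjI ballI)
      show "0 \<in> \<Union>\<C>" "1 \<in> \<Union>\<C>" using CA[OF B0] B0 by (auto simp: AA_def is_subring_def)
      fix x y assume "x \<in> \<Union>\<C>" "y \<in> \<Union>\<C>"
      then obtain X Y where XY: "X \<in> \<C>" "Y \<in> \<C>" "x \<in> X" "y \<in> Y" by blast
      have "X \<subseteq> Y \<or> Y \<subseteq> X" using C XY by (auto simp: subset.chain_def)
      then obtain Z where Z: "Z \<in> \<C>" "x \<in> Z" "y \<in> Z" using XY by blast
      then have "is_subring Z" using CA by (auto simp: AA_def)
      then show "x - y \<in> \<Union>\<C>" "x * y \<in> \<Union>\<C>" using Z by (auto simp: is_subring_def)
    qed
    then show ?thesis using CA B0 unfolding AA_def by blast
  qed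
  from subset_Zorn_nonempty[OF ne this] obtain A where A: "A \<in> AA" "\<And>X. X \<in> AA \<Longrightarrow> A \<subseteq> X \<Longrightarrow> X = A" by blast
  then have A': "is_subring A" "A \<subseteq> L" "R \<subseteq> A" "inverse b \<in> A" "b \<notin> A" by (auto simp: AA_def)
  interpret A: subring_of A using A' by unfold_locales
  have max: "b \<in> A.adjoin x" if "x \<in> L" "x \<notin> A" for x
  proof (rule ccontr)
    assume "b \<notin> A.adjoin x"
    then have "A.adjoin x \<in> AA" unfolding AA_def
      using A.adjoin_subring sub[OF A'(1,2) that(1)] A.adjoin_base[of x] A' by auto
    then show False using A(2) A.adjoin_base A.adjoin_elem that by blast
  qed
  \<comment> \<open>The inverse of \<open>b\<close> lies in the Jacobson radical of
    \<open>A\<close>: if \<open>u\<close> were not invertible, maximality would put \<open>b\<close>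
    into \<open>A\<close> with \<open>inverse u\<close> adjoined, so some \<open>b * u ^ n\<close>
    would lie in \<open>A\<close>.\<close>
  have unit: "inverse (1 + inverse b * a) \<in> A \<and> 1 + inverse b * a \<noteq> 0" if a: "a \<in> A" for a
  proof (cases "1 + inverse b * a = 0")
    case True
    then have "b = - a" using b0 by (simp add: field_simps add_eq_0_iff)
    then show ?thesis using A' a by auto
  next
    case False
    define u where "u = 1 + inverse b * a"
    have uA: "u \<in> A" using a A' by (auto simp: u_def)
    have "inverse u \<in> A"
    proof (rule ccontr)
      assume nu: "inverse u \<notin> A"
      have "inverse u \<in> L" using uA A' L.inv by blast
      from max[OF this nu] obtain p where p: "p \<in> pol A" "b = poly p (inverse u)" by (rule A.adjoinE)
      define n where "n = degree p"
      have u0: "u \<noteq> 0" using False u_def by simp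
      have "poly p (inverse u) * u ^ n = (\<Sum>i\<le>n. coeff p i * u ^ (n - i))"
        unfolding poly_altdef n_def sum_distrib_right
        by (intro sum.cong) (auto simp: u0 power_diff field_simps)
      then have "b * u ^ n = (\<Sum>i\<le>n. coeff p i * u ^ (n - i))" using p(2) by simp
      then have bu: "b * u ^ n \<in> A" using p uA by (auto simp: pol_def)
      \<comment> \<open>Since \<open>b * u = b + a\<close>, multiplying by \<open>u\<close> does not
        change \<open>b\<close> modulo \<open>A\<close>; with \<open>b * u ^ n\<close> in
        \<open>A\<close> this would put \<open>b\<close> into \<open>A\<close>.\<close>
      have "\<exists>c\<in>A. b * u ^ k = b + c" for k
      proof (induction k)
        case 0 then show ?case by (intro bexI[of _ 0]) auto
      next
        case (Suc k)
        then obtain c where c: "c \<in> A" "b * u ^ k = b + c" by blast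
        have "b * u ^ Suc k = (b * u ^ k) * u" by simp
        also have "\<dots> = (b + c) * u" using c(2) by simp
        also have "\<dots> = b + (a + c * u)" using b0 by (simp add: u_def algebra_simps)
        finally show ?case using c uA a by blast
      qed
      then obtain c where c: "c \<in> A" "b * u ^ n = b + c" by blast
      then have "b = b * u ^ n - c" by simp
      then show False using bu c A' A.diff by metis
    qed
    then show ?thesis using False u_def by simp
  qed
  have "x \<in> A \<or> inverse x \<in> A" if x: "x \<in> L" for x
  proof (rule ccontr)
    assume "\<not> ?thesis"
    then have nx: "x \<notin> A" "inverse x \<notin> A" by auto
    have x0: "x \<noteq> 0" using nx by auto
    \<comment> \<open>If neither \<open>x\<close> nor its inverse lies in \<open>A\<close>,
      adjoining either one produces \<open>b\<close>. Both expressions are taken of least degree,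
      and the longer one is then shortened with the help of the shorter.\<close>
    define ph where "ph = (\<lambda>x p. p \<in> pol A \<and> b = poly p x)"
    have ex: "\<exists>p. ph x p" "\<exists>p. ph (inverse x) p"
      using max[OF x nx(1)] max[OF L.inv[OF x] nx(2)] A.adjoinE unfolding ph_def by metis+
    obtain p where p: "ph x p" "\<And>p'. ph x p' \<Longrightarrow> degree p \<le> degree p'"
      using ex_has_least_nat[of "ph x" _ degree] ex(1) by blast
    obtain q where q: "ph (inverse x) q" "\<And>p'. ph (inverse x) p' \<Longrightarrow> degree q \<le> degree p'"
      using ex_has_least_nat[of "ph (inverse x)" _ degree] ex(2) by blast
    have red: False if y: "y \<noteq> 0" "p \<in> pol A" "b = poly p y" "\<And>p'. ph y p' \<Longrightarrow> degree p \<le> degree p'"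
       and q: "q \<in> pol A" "b = poly q (inverse y)" and le: "degree q \<le> degree p" for y p q
    proof -
      define n where "n = degree p"
      define m where "m = degree q"
      have n0: "n > 0"
      proof (rule ccontr)
        assume "\<not> n > 0"
        then obtain c where "p = [:c:]" by (auto simp: n_def elim!: degree_eq_zeroE)
        then show False using y A' polD[of p A 0] by simp
      qed
      \<comment> \<open>Dividing \<open>b = q(1/y)\<close> by \<open>b\<close> and isolating its constant term, a unit times 1,
        expresses 1 by negative powers of \<open>y\<close> with coefficients in \<open>b\<^sup>-\<^sup>1 A\<close>;
        this eliminates the leading term of \<open>p\<close>.\<close>
      define q0 where "q0 = coeff q 0"
      have q0: "q0 \<in> A" using q by (auto simp: q0_def pol_def)
      define u where "u = 1 - inverse b * q0"
      have u: "inverse u \<in> A" "u \<noteq> 0" using unit[of "- q0"] q0 by (auto simp: u_def)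
      have "b = (\<Sum>i\<le>m. coeff q i * inverse y ^ i)" using q by (simp add: poly_altdef m_def)
      also have "\<dots> = q0 + (\<Sum>i\<in>{1..m}. coeff q i * inverse y ^ i)"
      proof -
        have "{..m} = insert 0 {1..m}" by auto
        then show ?thesis by (simp add: q0_def)
      qed
      finally have "b - q0 = (\<Sum>i\<in>{1..m}. coeff q i * inverse y ^ i)" by simp
      moreover have "b - q0 = b * u" using b0 by (simp add: u_def algebra_simps)
      ultimately have bu: "b * u = (\<Sum>i\<in>{1..m}. coeff q i * inverse y ^ i)" by simp
      define r where "r = p - monom (coeff p n) n + smult (coeff p n * inverse b * inverse u) (\<Sum>i\<in>{1..m}. monom (coeff q i) (n - i))"
      have "poly (\<Sum>i\<in>{1..m}. monom (coeff q i) (n - i)) y = (\<Sum>i\<in>{1..m}. y ^ n * (coeff q i * inverse y ^ i))"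
        using le y(1) by (auto simp: poly_sum poly_monom n_def m_def power_diff field_simps intro!: sum.cong)
      also have "\<dots> = y ^ n * (b * u)" by (simp add: bu sum_distrib_left)
      finally have *: "poly (\<Sum>i\<in>{1..m}. monom (coeff q i) (n - i)) y = y ^ n * (b * u)" .
      have "coeff p n * inverse b * inverse u * (y ^ n * (b * u)) = coeff p n * y ^ n" using b0 u(2) by (simp add: field_simps)
      then have "poly r y = poly p y" unfolding r_def by (simp only: poly_add poly_diff poly_smult poly_monom *) simp
      moreover have rA: "r \<in> pol A"
        unfolding pol_def r_def using y(2) q(1) u(1) A'(4)
        by (auto simp: coeff_sum pol_def intro!: A.add A.diff A.mult A.sum)
      ultimately have "ph y r" using y by (simp add: ph_def)
      moreover have "degree r < n"
      proof -
        have "coeff r i = 0" if "i \<ge> n" for i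
          using that n0 by (cases "i = n") (auto simp: r_def coeff_sum n_def coeff_eq_0 intro!: sum.neutral)
        then have "degree r \<le> n - 1" using n0 by (intro degree_le) auto
        then show ?thesis using n0 by simp
      qed
      ultimately show False using y(4) n_def by fastforce
    qed
    show False
    proof (cases "degree q \<le> degree p")
      case True
      then show False using red[of x p q] p q x0 ph_def by blast
    next
      case False
      have "b = poly p (inverse (inverse x))" using p ph_def by simp
      then show False using red[of "inverse x" q p] p q x0 False ph_def by auto
    qed
  qed
  then show ?thesis using A' unfolding valuation_ring_def by blast
qed

text \<open>With the whole field as \<open>L\<close>, the integral elements are an intersection of
  valuation rings, and these are subrings.\<close>

lemma integral_over_subring:
  assumes R: "is_subring R"
  shows "is_subring {b. integral_over R b}"
proof -
  have L: "is_subfield (UNIV :: 'a set)" by (simp add: is_subfield_def)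
  have *: "integral_over R b \<longleftrightarrow> (\<forall>A. valuation_ring UNIV A \<longrightarrow> R \<subseteq> A \<longrightarrow> b \<in> A)" for b
    using nonintegral_valuation_ring[OF L R] integral_in_valuation_ring by blast
  show ?thesis
    unfolding is_subring_def * valuation_ring_def by auto
qed

lemma algebraic_int_integral: "algebraic_int (x::'a::field_char_0) \<longleftrightarrow> integral_over \<int> x"
  by (auto simp: algebraic_int.simps integral_over_def pol_def)

lemma Ints_subring: "is_subring (\<int> :: 'a::field_char_0 set)"
  by (auto simp: is_subring_def)

interpretation algint: subring_of "{x::'a::field_char_0. algebraic_int x}"
  using integral_over_subring[OF Ints_subring] by unfold_locales (simp add: algebraic_int_integral)

lemma algebraic_int_add: "algebraic_int x \<Longrightarrow> algebraic_int y \<Longrightarrow> algebraic_int (x + y :: 'a::field_char_0)"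
  and algebraic_int_diff: "algebraic_int x \<Longrightarrow> algebraic_int y \<Longrightarrow> algebraic_int (x - y :: 'a::field_char_0)"
  and algebraic_int_mult: "algebraic_int x \<Longrightarrow> algebraic_int y \<Longrightarrow> algebraic_int (x * y :: 'a::field_char_0)"
  and algebraic_int_power: "algebraic_int x \<Longrightarrow> algebraic_int (x ^ n :: 'a::field_char_0)"
  using algint.add algint.diff algint.mult algint.power by auto

lemma algebraic_int_sum: "(\<And>i. i \<in> I \<Longrightarrow> algebraic_int (f i)) \<Longrightarrow> algebraic_int (sum f I :: 'a::field_char_0)"
  and algebraic_int_prod: "(\<And>i. i \<in> I \<Longrightarrow> algebraic_int (f i)) \<Longrightarrow> algebraic_int (prod f I :: 'a::field_char_0)"
  using algint.sum[of I f] algint.prod[of I f] by auto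

text \<open>Over a field, algebraic and integral mean the same, so the ring operations are
  inherited; the reflected polynomial handles inverses.\<close>

lemma alg_over_subfield:
  assumes K: "is_subfield K"
  shows "is_subfield {x. alg_over K x}"
proof -
  interpret subfield_of K using K by unfold_locales
  have eq: "alg_over K x \<longleftrightarrow> integral_over K x" for x
  proof
    assume "alg_over K x"
    then show "integral_over K x" using minpol_exists by (auto simp: integral_over_def minpol_def)
  next
    assume "integral_over K x"
    then obtain p where "p \<in> pol K" "lead_coeff p = 1" "poly p x = 0" by (auto simp: integral_over_def)
    moreover from this have "p \<noteq> 0" by auto
    ultimately show "alg_over K x" by (auto simp: alg_over_def)
  qed
  have "alg_over K (inverse x)" if x: "alg_over K x" for x
  proof (cases "x = 0")
    case False
    obtain p where p: "p \<in> pol K" "p \<noteq> 0" "poly p x = 0" using x by (auto simp: alg_over_def)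
    have "reflect_poly p \<in> pol K" using p(1) by (auto simp: pol_def coeff_reflect_poly)
    moreover have "reflect_poly p \<noteq> 0" using p by simp
    moreover have "poly (reflect_poly p) (inverse x) = 0" using p False by (simp add: poly_reflect_poly_nz)
    ultimately show ?thesis unfolding alg_over_def by blast
  qed (use x in auto)
  moreover have "is_subring {x. alg_over K x}"
    using integral_over_subring[OF subfield_subring[OF K]] by (simp add: eq)
  ultimately show ?thesis by (auto simp: is_subring_def is_subfield_def)
qed

lemma Rats_subfield: "is_subfield (\<rat> :: 'a::field_char_0 set)"
  by (auto simp: is_subfield_def)

interpretation Q: subfield_of "\<rat> :: 'a::field_char_0 set"
  using Rats_subfield by unfold_locales

lemma algebraic_alg_over: "algebraic (x::'a::field_char_0) \<longleftrightarrow> alg_over \<rat> x"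
  by (auto simp: algebraic_altdef alg_over_def pol_def)

lemma algebraic_int_multiple:
  assumes "algebraic (x::'a::field_char_0)"
  shows "\<exists>d::nat. d > 0 \<and> algebraic_int (of_nat d * x)"
proof -
  obtain p where p: "p \<noteq> 0" "poly (map_poly of_int p) x = 0"
    using assms by (rule algebraicE')
  define c where "c = lead_coeff p"
  have c0: "c \<noteq> 0" using p by (simp add: c_def)
  have "\<exists>A. valuation_ring UNIV A \<and> \<int> \<subseteq> A \<and> of_int c * x \<notin> A" if "\<not> integral_over \<int> (of_int c * x)"
    by (rule nonintegral_valuation_ring) (use that Ints_subring in \<open>auto simp: is_subfield_def\<close>)
  moreover have "of_int c * x \<in> A" if A: "valuation_ring UNIV A" "\<int> \<subseteq> A" for A
  proof (rule integral_in_valuation_ring[OF _ A(2,1)])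
    define n where "n = degree p"
    have n0: "n > 0"
    proof (rule ccontr)
      assume "\<not> n > 0"
      then obtain e where "p = [:e:]" by (auto simp: n_def elim!: degree_eq_zeroE)
      then show False using p by (auto simp: map_poly_pCons)
    qed
    \<comment> \<open>This is \<open>c ^ (n - 1)\<close> times the given polynomial at
      \<open>X / c\<close>; it is monic with integer coefficients and has the root
      \<open>c * x\<close>.\<close>
    define q where "q = monom 1 n + (\<Sum>i<n. monom (of_int (coeff p i * c ^ (n - 1 - i)) :: 'a) i)"
    have q: "coeff q j = (if j = n then 1 else if j < n then of_int (coeff p j * c ^ (n - 1 - j)) else 0)" for j
      by (simp add: q_def coeff_sum del: of_int_mult of_int_power)
    have dq: "degree q = n"
      by (rule antisym[OF degree_le le_degree]) (auto simp: q)
    have "poly q (of_int c * x) = (\<Sum>i\<le>n. coeff q i * (of_int c * x) ^ i)" by (simp add: poly_altdef dq)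
    also have "\<dots> = (of_int c * x) ^ n + (\<Sum>i<n. of_int (coeff p i * c ^ (n - 1 - i)) * (of_int c * x) ^ i)"
      by (simp add: q lessThan_Suc_atMost[symmetric])
    also have "(\<Sum>i<n. of_int (coeff p i * c ^ (n - 1 - i)) * (of_int c * x) ^ i) =
        (\<Sum>i<n. of_int c ^ (n - 1) * (of_int (coeff p i) * x ^ i))"
    proof (rule sum.cong)
      fix i assume "i \<in> {..<n}"
      then have "n - 1 = (n - 1 - i) + i" by auto
      then have "(of_int c :: 'a) ^ (n - 1) = of_int c ^ (n - 1 - i) * of_int c ^ i" by (metis power_add)
      then show "of_int (coeff p i * c ^ (n - 1 - i)) * (of_int c * x) ^ i = of_int c ^ (n - 1) * (of_int (coeff p i) * x ^ i)"
        by (simp add: power_mult_distrib algebra_simps)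
    qed simp
    also have "(of_int c * x) ^ n = of_int c ^ (n - 1) * (of_int (coeff p n) * x ^ n)"
      using n0 by (cases n) (auto simp: c_def n_def power_mult_distrib)
    also have "\<dots> + (\<Sum>i<n. of_int c ^ (n - 1) * (of_int (coeff p i) * x ^ i)) =
       of_int c ^ (n - 1) * (\<Sum>i\<le>n. of_int (coeff p i) * x ^ i)"
      by (simp add: sum_distrib_left lessThan_Suc_atMost[symmetric] distrib_left add.commute)
    also have "(\<Sum>i\<le>n. of_int (coeff p i) * x ^ i) = 0"
      using p(2) by (simp add: poly_altdef n_def coeff_map_poly degree_map_poly)
    finally have "poly q (of_int c * x) = 0" by simp
    moreover have "q \<in> pol \<int>" by (auto simp: pol_def q)
    moreover have "lead_coeff q = 1" by (simp add: dq q)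
    ultimately show "integral_over \<int> (of_int c * x)" unfolding integral_over_def by blast
  qed auto
  ultimately have "algebraic_int (of_int c * x)" unfolding algebraic_int_integral by blast
  \<comment> \<open>Multiplying by the sign of \<open>c\<close> turns the integer multiplier into a
    natural number.\<close>
  then have "algebraic_int (of_int (sgn c) * (of_int c * x))"
    by (rule algebraic_int_mult[rotated]) simp
  moreover have "of_int (sgn c) * of_int c = (of_nat (nat \<bar>c\<bar>) :: 'a)"
    by (simp add: mult_sgn_abs abs_sgn[symmetric] mult.commute flip: of_int_mult)
  ultimately have "algebraic_int (of_nat (nat \<bar>c\<bar>) * x)" by (simp add: mult.assoc[symmetric])
  then show ?thesis using c0 by (intro exI[of _ "nat \<bar>c\<bar>"]) auto
qed

section \<open>The normalized absolute value of a valuation ring above a prime\<close>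

locale val_ring = subfield_of L for L :: "'a::field_char_0 set" +
  fixes A :: "'a set" and p :: nat
  assumes val: "valuation_ring L A" and p: "prime p" "inverse (of_nat p) \<notin> A"
    and alg: "\<And>x. x \<in> L \<Longrightarrow> algebraic x"
begin

lemma A_subring: "is_subring A" and A_sub: "A \<subseteq> L"
  and A_total: "x \<in> L \<Longrightarrow> x \<in> A \<or> inverse x \<in> A"
  using val by (auto simp: valuation_ring_def)

sublocale A: subring_of A using A_subring by unfold_locales

definition ut :: "'a \<Rightarrow> bool" where "ut x \<longleftrightarrow> x \<noteq> 0 \<and> x \<in> A \<and> inverse x \<in> A"

lemma ut_mult: "ut x \<Longrightarrow> ut y \<Longrightarrow> ut (x * y)"
  by (auto simp: ut_def inverse_mult_distrib)

lemma ut_inverse: "ut x \<Longrightarrow> ut (inverse x)"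
  by (auto simp: ut_def)

lemma ut_power: "ut x \<Longrightarrow> ut (x ^ n)"
  by (induction n) (auto simp: ut_mult, simp add: ut_def)

lemma ut_factor: "x \<in> A \<Longrightarrow> y \<in> A \<Longrightarrow> ut (x * y) \<Longrightarrow> ut x"
proof -
  assume xy: "x \<in> A" "y \<in> A" "ut (x * y)"
  then have "y \<noteq> 0" by (auto simp: ut_def)
  then have "y * inverse (x * y) = inverse x" by (simp add: field_simps)
  moreover have "y * inverse (x * y) \<in> A" using xy by (intro A.mult) (auto simp: ut_def)
  ultimately have "inverse x \<in> A" by metis
  then show "ut x" using xy by (auto simp: ut_def simp del: inverse_mult_distrib)
qed

text \<open>A valuation ring is local: of two nonzero elements one divides the other and hence the
  sum, and a divisor of a unit is a unit.\<close>

lemma ut_add: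
  assumes "x \<in> A" "y \<in> A" "ut (x + y)"
  shows "ut x \<or> ut y"
proof (cases "x = 0 \<or> y = 0")
  case True then show ?thesis using assms by auto
next
  case False
  have *: "ut x" if "x \<in> A" "x \<noteq> 0" "y * inverse x \<in> A" "ut (x + y)" for x y
  proof -
    have "x + y = x * (1 + y * inverse x)" using that by (simp add: field_simps)
    then show ?thesis using that ut_factor[of x "1 + y * inverse x"] by auto
  qed
  have "y * inverse x \<in> A \<or> x * inverse y \<in> A"
    using A_total[of "y * inverse x"] assms A_sub False by (auto simp: inverse_mult_distrib mult.commute)
  then show ?thesis using *[of x y] *[of y x] assms False by (auto simp: add.commute)
qed

lemma ut_sum:
  assumes "finite I" "\<And>i. i \<in> I \<Longrightarrow> g i \<in> A" "ut (sum g I)"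
  shows "\<exists>i\<in>I. ut (g i)"
  using assms
proof (induction I)
  case empty then show ?case by (simp add: ut_def)
next
  case (insert i I)
  then show ?case using ut_add[of "g i" "sum g I"] by auto
qed

lemma p0: "of_nat p \<noteq> (0::'a)"
  using p(1) by (simp add: prime_gt_0_nat)

lemma ut_coprime:
  assumes "coprime a (int p)"
  shows "ut (of_int a)"
proof -
  obtain u v where "u * a + v * int p = 1"
    using bezout_int[of a "int p"] assms by (auto simp: coprime_iff_gcd_eq_1)
  then have "of_int (u * a + v * int p) = (1 :: 'a)" by simp
  then have "of_int a * of_int u + of_nat p * of_int v = (1 :: 'a)" by (simp add: mult.commute)
  moreover have "ut 1" by (simp add: ut_def)
  ultimately have "ut (of_int a * of_int u) \<or> ut (of_nat p * of_int v)"
    using ut_add[of "of_int a * of_int u" "of_nat p * of_int v"] by auto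
  then show ?thesis using ut_factor[of "of_int a" "of_int u"] ut_factor[of "of_nat p" "of_int v"] p(2)
    by (auto simp: ut_def)
qed

lemma ut_int:
  assumes "a \<noteq> 0"
  shows "ut (of_int a * of_nat p powi (- int (multiplicity (int p) a)))"
proof -
  have "\<not> is_unit (int p)" using p(1) prime_gt_1_nat[of p] by auto
  then obtain c where c: "a = int p ^ multiplicity (int p) a * c" "\<not> int p dvd c"
    using assms by (metis multiplicity_decompose')
  have "coprime (int p) c" using c(2) p(1) by (intro prime_imp_coprime) auto
  then have "coprime c (int p)" by (simp add: coprime_commute)
  moreover have "of_int a * of_nat p powi (- int (multiplicity (int p) a)) = (of_int c :: 'a)"
    by (subst (1) c(1)) (use p0 in \<open>simp add: power_int_minus field_simps\<close>)
  ultimately show ?thesis using ut_coprime by simp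
qed

lemma ut_p_powi: "ut (of_nat p powi k) \<longleftrightarrow> k = 0"
proof
  have *: False if "ut (of_nat p powi int (Suc m))" for m
  proof -
    have "ut (of_nat p * of_nat p ^ m)" using that by (simp only: power_int_of_nat power_Suc)
    then have "ut (of_nat p)" by (rule ut_factor[rotated 2]) auto
    then show False using p(2) by (simp add: ut_def)
  qed
  show "ut (of_nat p powi k) \<Longrightarrow> k = 0"
  proof (cases k rule: int_cases3)
    case (pos n)
    then show "ut (of_nat p powi k) \<Longrightarrow> k = 0" using *[of "n - 1"] by auto
  next
    case (neg n)
    have "ut (of_nat p powi k) \<Longrightarrow> ut (of_nat p powi int (Suc (n - 1)))"
      using ut_inverse[of "of_nat p powi k"] neg by (simp add: power_int_minus)
    then show "ut (of_nat p powi k) \<Longrightarrow> k = 0" using * by blast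
  qed auto
qed (auto simp: ut_def)

text \<open>The relation says that \<open>x\<close> has absolute value \<open>p powr r\<close>: up
  to a unit, \<open>x ^ n\<close> is \<open>p\<close> to the power \<open>- k\<close>, and
  \<open>p\<close> itself has absolute value \<open>1 / p\<close>. A rational exponent exists for
  every nonzero element because the field is algebraic.\<close>

definition vrel :: "'a \<Rightarrow> real \<Rightarrow> bool" where
  "vrel x r \<longleftrightarrow> (\<exists>n k. n > 0 \<and> ut (x ^ n * of_nat p powi k) \<and> r = real_of_int k / real n)"

lemma vrel_unique:
  assumes "vrel x r" "vrel x s"
  shows "r = s"
proof -
  obtain n k m l where *: "n > 0" "ut (x ^ n * of_nat p powi k)" "r = of_int k / real n"
     "m > 0" "ut (x ^ m * of_nat p powi l)" "s = of_int l / real m"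
    using assms by (auto simp: vrel_def)
  have x0: "x \<noteq> 0" using * by (auto simp: ut_def)
  have "ut ((x ^ n * of_nat p powi k) ^ m * inverse ((x ^ m * of_nat p powi l) ^ n))"
    using * by (meson ut_mult ut_power ut_inverse)
  moreover have "(x ^ n * of_nat p powi k) ^ m * inverse ((x ^ m * of_nat p powi l) ^ n)
      = of_nat p powi (k * int m - l * int n)"
    using x0 p0 by (simp add: power_mult_distrib power_int_diff power_int_mult field_simps flip: power_mult)
  ultimately have "k * int m = l * int n" using ut_p_powi by simp
  then have "real_of_int k * real m = real_of_int l * real n" by (metis of_int_mult of_int_of_nat_eq)
  then show ?thesis unfolding *(3,6) using *(1,4) by (simp add: frac_eq_eq)
qed

lemma powi_ratio:
  assumes "P \<noteq> (0::'a)"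
  shows "(a * P powi (- i)) * inverse (c * P powi (- j)) = a / c * P powi (j - i)"
  using assms by (simp add: power_int_diff power_int_minus field_simps)

lemma ut_rat_ratio:
  assumes "a \<noteq> 0" "c \<noteq> 0"
  shows "\<exists>k. ut (of_int a / of_int c * of_nat p powi k)"
proof -
  have "ut ((of_int a * of_nat p powi (- int (multiplicity (int p) a))) * inverse (of_int c * of_nat p powi (- int (multiplicity (int p) c))))"
    using ut_mult[OF ut_int[OF assms(1)] ut_inverse[OF ut_int[OF assms(2)]]] .
  also have "((of_int a :: 'a) * of_nat p powi (- int (multiplicity (int p) a))) * inverse (of_int c * of_nat p powi (- int (multiplicity (int p) c)))
     = of_int a / of_int c * of_nat p powi (int (multiplicity (int p) c) - int (multiplicity (int p) a))"
    by (rule powi_ratio[OF p0])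
  finally show ?thesis ..
qed

text \<open>The step behind Newton polygons: when the terms of a polynomial equation sum to 0, two
  of them have the same size. After division by a term of largest size all quotients lie in
  \<open>A\<close> and the remaining ones sum to -1, a unit, so one of them is a unit.\<close>

lemma unit_ratio_exists:
  assumes x: "x \<in> L" "x \<noteq> 0" and P: "P \<noteq> 0" "poly (map_poly of_int P) x = 0"
  shows "\<exists>i j. j < i \<and> i \<le> degree P \<and> coeff P i \<noteq> 0 \<and> coeff P j \<noteq> 0 \<and>
    ut (of_int (coeff P i) * x ^ i / (of_int (coeff P j) * x ^ j))"
proof -
  define I where "I = {i. i \<le> degree P \<and> coeff P i \<noteq> 0}"
  define T where "T = (\<lambda>i. of_int (coeff P i) * x ^ i)"
  have fin: "finite I" by (simp add: I_def)
  have ne: "I \<noteq> {}" using P by (auto simp: I_def intro!: exI[of _ "degree P"])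
  have TL: "T i \<in> L" "T i \<noteq> 0" if "i \<in> I" for i using that x by (auto simp: T_def I_def)
  \<comment> \<open>Divisibility in a valuation ring is total, so finitely many nonzero terms have a
    largest one.\<close>
  have "\<exists>j\<in>J. \<forall>i\<in>J. T i / T j \<in> A" if "finite J" "J \<noteq> {}" "J \<subseteq> I" for J
    using that
  proof (induction J rule: finite_ne_induct)
    case (singleton j)
    then show ?case using TL by auto
  next
    case (insert k J)
    then obtain j where j: "j \<in> J" "\<forall>i\<in>J. T i / T j \<in> A" by auto
    show ?case
    proof (cases "T k / T j \<in> A")
      case True then show ?thesis using j by auto
    next
      case False
      have "T k / T j \<in> L" using TL insert.prems j by (intro divide) auto
      then have jk: "T j / T k \<in> A" using A_total[of "T k / T j"] False by simp
      have "T i / T k \<in> A" if "i \<in> J" for i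
      proof -
        have "T j \<noteq> 0" using TL(2)[of j] j insert.prems by auto
        then have "(T i / T j) * (T j / T k) = T i / T k" by simp
        then show ?thesis using A.mult[OF _ jk] j(2) that by metis
      qed
      moreover have "T k / T k \<in> A" using TL(2)[of k] insert.prems by auto
      ultimately show ?thesis by auto
    qed
  qed
  from this[OF fin ne] obtain j where j: "j \<in> I" "\<forall>i\<in>I. T i / T j \<in> A" by auto
  have "(\<Sum>i\<in>I. T i) = (\<Sum>i\<le>degree P. T i)"
    by (rule sum.mono_neutral_left) (auto simp: I_def T_def)
  also have "\<dots> = 0" using P by (simp add: T_def poly_altdef coeff_map_poly degree_map_poly)
  finally have "T j + (\<Sum>i\<in>I-{j}. T i) = 0" using fin j by (simp add: sum.remove)
  then have "(\<Sum>i\<in>I-{j}. T i / T j) = -1" using TL(2)[OF j(1)]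
    by (simp add: sum_divide_distrib[symmetric] field_simps eq_neg_iff_add_eq_0 add.commute)
  moreover have "ut (-1)" by (auto simp: ut_def)
  ultimately obtain i where i: "i \<in> I" "i \<noteq> j" "ut (T i / T j)"
    using ut_sum[of "I - {j}" "\<lambda>i. T i / T j"] fin j by auto
  have "ut (T j / T i)" using ut_inverse[OF i(3)] by simp
  then show ?thesis using i j unfolding I_def T_def by (cases "i < j") (blast, metis (lifting) mem_Collect_eq linorder_neqE_nat)
qed

text \<open>The quotient of two terms of equal size is a power of \<open>x\<close> times a rational
  number, and the latter is a power of \<open>p\<close> up to a unit.\<close>

lemma vrel_exists:
  assumes x: "x \<in> L" "x \<noteq> 0"
  shows "\<exists>r. vrel x r"
proof -
  obtain P where P: "P \<noteq> 0" "poly (map_poly of_int P) x = 0"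
    using algebraicE'[OF alg[OF x(1)]] by blast
  obtain i j where ij: "j < i" and nz: "coeff P i \<noteq> 0" "coeff P j \<noteq> 0"
    and u: "ut (of_int (coeff P i) * x ^ i / (of_int (coeff P j) * x ^ j))"
    using unit_ratio_exists[OF x P] by blast
  obtain k where k: "ut (of_int (coeff P i) / of_int (coeff P j) * of_nat p powi k)"
    using ut_rat_ratio[OF nz] by blast
  have "ut (of_int (coeff P i) * x ^ i / (of_int (coeff P j) * x ^ j) * inverse (of_int (coeff P i) / of_int (coeff P j) * of_nat p powi k))"
    by (rule ut_mult[OF u ut_inverse[OF k]])
  also have "of_int (coeff P i) * x ^ i / (of_int (coeff P j) * x ^ j) * inverse (of_int (coeff P i) / of_int (coeff P j) * of_nat p powi k)
     = x ^ (i - j) * of_nat p powi (- k)"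
    using nz ij x by (simp add: power_diff power_int_minus field_simps)
  finally show ?thesis using ij by (auto simp: vrel_def intro!: exI[of _ "i - j"] exI[of _ "- k"])
qed

definition vabs :: "'a \<Rightarrow> real" where
  "vabs = restrict (\<lambda>x. if x = 0 then 0 else real p powr (THE r. vrel x r)) L"

lemma vabs_eq: "x \<in> L \<Longrightarrow> vrel x r \<Longrightarrow> vabs x = real p powr r"
proof -
  assume *: "x \<in> L" "vrel x r"
  then have "x \<noteq> 0" by (auto simp: vrel_def ut_def zero_power)
  moreover have "(THE r. vrel x r) = r" using * vrel_unique by blast
  ultimately show ?thesis using * by (simp add: vabs_def)
qed

lemma p_gt1: "real p > 1" using p(1) prime_gt_1_nat by simp

lemma vabs_0 [simp]: "vabs 0 = 0" by (simp add: vabs_def)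

lemma vabs_pos: "x \<in> L \<Longrightarrow> x \<noteq> 0 \<Longrightarrow> vabs x > 0"
  using vrel_exists[of x] vabs_eq[of x] p_gt1 by auto

lemma vabs_mult:
  assumes "x \<in> L" "y \<in> L"
  shows "vabs (x * y) = vabs x * vabs y"
proof (cases "x = 0 \<or> y = 0")
  case False
  obtain r s where rs: "vrel x r" "vrel y s" using vrel_exists assms False by blast
  then obtain n k m l where *: "n > 0" "ut (x ^ n * of_nat p powi k)" "r = of_int k / real n"
     "m > 0" "ut (y ^ m * of_nat p powi l)" "s = of_int l / real m"
    by (auto simp: vrel_def)
  have "ut ((x ^ n * of_nat p powi k) ^ m * (y ^ m * of_nat p powi l) ^ n)"
    using * by (meson ut_mult ut_power)
  moreover have "(x ^ n * of_nat p powi k) ^ m * (y ^ m * of_nat p powi l) ^ n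
      = (x * y) ^ (n * m) * of_nat p powi (k * int m + l * int n)"
    using p0 by (simp add: power_mult_distrib power_int_add power_int_mult mult.commute[of n m] mult_ac flip: power_mult)
  moreover have "r + s = real_of_int (k * int m + l * int n) / real (n * m)" using * by (simp add: field_simps)
  ultimately have "vrel (x * y) (r + s)" unfolding vrel_def using * by (metis mult_pos_pos)
  then show ?thesis using rs assms by (simp add: vabs_eq mult powr_add)
qed (use assms in auto)

text \<open>The ring is recovered from its absolute value because it contains every element one of
  whose positive powers it contains: \<open>x\<close> is \<open>x ^ n\<close> times a power of its
  inverse.\<close>

lemma vabs_le_1: "x \<in> L \<Longrightarrow> vabs x \<le> 1 \<longleftrightarrow> x \<in> A"
proof (cases "x = 0")
  case False
  assume x: "x \<in> L"
  obtain r where r: "vrel x r" using vrel_exists x False by blast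
  then obtain n k where *: "n > 0" "ut (x ^ n * of_nat p powi k)" "r = of_int k / real n"
    by (auto simp: vrel_def)
  have "vabs x \<le> 1 \<longleftrightarrow> r \<le> 0" using vabs_eq[OF x r] p_gt1 powr_le_cancel_iff[of p r 0] by simp
  also have "\<dots> \<longleftrightarrow> k \<le> 0" unfolding *(3) using *(1) by (simp add: divide_le_0_iff)
  also have "\<dots> \<longleftrightarrow> x \<in> A"
  proof
    assume k: "k \<le> 0"
    have "x ^ n = x ^ n * of_nat p powi k * of_nat p ^ nat (- k)"
      using k p0 by (simp add: power_int_def field_simps)
    then have xn: "x ^ n \<in> A" using *(2) by (metis A.mult A.power A.of_nat ut_def)
    show "x \<in> A"
    proof (rule ccontr)
      assume "x \<notin> A"
      then have i: "inverse x \<in> A" using A_total[OF x] by simp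
      obtain m where m: "n = Suc m" using * by (cases n) auto
      have "x = x ^ n * inverse x ^ m" using False by (simp add: m power_inverse)
      then show False using xn i \<open>x \<notin> A\<close> by (metis A.mult A.power)
    qed
  next
    assume xA: "x \<in> A"
    show "k \<le> 0"
    proof (rule ccontr)
      assume "\<not> k \<le> 0"
      then have "of_nat p powi k = (of_nat p ^ nat k :: 'a)" by (simp add: power_int_def)
      then have "ut (of_nat p powi k)"
        using ut_factor[of "of_nat p ^ nat k" "x ^ n"] *(2) xA by (auto simp: mult.commute)
      then show False using ut_p_powi \<open>\<not> k \<le> 0\<close> by simp
    qed
  qed
  finally show ?thesis .
qed auto

lemma vabs_ultra:
  assumes "x \<in> L" "y \<in> L"
  shows "vabs (x + y) \<le> max (vabs x) (vabs y)"
proof -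
  have *: "vabs (x + y) \<le> max (vabs x) (vabs y)" if "x \<in> L" "y \<in> L" "y / x \<in> A" "x \<noteq> 0" for x y
  proof -
    have "x + y = x * (1 + y / x)" using that by (simp add: field_simps)
    then have "vabs (x + y) = vabs x * vabs (1 + y / x)" using vabs_mult that by (metis add divide one)
    also have "\<dots> \<le> vabs x * 1"
      using that vabs_le_1[of "1 + y / x"] vabs_pos[of x] A.add[OF A.one that(3)] A_sub by (intro mult_left_mono) auto
    finally show ?thesis by simp
  qed
  show ?thesis
  proof (cases "x = 0 \<or> y = 0")
    case True then show ?thesis using assms vabs_pos[of x] vabs_pos[of y] by (cases "x = 0"; cases "y = 0") auto
  next
    case False
    then have "y / x \<in> A \<or> x / y \<in> A" using A_total[of "y / x"] assms by auto
    then show ?thesis using *[of x y] *[of y x] assms False by (auto simp: add.commute max.commute)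
  qed
qed

lemma of_rat_in: "of_rat q \<in> L"
  by (cases q) (auto simp: of_rat_rat divide)

lemma vabs_rat: "vabs (of_rat q) = padic_abs p q"
proof (cases "q = 0")
  case False
  obtain a c where ac: "quotient_of q = (a, c)" by (cases "quotient_of q")
  have c: "c > 0" "q = of_int a / of_int c" using quotient_of_denom_pos[OF ac] quotient_of_div[OF ac] by auto
  have a: "a \<noteq> 0" using c False by auto
  define k where "k = int (multiplicity (int p) c) - int (multiplicity (int p) a)"
  have "ut ((of_int a * of_nat p powi (- int (multiplicity (int p) a))) * inverse (of_int c * of_nat p powi (- int (multiplicity (int p) c))))"
    using ut_mult[OF ut_int[OF a] ut_inverse[OF ut_int[of c]]] c by simp
  also have "((of_int a :: 'a) * of_nat p powi (- int (multiplicity (int p) a))) * inverse (of_int c * of_nat p powi (- int (multiplicity (int p) c)))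
     = of_rat q * of_nat p powi k"
    unfolding powi_ratio[OF p0] k_def c(2) by (simp add: of_rat_divide)
  finally have "vrel (of_rat q) (of_int k)" by (auto simp: vrel_def intro!: exI[of _ 1] exI[of _ k])
  then have "vabs (of_rat q) = real p powr of_int k" using vabs_eq of_rat_in by blast
  also have "\<dots> = real p powi k" using p_gt1 by (simp add: powr_real_of_int')
  finally show ?thesis using False ac by (simp add: padic_abs_def k_def)
qed (simp add: padic_abs_def)

lemma vabs_absolute_value: "vabs \<in> absolute_values L"
proof -
  have "vabs (x + y) \<le> vabs x + vabs y" if "x \<in> L" "y \<in> L" for x y
    using vabs_ultra[OF that] vabs_pos[of x] vabs_pos[of y] that by (cases "x = 0"; cases "y = 0") auto
  moreover have "0 \<le> vabs x" if "x \<in> L" for x using vabs_pos[OF that] by (cases "x = 0") auto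
  moreover have "vabs x = 0 \<longleftrightarrow> x = 0" if "x \<in> L" for x using vabs_pos[OF that] by (cases "x = 0") auto
  moreover have "vabs \<in> extensional L" by (simp add: vabs_def)
  ultimately show ?thesis by (simp add: absolute_values_def vabs_mult)
qed

end

text \<open>If all primes were invertible in \<open>A\<close>, it would contain the rational
  numbers, over which every element of \<open>L\<close> is integral.\<close>

lemma valuation_ring_prime:
  assumes alg: "\<And>x. x \<in> L \<Longrightarrow> algebraic (x :: 'a::field_char_0)" and A: "valuation_ring L A" and b: "b \<in> L" "b \<notin> A"
  shows "\<exists>p. prime p \<and> inverse (of_nat p) \<notin> A"
proof (rule ccontr)
  interpret A: subring_of A using A by unfold_locales (simp add: valuation_ring_def)
  assume "\<not> ?thesis"
  then have pr: "inverse (of_nat p) \<in> A" if "prime p" for p using that by blast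
  have n: "inverse (of_nat n) \<in> A" if "n > 0" for n :: nat
    using that
  proof (induction n rule: less_induct)
    case (less n)
    show ?case
    proof (cases "n = 1")
      case False
      then obtain p m where "prime p" "n = p * m" using prime_factor_nat[of n] by (auto elim: dvdE)
      moreover from this have "m < n" "m > 0" using less prime_gt_1_nat[of p] by auto
      ultimately show ?thesis using less.IH[of m] pr by (auto simp: inverse_mult_distrib)
    qed auto
  qed
  have "\<rat> \<subseteq> A"
  proof
    fix x :: 'a assume "x \<in> \<rat>"
    then obtain u v where "x = of_int u / of_int v" "v > 0" by (metis Rats_cases')
    then have "x = of_int u * inverse (of_nat (nat v))" by (simp add: divide_inverse)
    then show "x \<in> A" using n[of "nat v"] \<open>v > 0\<close> by auto
  qed
  moreover have "integral_over \<rat> b"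
  proof -
    have "alg_over \<rat> b" using alg[OF b(1)] algebraic_alg_over by blast
    then show ?thesis using Q.minpol_exists by (auto simp: minpol_def integral_over_def)
  qed
  ultimately show False using integral_in_valuation_ring A b by blast
qed

text \<open>Used in contraposed form to bound denominators: an element that is at most 1 for all
  nonarchimedean absolute values is an algebraic integer.\<close>

lemma nonintegral_abs:
  fixes L :: "'a::field_char_0 set"
  assumes L: "is_subfield L" and alg: "\<And>x. x \<in> L \<Longrightarrow> algebraic x"
    and b: "b \<in> L" "\<not> algebraic_int b"
  obtains f p where "f \<in> absolute_values L" "\<And>x y. x \<in> L \<Longrightarrow> y \<in> L \<Longrightarrow> f (x + y) \<le> max (f x) (f y)"
    "prime p" "\<And>q. f (of_rat q) = padic_abs p q" "f b > 1"
proof -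
  interpret subfield_of L using L by unfold_locales
  have "\<int> \<subseteq> L" by (auto elim: Ints_cases)
  then obtain A where A: "valuation_ring L A" "\<int> \<subseteq> A" "b \<notin> A"
    using nonintegral_valuation_ring[OF L Ints_subring _ b(1)] b(2) algebraic_int_integral by blast
  obtain p where p: "prime p" "inverse (of_nat p) \<notin> A"
    using valuation_ring_prime[OF alg A(1) b(1) A(3)] by blast
  interpret V: val_ring L A p using A p alg by unfold_locales
  show ?thesis
    using that[OF V.vabs_absolute_value V.vabs_ultra p(1) V.vabs_rat] V.vabs_le_1[OF b(1)] A(3) by auto
qed

section \<open>Roots of unity and their conjugates\<close>

text \<open>The powers of \<open>w\<close> other than 1 are the roots of the monic polynomial
  \<open>1 + X + ... + X ^ (n - 1)\<close>; its product form and its sum form are evaluated at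
  1.\<close>

lemma prod_one_minus_root_unity:
  fixes w :: "'a::field_char_0"
  assumes n: "n > 0" "w ^ n = 1" "\<And>i. 0 < i \<Longrightarrow> i < n \<Longrightarrow> w ^ i \<noteq> 1"
  shows "(\<Prod>i\<in>{1..<n}. 1 - w ^ i) = of_nat n"
proof -
  define P where "P = (\<Prod>i\<in>{1..<n}. [:- (w ^ i), 1:])"
  define Q :: "'a poly" where "Q = (\<Sum>i<n. monom 1 i)"
  have w0: "w \<noteq> 0" using n by (auto simp: power_0_left)
  have inj: "inj_on (\<lambda>i. w ^ i) {1..<n}"
  proof (rule linorder_inj_onI)
    fix i j assume ij: "i < j" "i \<in> {1..<n}" "j \<in> {1..<n}"
    have "w ^ j = w ^ i * w ^ (j - i)" using ij by (simp flip: power_add)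
    then show "w ^ i \<noteq> w ^ j" using n(3)[of "j - i"] ij w0 by auto
  qed auto
  have cP: "degree P = n - 1"
    unfolding P_def by (subst degree_prod_eq_sum_degree) auto
  have lP: "lead_coeff P = 1"
    unfolding P_def by (subst lead_coeff_prod) auto
  have cQ: "coeff Q j = (if j < n then 1 else 0)" for j by (simp add: Q_def coeff_sum)
  have dQ: "degree Q = n - 1"
    by (rule antisym[OF degree_le le_degree]) (use n in \<open>auto simp: cQ\<close>)
  have "P = Q"
  proof (rule poly_eqI_degree_lead_coeff[of _ "n - 1" _ "(\<lambda>i. w ^ i) ` {1..<n}"])
    show "coeff P (n - 1) = coeff Q (n - 1)" using lP n by (simp add: cQ cP)
    show "n - 1 \<le> card ((\<lambda>i. w ^ i) ` {1..<n})" using card_image[OF inj] by simp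
    fix x assume "x \<in> (\<lambda>i. w ^ i) ` {1..<n}"
    then obtain i where i: "i \<in> {1..<n}" "x = w ^ i" by auto
    have "poly P x = 0" using i by (auto simp: P_def poly_prod)
    moreover have "poly Q x = (\<Sum>k<n. x ^ k)" by (simp add: Q_def poly_sum poly_monom)
    moreover have "x ^ n = 1" using i n by (metis power_mult mult.commute power_one)
    then have "(\<Sum>k<n. x ^ k) = 0" using n(3)[of i] i geometric_sum[of x n] by auto
    ultimately show "poly P x = poly Q x" by simp
  qed (use cP dQ in auto)
  then have "poly P 1 = poly Q 1" by simp
  then show ?thesis by (simp add: P_def Q_def poly_prod poly_sum poly_monom)
qed

lemma root_unity_algebraic_int: "n > 0 \<Longrightarrow> (w::'a::field_char_0) ^ n = 1 \<Longrightarrow> algebraic_int w"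
  by (rule algebraic_int_root[of 1 "monom 1 n"]) (auto simp: poly_monom degree_monom_eq)

section \<open>Frobenius congruences and the conjugates of a root of unity\<close>

lemma (in subring_of) frobenius_add:
  assumes q: "prime q" and xy: "x \<in> A" "y \<in> A"
  shows "\<exists>u\<in>A. (x + y) ^ q = x ^ q + y ^ q + of_nat q * u"
proof -
  have q1: "q > 1" using q prime_gt_1_nat by blast
  have "\<exists>c. q choose k = q * c" if "k \<in> {1..<q}" for k
    using dvd_choose_prime[OF _ _ _ q, of k] that by (auto elim: dvdE)
  then obtain c where c: "\<And>k. k \<in> {1..<q} \<Longrightarrow> q choose k = q * c k" by metis
  have "{..q} = insert 0 (insert q {1..<q})" using q1 by auto
  then have "(x + y) ^ q = x ^ q + y ^ q + (\<Sum>k\<in>{1..<q}. of_nat (q choose k) * x ^ k * y ^ (q - k))"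
    using q1 by (simp add: binomial_ring)
  also have "(\<Sum>k\<in>{1..<q}. of_nat (q choose k) * x ^ k * y ^ (q - k))
     = of_nat q * (\<Sum>k\<in>{1..<q}. of_nat (c k) * x ^ k * y ^ (q - k))"
    unfolding sum_distrib_left by (rule sum.cong) (simp_all add: c mult.assoc)
  finally show ?thesis using xy by (intro bexI[of _ "\<Sum>k\<in>{1..<q}. of_nat (c k) * x ^ k * y ^ (q - k)"]) auto
qed

lemma (in subring_of) frobenius_sum:
  assumes q: "prime q" and x: "finite I" "\<And>i. i \<in> I \<Longrightarrow> x i \<in> A"
  shows "\<exists>u\<in>A. (\<Sum>i\<in>I. x i) ^ q = (\<Sum>i\<in>I. x i ^ q) + of_nat q * u"
  using x
proof (induction I)
  case empty
  then show ?case using q by (intro bexI[of _ 0]) (auto simp: power_0_left prime_gt_0_nat)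
next
  case (insert i I)
  obtain u where u: "u \<in> A" "(\<Sum>i\<in>I. x i) ^ q = (\<Sum>i\<in>I. x i ^ q) + of_nat q * u" using insert by auto
  obtain v where v: "v \<in> A" "(x i + (\<Sum>i\<in>I. x i)) ^ q = x i ^ q + (\<Sum>i\<in>I. x i) ^ q + of_nat q * v"
    using frobenius_add[OF q, of "x i" "\<Sum>i\<in>I. x i"] insert.prems by auto
  show ?case using insert.hyps u v by (intro bexI[of _ "u + v"]) (auto simp: algebra_simps)
qed

lemma (in subring_of) frobenius_int:
  assumes q: "prime q"
  shows "\<exists>u\<in>A. of_int a ^ q = of_int a + of_nat q * u"
proof (induction a rule: int_induct[of _ 0])
  case base
  then show ?case using q by (intro bexI[of _ 0]) (auto simp: power_0_left prime_gt_0_nat)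
next
  case (step1 a)
  obtain u where u: "u \<in> A" "of_int a ^ q = of_int a + of_nat q * u" using step1 by auto
  obtain v where v: "v \<in> A" "(of_int a + 1) ^ q = of_int a ^ q + 1 ^ q + of_nat q * v"
    using frobenius_add[OF q of_int one] by blast
  show ?case using u v by (intro bexI[of _ "u + v"]) (auto simp: algebra_simps)
next
  case (step2 a)
  obtain u where u: "u \<in> A" "of_int a ^ q = of_int a + of_nat q * u" using step2 by auto
  obtain v where v: "v \<in> A" "(of_int (a - 1) + 1) ^ q = of_int (a - 1) ^ q + 1 ^ q + of_nat q * v"
    using frobenius_add[OF q of_int[of "a - 1"] one] by blast
  have "of_int (a - 1) ^ q = of_int (a - 1) + of_nat q * (u - v)"
    using u(2) v(2) by (simp add: algebra_simps)
  then show ?case using u v by blast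
qed

text \<open>Modulo \<open>q\<close> the integer coefficients are unchanged by the
  \<open>q\<close>-th power, by Fermat, so only the argument is raised. The cofactor
  \<open>u\<close> stands in for a quotient ring modulo \<open>q\<close>.\<close>

lemma (in subring_of) frobenius_poly:
  assumes q: "prime q" and p: "p \<in> pol \<int>" and w: "w \<in> A"
  shows "\<exists>u\<in>A. poly p w ^ q = poly p (w ^ q) + of_nat q * u"
proof -
  have iA: "coeff p i \<in> A" for i using p by (auto simp: pol_def elim: Ints_cases intro: of_int) (metis Ints_cases of_int)
  have "\<exists>u\<in>A. coeff p i ^ q = coeff p i + of_nat q * u" for i
    using frobenius_int[OF q] p by (metis Ints_cases polD)
  then obtain c where c: "\<And>i. c i \<in> A" "\<And>i. coeff p i ^ q = coeff p i + of_nat q * c i" by metis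
  obtain u where u: "u \<in> A" "(\<Sum>i\<le>degree p. coeff p i * w ^ i) ^ q = (\<Sum>i\<le>degree p. (coeff p i * w ^ i) ^ q) + of_nat q * u"
    using frobenius_sum[OF q, of "{..degree p}" "\<lambda>i. coeff p i * w ^ i"] iA w by auto
  have "(\<Sum>i\<le>degree p. (coeff p i * w ^ i) ^ q) = poly p (w ^ q) + of_nat q * (\<Sum>i\<le>degree p. c i * (w ^ q) ^ i)"
    by (simp add: power_mult_distrib c(2) algebra_simps sum.distrib poly_altdef sum_distrib_left flip: power_mult)
  with u have "poly p w ^ q = poly p (w ^ q) + of_nat q * ((\<Sum>i\<le>degree p. c i * (w ^ q) ^ i) + u)"
    by (simp add: poly_altdef algebra_simps)
  moreover have "(\<Sum>i\<le>degree p. c i * (w ^ q) ^ i) + u \<in> A" using u(1) c(1) w by (intro add sum mult power)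
  ultimately show ?thesis by blast
qed

text \<open>Distinct \<open>N\<close>-th roots of unity thus stay distinct modulo every prime not
  dividing \<open>N\<close>; this replaces the discriminant of \<open>X ^ N - 1\<close>.\<close>

lemma root_unity_diff_dvd:
  fixes w :: "'a::field_char_0"
  assumes N: "N > 0" and z: "z ^ N = 1" "w ^ N = 1" "z \<noteq> w"
  shows "\<exists>y. algebraic_int y \<and> (w - z) * y = of_nat N"
proof -
  define u where "u = z / w"
  have w0: "w \<noteq> 0" using z N by (auto simp: power_0_left)
  have u: "u ^ N = 1" "u \<noteq> 1" using z w0 by (auto simp: u_def power_divide)
  \<comment> \<open>The factor \<open>1 - u\<close> turns each inner sum into
    \<open>1 - u ^ k\<close>, and the powers of \<open>u\<close> sum to 0, so the product is
    \<open>N\<close>.\<close>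
  define y where "y = (\<Sum>k<N. \<Sum>j<k. u ^ j)"
  have "(1 - u) * y = (\<Sum>k<N. (1 - u) * (\<Sum>j<k. u ^ j))" by (simp add: y_def sum_distrib_left)
  also have "\<dots> = (\<Sum>k<N. 1 - u ^ k)" by (intro sum.cong) (auto simp: one_diff_power_eq)
  also have "\<dots> = of_nat N" using u geometric_sum[of u N] by (simp add: sum_subtractf)
  finally have 1: "(1 - u) * y = of_nat N" .
  have au: "algebraic_int u" using root_unity_algebraic_int[OF N u(1)] .
  have ay: "algebraic_int y" unfolding y_def using au by (intro algebraic_int_sum algebraic_int_power)
  have wN: "w ^ (N - 1) * w = 1" using N z by (metis power_minus_mult)
  have aw: "algebraic_int w" using root_unity_algebraic_int[OF N z(2)] .
  have "(w - z) = w * (1 - u)" using w0 by (simp add: u_def field_simps)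
  then have "(w - z) * (w ^ (N - 1) * y) = (w ^ (N - 1) * w) * ((1 - u) * y)" by (simp add: mult_ac)
  then have "(w - z) * (w ^ (N - 1) * y) = of_nat N" unfolding 1 wN by simp
  moreover have "algebraic_int (w ^ (N - 1) * y)" by (intro algebraic_int_mult algebraic_int_power aw ay)
  ultimately show ?thesis by blast
qed

text \<open>The coefficients are integer polynomials in the roots and hence algebraic integers;
  being rational, they are integers.\<close>

lemma minpol_rat_int_coeffs:
  fixes x :: "'a::{alg_closed_field,field_char_0}"
  assumes P: "minpol \<rat> x P" and int: "\<And>z. poly P z = 0 \<Longrightarrow> algebraic_int z"
  shows "P \<in> pol \<int>" and "\<exists>A. P = (\<Prod>z\<in>#A. [:-z, 1:])"
proof -
  have P': "P \<in> pol \<rat>" "lead_coeff P = 1" "P \<noteq> 0" using P by (auto simp: minpol_def)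
  obtain A where A: "P = smult (lead_coeff P) (\<Prod>x\<in>#A. [:-x, 1:])"
    using alg_closed_imp_factorization[OF P'(3)] by blast
  then have A': "P = (\<Prod>x\<in>#A. [:-x, 1:])" using P' by simp
  then show "\<exists>A. P = (\<Prod>z\<in>#A. [:-z, 1:])" by blast
  have "algebraic_int z" if "z \<in># A" for z
    using that by (intro int) (auto simp: A' poly_prod_mset prod_mset_zero_iff)
  then have "\<forall>i. algebraic_int (coeff (\<Prod>x\<in>#A. [:-x, 1:]) i)"
  proof (induction A)
    case empty then show ?case by (auto simp: coeff_1)
  next
    case (add z A)
    have "algebraic_int (coeff ([:-z, 1:] * q) i)" if "\<forall>i. algebraic_int (coeff q i)" for q i
      unfolding coeff_mult using that add.prems
      by (intro algebraic_int_sum algebraic_int_mult) (auto simp: coeff_pCons split: nat.split)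
    then show ?case using add by (simp del: mult_pCons_left)
  qed
  then show "P \<in> pol \<int>" using P'(1) A' rational_algebraic_int_is_int unfolding pol_def by auto
qed

text \<open>The classical proof that cyclotomic polynomials are irreducible. For a prime
  \<open>q\<close> not dividing \<open>N\<close>, the value of \<open>P\<close> at
  \<open>z ^ q\<close> is a multiple of \<open>q\<close> by Frobenius. If it were nonzero, it would
  be a product of differences of distinct \<open>N\<close>-th roots of unity and so divide a power
  of \<open>N\<close>.\<close>

theorem minpol_root_unity_conjugate:
  fixes w :: "'a::{alg_closed_field,field_char_0}"
  assumes N: "N > 0" and w: "w ^ N = 1" and s: "coprime s N" and P: "minpol \<rat> w P"
  shows "poly P (w ^ s) = 0"
proof -
  interpret algint: subring_of "{x::'a. algebraic_int x}"
    using integral_over_subring[OF Ints_subring] by unfold_locales (simp add: algebraic_int_integral)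
  have X: "monom 1 N - 1 \<in> pol (\<rat> :: 'a set)" by (intro Q.pol_diff Q.pol_monom) auto
  have "poly (monom 1 N - 1) w = 0" using w by (simp add: poly_monom)
  then obtain S where S: "monom 1 N - 1 = P * S" using Q.minpol_dvd[OF P X] by blast
  have rt: "z ^ N = 1" if "poly P z = 0" for z
  proof -
    have "poly (monom 1 N - 1) z = 0" using that by (simp add: S)
    then show ?thesis by (simp add: poly_monom)
  qed
  have int: "algebraic_int z" if "poly P z = 0" for z using root_unity_algebraic_int[OF N rt[OF that]] .
  have PZ: "P \<in> pol \<int>" using minpol_rat_int_coeffs(1)[OF P int] .
  obtain A where A: "P = (\<Prod>z\<in>#A. [:-z, 1:])" using minpol_rat_int_coeffs(2)[OF P int] by blast
  have prime_step: "poly P (z ^ q) = 0" if z: "poly P z = 0" and q: "prime q" "\<not> q dvd N" for z q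
  proof (rule ccontr)
    assume nz: "poly P (z ^ q) \<noteq> 0"
    have zN: "(z ^ q) ^ N = 1" using rt[OF z] by (metis power_mult mult.commute power_one)
    have az: "z \<in> {x. algebraic_int x}" using int z by simp
    obtain u where u: "algebraic_int u" "poly P z ^ q = poly P (z ^ q) + of_nat q * u"
      using algint.frobenius_poly[OF q(1) PZ az] by auto
    have e: "poly P (z ^ q) = - (of_nat q * u)" using u(2) z q(1) by (simp add: power_0_left prime_gt_0_nat eq_neg_iff_add_eq_0)
    have "\<exists>y k. algebraic_int y \<and> (\<Prod>v\<in>#B. z ^ q - v) * y = of_nat N ^ k" if "B \<subseteq># A" for B
      using that
    proof (induction B)
      case empty then show ?case by (intro exI[of _ "1::'a"] exI[of _ "0::nat"]) auto
    next
      case (add v B)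
      have vA: "v \<in># A" using add.prems by (metis mset_subset_eqD union_single_eq_member)
      then have "poly P v = 0" by (auto simp: A poly_prod_mset prod_mset_zero_iff)
      moreover have "v \<noteq> z ^ q" using nz \<open>poly P v = 0\<close> by auto
      ultimately obtain y where y: "algebraic_int y" "(z ^ q - v) * y = of_nat N"
        using root_unity_diff_dvd[OF N rt zN] by blast
      obtain y' k where y': "algebraic_int y'" "(\<Prod>v\<in>#B. z ^ q - v) * y' = of_nat N ^ k"
        using add.IH add.prems by (metis mset_subset_eq_insertD subset_mset.less_imp_le)
      have "(\<Prod>v\<in>#add_mset v B. z ^ q - v) * (y * y') = ((z ^ q - v) * y) * ((\<Prod>v\<in>#B. z ^ q - v) * y')"
        by (simp add: mult_ac)
      also have "\<dots> = of_nat N ^ Suc k" using y(2) y'(2) by simp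
      finally show ?case using algebraic_int_mult[OF y(1) y'(1)] by blast
    qed
    from this[of A] obtain y k where y: "algebraic_int y" "(\<Prod>v\<in>#A. z ^ q - v) * y = of_nat N ^ k" by auto
    have "(\<Prod>v\<in>#A. z ^ q - v) = poly P (z ^ q)" by (simp add: A poly_prod_mset)
    then have "of_nat N ^ k = of_nat q * (- u * y)" unfolding y(2)[symmetric] e by simp
    then have eq: "of_nat (N ^ k) / of_nat q = - u * y" using q(1) by (simp add: field_simps prime_gt_0_nat)
    have "algebraic_int (- u * y)" using u y by (intro algebraic_int_mult) auto
    \<comment> \<open>A rational algebraic integer is an integer, so \<open>q\<close> would divide a
      power of \<open>N\<close>.\<close>
    then have "of_nat (N ^ k) / of_nat q \<in> (\<int> :: 'a set)"
      unfolding eq[symmetric] by (intro rational_algebraic_int_is_int) auto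
    then obtain c where "of_nat (N ^ k) / of_nat q = (of_int c :: 'a)" by (elim Ints_cases)
    then have "(of_nat (N ^ k) :: 'a) = of_int (int q * c)" using q(1) by (simp add: field_simps prime_gt_0_nat)
    then have "int (N ^ k) = int q * c" by (metis of_int_eq_iff of_int_of_nat_eq)
    then have "q dvd N ^ k" by (metis dvd_triv_left int_dvd_int_iff)
    then show False using q prime_dvd_power_nat by blast
  qed
  have P0: "poly P w = 0" using P by (simp add: minpol_def)
  \<comment> \<open>A general exponent is reached one prime factor at a time; exponent 0 is coprime
    to \<open>N\<close> only if \<open>N = 1\<close>.\<close>
  show ?thesis using s
  proof (induction s rule: less_induct)
    case (less s)
    show ?case
    proof (cases "s \<le> 1")
      case True
      then consider "s = 1" | "s = 0" by linarith
      then show ?thesis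
      proof cases
        case 2
        have "coprime 0 N" using less.prems unfolding 2 .
        then have "N = 1" by (metis coprime_0_left_iff nat_dvd_1_iff_1)
        then show ?thesis using w P0 2 by simp
      qed (use P0 in simp)
    next
      case False
      then obtain q r where q: "prime q" "s = q * r" using prime_factor_nat[of s] by (auto elim: dvdE)
      moreover from q have "r < s" using False prime_gt_1_nat[of q] by (cases "r = 0") auto
      moreover have "\<not> q dvd N" using less.prems q
        by (metis coprime_mult_left_iff coprime_absorb_left not_prime_unit)
      moreover have "coprime r N" using less.prems q by simp
      ultimately have "poly P ((w ^ r) ^ q) = 0" using prime_step less.IH by blast
      then show ?thesis using q by (metis power_mult mult.commute)
    qed
  qed
qed

lemma algebraic_root_unity: "n > 0 \<Longrightarrow> (w::'a::field_char_0) ^ n = 1 \<Longrightarrow> algebraic w"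
  using root_unity_algebraic_int algebraic_int_imp_algebraic by blast

lemma rat_poly_root_unity_conjugate:
  fixes w :: "'a::{alg_closed_field,field_char_0}"
  assumes N: "N > 0" "w ^ N = 1" "coprime s N" and p: "p \<in> pol \<rat>" "poly p w = 0"
  shows "poly p (w ^ s) = 0"
proof -
  obtain P where P: "minpol \<rat> w P"
    using Q.minpol_exists algebraic_root_unity[OF N(1,2)] algebraic_alg_over by blast
  obtain S where "p = P * S" using Q.minpol_dvd[OF P p] by blast
  then show ?thesis using minpol_root_unity_conjugate[OF N P] by simp
qed

lemma root_unity_hom:
  fixes w :: "'a::{alg_closed_field,field_char_0}"
  assumes N: "N > 0" "w ^ N = 1" "coprime s N"
  shows "\<exists>t. hom_on (adj \<rat> w) t \<and> t w = w ^ s"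
proof -
  interpret field_hom "\<rat> :: 'a set" id by unfold_locales (auto simp: hom_on_def)
  obtain P where P: "minpol \<rat> w P"
    using Q.minpol_exists algebraic_root_unity[OF N(1,2)] algebraic_alg_over by blast
  have id: "map_poly id P = P" by (rule poly_eqI) (simp add: coeff_map_poly)
  show ?thesis using extend'[OF P, of "w ^ s"] minpol_root_unity_conjugate[OF N P] unfolding id by auto
qed

section \<open>Integers of cyclotomic fields\<close>

definition zeta :: "nat \<Rightarrow> complex" where "zeta N = cis (2 * pi / real N)"

definition units_mod :: "nat \<Rightarrow> nat set" where "units_mod N = {s. s < N \<and> coprime s N}"

text \<open>One function carries all conjugates of an element. With \<open>R\<close> the integers or
  the rationals and \<open>s\<close> coprime to \<open>N\<close>, the value \<open>g s\<close> is
  the conjugate of \<open>g 1\<close> obtained by raising \<open>zeta N\<close> to the power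
  \<open>s\<close>.\<close>

definition zfun :: "complex set \<Rightarrow> nat \<Rightarrow> (nat \<Rightarrow> complex) \<Rightarrow> bool" where
  "zfun R N g \<longleftrightarrow> (\<exists>p\<in>pol R. \<forall>s. g s = poly p (zeta N ^ s))"

text \<open>The mean over all conjugates, which measures size in the induction of Cassels and
  Loxton.\<close>

definition mean_sq :: "nat \<Rightarrow> (nat \<Rightarrow> complex) \<Rightarrow> real" where
  "mean_sq N g = (\<Sum>s\<in>units_mod N. (cmod (g s))\<^sup>2) / real (card (units_mod N))"

lemma zeta_power: "zeta N ^ k = cis (2 * pi * real k / real N)"
  by (simp add: zeta_def Complex.DeMoivre mult_ac)

lemma zeta_power_N [simp]: "zeta N ^ N = 1"
  by (cases "N = 0") (auto simp: zeta_power)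

lemma zeta_power_mod: "zeta N ^ (k mod N) = zeta N ^ k"
proof -
  have "zeta N ^ k = zeta N ^ (N * (k div N) + k mod N)" by simp
  also have "\<dots> = zeta N ^ (k mod N)" unfolding power_add power_mult by simp
  finally show ?thesis ..
qed

lemma zeta_power_cong: "[i = j] (mod N) \<Longrightarrow> zeta N ^ i = zeta N ^ j"
  by (metis zeta_power_mod cong_def)

lemma zeta_power_eq_1_iff: "N > 0 \<Longrightarrow> zeta N ^ k = 1 \<longleftrightarrow> N dvd k"
proof
  assume N: "N > 0" and "zeta N ^ k = 1"
  then have "zeta N ^ (k mod N) = zeta N ^ 0" by (simp add: zeta_power_mod)
  moreover have "inj_on (\<lambda>k. zeta N ^ k) {..<N}"
    using bij_betw_roots_unity[OF N] by (simp add: zeta_power bij_betw_def)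
  ultimately have "k mod N = 0" using N inj_onD[of "\<lambda>k. zeta N ^ k" "{..<N}" "k mod N" 0] by simp
  then show "N dvd k" by auto
qed (auto simp: power_mult elim: dvdE)

lemma zeta_roots: "N > 0 \<Longrightarrow> z ^ N = 1 \<Longrightarrow> \<exists>k<N. z = zeta N ^ k"
  using bij_betw_roots_unity[of N] by (auto simp: zeta_power bij_betw_def image_iff set_eq_iff)

lemma zeta_power_divide: "d > 0 \<Longrightarrow> m > 0 \<Longrightarrow> zeta (d * m) ^ d = zeta m"
  by (simp add: zeta_power) (simp add: zeta_def)

lemma zeta_nonzero [simp]: "zeta N \<noteq> 0"
  by (simp add: zeta_def)

lemma cmod_zeta [simp]: "cmod (zeta N) = 1"
  by (simp add: zeta_def)

lemma zeta_orthogonality: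
  assumes "N > 0"
  shows "(\<Sum>k<N. zeta N ^ (k * m)) = (if N dvd m then of_nat N else 0)"
proof (cases "N dvd m")
  case True
  then have "zeta N ^ (k * m) = 1" for k using assms zeta_power_eq_1_iff by (simp add: dvd_mult)
  then show ?thesis using True by simp
next
  case False
  then have "zeta N ^ m \<noteq> 1" using assms zeta_power_eq_1_iff by simp
  moreover have "(zeta N ^ m) ^ N = 1" by (metis power_mult mult.commute power_one zeta_power_N)
  ultimately have "(\<Sum>k<N. (zeta N ^ m) ^ k) = 0" using geometric_sum[of "zeta N ^ m" N] by simp
  then show ?thesis using False by (simp add: mult.commute flip: power_mult)
qed

lemma units_mod_finite [simp, intro]: "finite (units_mod N)"
  by (simp add: units_mod_def)

lemma units_mod_nonempty: "N > 0 \<Longrightarrow> 1 mod N \<in> units_mod N"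
  by (auto simp: units_mod_def)

lemma card_units_mod_pos: "N > 0 \<Longrightarrow> card (units_mod N) > 0"
  using units_mod_nonempty by (auto simp: card_gt_0_iff)

lemma units_mod_bij:
  assumes "N > 0" "coprime u N"
  shows "bij_betw (\<lambda>s. (u * s) mod N) (units_mod N) (units_mod N)"
proof -
  have inj: "inj_on (\<lambda>s. (u * s) mod N) (units_mod N)"
  proof (rule inj_onI)
    fix x y assume "x \<in> units_mod N" "y \<in> units_mod N" "(u * x) mod N = (u * y) mod N"
    then have "[u * x = u * y] (mod N)" "x < N" "y < N" by (auto simp: cong_def units_mod_def)
    then show "x = y" using assms cong_mult_lcancel_nat cong_less_modulus_unique_nat by blast
  qed
  moreover have "(\<lambda>s. (u * s) mod N) ` units_mod N \<subseteq> units_mod N"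
    using assms by (auto simp: units_mod_def)
  ultimately show ?thesis unfolding bij_betw_def using endo_inj_surj[OF units_mod_finite] by blast
qed

lemma zfun_cong: "zfun R N g \<Longrightarrow> [i = j] (mod N) \<Longrightarrow> g i = g j"
  unfolding zfun_def using zeta_power_cong by metis

lemma zfun_mono: "R \<subseteq> R' \<Longrightarrow> zfun R N g \<Longrightarrow> zfun R' N g"
  unfolding zfun_def using pol_mono by blast

locale csubring = subring_of R for R :: "complex set"
begin

lemma zfun_const: "c \<in> R \<Longrightarrow> zfun R N (\<lambda>s. c)"
  unfolding zfun_def by (rule bexI[of _ "[:c:]"]) (auto simp: pol_def coeff_pCons split: nat.split)

lemma zfun_zeta: "zfun R N (\<lambda>s. zeta N ^ (i * s))"
  unfolding zfun_def by (rule bexI[of _ "monom 1 i"]) (auto simp: pol_def poly_monom mult.commute simp flip: power_mult)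

lemma zfun_add: "zfun R N f \<Longrightarrow> zfun R N g \<Longrightarrow> zfun R N (\<lambda>s. f s + g s)"
proof -
  assume "zfun R N f" "zfun R N g"
  then obtain p q where pq: "p \<in> pol R" "q \<in> pol R" "\<And>s. f s = poly p (zeta N ^ s)" "\<And>s. g s = poly q (zeta N ^ s)"
    unfolding zfun_def by blast
  have "p + q \<in> pol R" using pq by (auto simp: pol_def)
  then show ?thesis unfolding zfun_def using pq by (intro bexI[of _ "p + q"]) auto
qed

lemma zfun_mult: "zfun R N f \<Longrightarrow> zfun R N g \<Longrightarrow> zfun R N (\<lambda>s. f s * g s)"
proof -
  assume "zfun R N f" "zfun R N g"
  then obtain p q where pq: "p \<in> pol R" "q \<in> pol R" "\<And>s. f s = poly p (zeta N ^ s)" "\<And>s. g s = poly q (zeta N ^ s)"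
    unfolding zfun_def by blast
  have "p * q \<in> pol R" using pq by (auto simp: pol_def coeff_mult)
  then show ?thesis unfolding zfun_def using pq by (intro bexI[of _ "p * q"]) auto
qed

lemma zfun_diff: "zfun R N f \<Longrightarrow> zfun R N g \<Longrightarrow> zfun R N (\<lambda>s. f s - g s)"
  using zfun_add[of N f "\<lambda>s. -1 * g s"] zfun_mult[OF zfun_const[of "-1"], of N g] by auto

lemma zfun_sum: "(\<And>i. i \<in> I \<Longrightarrow> zfun R N (f i)) \<Longrightarrow> zfun R N (\<lambda>s. \<Sum>i\<in>I. f i s)"
  by (induction I rule: infinite_finite_induct) (auto intro: zfun_const zfun_add)

lemma zfun_prod: "(\<And>i. i \<in> I \<Longrightarrow> zfun R N (f i)) \<Longrightarrow> zfun R N (\<lambda>s. \<Prod>i\<in>I. f i s)"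
  by (induction I rule: infinite_finite_induct) (auto intro: zfun_const zfun_mult)

lemma zfun_shift: "zfun R N f \<Longrightarrow> zfun R N (\<lambda>s. f (u * s))"
proof -
  assume "zfun R N f"
  then obtain p where p: "p \<in> pol R" "\<And>s. f s = poly p (zeta N ^ s)" unfolding zfun_def by blast
  have "f (u * s) = (\<Sum>i\<le>degree p. coeff p i * zeta N ^ ((u * i) * s))" for s
    by (simp add: p poly_altdef mult_ac flip: power_mult)
  moreover have "zfun R N (\<lambda>s. \<Sum>i\<le>degree p. coeff p i * zeta N ^ ((u * i) * s))"
    using p by (intro zfun_sum zfun_mult zfun_const zfun_zeta) (auto simp: pol_def)
  ultimately show ?thesis by simp
qed

end

text \<open>Sorting all exponents below \<open>N\<close> by their gcd with \<open>N\<close>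
  expresses the full sum, which is \<open>N\<close> or 0, through the Ramanujan sums of the divisors
  of \<open>N\<close>; those of the smaller divisors are integers by induction.\<close>

lemma ramanujan_sum_int:
  assumes "N > 0"
  shows "(\<Sum>s\<in>units_mod N. zeta N ^ (i * s)) \<in> \<int>"
  using assms
proof (induction N rule: less_induct)
  case (less N)
  define D where "D = {d. d dvd N}"
  have D: "finite D" "1 \<in> D" using less.prems by (auto simp: D_def)
  have fib: "(\<Sum>k\<in>{k \<in> {..<N}. gcd k N = d}. zeta N ^ (k * i)) = (\<Sum>s\<in>units_mod (N div d). zeta (N div d) ^ (i * s))"
    if d: "d \<in> D" for d
  proof -
    define m where "m = N div d"
    have m: "N = d * m" "d > 0" "m > 0" using d less.prems by (auto simp: D_def m_def)
    have "{k \<in> {..<N}. gcd k N = d} = (\<lambda>s. d * s) ` units_mod m"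
    proof (intro equalityI subsetI)
      fix k assume "k \<in> {k \<in> {..<N}. gcd k N = d}"
      then have k: "k < N" "gcd k N = d" by auto
      then obtain s where s: "k = d * s" by (metis gcd_dvd1 dvdE)
      then have "d * gcd s m = d" using k m by (simp add: gcd_mult_distrib_nat)
      then have "coprime s m" using m by (simp add: coprime_iff_gcd_eq_1)
      then show "k \<in> (\<lambda>s. d * s) ` units_mod m" using s k m by (auto simp: units_mod_def)
    next
      fix k assume "k \<in> (\<lambda>s. d * s) ` units_mod m"
      then obtain s where s: "k = d * s" "s < m" "coprime s m" by (auto simp: units_mod_def)
      then have "gcd k N = d" using m gcd_mult_distrib_nat[of d s m] by (simp add: coprime_iff_gcd_eq_1)
      then show "k \<in> {k \<in> {..<N}. gcd k N = d}" using s m by auto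
    qed
    moreover have "inj_on (\<lambda>s. d * s) (units_mod m)" using m by (auto simp: inj_on_def)
    moreover have "zeta N ^ (d * s * i) = zeta m ^ (i * s)" for s
    proof -
      have "zeta N ^ (d * s * i) = (zeta (d * m) ^ d) ^ (i * s)" by (simp add: m(1) mult_ac flip: power_mult)
      then show ?thesis using zeta_power_divide m by simp
    qed
    ultimately show ?thesis by (simp add: sum.reindex m_def)
  qed
  have "(\<Sum>d\<in>D. \<Sum>k\<in>{k \<in> {..<N}. gcd k N = d}. zeta N ^ (k * i)) = (\<Sum>k<N. zeta N ^ (k * i))"
    using D by (intro sum.group) (auto simp: D_def)
  then have "(\<Sum>d\<in>D. \<Sum>s\<in>units_mod (N div d). zeta (N div d) ^ (i * s)) = (\<Sum>k<N. zeta N ^ (k * i))"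
    using fib by simp
  then have "(\<Sum>s\<in>units_mod N. zeta N ^ (i * s)) = (\<Sum>k<N. zeta N ^ (k * i)) -
     (\<Sum>d\<in>D-{1}. \<Sum>s\<in>units_mod (N div d). zeta (N div d) ^ (i * s))"
    using D by (simp add: sum.remove[of D 1] eq_diff_eq)
  moreover have "(\<Sum>d\<in>D-{1}. \<Sum>s\<in>units_mod (N div d). zeta (N div d) ^ (i * s)) \<in> \<int>"
  proof (rule Ints_sum)
    fix d assume d: "d \<in> D - {1}"
    then have "d dvd N" "d \<noteq> 1" "d \<noteq> 0" using less.prems by (auto simp: D_def)
    then obtain m where "N = d * m" "m > 0" "d > 1" using less.prems by (auto elim!: dvdE)
    then have "N div d < N" "N div d > 0" by auto
    then show "(\<Sum>s\<in>units_mod (N div d). zeta (N div d) ^ (i * s)) \<in> \<int>" using less.IH by simp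
  qed
  ultimately show ?case using zeta_orthogonality[OF less.prems] by (auto intro!: Ints_diff)
qed

text \<open>By linearity the trace of a polynomial in \<open>zeta N\<close> is a combination of
  Ramanujan sums with coefficients in \<open>R\<close>.\<close>

lemma (in csubring) zfun_trace:
  assumes N: "N > 0" and g: "zfun R N g"
  shows "(\<Sum>s\<in>units_mod N. g s) \<in> R"
proof -
  obtain p where p: "p \<in> pol R" "\<And>s. g s = poly p (zeta N ^ s)" using g unfolding zfun_def by blast
  have "(\<Sum>s\<in>units_mod N. g s) = (\<Sum>i\<le>degree p. coeff p i * (\<Sum>s\<in>units_mod N. zeta N ^ (i * s)))"
    by (simp add: p poly_altdef sum_distrib_left mult.commute sum.swap[of _ "units_mod N"] flip: power_mult)
  moreover have "(\<Sum>s\<in>units_mod N. zeta N ^ (i * s)) \<in> R" for i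
    using ramanujan_sum_int[OF N, of i] by (metis Ints_cases of_int)
  ultimately show ?thesis using p by (auto simp: pol_def)
qed

lemma units_mod_solve:
  fixes N :: nat
  assumes "N > 0" "coprime s N" "coprime s' N"
  shows "\<exists>u. coprime u N \<and> [s * u = s'] (mod N)"
proof -
  obtain x where x: "[s * x = 1] (mod N)" using cong_solve_coprime_nat[OF assms(2)] by auto
  then have "coprime (s * x) N" by (metis cong_imp_coprime cong_sym coprime_1_left)
  then have cx: "coprime x N" by simp
  have "[s * x * s' = 1 * s'] (mod N)" using x by (rule cong_mult) simp
  then show ?thesis using cx assms(3) by (intro exI[of _ "x * s'"]) (auto simp: mult.assoc)
qed

lemma zfun_zero_conjugate:
  assumes N: "N > 0" and g: "zfun \<rat> N g" and s: "coprime s N" "coprime s' N" "g s = 0"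
  shows "g s' = 0"
proof -
  obtain p where p: "p \<in> pol \<rat>" "\<And>s. g s = poly p (zeta N ^ s)" using g unfolding zfun_def by blast
  obtain u where u: "coprime u N" "[s * u = s'] (mod N)" using units_mod_solve[OF N s(1,2)] by blast
  have "(zeta N ^ s) ^ N = 1" by (metis power_mult mult.commute power_one zeta_power_N)
  then have "poly p ((zeta N ^ s) ^ u) = 0"
    using rat_poly_root_unity_conjugate[OF N _ u(1) p(1)] s(3) p(2) by simp
  then show ?thesis using p(2) zeta_power_cong[OF u(2)] by (simp flip: power_mult)
qed

lemma Ints_csubring: "csubring \<int>" and Rats_csubring: "csubring \<rat>"
  using Ints_subring subfield_subring[OF Rats_subfield] by (auto simp: csubring_def subring_of_def)

interpretation Zc: csubring "\<int>" by (rule Ints_csubring)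
interpretation Qc: csubring "\<rat>" by (rule Rats_csubring)

lemma Ints_Rats: "(\<int> :: 'a::field_char_0 set) \<subseteq> \<rat>"
  by (auto elim: Ints_cases)

lemma algebraic_int_poly: "p \<in> pol \<int> \<Longrightarrow> algebraic_int (w::'a::field_char_0) \<Longrightarrow> algebraic_int (poly p w)"
  unfolding poly_altdef
  by (intro algebraic_int_sum algebraic_int_mult algebraic_int_power) (auto simp: pol_def intro: int_imp_algebraic_int)

lemma algebraic_int_zeta: "N > 0 \<Longrightarrow> algebraic_int (zeta N)"
  using root_unity_algebraic_int[of N "zeta N"] by simp

lemma zfun_algebraic_int: "N > 0 \<Longrightarrow> zfun \<int> N g \<Longrightarrow> algebraic_int (g s)"
  unfolding zfun_def using algebraic_int_poly algebraic_int_power algebraic_int_zeta by metis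

text \<open>The product over all conjugates takes the same value \<open>x\<close> at every unit, so
  its trace is a positive multiple of \<open>x\<close>. Hence \<open>x\<close> is rational, and it
  is an algebraic integer.\<close>

lemma zfun_norm_int:
  assumes N: "N > 0" and g: "zfun \<int> N g"
  shows "(\<Prod>u\<in>units_mod N. g u) \<in> \<int>"
proof -
  define h where "h = (\<lambda>s. \<Prod>u\<in>units_mod N. g (u * s))"
  define x where "x = (\<Prod>u\<in>units_mod N. g u)"
  have h: "zfun \<int> N h" unfolding h_def by (intro Zc.zfun_prod Zc.zfun_shift g)
  have "h s = x" if "s \<in> units_mod N" for s
  proof -
    have "h s = (\<Prod>u\<in>units_mod N. g ((s * u) mod N))"
      unfolding h_def by (intro prod.cong refl zfun_cong[OF g]) (auto simp: cong_def mult.commute)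
    also have "\<dots> = x" unfolding x_def
      by (rule prod.reindex_bij_betw[OF units_mod_bij[OF N]]) (use that in \<open>simp add: units_mod_def\<close>)
    finally show ?thesis .
  qed
  then have "of_nat (card (units_mod N)) * x \<in> \<int>" using Zc.zfun_trace[OF N h] by simp
  then obtain c where "of_nat (card (units_mod N)) * x = of_int c" by (elim Ints_cases)
  moreover have "(of_nat (card (units_mod N)) :: complex) \<noteq> 0" using card_units_mod_pos[OF N]
    by (metis of_nat_eq_0_iff less_numeral_extra(3))
  ultimately have "x = of_int c / of_nat (card (units_mod N))" by (metis nonzero_mult_div_cancel_left)
  then have "x \<in> \<rat>" by simp
  moreover have "algebraic_int x" unfolding x_def using zfun_algebraic_int[OF N g] by (intro algebraic_int_prod)
  ultimately show ?thesis unfolding x_def[symmetric] using rational_algebraic_int_is_int by blast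
qed

text \<open>The inequality of arithmetic and geometric means, applied to a norm: the product of the
  squared absolute values is the square of a nonzero integer.\<close>

lemma mean_sq_ge_1:
  assumes N: "N > 0" and g: "zfun \<int> N g" and s: "coprime s N" "g s \<noteq> 0"
  shows "mean_sq N g \<ge> 1"
proof (rule ccontr)
  assume less: "\<not> mean_sq N g \<ge> 1"
  let ?U = "units_mod N"
  have nz: "g u \<noteq> 0" if "u \<in> ?U" for u
    using zfun_zero_conjugate[OF N zfun_mono[OF Ints_Rats g] _ s(1), of u] s(2) that by (auto simp: units_mod_def)
  \<comment> \<open>Multiplying \<open>x <= exp (x - 1)\<close> over all conjugates yields the
    inequality of the means.\<close>
  have "(\<Prod>u\<in>?U. (cmod (g u))\<^sup>2) \<le> (\<Prod>u\<in>?U. exp ((cmod (g u))\<^sup>2 - 1))"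
    using exp_ge_add_one_self by (intro prod_mono) (auto simp: add.commute, smt (verit) exp_ge_add_one_self)
  also have "\<dots> = exp (\<Sum>u\<in>?U. (cmod (g u))\<^sup>2 - 1)" by (simp add: exp_sum)
  also have "(\<Sum>u\<in>?U. (cmod (g u))\<^sup>2 - 1) = (\<Sum>u\<in>?U. (cmod (g u))\<^sup>2) - real (card ?U)"
    by (simp add: sum_subtractf)
  also have "(\<Sum>u\<in>?U. (cmod (g u))\<^sup>2) < real (card ?U)"
    using less card_units_mod_pos[OF N] by (simp add: mean_sq_def field_simps)
  then have "exp ((\<Sum>u\<in>?U. (cmod (g u))\<^sup>2) - real (card ?U)) < 1" by simp
  finally have "(\<Prod>u\<in>?U. (cmod (g u))\<^sup>2) < 1" .
  moreover have "(cmod (\<Prod>u\<in>?U. g u))\<^sup>2 = (\<Prod>u\<in>?U. (cmod (g u))\<^sup>2)"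
    by (simp only: prod_norm[symmetric] prod_power_distrib)
  ultimately have lt: "(cmod (\<Prod>u\<in>?U. g u))\<^sup>2 < 1" by simp
  obtain c where c: "(\<Prod>u\<in>?U. g u) = of_int c" using zfun_norm_int[OF N g] by (elim Ints_cases)
  have "c \<noteq> 0" using c nz by auto
  then have "1 \<le> \<bar>real_of_int c\<bar>" by linarith
  then have "1 \<le> \<bar>real_of_int c\<bar>\<^sup>2" by (rule one_le_power)
  then have "1 \<le> (cmod (of_int c))\<^sup>2" by simp
  then show False using lt c by simp
qed

section \<open>The ring of integers of a cyclotomic field\<close>

abbreviation ZZ :: "complex \<Rightarrow> complex set" where "ZZ w \<equiv> subring_of.adjoin \<int> w"
abbreviation QQ :: "complex \<Rightarrow> complex set" where "QQ w \<equiv> subring_of.adjoin \<rat> w"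

lemma (in subfield_of) pol_pcompose: "p \<in> pol L \<Longrightarrow> q \<in> pol L \<Longrightarrow> pcompose p q \<in> pol L"
proof (induction p)
  case (pCons a p)
  have "a \<in> L" using polD[OF pCons.prems(1), of 0] by simp
  moreover have "coeff p i \<in> L" for i using polD[OF pCons.prems(1), of "Suc i"] by simp
  then have "p \<in> pol L" by (simp add: pol_def)
  ultimately show ?case using pCons.IH pCons.prems(2) by (simp add: pcompose_pCons pol_add pol_mult pol_const)
qed simp

lemma QQ_conjugate_algebraic_int:
  assumes N: "N > 0" and p: "p \<in> pol \<rat>" "algebraic_int (poly p (zeta N))" and s: "coprime s N"
  shows "algebraic_int (poly p (zeta N ^ s))"
proof -
  obtain q where q: "q \<in> pol \<int>" "lead_coeff q = 1" "poly q (poly p (zeta N)) = 0"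
    using p(2) unfolding algebraic_int_integral integral_over_def by blast
  have "pcompose q p \<in> pol \<rat>" using q(1) p(1) pol_mono[OF Ints_Rats] by (intro Q.pol_pcompose) auto
  then have "poly (pcompose q p) (zeta N ^ s) = 0"
    using rat_poly_root_unity_conjugate[OF N zeta_power_N s, of "pcompose q p"] q(3) by (simp add: poly_pcompose)
  then show ?thesis unfolding algebraic_int_integral integral_over_def using q by (auto simp: poly_pcompose)
qed

text \<open>With natural exponents \<open>N - 1\<close> plays the part of -1; this is the
  orthogonality condition for exponents \<open>j\<close> and \<open>u\<close> in that
  disguise.\<close>

lemma dvd_add_pred_mult:
  fixes N :: nat
  assumes N: "N > 0"
  shows "N dvd j + (N - 1) * u \<longleftrightarrow> [j = u] (mod N)"
proof -
  have "j + (N - 1) * u + u = j + N * u" using N by (cases N) auto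
  then have *: "[j + (N - 1) * u + u = j] (mod N)" by (metis cong_def mod_mult_self2)
  have "N dvd j + (N - 1) * u \<longleftrightarrow> [j + (N - 1) * u = 0] (mod N)" by (simp add: cong_0_iff)
  also have "\<dots> \<longleftrightarrow> [j + (N - 1) * u + u = 0 + u] (mod N)" by (simp only: cong_add_rcancel_nat)
  also have "\<dots> \<longleftrightarrow> [j = u] (mod N)" using * by (metis add_0 cong_sym cong_trans)
  finally show ?thesis .
qed

text \<open>Fourier inversion in the exponent. The coefficients are traces, so integrality and
  bounds of traces pass to the coordinates of \<open>g 1\<close>.\<close>

lemma trace_expansion:
  assumes N: "N > 0" and g: "zfun R N g"
  shows "of_nat N * g 1 = (\<Sum>i<N. (\<Sum>u\<in>units_mod N. g u * zeta N ^ ((N - 1) * i * u)) * zeta N ^ i)"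
proof -
  have u1: "1 mod N \<in> units_mod N" using units_mod_nonempty[OF N] .
  have "(\<Sum>i<N. (\<Sum>u\<in>units_mod N. g u * zeta N ^ ((N - 1) * i * u)) * zeta N ^ i)
      = (\<Sum>u\<in>units_mod N. g u * (\<Sum>i<N. zeta N ^ (i * (1 + (N - 1) * u))))"
    unfolding sum_distrib_right sum_distrib_left
    by (subst sum.swap, intro sum.cong refl) (simp add: power_add mult_ac)
  also have "\<dots> = (\<Sum>u\<in>units_mod N. if u = 1 mod N then of_nat N * g u else 0)"
  proof (rule sum.cong)
    fix u assume u: "u \<in> units_mod N"
    have "N dvd 1 + (N - 1) * u \<longleftrightarrow> u = 1 mod N"
      unfolding dvd_add_pred_mult[OF N] using u by (auto simp: cong_def units_mod_def)
    then show "g u * (\<Sum>i<N. zeta N ^ (i * (1 + (N - 1) * u))) = (if u = 1 mod N then of_nat N * g u else 0)"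
      unfolding zeta_orthogonality[OF N] by simp
  qed simp
  also have "\<dots> = of_nat N * g (1 mod N)" using u1 by simp
  also have "g (1 mod N) = g 1" using zfun_cong[OF g, of "1 mod N" 1] by (simp add: cong_def)
  finally show ?thesis ..
qed

text \<open>The coordinates in the trace expansion are rational traces of algebraic integers, hence
  integers.\<close>

lemma algebraic_int_multiple_in_ZZ:
  assumes N: "N > 0" and x: "x \<in> QQ (zeta N)" "algebraic_int x"
  shows "of_nat N * x \<in> ZZ (zeta N)"
proof -
  obtain p where p: "p \<in> pol \<rat>" "x = poly p (zeta N)" using x(1) by (rule Qc.adjoinE)
  define g where "g = (\<lambda>s. poly p (zeta N ^ s))"
  have g: "zfun \<rat> N g" using p by (auto simp: zfun_def g_def)
  have ga: "algebraic_int (g s)" if "coprime s N" for s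
    unfolding g_def using QQ_conjugate_algebraic_int[OF N p(1) _ that] x(2) p(2) by simp
  define c where "c = (\<lambda>i. \<Sum>u\<in>units_mod N. g u * zeta N ^ ((N - 1) * i * u))"
  have c: "c i \<in> \<int>" for i
  proof (rule rational_algebraic_int_is_int)
    show "c i \<in> \<rat>" unfolding c_def by (intro Qc.zfun_trace[OF N] Qc.zfun_mult Qc.zfun_zeta g)
    show "algebraic_int (c i)" unfolding c_def
      by (intro algebraic_int_sum algebraic_int_mult algebraic_int_power algebraic_int_zeta N ga) (auto simp: units_mod_def)
  qed
  have "of_nat N * x = (\<Sum>i<N. c i * zeta N ^ i)"
    using trace_expansion[OF N g] by (simp add: c_def g_def p(2))
  moreover interpret Z: subring_of "ZZ (zeta N)" by unfold_locales (rule Zc.adjoin_subring)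
  have "c i \<in> ZZ (zeta N)" for i using c Zc.adjoin_base by blast
  ultimately show ?thesis using Zc.adjoin_elem[of "zeta N"] by (simp only:) (intro Z.sum Z.mult Z.power)
qed

lemma ZZ_algebraic_int: "algebraic_int w \<Longrightarrow> x \<in> ZZ w \<Longrightarrow> algebraic_int x"
  using algebraic_int_poly by (auto elim!: Zc.adjoinE)

lemma QQ_subfield_facts:
  "is_subring (QQ w)" "ZZ w \<subseteq> QQ w" "q \<in> \<rat> \<Longrightarrow> x \<in> QQ w \<Longrightarrow> q * x \<in> QQ w"
proof -
  show s: "is_subring (QQ w)" by (rule Qc.adjoin_subring)
  show "ZZ w \<subseteq> QQ w" unfolding Zc.adjoin_def Qc.adjoin_def using pol_mono[OF Ints_Rats] by blast
  interpret subring_of "QQ w" using s by unfold_locales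
  show "q \<in> \<rat> \<Longrightarrow> x \<in> QQ w \<Longrightarrow> q * x \<in> QQ w" using Qc.adjoin_base by blast
qed

lemma power_cong_1_exists:
  assumes "N > 0" "coprime (a::nat) N"
  shows "\<exists>k>0. [a ^ k = 1] (mod N)"
proof -
  have "finite ((\<lambda>i. a ^ i mod N) ` UNIV)"
    by (rule finite_subset[of _ "{..<N}"]) (use assms in auto)
  then have "\<not> inj (\<lambda>i::nat. a ^ i mod N)" using finite_imageD[of "\<lambda>i. a ^ i mod N" UNIV] by auto
  then obtain i j where ij: "i \<noteq> j" "a ^ i mod N = a ^ j mod N" by (auto simp: inj_on_def)
  have *: "\<exists>k>0. [a ^ k = 1] (mod N)" if "i < j" "a ^ i mod N = a ^ j mod N" for i j
  proof -
    have "[a ^ i * a ^ (j - i) = a ^ i * 1] (mod N)" using that by (simp add: cong_def flip: power_add)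
    moreover have "coprime (a ^ i) N" using assms by simp
    ultimately have "[a ^ (j - i) = 1] (mod N)" using cong_mult_lcancel_nat by blast
    then show ?thesis using that by (intro exI[of _ "j - i"]) auto
  qed
  show ?thesis using *[of i j] *[of j i] ij by (cases "i < j") auto
qed

text \<open>An unramified prime: Frobenius is bijective modulo \<open>p\<close> on \<open>\<int>[\<zeta>\<^sub>N]\<close>, so this ring is
  reduced modulo \<open>p\<close>.\<close>
lemma ZZ_unramified_divides:
  assumes N: "N > 0" and p: "prime p" "\<not> p dvd N" and b: "b \<in> ZZ (zeta N)" "algebraic_int (b ^ n / of_nat p)"
  shows "\<exists>b'\<in>ZZ (zeta N). b = of_nat p * b'"
proof -
  interpret Z: subring_of "ZZ (zeta N)" by unfold_locales (rule Zc.adjoin_subring)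
  have p0: "of_nat p \<noteq> (0::complex)" using p(1) by (simp add: prime_gt_0_nat)
  have cop: "coprime p N" using p by (simp add: prime_imp_coprime)
  obtain h where h: "h \<in> pol \<int>" "b = poly h (zeta N)" using b(1) by (rule Zc.adjoinE)
  \<comment> \<open>Modulo \<open>p\<close>, repeated \<open>p\<close>-th powers act on
    \<open>zeta N\<close> alone.\<close>
  have fr: "\<exists>u\<in>ZZ (zeta N). b ^ (p ^ f) = poly h (zeta N ^ (p ^ f)) + of_nat p * u" for f
  proof (induction f)
    case 0 show ?case using h by (intro bexI[of _ 0]) auto
  next
    case (Suc f)
    then obtain u where u: "u \<in> ZZ (zeta N)" "b ^ (p ^ f) = poly h (zeta N ^ (p ^ f)) + of_nat p * u" by blast
    define y where "y = poly h (zeta N ^ (p ^ f))"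
    have zp: "zeta N ^ (p ^ f) \<in> ZZ (zeta N)" using Zc.adjoin_elem by auto
    have "b ^ (p ^ f) - of_nat p * u \<in> ZZ (zeta N)" by (intro Z.diff Z.power Z.mult Z.of_nat b(1) u(1))
    moreover have "y = b ^ (p ^ f) - of_nat p * u" using u(2) by (simp add: y_def)
    ultimately have y: "y \<in> ZZ (zeta N)" by metis
    obtain v where v: "v \<in> ZZ (zeta N)" "(y + of_nat p * u) ^ p = y ^ p + (of_nat p * u) ^ p + of_nat p * v"
      using Z.frobenius_add[OF p(1) y, of "of_nat p * u"] u(1) by auto
    obtain v' where v': "v' \<in> ZZ (zeta N)" "y ^ p = poly h ((zeta N ^ (p ^ f)) ^ p) + of_nat p * v'"
      unfolding y_def using Z.frobenius_poly[OF p(1) h(1) zp] by blast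
    obtain p' where p': "p = Suc p'" using p(1) prime_gt_0_nat by (metis Suc_pred)
    have "b ^ (p ^ Suc f) = (b ^ (p ^ f)) ^ p" by (simp add: mult.commute flip: power_mult)
    also have "\<dots> = poly h (zeta N ^ (p ^ Suc f)) + of_nat p * (v' + u * (of_nat p * u) ^ p' + v)"
    proof -
      have e: "(zeta N ^ (p ^ f)) ^ p = zeta N ^ (p ^ Suc f)" by (simp add: mult.commute flip: power_mult)
      have "(of_nat p * u) ^ p = of_nat p * (u * (of_nat p * u) ^ p')"
        unfolding p' by (simp only: power_Suc mult.assoc)
      then show ?thesis unfolding u(2) y_def[symmetric] v(2) v'(2) e by (simp add: algebra_simps)
    qed
    finally have "b ^ (p ^ Suc f) = poly h (zeta N ^ (p ^ Suc f)) + of_nat p * (v' + u * (of_nat p * u) ^ p' + v)" .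
    moreover have "v' + u * (of_nat p * u) ^ p' + v \<in> ZZ (zeta N)"
      by (intro Z.add Z.mult Z.power Z.of_nat u(1) v(1) v'(1))
    ultimately show ?case by blast
  qed
  \<comment> \<open>For \<open>p ^ f\<close> congruent to 1 modulo \<open>N\<close> the power map is
    the identity modulo \<open>p\<close>. Taking \<open>f\<close> a multiple of \<open>n\<close>
    also makes \<open>p ^ f\<close> at least \<open>n\<close>, so \<open>b\<close> is congruent to a
    multiple of \<open>b ^ n\<close>.\<close>
  obtain k where k: "k > 0" "[p ^ k = 1] (mod N)" using power_cong_1_exists[OF N cop] by blast
  define f where "f = k * n"
  have "n \<le> f" using k by (simp add: f_def)
  also have "f < p ^ f" using p(1) prime_gt_1_nat by (intro power_gt_expt) auto
  finally have nf: "n \<le> p ^ f" by simp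
  have "[p ^ f = 1] (mod N)" using cong_pow[OF k(2), of n] by (simp add: f_def power_mult)
  then have "zeta N ^ (p ^ f) = zeta N" using zeta_power_cong by fastforce
  then obtain u where u: "u \<in> ZZ (zeta N)" "b ^ (p ^ f) = b + of_nat p * u" using fr[of f] h by auto
  have ai: "algebraic_int y" if "y \<in> ZZ (zeta N)" for y using ZZ_algebraic_int algebraic_int_zeta[OF N] that by blast
  have "b / of_nat p = (b ^ n / of_nat p) * b ^ (p ^ f - n) - u"
    using u(2) p0 nf by (simp add: field_simps flip: power_add)
  moreover have "algebraic_int ((b ^ n / of_nat p) * b ^ (p ^ f - n) - u)"
    using b ai u by (intro algebraic_int_diff algebraic_int_mult algebraic_int_power) auto
  ultimately have a: "algebraic_int (b / of_nat p)" by simp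
  have "inverse (of_nat p) * b \<in> QQ (zeta N)" using b QQ_subfield_facts(2) by (intro QQ_subfield_facts(3)) auto
  then have "b / of_nat p \<in> QQ (zeta N)" by (simp add: field_simps)
  \<comment> \<open>So far \<open>b / p\<close> is only an algebraic integer. Its multiples by
    \<open>N\<close> and by \<open>p\<close> lie in the ring, and these two numbers are
    coprime.\<close>
  from algebraic_int_multiple_in_ZZ[OF N this a] have 1: "of_nat N * (b / of_nat p) \<in> ZZ (zeta N)" .
  obtain r s where "r * int N + s * int p = 1" using bezout_int[of "int N" "int p"] cop
    by (metis coprime_commute coprime_iff_gcd_eq_1 coprime_int_iff)
  then have "of_int (r * int N + s * int p) = (1::complex)" by simp
  then have "b / of_nat p = of_int r * (of_nat N * (b / of_nat p)) + of_int s * b"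
    using p0 by (simp add: field_simps) (metis distrib_left mult.assoc mult.commute mult_1)
  then have "b / of_nat p \<in> ZZ (zeta N)" using 1 b by (metis Z.add Z.mult Z.of_int)
  then show ?thesis using p0 by (intro bexI[of _ "b / of_nat p"]) auto
qed

text \<open>Let \<open>q\<close> be the power of \<open>p\<close> in \<open>N = q * N'\<close>. Up
  to factors in the ring, \<open>p\<close> is the \<open>ph\<close>-th power of
  \<open>pe = 1 - zeta q\<close>, and the ring is generated by \<open>pe\<close> over that of level
  \<open>N'\<close>. Modulo \<open>p\<close>, the element \<open>of_nat p * x\<close> is divisible
  by higher and higher powers of \<open>pe\<close>: each time the constant coefficient is divisible
  by \<open>pe\<close> and therefore, as level \<open>N'\<close> is unramified, by
  \<open>p\<close>.\<close>

lemma ZZ_saturated: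
  assumes N: "N > 0" and p: "prime p" "p dvd N" and x: "algebraic_int x" "of_nat p * x \<in> ZZ (zeta N)"
  shows "x \<in> ZZ (zeta N)"
proof -
  let ?R = "ZZ (zeta N)" 
  obtain k N' where N': "N = p ^ k * N'" "\<not> p dvd N'"
    using multiplicity_decompose'[of N p] N p(1) by (metis not_prime_unit not_gr0)
  let ?R' = "ZZ (zeta N')"
  have k: "k > 0" using N' p by (cases k) auto
  have p1: "p > 1" using p(1) prime_gt_1_nat by blast
  have p0: "of_nat p \<noteq> (0::complex)" using p1 by simp
  have N'0: "N' > 0" using N N' by (cases N') auto
  define q where "q = p ^ k"
  have q: "q > 1" using one_less_power[OF p1 k] by (simp add: q_def)
  then have "q > 0" by simp
  note q = q this
  have Nq: "N = q * N'" by (simp add: N' q_def)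
  define z where "z = zeta q"
  define pe where "pe = 1 - z"
  have zN: "zeta N ^ N' = z" "zeta N ^ q = zeta N'"
    using zeta_power_divide[of N' q] zeta_power_divide[of q N'] N'0 q by (auto simp: Nq z_def mult.commute)
  interpret Z: subring_of "?R" by unfold_locales (rule Zc.adjoin_subring)
  interpret Z': subring_of "?R'" by unfold_locales (rule Zc.adjoin_subring)
  have ai: "algebraic_int y" if "y \<in> ?R" for y using ZZ_algebraic_int algebraic_int_zeta[OF N] that by blast
  have zR: "z \<in> ?R" using zN(1) Zc.adjoin_elem Z.power by metis
  have sub: "?R' \<subseteq> ?R"
  proof
    fix y assume "y \<in> ?R'"
    then obtain h where h: "h \<in> pol \<int>" "y = poly h (zeta N')" by (rule Zc.adjoinE)
    have "zeta N' \<in> ?R" using zN(2) Zc.adjoin_elem Z.power by metis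
    moreover have "coeff h i \<in> ?R" for i using h Zc.adjoin_base by (auto simp: pol_def)
    ultimately show "y \<in> ?R" using h by (auto simp: poly_altdef)
  qed
  have piR: "pe \<in> ?R" using zR by (auto simp: pe_def)
  \<comment> \<open>The number \<open>ph\<close> of these exponents is Euler's function of
    \<open>q\<close>, the ramification index of \<open>p\<close>.\<close>
  define U where "U = {u. u < q \<and> coprime u p}"
  have U: "finite U" by (simp add: U_def)
  have "1 \<in> U" using q by (auto simp: U_def)
  define ph where "ph = card U"
  have phi: "ph > 0" using \<open>1 \<in> U\<close> U by (auto simp: ph_def card_gt_0_iff)
  \<comment> \<open>The product over all exponents from 1 to \<open>q - 1\<close> is
    \<open>q\<close>, and the one over the multiples of \<open>p\<close> is \<open>q / p\<close>;
    what remains is \<open>p\<close>.\<close>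
  have prodU: "(\<Prod>u\<in>U. 1 - z ^ u) = of_nat p"
  proof -
    define r where "r = p ^ (k - 1)"
    have "Suc (k - 1) = k" using k by simp
    then have "q = p * r" unfolding q_def r_def by (metis power_Suc)
    moreover have "r > 0" using p1 by (simp add: r_def)
    ultimately have qr: "q = p * r" "r > 0" by auto
    have "(\<Prod>i\<in>{1..<q}. 1 - z ^ i) = of_nat q"
      by (rule prod_one_minus_root_unity) (use q zeta_power_eq_1_iff in \<open>auto simp: z_def dest: nat_dvd_not_less\<close>)
    moreover have "{1..<q} = U \<union> (\<lambda>i. p * i) ` {1..<r}"
    proof (intro equalityI subsetI)
      fix i assume i: "i \<in> {1..<q}"
      show "i \<in> U \<union> (\<lambda>i. p * i) ` {1..<r}"
      proof (cases "p dvd i")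
        case True
        then obtain j where "i = p * j" by (elim dvdE)
        then show ?thesis using i qr p1 by (auto intro!: imageI)
      next
        case False
        then have "coprime i p" using prime_imp_coprime[OF p(1) False] by (simp add: coprime_commute)
        then show ?thesis using i by (auto simp: U_def)
      qed
    next
      fix i assume "i \<in> U \<union> (\<lambda>i. p * i) ` {1..<r}"
      then show "i \<in> {1..<q}" using qr p1 p(1) by (cases "i = 0") (auto simp: U_def)
    qed
    moreover have "U \<inter> (\<lambda>i. p * i) ` {1..<r} = {}" using p1 by (auto simp: U_def)
    moreover have "(\<Prod>i\<in>(\<lambda>i. p * i) ` {1..<r}. 1 - z ^ i) = of_nat r"
    proof -
      have "(\<Prod>i\<in>(\<lambda>i. p * i) ` {1..<r}. 1 - z ^ i) = (\<Prod>i\<in>{1..<r}. 1 - (z ^ p) ^ i)"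
        using p1 by (subst prod.reindex) (auto simp: inj_on_def power_mult)
      also have "z ^ p = zeta r" using zeta_power_divide[of p r] qr p1 by (simp add: z_def)
      also have "(\<Prod>i\<in>{1..<r}. 1 - zeta r ^ i) = of_nat r"
        by (rule prod_one_minus_root_unity) (use qr zeta_power_eq_1_iff in \<open>auto dest: nat_dvd_not_less\<close>)
      finally show ?thesis .
    qed
    ultimately have "(\<Prod>u\<in>U. 1 - z ^ u) * of_nat r = of_nat q"
      using U by (simp add: prod.union_disjoint)
    then show ?thesis using qr by simp
  qed
  have "\<exists>s\<in>?R. 1 - z ^ u = pe * s" for u
    using zR by (intro bexI[of _ "\<Sum>i<u. z ^ i"]) (auto simp: pe_def one_diff_power_eq)
  then obtain s where s: "\<And>u. s u \<in> ?R" "\<And>u. 1 - z ^ u = pe * s u" by metis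
  \<comment> \<open>Each \<open>1 - z ^ u\<close> is an associate of \<open>pe\<close>: as
    \<open>u\<close> is invertible modulo \<open>q\<close>, \<open>z\<close> is conversely a power
    of \<open>z ^ u\<close>.\<close>
  have "\<exists>t\<in>?R. pe = (1 - z ^ u) * t" if "u \<in> U" for u
  proof -
    have "coprime u q" using that by (auto simp: U_def q_def)
    then obtain v where "[u * v = 1] (mod q)" using cong_solve_coprime_nat by auto
    then have "z ^ (u * v) = z" unfolding z_def using zeta_power_cong by fastforce
    then have "pe = 1 - (z ^ u) ^ v" by (simp add: pe_def power_mult)
    then show ?thesis using zR by (intro bexI[of _ "\<Sum>i<v. (z ^ u) ^ i"]) (auto simp: one_diff_power_eq)
  qed
  then obtain t where t: "\<And>u. u \<in> U \<Longrightarrow> t u \<in> ?R" "\<And>u. u \<in> U \<Longrightarrow> pe = (1 - z ^ u) * t u" by metis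
  define et where "et = (\<Prod>u\<in>U. s u)"
  define ep where "ep = (\<Prod>u\<in>U. t u)"
  have R: "et \<in> ?R" "ep \<in> ?R" using s t by (auto simp: et_def ep_def)
  have eta: "of_nat p = pe ^ ph * et"
    by (simp add: prodU[symmetric] s(2) prod.distrib et_def ph_def)
  have "pe ^ ph = (\<Prod>u\<in>U. (1 - z ^ u) * t u)" using t(2) by (simp add: ph_def cong: prod.cong flip: prod_constant)
  then have eps: "pe ^ ph = of_nat p * ep" by (simp add: prod.distrib prodU ep_def)
  have pi0: "pe \<noteq> 0" using eta p0 phi by (auto simp: power_0_left)
  \<comment> \<open>By the Chinese remainder theorem \<open>zeta N\<close> is a product of powers of
    \<open>zeta q\<close> and \<open>zeta N'\<close>.\<close>
  have gen: "\<exists>B\<in>pol (?R'). y = poly B pe" if y: "y \<in> ?R" for y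
  proof -
    interpret A: subring_of "Z'.adjoin pe" by unfold_locales (rule Z'.adjoin_subring)
    have zA: "z \<in> Z'.adjoin pe" using A.diff[OF A.one Z'.adjoin_elem] by (simp add: pe_def)
    have z'A: "zeta N' \<in> Z'.adjoin pe" using Z'.adjoin_base Zc.adjoin_elem by blast
    have "coprime N' q" using prime_imp_coprime[OF p(1) N'(2)] by (simp add: q_def coprime_commute)
    then obtain u v where uv: "[N' * u = 1] (mod q)" "[q * v = 1] (mod N')"
      using cong_solve_coprime_nat[of N' q] cong_solve_coprime_nat[of q N'] by (auto simp: coprime_commute)
    have "[N' * u + q * v = 1 + 0] (mod q)" by (intro cong_add uv) (simp add: cong_0_iff)
    moreover have "[N' * u + q * v = 0 + 1] (mod N')" by (intro cong_add uv) (simp add: cong_0_iff)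
    ultimately have "[N' * u + q * v = 1] (mod q)" "[N' * u + q * v = 1] (mod N')" by simp_all
    then have "[N' * u + q * v = 1] (mod q * N')"
      using \<open>coprime N' q\<close> by (intro coprime_cong_mult_nat) (auto simp: coprime_commute)
    then have "zeta N ^ (N' * u + q * v) = zeta N ^ 1" unfolding Nq by (rule zeta_power_cong)
    then have "zeta N = zeta N ^ (N' * u + q * v)" by (simp only: power_one_right)
    also have "\<dots> = z ^ u * zeta N' ^ v" by (simp only: power_add power_mult zN)
    finally have "zeta N = z ^ u * zeta N' ^ v" .
    then have zz: "zeta N \<in> Z'.adjoin pe" using zA z'A by (metis A.mult A.power)
    obtain h where h: "h \<in> pol \<int>" "y = poly h (zeta N)" using y by (rule Zc.adjoinE)
    have "coeff h i \<in> Z'.adjoin pe" for i using h(1) by (auto simp: pol_def) (metis A.of_int Ints_cases)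
    then have "y \<in> Z'.adjoin pe" using h zz by (auto simp: poly_altdef)
    then show ?thesis by (auto elim: Z'.adjoinE)
  qed
  define be where "be = of_nat p * x"
  \<comment> \<open>Each step raises the exponent of \<open>pe\<close> by one. At
    \<open>j = ph\<close> the last summand is a multiple of \<open>p\<close> too, and
    \<open>p\<close> cancels.\<close>
  have claim: "\<exists>r\<in>?R. \<exists>\<gamma>\<in>?R. be = of_nat p * r + pe ^ j * \<gamma>" if "j \<le> ph" for j
    using that
  proof (induction j)
    case 0
    have "be = of_nat p * 0 + pe ^ 0 * be" by simp
    then show ?case using x(2) Z.zero be_def by metis
  next
    case (Suc j)
    then obtain r \<gamma> where r: "r \<in> ?R" "\<gamma> \<in> ?R" "be = of_nat p * r + pe ^ j * \<gamma>" by auto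
    obtain B where B: "B \<in> pol (?R')" "\<gamma> = poly B pe" using gen[OF r(2)] by blast
    obtain b B' where bB: "B = pCons b B'" by (cases B)
    have b: "b \<in> ?R'" "\<And>i. coeff B' i \<in> ?R'" using B(1) bB unfolding pol_def
      by (metis (mono_tags, lifting) coeff_pCons_0 mem_Collect_eq, metis (mono_tags, lifting) coeff_pCons_Suc mem_Collect_eq)
    define \<gamma>' where "\<gamma>' = poly B' pe"
    have g': "\<gamma>' \<in> ?R" using b(2) sub piR by (auto simp: \<gamma>'_def poly_altdef)
    have gb: "\<gamma> = b + pe * \<gamma>'" by (simp add: B(2) bB \<gamma>'_def)
    have "ph = Suc j + (ph - Suc j)" using Suc.prems by simp
    then have pp: "pe ^ ph = pe ^ j * pe * pe ^ (ph - Suc j)" by (metis power_add power_Suc2)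
    have "(x - r) * (of_nat p) = pe ^ j * \<gamma>" using r(3) by (simp add: be_def algebra_simps)
    then have "(x - r) * (pe ^ j * pe * pe ^ (ph - Suc j)) * et = pe ^ j * \<gamma>"
      by (simp only: pp[symmetric], simp only: mult.assoc eta[symmetric])
    then have "pe ^ j * (pe * ((x - r) * pe ^ (ph - Suc j) * et)) = pe ^ j * \<gamma>" by (simp only: mult_ac)
    then have "\<gamma> = pe * ((x - r) * pe ^ (ph - Suc j) * et)" using pi0 by (metis mult_left_cancel power_not_zero)
    then have bp: "b = pe * ((x - r) * pe ^ (ph - Suc j) * et - \<gamma>')" using gb by (simp add: algebra_simps)
    define c where "c = (x - r) * pe ^ (ph - Suc j) * et - \<gamma>'"
    have c: "algebraic_int c" unfolding c_def using x(1) ai r R piR g'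
      by (intro algebraic_int_diff algebraic_int_mult algebraic_int_power) auto
    \<comment> \<open>The constant coefficient \<open>b\<close> is \<open>pe\<close> times an
      algebraic integer, so its \<open>ph\<close>-th power is divisible by \<open>p\<close>;
      reducedness modulo \<open>p\<close> at level \<open>N'\<close> makes \<open>b\<close> itself
      divisible.\<close>
    have "b ^ ph = pe ^ ph * c ^ ph" unfolding bp c_def[symmetric] by (rule power_mult_distrib)
    then have "b ^ ph / of_nat p = ep * c ^ ph" using p0 by (simp add: eps)
    moreover have "algebraic_int (ep * c ^ ph)" using c ai[OF R(2)] by (intro algebraic_int_mult algebraic_int_power)
    ultimately have "algebraic_int (b ^ ph / of_nat p)" by metis
    then obtain b' where b': "b' \<in> ?R'" "b = of_nat p * b'"
      using ZZ_unramified_divides[OF N'0 p(1) N'(2) b(1)] by blast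
    have "be = of_nat p * (r + pe ^ j * b') + pe ^ Suc j * \<gamma>'" using r(3) gb b'(2) by (simp add: algebra_simps)
    moreover have "r + pe ^ j * b' \<in> ?R" using b'(1) sub by (intro Z.add Z.mult Z.power r(1) piR) auto
    ultimately show ?case using g' by blast
  qed
  from claim[of ph] obtain r \<gamma> where r: "r \<in> ?R" "\<gamma> \<in> ?R" "be = of_nat p * r + pe ^ ph * \<gamma>" by auto
  then have "of_nat p * x = of_nat p * (r + ep * \<gamma>)" by (simp add: be_def eps algebra_simps)
  then have "x = r + ep * \<gamma>" using p0 by simp
  then show ?thesis using Z.add[OF r(1) Z.mult[OF R(2) r(2)]] by metis
qed

text \<open>The trace expansion puts \<open>N\<close> times \<open>x\<close> into the ring, and
  saturation removes the prime factors of \<open>N\<close> one after another.\<close>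

theorem cyclotomic_ring_of_integers:
  assumes N: "N > 0" and x: "x \<in> QQ (zeta N)" "algebraic_int x"
  shows "x \<in> ZZ (zeta N)"
proof -
  have "x \<in> ZZ (zeta N)" if "m > 0" "m dvd N" "of_nat m * x \<in> ZZ (zeta N)" for m
    using that
  proof (induction m rule: less_induct)
    case (less m)
    show ?case
    proof (cases "m = 1")
      case False
      then obtain p r where pr: "prime p" "m = p * r" using prime_factor_nat[of m] by (auto elim: dvdE)
      then have "r < m" "r > 0" using less.prems(1) prime_gt_1_nat[of p] by auto
      moreover have "r dvd N" using less.prems pr by (metis dvd_mult_right)
      moreover have "of_nat r * x \<in> ZZ (zeta N)"
      proof (rule ZZ_saturated[OF N pr(1)])
        show "p dvd N" using less.prems pr by (metis dvd_mult_left)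
        show "algebraic_int (of_nat r * x)" using x(2) by (intro algebraic_int_mult) auto
        show "of_nat p * (of_nat r * x) \<in> ZZ (zeta N)" using less.prems(3) pr by (simp add: mult.assoc)
      qed
      ultimately show ?thesis using less.IH by blast
    qed (use less in simp)
  qed
  from this[OF N _ algebraic_int_multiple_in_ZZ[OF assms]] show ?thesis by simp
qed

section \<open>Cyclotomic integers of bounded mean square\<close>

definition root_unity :: "'a::field \<Rightarrow> bool" where "root_unity z \<longleftrightarrow> (\<exists>n>0. z ^ n = 1)"

text \<open>Zero terms are allowed as padding, so the notion means at most \<open>B\<close> roots of
  unity and is monotone in \<open>B\<close>.\<close>

definition rsum :: "nat \<Rightarrow> 'a::field \<Rightarrow> bool" where
  "rsum B x \<longleftrightarrow> (\<exists>f. (\<forall>j<B. f j = 0 \<or> root_unity (f j)) \<and> x = (\<Sum>j<B. f j))"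

lemma root_unity_mult: "root_unity x \<Longrightarrow> root_unity y \<Longrightarrow> root_unity (x * y)"
proof -
  assume "root_unity x" "root_unity y"
  then obtain n m where "n > 0" "m > 0" "x ^ n = 1" "y ^ m = 1" by (auto simp: root_unity_def)
  then have "n * m > 0" "(x * y) ^ (n * m) = 1"
    by (auto simp: power_mult_distrib power_mult) (metis power_mult mult.commute power_one)
  then show ?thesis unfolding root_unity_def by blast
qed

lemma root_unity_power: "root_unity x \<Longrightarrow> root_unity (x ^ k)"
proof (induction k)
  case 0 then show ?case unfolding root_unity_def by (intro exI[of _ 1]) auto
qed (simp add: root_unity_mult)

lemma root_unity_zeta: "N > 0 \<Longrightarrow> root_unity (zeta N)"
  unfolding root_unity_def by (intro exI[of _ N]) auto

lemma rsum_0 [simp]: "rsum B 0"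
  unfolding rsum_def by (rule exI[of _ "\<lambda>_. 0"]) auto

lemma rsum_mono: "rsum B x \<Longrightarrow> B \<le> B' \<Longrightarrow> rsum B' x"
proof -
  assume "rsum B x" and le: "B \<le> B'"
  then obtain f where f: "\<forall>j<B. f j = 0 \<or> root_unity (f j)" "x = (\<Sum>j<B. f j)" by (auto simp: rsum_def)
  define h where "h = (\<lambda>j. if j < B then f j else 0)"
  have "(\<Sum>j<B'. h j) = (\<Sum>j<B. h j)" by (rule sum.mono_neutral_right) (use le in \<open>auto simp: h_def\<close>)
  also have "\<dots> = x" using f by (simp add: h_def)
  finally show ?thesis unfolding rsum_def using f by (intro exI[of _ h]) (auto simp: h_def)
qed

lemma rsum_add: "rsum A x \<Longrightarrow> rsum B y \<Longrightarrow> rsum (A + B) (x + y)"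
proof -
  assume "rsum A x" "rsum B y"
  then obtain f g where f: "\<forall>j<A. f j = 0 \<or> root_unity (f j)" "x = (\<Sum>j<A. f j)"
    and g: "\<forall>j<B. g j = 0 \<or> root_unity (g j)" "y = (\<Sum>j<B. g j)" by (auto simp: rsum_def)
  define h where "h = (\<lambda>j. if j < A then f j else g (j - A))"
  have "(\<Sum>j<A+B. h j) = (\<Sum>j<A. h j) + (\<Sum>j\<in>{A..<A+B}. h j)"
    by (simp add: lessThan_atLeast0 sum.atLeastLessThan_concat)
  also have "(\<Sum>j\<in>{A..<A+B}. h j) = (\<Sum>j<B. h (j + A))"
    using sum.shift_bounds_nat_ivl[of h 0 A B] by (simp add: lessThan_atLeast0 add.commute)
  finally have "(\<Sum>j<A+B. h j) = x + y" using f g by (simp add: h_def)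
  then show ?thesis unfolding rsum_def using f g by (intro exI[of _ h]) (auto simp: h_def)
qed

lemma rsum_mult: "root_unity z \<Longrightarrow> rsum B x \<Longrightarrow> rsum B (z * x)"
proof -
  assume z: "root_unity z" and "rsum B x"
  then obtain f where f: "\<forall>j<B. f j = 0 \<or> root_unity (f j)" "x = (\<Sum>j<B. f j)" by (auto simp: rsum_def)
  then show ?thesis unfolding rsum_def using z
    by (intro exI[of _ "\<lambda>j. z * f j"]) (auto simp: sum_distrib_left root_unity_mult)
qed

lemma rsum_sum: "finite I \<Longrightarrow> (\<And>i. i \<in> I \<Longrightarrow> rsum B (x i)) \<Longrightarrow> rsum (card I * B) (sum x I)"
proof (induction I rule: finite_induct)
  case (insert i I)
  then show ?case using rsum_add[of B "x i" "card I * B" "sum x I"] by simp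
qed auto

lemma rsum_of_nat: "rsum n (of_nat n)"
proof -
  have "root_unity (1::'a)" by (auto simp: root_unity_def)
  then show ?thesis unfolding rsum_def by (intro exI[of _ "\<lambda>_. 1"]) auto
qed

lemma root_unity_minus_1: "root_unity (-1)"
  unfolding root_unity_def by (intro exI[of _ 2]) auto

lemma rsum_Ints: "c \<in> \<int> \<Longrightarrow> \<exists>n. rsum n (c::'a::field_char_0)"
proof -
  assume "c \<in> \<int>"
  then obtain k where k: "c = of_int k" by (elim Ints_cases)
  show ?thesis
  proof (cases k rule: int_cases2)
    case (nonneg n)
    then show ?thesis using k rsum_of_nat by auto
  next
    case (nonpos n)
    then have "c = -1 * of_nat n" using k by simp
    then show ?thesis using rsum_mult[OF root_unity_minus_1 rsum_of_nat] by metis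
  qed
qed

lemma zfun_rsum:
  assumes N: "N > 0" and g: "zfun \<int> N g"
  shows "\<exists>B. rsum B (g 1)"
proof -
  obtain p where p: "p \<in> pol \<int>" "\<And>s. g s = poly p (zeta N ^ s)" using g unfolding zfun_def by blast
  have "\<exists>b. rsum b (coeff p i)" for i using p rsum_Ints by (auto simp: pol_def)
  then obtain b where b: "\<And>i. rsum (b i) (coeff p i)" by metis
  have "rsum (Max (b ` {..degree p})) (zeta N ^ i * coeff p i)" if "i \<in> {..degree p}" for i
    using that by (intro rsum_mult root_unity_power root_unity_zeta N rsum_mono[OF b]) auto
  then have "rsum (card {..degree p} * Max (b ` {..degree p})) (\<Sum>i\<le>degree p. zeta N ^ i * coeff p i)"
    by (intro rsum_sum) auto
  then show ?thesis using p by (auto simp: poly_altdef mult.commute)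
qed

lemma cnj_zeta: "N > 0 \<Longrightarrow> cnj (zeta N) = zeta N ^ (N - 1)"
proof -
  assume N: "N > 0"
  have "cnj (zeta N) * zeta N = 1" by (simp add: mult.commute complex_norm_square[symmetric])
  moreover have "zeta N ^ (N - 1) * zeta N = 1" using N by (metis power_minus_mult zeta_power_N)
  ultimately show ?thesis by (metis mult_right_cancel zeta_nonzero)
qed

section \<open>Splitting a cyclotomic integer at a prime divisor of the level\<close>

lemma parseval_finite:
  assumes q: "q > 0"
  shows "(\<Sum>i<q. (cmod (\<Sum>j<q. b j * zeta q ^ (j * i)))\<^sup>2) = real q * (\<Sum>j<q. (cmod (b j))\<^sup>2)"
proof -
  have "complex_of_real (\<Sum>i<q. (cmod (\<Sum>j<q. b j * zeta q ^ (j * i)))\<^sup>2) =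
      (\<Sum>i<q. (\<Sum>j<q. b j * zeta q ^ (j * i)) * (\<Sum>k<q. cnj (b k) * zeta q ^ ((q - 1) * (k * i))))"
    by (simp add: complex_norm_square cnj_zeta[OF q] del: of_real_power flip: power_mult)
  also have "\<dots> = (\<Sum>i<q. \<Sum>j<q. \<Sum>k<q. (b j * zeta q ^ (j * i)) * (cnj (b k) * zeta q ^ ((q - 1) * (k * i))))"
    by (simp only: sum_product)
  also have "\<dots> = (\<Sum>j<q. \<Sum>i<q. \<Sum>k<q. (b j * zeta q ^ (j * i)) * (cnj (b k) * zeta q ^ ((q - 1) * (k * i))))"
    by (rule sum.swap)
  also have "\<dots> = (\<Sum>j<q. \<Sum>k<q. \<Sum>i<q. (b j * zeta q ^ (j * i)) * (cnj (b k) * zeta q ^ ((q - 1) * (k * i))))"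
    by (rule sum.cong[OF refl], rule sum.swap)
  also have "\<dots> = (\<Sum>j<q. \<Sum>k<q. b j * cnj (b k) * (\<Sum>i<q. zeta q ^ (i * (j + (q - 1) * k))))"
  proof -
    have "zeta q ^ (i * (j + n * k)) = zeta q ^ (j * i) * zeta q ^ (n * (k * i))" for i j k n
      by (simp add: distrib_left power_add mult_ac)
    then show ?thesis by (simp add: sum_distrib_left mult_ac)
  qed
  also have "\<dots> = (\<Sum>j<q. \<Sum>k<q. if k = j then b j * cnj (b j) * of_nat q else 0)"
  proof (intro sum.cong refl)
    fix j k assume "j \<in> {..<q}" "k \<in> {..<q}"
    then have "q dvd j + (q - 1) * k \<longleftrightarrow> k = j"
      unfolding dvd_add_pred_mult[OF q] by (auto simp: cong_def)
    then show "b j * cnj (b k) * (\<Sum>i<q. zeta q ^ (i * (j + (q - 1) * k))) = (if k = j then b j * cnj (b j) * of_nat q else 0)"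
      unfolding zeta_orthogonality[OF q] by simp
  qed
  also have "\<dots> = complex_of_real (real q * (\<Sum>j<q. (cmod (b j))\<^sup>2))"
    by (simp add: complex_norm_square sum_distrib_left mult.commute del: of_real_power)
  finally show ?thesis using of_real_eq_iff by blast
qed

lemma mean_sq_nonneg: "mean_sq N g \<ge> 0"
  by (simp add: mean_sq_def sum_nonneg)

lemma mean_sq_cong: "(\<And>s. s \<in> units_mod N \<Longrightarrow> cmod (f s) = cmod (g s)) \<Longrightarrow> mean_sq N f = mean_sq N g"
  by (simp add: mean_sq_def)

text \<open>The common part of the two decompositions at a prime \<open>q\<close>: powers of
  \<open>zeta N\<close> are split, and terms whose exponents of \<open>w s\<close> agree modulo
  \<open>q\<close> are collected. The hypothesis \<open>per\<close> covers both uses, where either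
  \<open>w s\<close> has period \<open>q\<close> or the exponents \<open>u i\<close> are already
  below \<open>q\<close>.\<close>

lemma zfun_split:
  assumes q: "q > 0" and g: "zfun \<int> N g"
    and split: "\<And>i s. zeta N ^ (i * s) = w s ^ (u i) * zeta m ^ (v i * s)" and per: "\<And>s i. w s ^ (i mod q) = w s ^ i \<or> (\<forall>i. u i < q)"
  shows "\<exists>al. (\<forall>j. zfun \<int> m (al j)) \<and> (\<forall>s. g s = (\<Sum>j<q. w s ^ j * al j s))"
proof -
  obtain p where p: "p \<in> pol \<int>" "\<And>s. g s = poly p (zeta N ^ s)" using g unfolding zfun_def by blast
  define al where "al = (\<lambda>j s. \<Sum>i\<in>{i\<in>{..degree p}. u i mod q = j}. coeff p i * zeta m ^ (v i * s))"
  have "zfun \<int> m (al j)" for j unfolding al_def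
    using p by (intro Zc.zfun_sum Zc.zfun_mult Zc.zfun_const Zc.zfun_zeta) (auto simp: pol_def)
  moreover have "g s = (\<Sum>j<q. w s ^ j * al j s)" for s
  proof -
    have wm: "w s ^ u i = w s ^ (u i mod q)" for i using per[of s "u i"] by auto
    have pw: "(zeta N ^ s) ^ i = w s ^ (u i mod q) * zeta m ^ (v i * s)" for i
      using split[of i s] wm[of i] by (simp add: mult.commute flip: power_mult)
    have "g s = (\<Sum>i\<in>{..degree p}. w s ^ (u i mod q) * (coeff p i * zeta m ^ (v i * s)))"
      by (simp add: p poly_altdef pw mult_ac)
    also have "\<dots> = (\<Sum>j\<in>{..<q}. \<Sum>i\<in>{i\<in>{..degree p}. u i mod q = j}. w s ^ (u i mod q) * (coeff p i * zeta m ^ (v i * s)))"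
      using q by (intro sum.group[symmetric]) auto
    also have "\<dots> = (\<Sum>j<q. w s ^ j * al j s)" by (simp add: al_def sum_distrib_left)
    finally show ?thesis .
  qed
  ultimately show ?thesis by blast
qed

text \<open>When \<open>q\<close> divides the level twice, the conjugates of \<open>zeta N\<close>
  over level \<open>m\<close> differ by all \<open>q\<close>-th roots of unity, so Parseval's
  identity separates the components.\<close>

lemma ramified_decomposition:
  assumes q: "prime q" "N = q * m" "q dvd m" and N: "N > 0" and g: "zfun \<int> N g"
  shows "\<exists>al. (\<forall>j. zfun \<int> m (al j)) \<and> (\<forall>s. g s = (\<Sum>j<q. zeta N ^ (s * j) * al j s)) \<and>
     mean_sq N g = (\<Sum>j<q. mean_sq m (al j))"
proof -
  have q0: "q > 0" and m: "m > 0" using q N by (auto simp: prime_gt_0_nat)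
  have zq: "zeta N ^ q = zeta m" "zeta N ^ m = zeta q"
    using zeta_power_divide[of q m] zeta_power_divide[of m q] q0 m q(2) by (auto simp: mult.commute)
  have "zeta N ^ (i * s) = (zeta N ^ s) ^ (i mod q) * zeta m ^ (i div q * s)" for i s
  proof -
    have "zeta N ^ (i * s) = zeta N ^ ((q * (i div q) + i mod q) * s)" by simp
    also have "(q * a + b) * s = q * (a * s) + s * b" for a b by (simp add: algebra_simps)
    also have "zeta N ^ (q * (i div q * s) + s * (i mod q)) = zeta N ^ (q * (i div q * s)) * zeta N ^ (s * (i mod q))"
      by (rule power_add)
    finally show ?thesis by (simp only: power_mult zq mult.commute)
  qed
  then obtain al where a: "\<And>j. zfun \<int> m (al j)" "\<And>s. g s = (\<Sum>j<q. (zeta N ^ s) ^ j * al j s)"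
    using zfun_split[OF q0 g, of "\<lambda>s. zeta N ^ s" "\<lambda>i. i mod q" m "\<lambda>i. i div q"] q0 by auto
  \<comment> \<open>As \<open>q\<close> divides \<open>m\<close>, being coprime to \<open>N\<close>
    means being coprime to \<open>m\<close>.\<close>
  have U: "bij_betw (\<lambda>(s, i). s + m * i) (units_mod m \<times> {..<q}) (units_mod N)"
  proof (rule bij_betw_byWitness[where f' = "\<lambda>s. (s mod m, s div m)"])
    show "\<forall>a\<in>units_mod m \<times> {..<q}. (\<lambda>s. (s mod m, s div m)) ((\<lambda>(s, i). s + m * i) a) = a"
      by (auto simp: units_mod_def)
    have cop: "coprime s (q * m) \<longleftrightarrow> coprime s m" for s
      using q(3) by (metis coprime_mult_right_iff coprime_divisors dvd_refl)
    show "(\<lambda>(s, i). s + m * i) ` (units_mod m \<times> {..<q}) \<subseteq> units_mod N"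
    proof safe
      fix s i assume s: "s \<in> units_mod m" "i < q"
      have "s + m * i < m * Suc i" using s by (simp add: units_mod_def)
      also have "\<dots> \<le> m * q" using s by (intro mult_left_mono) auto
      finally have "s + m * i < q * m" by (simp add: mult.commute)
      moreover have "gcd m (i * m + s) = gcd m s" by (rule gcd_add_mult)
      then have "coprime (s + m * i) m" using s
        by (simp add: units_mod_def coprime_iff_gcd_eq_1 gcd.commute add.commute mult.commute)
      ultimately show "s + m * i \<in> units_mod N" using cop q(2) by (simp add: units_mod_def)
    qed
    show "(\<lambda>s. (s mod m, s div m)) ` units_mod N \<subseteq> units_mod m \<times> {..<q}"
    proof (rule image_subsetI)
      fix s assume "s \<in> units_mod N"
      then have "s < q * m" "coprime s m" using q(2) cop by (auto simp: units_mod_def)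
      then show "(s mod m, s div m) \<in> units_mod m \<times> {..<q}"
        using m by (auto simp: units_mod_def less_mult_imp_div_less)
    qed
  qed auto
  have inner: "(\<Sum>i<q. (cmod (g (s + m * i)))\<^sup>2) = real q * (\<Sum>j<q. (cmod (al j s))\<^sup>2)" for s
  proof -
    have "g (s + m * i) = (\<Sum>j<q. (zeta N ^ (s * j) * al j s) * zeta q ^ (j * i))" for i
    proof -
      have "al j (s + m * i) = al j s" for j by (rule zfun_cong[OF a(1)]) (simp add: cong_def)
      moreover have "(zeta N ^ (s + m * i)) ^ j = zeta N ^ (s * j) * zeta q ^ (j * i)" for j
        by (simp add: zq(2)[symmetric] power_add algebra_simps flip: power_mult)
      ultimately show ?thesis by (simp add: a(2) mult_ac)
    qed
    then show ?thesis using parseval_finite[OF q0, of "\<lambda>j. zeta N ^ (s * j) * al j s"]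
      by (simp add: norm_mult norm_power)
  qed
  have "(\<Sum>s\<in>units_mod N. (cmod (g s))\<^sup>2) = (\<Sum>s\<in>units_mod m. \<Sum>i<q. (cmod (g (s + m * i)))\<^sup>2)"
    using sum.reindex_bij_betw[OF U, of "\<lambda>s. (cmod (g s))\<^sup>2"]
    by (simp add: sum.cartesian_product case_prod_unfold)
  also have "\<dots> = real q * (\<Sum>j<q. \<Sum>s\<in>units_mod m. (cmod (al j s))\<^sup>2)"
    by (simp add: inner sum_distrib_left[symmetric] sum.swap[of _ "units_mod m"])
  finally have 1: "(\<Sum>s\<in>units_mod N. (cmod (g s))\<^sup>2) = real q * (\<Sum>j<q. \<Sum>s\<in>units_mod m. (cmod (al j s))\<^sup>2)" .
  have 2: "card (units_mod N) = card (units_mod m) * q"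
    using bij_betw_same_card[OF U] by (simp add: card_cartesian_product)
  have "mean_sq N g = (\<Sum>j<q. mean_sq m (al j))"
    using q0 by (simp add: mean_sq_def 1 2 sum_divide_distrib[symmetric])
  then show ?thesis using a by (intro exI[of _ al]) (auto simp flip: power_mult)
qed

text \<open>The right-hand side is what remains of Parseval's identity at a prime once frequency 0
  is removed.\<close>

lemma sum_sq_differences:
  fixes a :: "nat \<Rightarrow> complex"
  shows "real q * (\<Sum>j<q. (cmod (a j))\<^sup>2) - (cmod (\<Sum>j<q. a j))\<^sup>2 = (\<Sum>i<q. \<Sum>j<q. (cmod (a i - a j))\<^sup>2) / 2"
proof -
  have "complex_of_real (\<Sum>i<q. \<Sum>j<q. (cmod (a i - a j))\<^sup>2) =
     (\<Sum>i<q. \<Sum>j<q. a i * cnj (a i) + a j * cnj (a j) - a i * cnj (a j) - a j * cnj (a i))"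
    by (simp add: complex_norm_square algebra_simps del: of_real_power)
  also have "\<dots> = of_nat q * (\<Sum>i<q. a i * cnj (a i)) + of_nat q * (\<Sum>j<q. a j * cnj (a j))
     - (\<Sum>i<q. a i) * (\<Sum>j<q. cnj (a j)) - (\<Sum>i<q. a i) * (\<Sum>j<q. cnj (a j))"
  proof -
    have s1: "(\<Sum>i<q. \<Sum>j<q. a i * cnj (a j)) = (\<Sum>i<q. a i) * (\<Sum>j<q. cnj (a j))"
      by (simp only: sum_product)
    have s2: "(\<Sum>i<q. \<Sum>j<q. a j * cnj (a i)) = (\<Sum>i<q. a i) * (\<Sum>j<q. cnj (a j))"
      by (subst sum.swap) (simp only: sum_product)
    show ?thesis by (simp only: sum.distrib sum_subtractf s1 s2) (simp add: sum_distrib_left)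
  qed
  also have "\<dots> = complex_of_real (2 * (real q * (\<Sum>j<q. (cmod (a j))\<^sup>2) - (cmod (\<Sum>j<q. a j))\<^sup>2))"
    by (simp add: complex_norm_square algebra_simps del: of_real_power)
  finally have "(\<Sum>i<q. \<Sum>j<q. (cmod (a i - a j))\<^sup>2) = 2 * (real q * (\<Sum>j<q. (cmod (a j))\<^sup>2) - (cmod (\<Sum>j<q. a j))\<^sup>2)"
    using of_real_eq_iff by blast
  then show ?thesis by simp
qed

text \<open>When \<open>q\<close> divides the level once, the residue of \<open>s\<close> modulo
  \<open>q\<close> is never 0, so Parseval's identity lacks one frequency and controls only
  differences of components. This fits the fact that a common summand of all components drops out,
  as the powers of \<open>zeta q\<close> sum to 0.\<close>

lemma unramified_decomposition:
  assumes q: "prime q" "N = q * m" "\<not> q dvd m" and N: "N > 0" and g: "zfun \<int> N g"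
  shows "\<exists>al. (\<forall>j. zfun \<int> m (al j)) \<and> (\<forall>s. g s = (\<Sum>j<q. zeta q ^ (s * j) * al j s)) \<and>
     real (q - 1) * mean_sq N g = (\<Sum>i<q. \<Sum>j<q. mean_sq m (\<lambda>s. al i s - al j s)) / 2"
proof -
  have q0: "q > 0" and q1: "q > 1" and m: "m > 0" using q N prime_gt_1_nat[of q] by auto
  have cqm: "coprime q m" using q by (simp add: prime_imp_coprime)
  have zq: "zeta N ^ q = zeta m" "zeta N ^ m = zeta q"
    using zeta_power_divide[of q m] zeta_power_divide[of m q] q0 m q(2) by (auto simp: mult.commute)
  obtain u v where uv: "[m * u = 1] (mod q)" "[q * v = 1] (mod m)"
    using cong_solve_coprime_nat[of m q] cong_solve_coprime_nat[OF cqm] cqm by (auto simp: coprime_commute)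
  have "[m * u + q * v = 1 + 0] (mod q)" by (intro cong_add uv) (simp add: cong_0_iff)
  moreover have "[m * u + q * v = 0 + 1] (mod m)" by (intro cong_add uv) (simp add: cong_0_iff)
  ultimately have "[m * u + q * v = 1] (mod q)" "[m * u + q * v = 1] (mod m)" by simp_all
  then have "[m * u + q * v = 1] (mod N)" unfolding q(2) using cqm by (intro coprime_cong_mult_nat)
  then have "zeta N ^ (m * u + q * v) = zeta N ^ 1" by (rule zeta_power_cong)
  then have "zeta N = zeta N ^ (m * u + q * v)" by (simp only: power_one_right)
  also have "\<dots> = zeta q ^ u * zeta m ^ v" by (simp only: power_add power_mult zq)
  finally have zuv: "zeta N = zeta q ^ u * zeta m ^ v" .
  have "zeta N ^ (i * s) = (zeta q ^ s) ^ (u * i) * zeta m ^ (v * i * s)" for i s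
    by (subst zuv) (simp add: power_mult_distrib mult_ac flip: power_mult)
  moreover have "(zeta q ^ s) ^ (i mod q) = (zeta q ^ s) ^ i" for s i
    by (metis power_mult mult.commute zeta_power_mod)
  ultimately obtain al where a: "\<And>j. zfun \<int> m (al j)" "\<And>s. g s = (\<Sum>j<q. (zeta q ^ s) ^ j * al j s)"
    using zfun_split[OF q0 g, of "\<lambda>s. zeta q ^ s" "\<lambda>i. u * i" m "\<lambda>i. v * i"] by auto
  have U: "bij_betw (\<lambda>s. (s mod q, s mod m)) (units_mod N) (units_mod q \<times> units_mod m)"
    unfolding bij_betw_def
  proof (intro conjI inj_onI equalityI subsetI)
    fix x y assume "x \<in> units_mod N" "y \<in> units_mod N" "(x mod q, x mod m) = (y mod q, y mod m)"
    moreover from this have "[x = y] (mod q * m)" using cqm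
      by (intro coprime_cong_mult_nat) (auto simp: cong_def)
    ultimately have "[x = y] (mod N)" "x < N" "y < N" by (auto simp: units_mod_def q(2))
    then show "x = y" by (simp add: cong_def)
  next
    fix z assume "z \<in> (\<lambda>s. (s mod q, s mod m)) ` units_mod N"
    then show "z \<in> units_mod q \<times> units_mod m" using q0 m q(2) by (auto simp: units_mod_def)
  next
    fix z assume z: "z \<in> units_mod q \<times> units_mod m"
    obtain x where x: "x < q * m" "[x = fst z] (mod q)" "[x = snd z] (mod m)"
      using binary_chinese_remainder_unique_nat[OF cqm, of "fst z" "snd z"] q0 m by auto
    have "coprime x q" "coprime x m"
      using z cong_imp_coprime[OF cong_sym[OF x(2)]] cong_imp_coprime[OF cong_sym[OF x(3)]] by (auto simp: units_mod_def)
    then have "x \<in> units_mod N" using x by (simp add: units_mod_def q(2))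
    moreover have "z = (x mod q, x mod m)" using x z by (auto simp: cong_def units_mod_def)
    ultimately show "z \<in> (\<lambda>s. (s mod q, s mod m)) ` units_mod N" by blast
  qed
  define G where "G = (\<lambda>(s1, s2). (cmod (\<Sum>j<q. al j s2 * zeta q ^ (j * s1)))\<^sup>2)"
  have gG: "(cmod (g s))\<^sup>2 = G (s mod q, s mod m)" for s
  proof -
    have "al j (s mod m) = al j s" for j by (rule zfun_cong[OF a(1)]) (simp add: cong_def)
    moreover have "zeta q ^ (j * (s mod q)) = (zeta q ^ s) ^ j" for j
      by (metis power_mult mult.commute zeta_power_mod)
    ultimately show ?thesis by (simp add: G_def a(2) mult.commute)
  qed
  have Uq: "units_mod q = {..<q} - {0}"
  proof -
    have "coprime x q" if "x < q" "x \<noteq> 0" for x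
      using prime_imp_coprime[OF q(1), of x] that nat_dvd_not_less[of x q] by (simp add: coprime_commute)
    moreover have "\<not> coprime 0 q" using q1 by simp
    ultimately show ?thesis by (auto simp: units_mod_def)
  qed
  have inner: "(\<Sum>s1\<in>units_mod q. G (s1, s2)) = (\<Sum>i<q. \<Sum>j<q. (cmod (al i s2 - al j s2))\<^sup>2) / 2" for s2
  proof -
    have "(\<Sum>s1\<in>units_mod q. G (s1, s2)) = (\<Sum>s1<q. G (s1, s2)) - G (0, s2)"
      unfolding Uq using q0 by (simp add: sum_diff1)
    then show ?thesis using parseval_finite[OF q0, of "\<lambda>j. al j s2"] sum_sq_differences[of q "\<lambda>j. al j s2"]
      by (simp add: G_def)
  qed
  have "(\<Sum>s\<in>units_mod N. (cmod (g s))\<^sup>2) = (\<Sum>z\<in>units_mod q \<times> units_mod m. G z)"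
    unfolding gG by (rule sum.reindex_bij_betw[OF U])
  also have "\<dots> = (\<Sum>s1\<in>units_mod q. \<Sum>s2\<in>units_mod m. G (s1, s2))" by (simp add: sum.cartesian_product)
  also have "\<dots> = (\<Sum>s2\<in>units_mod m. \<Sum>s1\<in>units_mod q. G (s1, s2))" by (rule sum.swap)
  also have "\<dots> = (\<Sum>i<q. \<Sum>j<q. \<Sum>s\<in>units_mod m. (cmod (al i s - al j s))\<^sup>2) / 2"
    by (simp add: inner sum_divide_distrib[symmetric] sum.swap[of _ "units_mod m"])
  finally have 1: "(\<Sum>s\<in>units_mod N. (cmod (g s))\<^sup>2) = (\<Sum>i<q. \<Sum>j<q. \<Sum>s\<in>units_mod m. (cmod (al i s - al j s))\<^sup>2) / 2" .
  have 2: "card (units_mod N) = (q - 1) * card (units_mod m)"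
    using bij_betw_same_card[OF U] Uq q0 by (simp add: card_cartesian_product)
  have "real (q - 1) * mean_sq N g = (\<Sum>i<q. \<Sum>j<q. mean_sq m (\<lambda>s. al i s - al j s)) / 2"
    using q1 by (simp add: mean_sq_def 1 2 sum_divide_distrib[symmetric])
  then show ?thesis using a by (intro exI[of _ al]) (auto simp flip: power_mult)
qed

text \<open>At a fixed level the coordinates in the trace expansion are integers of bounded size, so
  only finitely many numbers occur.\<close>

lemma bounded_level_rsum:
  assumes N: "N > 0"
  shows "\<exists>B. \<forall>g. zfun \<int> N g \<longrightarrow> mean_sq N g \<le> R \<longrightarrow> rsum B (g 1)"
proof -
  define X where "X = {g 1 |g. zfun \<int> N g \<and> mean_sq N g \<le> R}"
  \<comment> \<open>Through \<open>x <= 1 + x ^ 2\<close> the mean square bounds the sum of the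
    absolute values of the conjugates.\<close>
  define b where "b = real (card (units_mod N)) * (1 + R)"
  define C where "C = {c::int. \<bar>real_of_int c\<bar> \<le> b}"
  have "C \<subseteq> {-\<lceil>b\<rceil>..\<lceil>b\<rceil>}" by (auto simp: C_def) linarith+
  then have finC: "finite C" using finite_subset by blast
  have "X \<subseteq> (\<lambda>c. (\<Sum>i<N. of_int (c i) * zeta N ^ i) / of_nat N) ` (PiE {..<N} (\<lambda>_. C))"
  proof
    fix x assume "x \<in> X"
    then obtain g where g: "zfun \<int> N g" "mean_sq N g \<le> R" "x = g 1" by (auto simp: X_def)
    define c where "c = (\<lambda>i. \<Sum>u\<in>units_mod N. g u * zeta N ^ ((N - 1) * i * u))"
    have "c i \<in> \<int>" for i unfolding c_def by (intro Zc.zfun_trace[OF N] Zc.zfun_mult Zc.zfun_zeta g)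
    then have "\<exists>k. c i = of_int k" for i by (meson Ints_cases)
    then obtain k where k: "\<And>i. c i = of_int (k i)" by metis
    have "(\<Sum>u\<in>units_mod N. (cmod (g u))\<^sup>2) \<le> real (card (units_mod N)) * R"
      using g(2) card_units_mod_pos[OF N] by (simp add: mean_sq_def field_simps)
    moreover have "cmod (g u) \<le> 1 + (cmod (g u))\<^sup>2" for u
      using zero_le_power2[of "cmod (g u) - 1"] norm_ge_zero[of "g u"] unfolding power2_diff by (simp del: norm_ge_zero)
    then have "(\<Sum>u\<in>units_mod N. cmod (g u)) \<le> (\<Sum>u\<in>units_mod N. 1 + (cmod (g u))\<^sup>2)" by (intro sum_mono)
    ultimately have s: "(\<Sum>u\<in>units_mod N. cmod (g u)) \<le> b" by (simp add: sum.distrib b_def algebra_simps)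
    have "cmod (c i) \<le> b" for i
    proof -
      have "cmod (c i) \<le> (\<Sum>u\<in>units_mod N. cmod (g u * zeta N ^ ((N - 1) * i * u)))" unfolding c_def by (rule norm_sum)
      then show ?thesis using s by (simp add: norm_mult norm_power)
    qed
    then have kC: "k i \<in> C" for i by (simp add: C_def k)
    have "of_nat N * x = (\<Sum>i<N. of_int (k i) * zeta N ^ i)"
      using trace_expansion[OF N g(1)] by (simp add: k[symmetric] c_def g(3))
    also have "\<dots> = (\<Sum>i<N. of_int (restrict k {..<N} i) * zeta N ^ i)" by simp
    finally have "x = (\<Sum>i<N. of_int (restrict k {..<N} i) * zeta N ^ i) / of_nat N" using N by (simp add: field_simps)
    moreover have "restrict k {..<N} \<in> PiE {..<N} (\<lambda>_. C)" using kC by auto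
    ultimately show "x \<in> (\<lambda>c. (\<Sum>i<N. of_int (c i) * zeta N ^ i) / of_nat N) ` (PiE {..<N} (\<lambda>_. C))" by blast
  qed
  then have finX: "finite X" by (rule finite_subset) (intro finite_imageI finite_PiE finite_lessThan finC)
  have "\<exists>B. rsum B x" if "x \<in> X" for x using that zfun_rsum[OF N] by (auto simp: X_def)
  then obtain B where B: "\<And>x. x \<in> X \<Longrightarrow> rsum (B x) x" by metis
  have "rsum (Max (B ` X)) x" if "x \<in> X" for x using rsum_mono[OF B[OF that]] finX that by simp
  then show ?thesis unfolding X_def by blast
qed

text \<open>The induction of Cassels and Loxton: \<open>R\<close> is lowered by 1/2 whenever a number splits into at
  least two nonzero parts at some prime, and the level \<open>N\<close> is lowered otherwise.\<close>
theorem bounded_mean_sq_rsum: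
  "\<exists>B. \<forall>N g. N > 0 \<longrightarrow> zfun \<int> N g \<longrightarrow> mean_sq N g \<le> real k / 2 \<longrightarrow> rsum B (g 1)"
proof (induction k)
  case 0
  have "g 1 = 0" if "N > 0" "zfun \<int> N g" "mean_sq N g \<le> real 0 / 2" for N g
    using mean_sq_ge_1[OF that(1,2), of 1] that(3) by (cases "g 1 = 0") auto
  then show ?case by (metis rsum_0)
next
  case (Suc k)
  define R where "R = real (Suc k) / 2"
  have R: "R > 0" "real k / 2 = R - 1/2" by (auto simp: R_def field_simps)
  obtain B1 where B1: "\<And>N g. N > 0 \<Longrightarrow> zfun \<int> N g \<Longrightarrow> mean_sq N g \<le> R - 1/2 \<Longrightarrow> rsum B1 (g 1)"
    using Suc.IH unfolding R(2) by blast
  \<comment> \<open>At most \<open>2 * R\<close> nonzero parts occur in either kind of splitting, so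
    \<open>K\<close> bounds their number.\<close>
  define K where "K = nat \<lceil>2 * R\<rceil>"
  have K: "X \<le> K" if "real X \<le> 2 * R" for X proof -
    have "real X \<le> real K" using that real_nat_ceiling_ge[of "2 * R"] unfolding K_def by linarith
    then show ?thesis by simp
  qed
  \<comment> \<open>If \<open>q > P\<close> and \<open>X <= 2 * R\<close> parts occur, then
    \<open>q - X\<close> exceeds \<open>2 * R * (X - 1)\<close>; this makes the gain in the
    unramified case at least 1/2.\<close>
  define P where "P = nat \<lceil>2 * R + 4 * R\<^sup>2\<rceil>"
  have P: "2 * R + 4 * R\<^sup>2 \<le> real P" unfolding P_def by (rule real_nat_ceiling_ge)
  have "\<exists>b. \<forall>N\<in>{1..fact P}. \<forall>g. zfun \<int> N g \<longrightarrow> mean_sq N g \<le> R \<longrightarrow> rsum (b N) (g 1)"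
    using bounded_level_rsum by (intro bchoice) auto
  then obtain b where b: "\<And>N g. N \<in> {1..fact P} \<Longrightarrow> zfun \<int> N g \<Longrightarrow> mean_sq N g \<le> R \<Longrightarrow> rsum (b N) (g 1)" by blast
  define B where "B = max (Max (b ` {1..fact P})) (K * B1)"
  have "rsum B (g 1)" if "N > 0" "zfun \<int> N g" "mean_sq N g \<le> R" for N g
    using that
  proof (induction N arbitrary: g rule: less_induct)
    case (less N)
    note N = less.prems(1) and g = less.prems(2) and gR = less.prems(3)
    \<comment> \<open>The common end of both splittings: a single part is treated at the smaller
      level with the same \<open>R\<close>, while two or more parts each fall under the outer
      induction.\<close>
    have split: ?case
      if J: "finite J" "g 1 = (\<Sum>j\<in>J. w j * ga j 1)" "\<And>j. j \<in> J \<Longrightarrow> root_unity (w j)" "real (card J) \<le> 2 * R"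
        and m: "m > 0" "m < N" "\<And>j. zfun \<int> m (ga j)"
        and one: "\<And>j. J = {j} \<Longrightarrow> mean_sq m (ga j) \<le> R"
        and two: "\<And>j. j \<in> J \<Longrightarrow> card J \<ge> 2 \<Longrightarrow> mean_sq m (ga j) \<le> R - 1/2"
      for J w ga m
    proof -
      consider "card J = 0" | "card J = 1" | "card J \<ge> 2" by linarith
      then show ?thesis
      proof cases
        case 1
        then show ?thesis using J by auto
      next
        case 2
        then obtain j where j: "J = {j}" by (auto simp: card_1_singleton_iff)
        have "rsum B (ga j 1)" using less.IH[OF m(2,1,3) one[OF j]] .
        then show ?thesis using J(2,3) j by (auto intro: rsum_mult)
      next
        case 3
        have "rsum B1 (w j * ga j 1)" if "j \<in> J" for j using B1[OF m(1,3) two[OF that 3]] J(3)[OF that] by (rule rsum_mult[rotated])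
        then have "rsum (card J * B1) (g 1)" unfolding J(2) by (intro rsum_sum J(1))
        moreover have "card J * B1 \<le> B" using K[OF J(4)] by (simp add: B_def le_max_iff_disj)
        ultimately show ?thesis by (rule rsum_mono)
      qed
    qed
    consider (ram) q where "prime q" "q * q dvd N" | (unram) q where "prime q" "q dvd N" "\<not> q * q dvd N" "q > P"
      | (small) "\<And>q. prime q \<Longrightarrow> q dvd N \<Longrightarrow> q \<le> P \<and> \<not> q * q dvd N" by (meson linorder_not_le)
    then show ?case
    proof cases
      case ram
      then obtain m' where "N = q * q * m'" by (elim dvdE)
      define m where "m = q * m'"
      have m: "N = q * m" "q dvd m" by (auto simp: m_def \<open>N = q * q * m'\<close>)
      have m0: "m > 0" "m < N" using m N prime_gt_1_nat[OF ram(1)] by auto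
      obtain al where a: "\<And>j. zfun \<int> m (al j)" "\<And>s. g s = (\<Sum>j<q. zeta N ^ (s * j) * al j s)"
         "mean_sq N g = (\<Sum>j<q. mean_sq m (al j))" using ramified_decomposition[OF ram(1) m N g] by blast
      define J where "J = {j\<in>{..<q}. al j 1 \<noteq> 0}"
      have J: "finite J" by (simp add: J_def)
      have ge1: "mean_sq m (al j) \<ge> 1" if "j \<in> J" for j
        using mean_sq_ge_1[OF m0(1) a(1), of 1] that by (auto simp: J_def)
      have sumJ: "(\<Sum>j\<in>J. mean_sq m (al j)) \<le> R"
      proof -
        have "J \<subseteq> {..<q}" by (auto simp: J_def)
        then have "(\<Sum>j\<in>J. mean_sq m (al j)) \<le> (\<Sum>j<q. mean_sq m (al j))"
          by (intro sum_mono2 mean_sq_nonneg) auto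
        then show ?thesis using a(3) gR by linarith
      qed
      have cJ: "real (card J) \<le> R" using sum_mono[of J "\<lambda>_. 1" "\<lambda>j. mean_sq m (al j)"] ge1 sumJ by simp
      show ?thesis
      proof (rule split[OF J, of "\<lambda>j. zeta N ^ j" al m])
        show "g 1 = (\<Sum>j\<in>J. zeta N ^ j * al j 1)" unfolding a(2)
          by (rule sum.mono_neutral_cong_right) (auto simp: J_def)
        fix j assume j: "j \<in> J" "card J \<ge> 2"
        \<comment> \<open>Every other nonzero part uses up a mean square of at least 1.\<close>
        have "(\<Sum>i\<in>J - {j}. 1) \<le> (\<Sum>i\<in>J - {j}. mean_sq m (al i))" using ge1 by (intro sum_mono) auto
        moreover have "(\<Sum>i\<in>J - {j}. (1::real)) \<ge> 1" using j J by simp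
        moreover have "(\<Sum>i\<in>J. mean_sq m (al i)) = mean_sq m (al j) + (\<Sum>i\<in>J - {j}. mean_sq m (al i))"
          using J j by (simp add: sum.remove)
        ultimately show "mean_sq m (al j) \<le> R - 1/2" using sumJ by linarith
      qed (use cJ R m0 a sumJ root_unity_power[OF root_unity_zeta[OF N]] in auto)
    next
      case unram
      then obtain m where m: "N = q * m" by (elim dvdE)
      have qm: "\<not> q dvd m" using unram m by (auto simp: mult_dvd_mono)
      have q1: "q > 1" using prime_gt_1_nat[OF unram(1)] .
      have m0: "m > 0" "m < N" using m N q1 by auto
      obtain al where a: "\<And>j. zfun \<int> m (al j)" "\<And>s. g s = (\<Sum>j<q. zeta q ^ (s * j) * al j s)"
         "real (q - 1) * mean_sq N g = (\<Sum>i<q. \<Sum>j<q. mean_sq m (\<lambda>s. al i s - al j s)) / 2"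
        using unramified_decomposition[OF unram(1) m qm N g] by blast
      define D where "D = (\<lambda>i j. mean_sq m (\<lambda>s. al i s - al j s))"
      have Dge: "D i j \<ge> 1" if "al i 1 \<noteq> al j 1" for i j
        unfolding D_def by (rule mean_sq_ge_1[OF m0(1) Zc.zfun_diff[OF a(1,1)], of 1]) (use that in auto)
      have D0: "D i j \<ge> 0" for i j by (simp add: D_def mean_sq_nonneg)
      have Dsym: "D i j = D j i" for i j unfolding D_def by (rule mean_sq_cong) (simp add: norm_minus_commute)
      have Deq: "D i j = D i' j" if "al i 1 = al i' 1" for i i' j
        unfolding D_def
      proof (rule mean_sq_cong)
        fix s assume "s \<in> units_mod m"
        then have "al i s - al i' s = 0"
          using zfun_zero_conjugate[OF m0(1) zfun_mono[OF Ints_Rats Zc.zfun_diff[OF a(1)[of i] a(1)[of i']]], of 1 s] that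
          by (auto simp: units_mod_def)
        then show "cmod (al i s - al j s) = cmod (al i' s - al j s)" by simp
      qed
      \<comment> \<open>All components may be shifted by a common one, since the powers of
        \<open>zeta q\<close> sum to 0. Subtracting one with the most frequent value at 1 leaves the
        fewest nonzero parts.\<close>
      define J where "J = (\<lambda>i. {j\<in>{..<q}. al j 1 \<noteq> al i 1})"
      have finJ: "finite (J i)" for i by (simp add: J_def)
      obtain i0 where i0: "i0 < q" "\<And>i. i < q \<Longrightarrow> card (J i0) \<le> card (J i)"
        using ex_has_least_nat[of "\<lambda>i. i < q" 0 "\<lambda>i. card (J i)"] q1 by auto
      define X where "X = card (J i0)"
      have tot: "(\<Sum>i<q. \<Sum>j<q. D i j) \<le> 2 * (real (q - 1) * R)"
      proof -
        have "(\<Sum>i<q. \<Sum>j<q. D i j) = 2 * (real (q - 1) * mean_sq N g)" unfolding D_def using a(3) by simp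
        then show ?thesis using mult_left_mono[OF gR, of "real (q - 1)"] by simp
      qed
      have "real q * real X \<le> (\<Sum>i<q. real (card (J i)))"
        using sum_mono[of "{..<q}" "\<lambda>_. real X" "\<lambda>i. real (card (J i))"] i0 by (simp add: X_def)
      also have "\<dots> \<le> (\<Sum>i<q. \<Sum>j<q. D i j)"
      proof (rule sum_mono)
        fix i assume "i \<in> {..<q}"
        have "real (card (J i)) = (\<Sum>j\<in>J i. 1)" by simp
        also have "\<dots> \<le> (\<Sum>j\<in>J i. D i j)" by (intro sum_mono) (auto simp: J_def intro!: Dge)
        also have "\<dots> \<le> (\<Sum>j<q. D i j)" by (rule sum_mono2) (auto simp: J_def D0)
        finally show "real (card (J i)) \<le> (\<Sum>j<q. D i j)" .
      qed
      also note tot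
      also have "2 * (real (q - 1) * R) \<le> real q * (2 * R)" using R by (simp add: mult_right_mono)
      finally have X2: "real X \<le> 2 * R" using q1 by simp
      define I where "I = {..<q} - J i0"
      have cI: "real (card I) = real q - real X"
      proof -
        have "J i0 \<subseteq> {..<q}" by (auto simp: J_def)
        then have "card I = q - X" "X \<le> q" unfolding I_def X_def using card_mono[of "{..<q}" "J i0"] by (auto simp: card_Diff_subset finJ)
        then show ?thesis by simp
      qed
      define ga where "ga = (\<lambda>j s. al j s - al i0 s)"
      have gaD: "mean_sq m (ga j) = D j i0" for j by (simp add: ga_def D_def)
      \<comment> \<open>Pairs with one index in \<open>I\<close> and the other in
        \<open>J i0\<close> are counted in both orders; for \<open>i\<close> in \<open>I\<close> the
        component \<open>al i\<close> may be replaced by \<open>al i0\<close>.\<close>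
      have "(\<Sum>i<q. \<Sum>j<q. D i j) \<ge> 2 * (real (card I) * (\<Sum>j\<in>J i0. D j i0))"
      proof -
        have IJ: "{..<q} = I \<union> J i0" "I \<inter> J i0 = {}" "finite I" by (auto simp: I_def J_def)
        have "(\<Sum>i<q. \<Sum>j<q. D i j) = (\<Sum>i\<in>I. \<Sum>j<q. D i j) + (\<Sum>i\<in>J i0. \<Sum>j<q. D i j)"
          unfolding IJ(1) by (rule sum.union_disjoint) (use IJ finJ in auto)
        moreover have "(\<Sum>i\<in>I. \<Sum>j<q. D i j) \<ge> (\<Sum>i\<in>I. \<Sum>j\<in>J i0. D j i0)"
        proof (rule sum_mono)
          fix i assume "i \<in> I"
          then have "al i 1 = al i0 1" by (auto simp: I_def J_def)
          then have "(\<Sum>j\<in>J i0. D j i0) = (\<Sum>j\<in>J i0. D i j)" using Deq Dsym by (intro sum.cong refl) metis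
          also have "\<dots> \<le> (\<Sum>j<q. D i j)" by (rule sum_mono2) (auto simp: J_def D0)
          finally show "(\<Sum>j\<in>J i0. D j i0) \<le> (\<Sum>j<q. D i j)" .
        qed
        moreover have "(\<Sum>i\<in>J i0. \<Sum>j<q. D i j) \<ge> (\<Sum>j\<in>J i0. \<Sum>i\<in>I. D j i0)"
        proof (rule sum_mono)
          fix j
          have "D j i0 = D j i" if "i \<in> I" for i
          proof -
            have "al i 1 = al i0 1" using that by (auto simp: I_def J_def)
            then show ?thesis using Deq Dsym by metis
          qed
          then have "(\<Sum>i\<in>I. D j i0) = (\<Sum>i\<in>I. D j i)" by (intro sum.cong refl)
          also have "\<dots> \<le> (\<Sum>i<q. D j i)" by (rule sum_mono2) (auto simp: I_def D0)
          finally show "(\<Sum>i\<in>I. D j i0) \<le> (\<Sum>i<q. D j i)" .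
        qed
        moreover have "(\<Sum>i\<in>I. \<Sum>j\<in>J i0. D j i0) = real (card I) * (\<Sum>j\<in>J i0. D j i0)"
          "(\<Sum>j\<in>J i0. \<Sum>i\<in>I. D j i0) = real (card I) * (\<Sum>j\<in>J i0. D j i0)"
          by (simp_all add: sum_distrib_left)
        ultimately show ?thesis by linarith
      qed
      then have main: "(real q - real X) * (\<Sum>j\<in>J i0. D j i0) \<le> (real q - 1) * R"
        using tot q1 by (simp add: cI of_nat_diff)
      show ?thesis
      proof (rule split[of "J i0" "\<lambda>j. zeta q ^ j" ga m])
        show "finite (J i0)" by (rule finJ)
        have "(\<Sum>j<q. zeta q ^ j) = 0" using zeta_orthogonality[of q 1] q1 by simp
        then have "g 1 = (\<Sum>j<q. zeta q ^ j * ga j 1)"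
          by (simp add: a(2) ga_def right_diff_distrib sum_subtractf flip: sum_distrib_right)
        also have "\<dots> = (\<Sum>j\<in>J i0. zeta q ^ j * ga j 1)"
          by (rule sum.mono_neutral_right) (auto simp: J_def ga_def)
        finally show "g 1 = (\<Sum>j\<in>J i0. zeta q ^ j * ga j 1)" .
        show "zfun \<int> m (ga j)" for j unfolding ga_def by (intro Zc.zfun_diff a)
        show "mean_sq m (ga j) \<le> R" if "J i0 = {j}" for j
        proof -
          have "X = 1" using that by (simp add: X_def)
          then show ?thesis using main that q1 by (simp add: gaD)
        qed
        show "mean_sq m (ga j) \<le> R - 1/2" if j: "j \<in> J i0" "card (J i0) \<ge> 2" for j
        proof -
          \<comment> \<open>Since \<open>X <= 2 * R\<close>, both \<open>X\<close> and
            \<open>(X - 1) * 2 * R\<close> fit below \<open>q\<close>, so the excess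
            \<open>(X - 1) * R\<close> hidden in \<open>main\<close> is at most half of
            \<open>q - X\<close>.\<close>
          have "real q > 2 * R + 4 * R\<^sup>2" using P unram by linarith
          moreover have "(real X - 1) * (2 * R) \<le> 2 * R * (2 * R)" using X2 R by (intro mult_right_mono) auto
          moreover have "2 * R * (2 * R) = 4 * R\<^sup>2" by (simp add: power2_eq_square)
          ultimately have qX: "real q - real X > (real X - 1) * (2 * R)" using X2 by linarith
          have X1: "real X \<ge> 2" using j by (simp add: X_def)
          have pos: "real q - real X > 0" using qX X1 R by (smt (verit) mult_nonneg_nonneg)
          have "(\<Sum>i\<in>J i0 - {j}. 1) \<le> (\<Sum>i\<in>J i0 - {j}. D i i0)" by (intro sum_mono) (auto simp: J_def intro!: Dge)
          moreover have "(\<Sum>i\<in>J i0 - {j}. (1::real)) \<ge> 1" using j finJ by simp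
          moreover have "(\<Sum>i\<in>J i0. D i i0) = D j i0 + (\<Sum>i\<in>J i0 - {j}. D i i0)"
            using finJ j by (simp add: sum.remove)
          ultimately have "D j i0 + 1 \<le> (\<Sum>i\<in>J i0. D i i0)" by linarith
          then have "(real q - real X) * (D j i0 + 1) \<le> (real q - 1) * R"
            using main mult_left_mono[of "D j i0 + 1" "\<Sum>i\<in>J i0. D i i0" "real q - real X"] pos by linarith
          also have "(real q - 1) * R = (real q - real X) * R + (real X - 1) * R" by (simp add: algebra_simps)
          also have "\<dots> \<le> (real q - real X) * R + (real q - real X) * (1/2)" using qX by simp
          finally have "(real q - real X) * (D j i0 + 1) \<le> (real q - real X) * (R + 1/2)" by (simp add: algebra_simps)
          then have "D j i0 + 1 \<le> R + 1/2" using pos by simp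
          then show ?thesis by (simp add: gaD)
        qed
      qed (use X2 X_def m0 root_unity_power[OF root_unity_zeta[of q]] q1 in auto)
    next
      case small
      \<comment> \<open>The level is squarefree with prime factors at most \<open>P\<close>, so
        finitely many levels remain, each with its own bound.\<close>
      have "N dvd fact P"
      proof (rule multiplicity_le_imp_dvd)
        fix p :: nat assume p: "prime p"
        show "multiplicity p N \<le> multiplicity p (fact P)"
        proof (cases "p dvd N")
          case True
          have "\<not> p ^ 2 dvd N" using small[OF p True] by (simp add: power2_eq_square)
          then have "multiplicity p N \<le> 1"
            by (metis not_less_eq_eq one_add_one multiplicity_dvd' plus_1_eq_Suc)
          moreover have "p dvd fact P" using small[OF p True] prime_ge_1_nat[OF p] by (intro dvd_fact) auto
          then have "multiplicity p (fact P :: nat) \<ge> 1" using p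
            by (intro multiplicity_geI) (auto simp: not_prime_unit)
          ultimately show ?thesis by linarith
        qed (simp add: not_dvd_imp_multiplicity_0)
      qed (use N in auto)
      then have "N \<in> {1..fact P}" using N by (auto dest: dvd_imp_le)
      from b[OF this g gR] show ?thesis
        by (rule rsum_mono) (use \<open>N \<in> {1..fact P}\<close> in \<open>auto simp: B_def le_max_iff_disj intro!: disjI1\<close>)
    qed
  qed
  then show ?case unfolding R_def by blast
qed

section \<open>Elements of bounded size in extensions generated by roots of unity\<close>

lemma hom_on_subset: "hom_on L t \<Longrightarrow> K \<subseteq> L \<Longrightarrow> hom_on K t"
  unfolding hom_on_def by blast

section \<open>Roots of unity in an arbitrary algebraically closed field\<close>

definition ratmap :: "'a::field_char_0 \<Rightarrow> 'b::field_char_0" where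
  "ratmap x = of_rat (THE q. of_rat q = x)"

lemma ratmap_of_rat: "ratmap (of_rat q) = of_rat q"
  unfolding ratmap_def by (rule arg_cong[of _ _ of_rat]) (auto simp: of_rat_eq_iff)

lemma hom_on_ratmap: "hom_on \<rat> ratmap"
  unfolding hom_on_def
  by (auto elim!: Rats_cases simp: ratmap_of_rat of_rat_add[symmetric] of_rat_mult[symmetric] simp del: of_rat_add of_rat_mult)
     (metis of_rat_1 ratmap_of_rat)

lemma (in field_hom) map_poly_Ints: "p \<in> pol \<int> \<Longrightarrow> map_poly t p \<in> pol \<int> \<and> (\<forall>x\<in>L. poly (map_poly t p) (t x) = t (poly p x))"
proof -
  assume p: "p \<in> pol \<int>"
  then have "p \<in> pol L" by (auto simp: pol_def elim: Ints_cases) (metis Ints_cases of_int)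
  moreover have "map_poly t p \<in> pol \<int>" using p unfolding pol_def
    by (auto simp: coeff_map_poly) (metis Ints_cases Ints_of_int h_of_int)
  ultimately show ?thesis using map_poly_eval by blast
qed

lemma (in field_hom) h_eq_1_iff: "x \<in> L \<Longrightarrow> t x = 1 \<longleftrightarrow> x = 1"
  using h_inj one by (metis h_one inj_onD)

lemma hom_algebraic_int:
  fixes t :: "'a::field_char_0 \<Rightarrow> 'b::field_char_0"
  assumes L: "is_subfield L" and t: "hom_on L t" and x: "x \<in> L" "algebraic_int x"
  shows "algebraic_int (t x)"
proof -
  interpret field_hom L t using L t by unfold_locales
  obtain p where p: "p \<in> pol \<int>" "lead_coeff p = 1" "poly p x = 0"
    using x(2) unfolding algebraic_int_integral integral_over_def by blast
  have pL: "p \<in> pol L" using p(1) by (auto simp: pol_def elim: Ints_cases) (metis Ints_cases of_int)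
  have "poly (map_poly t p) (t x) = 0" using map_poly_Ints[OF p(1)] x(1) p(3) by simp
  moreover have "lead_coeff (map_poly t p) = 1" using p(2) by (simp add: map_degree[OF pL] coeff_map_poly)
  ultimately show ?thesis unfolding algebraic_int_integral integral_over_def using map_poly_Ints[OF p(1)] by blast
qed

text \<open>The order is known for the complex number \<open>zeta N\<close>. A root of its
  transported minimal polynomial inherits it through a homomorphism, which is injective.\<close>

lemma primitive_root_unity_exists:
  assumes N: "N > 0"
  shows "\<exists>w::'a::{alg_closed_field,field_char_0}. w ^ N = 1 \<and> (\<forall>k. w ^ k = 1 \<longleftrightarrow> N dvd k)"
proof -
  interpret Q: field_hom "\<rat> :: complex set" "ratmap :: complex \<Rightarrow> 'a"
    using Rats_subfield hom_on_ratmap by unfold_locales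
  obtain P where P: "minpol \<rat> (zeta N) P"
    using Q.minpol_exists algebraic_root_unity[OF N zeta_power_N] algebraic_alg_over by blast
  have PQ: "P \<in> pol \<rat>" using P by (simp add: minpol_def)
  have "degree (map_poly (ratmap :: complex \<Rightarrow> 'a) P) > 0"
    using Q.minpol_degree_pos[OF P] Q.map_degree[OF PQ] by simp
  then obtain w where w: "poly (map_poly (ratmap :: complex \<Rightarrow> 'a) P) w = 0"
    using alg_closed_imp_poly_has_root by blast
  obtain t where t: "hom_on (adj \<rat> (zeta N)) t" "t (zeta N) = w" using Q.extend'[OF P w] by blast
  interpret T: field_hom "adj \<rat> (zeta N)" t using t Q.adj_subfield by unfold_locales
  have "w ^ k = 1 \<longleftrightarrow> N dvd k" for k
  proof -
    have "w ^ k = t (zeta N ^ k)" using T.h_power[OF Q.adj_elem] t by simp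
    moreover have "t (zeta N ^ k) = 1 \<longleftrightarrow> zeta N ^ k = 1"
      by (rule T.h_eq_1_iff[OF T.power[OF Q.adj_elem]])
    ultimately show ?thesis using zeta_power_eq_1_iff[OF N] by simp
  qed
  then show ?thesis by (intro exI[of _ w]) auto
qed

lemma primitive_root_unity_powers:
  fixes w :: "'a::field_char_0"
  assumes N: "N > 0" and w: "\<And>k. w ^ k = 1 \<longleftrightarrow> N dvd k" and z: "z ^ N = 1"
  shows "\<exists>k<N. z = w ^ k"
proof -
  have w0: "w \<noteq> 0" using w[of N] N by (auto simp: power_0_left)
  have "inj_on (\<lambda>k. w ^ k) {..<N}"
  proof (rule linorder_inj_onI)
    fix i j assume ij: "i < j" "i \<in> {..<N}" "j \<in> {..<N}"
    have "w ^ j = w ^ i * w ^ (j - i)" using ij by (simp flip: power_add)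
    then show "w ^ i \<noteq> w ^ j" using w[of "j - i"] ij w0 nat_dvd_not_less[of "j - i" N] by auto
  qed auto
  then have "card ((\<lambda>k. w ^ k) ` {..<N}) = N" using card_image by fastforce
  moreover have "(\<lambda>k. w ^ k) ` {..<N} \<subseteq> {z. z ^ N = 1}"
  proof safe
    fix k have "(w ^ k) ^ N = (w ^ N) ^ k" by (simp add: mult.commute flip: power_mult)
    then show "(w ^ k) ^ N = 1" using w[of N] by simp
  qed
  moreover have "finite {z::'a. z ^ N = 1}" "card {z::'a. z ^ N = 1} \<le> N"
  proof -
    have e: "{z::'a. z ^ N = 1} = {z. poly (monom 1 N - 1) z = 0}" by (simp add: poly_monom)
    have "coeff (monom 1 N - 1 :: 'a poly) N = 1" using N by simp
    then have nz: "(monom 1 N - 1 :: 'a poly) \<noteq> 0" by (metis coeff_0 zero_neq_one)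
    show "finite {z::'a. z ^ N = 1}" unfolding e by (rule poly_roots_finite[OF nz])
    have "degree (monom 1 N - 1 :: 'a poly) \<le> N" by (intro degree_diff_le) (auto simp: degree_monom_le)
    then show "card {z::'a. z ^ N = 1} \<le> N" unfolding e using card_poly_roots_bound[OF nz] by linarith
  qed
  ultimately have "(\<lambda>k. w ^ k) ` {..<N} = {z. z ^ N = 1}" by (metis card_seteq)
  then show ?thesis using z by auto
qed

definition cycl_field :: "'a::field set" where "cycl_field = is_subfield hull {z. root_unity z}"

lemma hull_subfield: "is_subfield (is_subfield hull S)"
  by (rule hull_in) (auto simp: is_subfield_def)

lemma cycl_field_subfield: "is_subfield cycl_field"
  unfolding cycl_field_def by (rule hull_subfield)

lemma root_unity_cycl_field: "root_unity z \<Longrightarrow> z \<in> cycl_field"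
  unfolding cycl_field_def using hull_subset by fast

lemma Rats_in_subfield: "is_subfield L \<Longrightarrow> (\<rat> :: 'a::field_char_0 set) \<subseteq> L"
proof
  fix x :: 'a assume L: "is_subfield L" and "x \<in> \<rat>"
  interpret subfield_of L using L by unfold_locales
  from \<open>x \<in> \<rat>\<close> show "x \<in> L" by (auto elim!: Rats_cases' intro: divide)
qed

lemma algebraic_subfield: "is_subfield {x::'a::field_char_0. algebraic x}"
  using alg_over_subfield[OF Rats_subfield] by (simp add: algebraic_alg_over)

lemma cycl_field_algebraic: "x \<in> cycl_field \<Longrightarrow> algebraic (x::'a::field_char_0)"
proof -
  have "cycl_field \<subseteq> {x::'a. algebraic x}" unfolding cycl_field_def
    by (rule hull_minimal) (auto simp: algebraic_subfield root_unity_def algebraic_root_unity)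
  then show "x \<in> cycl_field \<Longrightarrow> algebraic x" by blast
qed

lemma adj_Rats_mono:
  fixes w :: "'a::field_char_0"
  assumes w: "w = v ^ k"
  shows "adj \<rat> w \<subseteq> adj \<rat> v"
proof -
  interpret V: subfield_of "adj \<rat> v" using Q.adj_subfield by unfold_locales
  show ?thesis using w by (intro Q.adj_least Q.adj_subfield Q.adj_base) (auto intro: Q.adj_elem)
qed

text \<open>The fields generated by one root of unity form a directed family, so finitely many
  elements lie in one of them.\<close>

lemma cycl_field_finite_level:
  fixes X :: "'a::{alg_closed_field,field_char_0} set"
  assumes X: "finite X" "X \<subseteq> cycl_field"
  shows "\<exists>N w. N > 0 \<and> (\<forall>k. w ^ k = 1 \<longleftrightarrow> N dvd k) \<and> X \<subseteq> adj \<rat> w"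
proof -
  have join: "\<exists>N w. N > 0 \<and> (\<forall>k. w ^ k = 1 \<longleftrightarrow> N dvd k) \<and> adj \<rat> u \<subseteq> adj \<rat> w \<and> adj \<rat> v \<subseteq> adj \<rat> w"
    if uv: "root_unity u" "root_unity v" for u v :: 'a
  proof -
    obtain n m where nm: "n > 0" "m > 0" "u ^ n = 1" "v ^ m = 1" using uv by (auto simp: root_unity_def)
    obtain w :: 'a where w: "\<And>k. w ^ k = 1 \<longleftrightarrow> n * m dvd k"
      using primitive_root_unity_exists[of "n * m"] nm by auto
    have "u ^ (n * m) = 1" "v ^ (n * m) = 1" using nm by (simp_all add: power_mult) (metis power_mult mult.commute power_one)
    then have "\<exists>k. u = w ^ k" "\<exists>k. v = w ^ k"
      using primitive_root_unity_powers[of "n * m" w] w nm by auto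
    then have "adj \<rat> u \<subseteq> adj \<rat> w" "adj \<rat> v \<subseteq> adj \<rat> w" using adj_Rats_mono by auto
    then show ?thesis using w nm by (intro exI[of _ "n * m"] exI[of _ w]) auto
  qed
  have rt: "root_unity w" if "N > 0" "\<forall>k. w ^ k = 1 \<longleftrightarrow> N dvd k" for N and w :: 'a
    using that unfolding root_unity_def by (intro exI[of _ N]) auto
  define U where "U = {x::'a. \<exists>w. root_unity w \<and> x \<in> adj \<rat> w}"
  have two: "\<exists>w. root_unity w \<and> x \<in> adj \<rat> w \<and> y \<in> adj \<rat> w" if "x \<in> U" "y \<in> U" for x y
  proof -
    obtain u v where "root_unity u" "root_unity v" "x \<in> adj \<rat> u" "y \<in> adj \<rat> v" using \<open>x \<in> U\<close> \<open>y \<in> U\<close> by (auto simp: U_def)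
    then show ?thesis using join[of u v] rt by blast
  qed
  have adjs: "is_subfield (adj \<rat> w)" for w :: 'a by (rule Q.adj_subfield)
  have "is_subfield U"
    unfolding is_subfield_def
  proof (intro conjI ballI)
    have "root_unity (1::'a)" by (auto simp: root_unity_def)
    then show "0 \<in> U" "1 \<in> U" using Q.adj_base[of 1] by (auto simp: U_def)
    fix x assume x: "x \<in> U"
    show "inverse x \<in> U" using x adjs by (auto simp: U_def is_subfield_def)
    fix y assume y: "y \<in> U"
    show "x - y \<in> U" "x * y \<in> U" using two[OF x y] adjs by (auto simp: U_def is_subfield_def)
  qed
  moreover have "{z. root_unity z} \<subseteq> U" using Q.adj_elem by (auto simp: U_def)
  ultimately have U: "cycl_field \<subseteq> U" unfolding cycl_field_def by (intro hull_minimal)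
  have "\<exists>w. root_unity w \<and> X \<subseteq> adj \<rat> w" using X
  proof (induction X)
    case empty
    have "root_unity (1::'a)" by (auto simp: root_unity_def)
    then show ?case by blast
  next
    case (insert x X)
    obtain v where v: "root_unity v" "X \<subseteq> adj \<rat> v" using insert by auto
    obtain u where u: "root_unity u" "x \<in> adj \<rat> u" using insert.prems U by (auto simp: U_def)
    show ?case using join[OF v(1) u(1)] rt u v by blast
  qed
  then obtain w where "root_unity w" "X \<subseteq> adj \<rat> w" by blast
  then show ?thesis using join[of w w] by blast
qed

section \<open>Bounded representations by roots of unity, from the cyclotomic field upwards\<close>

definition esum :: "'a::field set \<Rightarrow> nat \<Rightarrow> 'a \<Rightarrow> bool" where
  "esum E B x \<longleftrightarrow> (\<exists>e z. (\<forall>j<B. e j \<in> E \<and> root_unity (z j)) \<and> x = (\<Sum>j<B. e j * z j))"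

definition size_bound :: "'a::field_char_0 set \<Rightarrow> real \<Rightarrow> nat \<Rightarrow> 'a \<Rightarrow> bool" where
  "size_bound L R m x \<longleftrightarrow> (\<forall>t::'a \<Rightarrow> complex. hom_on L t \<longrightarrow> cmod (t x) \<le> R) \<and> algebraic_int (of_nat m * x)"

text \<open>The property that is carried up the tower: the coefficients \<open>E\<close> and the
  length \<open>B\<close> depend on the size bound only, not on \<open>x\<close>.\<close>

definition bounded_repr :: "'a::field_char_0 set \<Rightarrow> bool" where
  "bounded_repr L \<longleftrightarrow> (\<forall>R m. m > 0 \<longrightarrow> (\<exists>E B. finite E \<and> E \<subseteq> L \<and> (\<forall>x\<in>L. size_bound L R m x \<longrightarrow> esum E B x)))"

text \<open>A complex embedding turns \<open>m * x\<close> into an integer of a cyclotomic field all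
  of whose conjugates are at most \<open>m * R\<close>. The bound for the mean square applies, and
  the resulting roots of unity are pulled back.\<close>

lemma bounded_repr_cycl_field: "bounded_repr (cycl_field :: 'a::{alg_closed_field,field_char_0} set)"
  unfolding bounded_repr_def
proof (intro allI impI)
  fix R :: real and m :: nat assume m: "m > 0"
  let ?F = "cycl_field :: 'a set"
  interpret F: subfield_of ?F using cycl_field_subfield by unfold_locales
  have alg: "alg_over \<rat> x" if "x \<in> ?F" for x using cycl_field_algebraic[OF that] algebraic_alg_over by blast
  obtain t0 :: "'a \<Rightarrow> complex" where "hom_on ?F t0"
    using hom_extend_alg_closed[OF Rats_subfield cycl_field_subfield Rats_in_subfield[OF cycl_field_subfield] alg hom_on_ratmap]
    by blast
  then interpret T: field_hom ?F t0 by unfold_locales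
  have t0Q: "t0 x \<in> \<rat>" if "x \<in> \<rat>" for x using that
    by (elim Rats_cases') (auto simp: T.h_divide)
  \<comment> \<open>The embedding preserves orders, so it hits a primitive root of unity of each
    order and hence all its powers.\<close>
  have lift: "\<exists>z. root_unity z \<and> t0 z = y" if y: "root_unity y" for y
  proof -
    obtain n where n: "n > 0" "y ^ n = 1" using y by (auto simp: root_unity_def)
    obtain w :: 'a where w: "w ^ n = 1" "\<And>k. w ^ k = 1 \<longleftrightarrow> n dvd k" using primitive_root_unity_exists[OF n(1)] by auto
    have rw: "root_unity w" using w n by (auto simp: root_unity_def)
    have "t0 w ^ k = 1 \<longleftrightarrow> n dvd k" for k
    proof -
      have "t0 w ^ k = t0 (w ^ k)" using T.h_power root_unity_cycl_field[OF rw] by simp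
      moreover have "t0 (w ^ k) = 1 \<longleftrightarrow> w ^ k = 1"
        by (rule T.h_eq_1_iff[OF root_unity_cycl_field[OF root_unity_power[OF rw]]])
      ultimately show ?thesis using w by simp
    qed
    then obtain k where "y = t0 w ^ k" using primitive_root_unity_powers[OF n(1) _ n(2)] by blast
    then have "t0 (w ^ k) = y" using T.h_power root_unity_cycl_field[OF rw] by simp
    then show ?thesis using root_unity_power[OF rw] by blast
  qed
  define k where "k = nat \<lceil>2 * (real m * R)\<^sup>2\<rceil>"
  have kR: "(real m * R)\<^sup>2 \<le> real k / 2" using real_nat_ceiling_ge[of "2 * (real m * R)\<^sup>2"] unfolding k_def by linarith
  obtain B where B: "\<And>N g. N > 0 \<Longrightarrow> zfun \<int> N g \<Longrightarrow> mean_sq N g \<le> real k / 2 \<Longrightarrow> rsum B (g 1)"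
    using bounded_mean_sq_rsum by blast
  have "esum {0, 1 / of_nat m} B x" if x: "x \<in> ?F" "size_bound ?F R m x" for x
  proof -
    have "finite {x}" "{x} \<subseteq> ?F" using x by auto
    from cycl_field_finite_level[OF this] obtain N w where
      Nw0: "N > 0" "\<forall>k. w ^ k = 1 \<longleftrightarrow> N dvd k" "{x} \<subseteq> adj \<rat> w" by blast
    have "x \<in> adj \<rat> w" using Nw0(3) by simp
    note Nw = Nw0(1) Nw0(2)[rule_format] this
    have "w ^ N = 1" using Nw(2)[of N] by simp
    then have rw: "root_unity w" using Nw(1) unfolding root_unity_def by blast
    have wF: "w \<in> ?F" using root_unity_cycl_field[OF rw] .
    have "t0 w ^ N = 1" using T.h_power[OF wF, of N] Nw(2)[of N] by simp
    then obtain u where u: "t0 w = zeta N ^ u" using zeta_roots[OF Nw(1)] by blast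
    have "\<exists>P. minpol \<rat> w P" using Q.minpol_exists alg[OF wF] by blast
    then obtain P where P: "minpol \<rat> w P" ..
    have PQ: "P \<in> pol \<rat>" using P by (simp add: minpol_def)
    have sub: "pol \<rat> \<subseteq> pol ?F" using pol_mono[OF Rats_in_subfield[OF cycl_field_subfield]] .
    obtain p where p: "p \<in> pol \<rat>" "x = poly p w" using Q.adj_eq[OF P] Nw(3) by auto
    define g where "g = (\<lambda>s. poly (map_poly t0 p) (zeta N ^ (u * s)))"
    have mapQ: "map_poly t0 q \<in> pol \<rat>" if "q \<in> pol \<rat>" for q
      using that t0Q by (auto simp: pol_def coeff_map_poly)
    have g1: "g 1 = t0 x" using T.map_poly_eval[OF subsetD[OF sub p(1)] wF] p(2) by (simp add: g_def u)
    have zg: "zfun \<rat> N g"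
    proof -
      have "zfun \<rat> N (\<lambda>s. poly (map_poly t0 p) (zeta N ^ s))" using mapQ[OF p(1)] by (auto simp: zfun_def)
      from Qc.zfun_shift[OF this, of u] show ?thesis by (simp add: g_def)
    qed
    \<comment> \<open>Each exponent \<open>s\<close> coprime to \<open>N\<close> comes from an
      embedding of the whole field, and \<open>size_bound\<close> speaks about all of these.\<close>
    have gR: "cmod (g s) \<le> R" if s: "coprime s N" for s
    proof -
      interpret TQ: field_hom "\<rat> :: 'a set" t0
        using hom_on_subset[OF T.hom Rats_in_subfield[OF cycl_field_subfield]] by unfold_locales
      have "poly (map_poly t0 P) (t0 w) = 0"
        using T.map_poly_eval[OF subsetD[OF sub PQ] wF] P by (simp add: minpol_def)
      then have "poly (map_poly t0 P) (t0 w ^ s) = 0"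
        using rat_poly_root_unity_conjugate[OF Nw(1) \<open>t0 w ^ N = 1\<close> s mapQ[OF PQ]] by blast
      from TQ.extend[OF P this] obtain t' where t': "hom_on (adj \<rat> w) t'"
        "\<And>h. h \<in> pol \<rat> \<Longrightarrow> t' (poly h w) = poly (map_poly t0 h) (t0 w ^ s)" by blast
      have sub2: "adj \<rat> w \<subseteq> ?F" using Q.adj_least[OF cycl_field_subfield Rats_in_subfield[OF cycl_field_subfield] wF] .
      obtain t'' where t'': "hom_on ?F t''" "\<forall>y\<in>adj \<rat> w. t'' y = t' y"
        using hom_extend_alg_closed[OF Q.adj_subfield cycl_field_subfield sub2 _ t'(1)] alg alg_over_mono[OF Q.adj_base] by blast
      have "g s = t'' x" using t'' Nw(3) t'(2)[OF p(1)] by (simp add: g_def p(2)[symmetric] u power_mult)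
      then show ?thesis using x(2) t'' by (simp add: size_bound_def)
    qed
    have "algebraic_int (t0 (of_nat m * x))"
      using hom_algebraic_int[OF cycl_field_subfield T.hom] x by (simp add: size_bound_def F.mult)
    then have ai: "algebraic_int (of_nat m * g 1)" using T.h_mult[of "of_nat m" x] x g1 by simp
    obtain r where r: "r \<in> pol \<rat>" "\<And>s. g s = poly r (zeta N ^ s)" using zg by (auto simp: zfun_def)
    have "g 1 \<in> QQ (zeta N)" unfolding Qc.adjoin_def using r by (auto intro: image_eqI[of _ _ r])
    then have "of_nat m * g 1 \<in> QQ (zeta N)" by (rule QQ_subfield_facts(3)[rotated]) auto
    from cyclotomic_ring_of_integers[OF Nw(1) this ai]
    obtain a where a: "a \<in> pol \<int>" "of_nat m * g 1 = poly a (zeta N)" by (rule Zc.adjoinE)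
    define G where "G = (\<lambda>s. poly a (zeta N ^ s))"
    have zG: "zfun \<int> N G" using a by (auto simp: zfun_def G_def)
    \<comment> \<open>\<open>G\<close> and \<open>of_nat m * g\<close> agree at exponent 1; a
      rational polynomial relation there carries over to all conjugates.\<close>
    have Gg: "G s = of_nat m * g s" if "coprime s N" for s
    proof -
      have "zfun \<rat> N (\<lambda>s. G s - of_nat m * g s)"
        using zfun_mono[OF Ints_Rats zG] zg by (intro Qc.zfun_diff Qc.zfun_mult Qc.zfun_const) auto
      from zfun_zero_conjugate[OF Nw(1) this _ that, of 1] show ?thesis using a by (simp add: G_def)
    qed
    have "mean_sq N G \<le> (real m * R)\<^sup>2"
    proof -
      have "(cmod (G s))\<^sup>2 \<le> (real m * R)\<^sup>2" if "s \<in> units_mod N" for s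
        using Gg[of s] gR[of s] that by (intro power_mono) (auto simp: units_mod_def norm_mult mult_left_mono)
      then have "(\<Sum>s\<in>units_mod N. (cmod (G s))\<^sup>2) \<le> real (card (units_mod N)) * (real m * R)\<^sup>2"
        by (intro sum_bounded_above)
      then show ?thesis using card_units_mod_pos[OF Nw(1)] by (simp add: mean_sq_def field_simps)
    qed
    then have "rsum B (G 1)" using B[OF Nw(1) zG] kR by linarith
    then obtain f where f: "\<forall>j<B. f j = 0 \<or> root_unity (f j)" "G 1 = (\<Sum>j<B. f j)" by (auto simp: rsum_def)
    have "\<exists>e z. e \<in> {0, 1 / of_nat m} \<and> root_unity z \<and> of_nat m * t0 (e * z) = f j" if jB: "j < B" for j
    proof (cases "f j = 0")
      case True
      have "root_unity (1::'a)" by (auto simp: root_unity_def)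
      then have "(0::'a) \<in> {0, 1 / of_nat m} \<and> root_unity (1::'a) \<and> of_nat m * t0 (0 * 1) = f j" using True by simp
      then show ?thesis by blast
    next
      case False
      then obtain z where z: "root_unity z" "t0 z = f j" using lift f(1) jB by blast
      have "t0 (1 / of_nat m * z) = t0 (1 / of_nat m) * f j"
        unfolding z(2)[symmetric] by (intro T.h_mult F.divide F.one F.of_nat root_unity_cycl_field z(1))
      also have "t0 (1 / of_nat m) = 1 / of_nat m" using T.h_divide[OF F.one F.of_nat, of m] by simp
      finally have "of_nat m * t0 (1 / of_nat m * z) = f j" using m by simp
      then show ?thesis using z by blast
    qed
    then have "\<forall>j\<in>{..<B}. \<exists>q. fst q \<in> {0, 1 / of_nat m} \<and> root_unity (snd q) \<and> of_nat m * t0 (fst q * snd q) = f j"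
      by fastforce
    from bchoice[OF this] obtain q where q: "\<forall>j\<in>{..<B}. fst (q j) \<in> {0, 1 / of_nat m} \<and> root_unity (snd (q j)) \<and>
        of_nat m * t0 (fst (q j) * snd (q j)) = f j" ..
    define e where "e = (\<lambda>j. fst (q j))"
    define z where "z = (\<lambda>j. snd (q j))"
    have ez: "e j \<in> {0, 1 / of_nat m} \<and> root_unity (z j) \<and> of_nat m * t0 (e j * z j) = f j" if "j < B" for j
      using q that by (simp add: e_def z_def)
    have inF: "e j * z j \<in> ?F" if "j < B" for j
    proof -
      have "e j \<in> ?F" using ez[OF that] F.divide[OF F.one F.of_nat, of m] by auto
      then show ?thesis using ez[OF that] root_unity_cycl_field by (intro F.mult) auto
    qed
    have "t0 (\<Sum>j<B. e j * z j) = (\<Sum>j<B. t0 (e j * z j))" using inF by (intro T.h_sum) auto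
    then have "of_nat m * t0 (\<Sum>j<B. e j * z j) = (\<Sum>j<B. f j)" using ez by (simp add: sum_distrib_left)
    also have "\<dots> = of_nat m * t0 x" using f(2) Gg[of 1] g1 by simp
    finally have "t0 (\<Sum>j<B. e j * z j) = t0 x" using m by simp
    moreover have "(\<Sum>j<B. e j * z j) \<in> ?F" using inF by (intro F.sum) auto
    ultimately have "x = (\<Sum>j<B. e j * z j)" using T.h_inj x(1) by (metis inj_onD)
    then show ?thesis unfolding esum_def using ez by blast
  qed
  moreover have "{0, 1 / of_nat m} \<subseteq> ?F" using F.divide[OF F.one F.of_nat] by auto
  ultimately show "\<exists>E B. finite E \<and> E \<subseteq> ?F \<and> (\<forall>x\<in>?F. size_bound ?F R m x \<longrightarrow> esum E B x)"
    by (intro exI[of _ "{0, 1 / of_nat m}"] exI[of _ B]) auto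
qed

definition lagr :: "'a::field set \<Rightarrow> 'a \<Rightarrow> 'a poly" where
  "lagr Z z = (\<Prod>y\<in>Z-{z}. smult (inverse (z - y)) [:-y, 1:])"

lemma lagrange_interpolation:
  fixes h :: "'a::field poly"
  assumes Z: "finite Z" "degree h < card Z"
  shows "h = (\<Sum>z\<in>Z. smult (poly h z) (lagr Z z))"
proof (rule poly_eqI_degree[of Z])
  show "card Z > degree h" by (rule Z)
  have dl: "degree (lagr Z z) \<le> card Z - 1" if "z \<in> Z" for z
  proof -
    have "degree (lagr Z z) \<le> (\<Sum>y\<in>Z-{z}. degree (smult (inverse (z - y)) [:-y, 1:]))"
      unfolding lagr_def using degree_prod_sum_le[of "Z - {z}" "\<lambda>y. smult (inverse (z - y)) [:-y, 1:]"] Z(1)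
      by (simp only: o_def finite_Diff)
    also have "\<dots> \<le> (\<Sum>y\<in>Z-{z}. 1)" by (intro sum_mono) auto
    also have "\<dots> = card Z - 1" using that Z by simp
    finally show ?thesis .
  qed
  have "degree (\<Sum>z\<in>Z. smult (poly h z) (lagr Z z)) \<le> card Z - 1"
    using Z dl by (intro degree_sum_le) (auto intro: order_trans[OF degree_smult_le])
  then show "card Z > degree (\<Sum>z\<in>Z. smult (poly h z) (lagr Z z))" using Z by linarith
  fix x assume x: "x \<in> Z"
  have "poly (lagr Z z) x = (if z = x then 1 else 0)" if "z \<in> Z" for z
  proof (cases "z = x")
    case False
    then show ?thesis using x Z by (auto simp: lagr_def poly_prod intro!: prod_zero bexI[of _ x])
  next
    case True
    have "poly (smult (inverse (x - y)) [:-y, 1:]) x = 1" if "y \<in> Z - {x}" for y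
    proof -
      have "poly (smult (inverse (x - y)) [:-y, 1:]) x = inverse (x - y) * (x - y)" by (simp add: algebra_simps)
      also have "\<dots> = 1" using that by (intro left_inverse) auto
      finally show ?thesis .
    qed
    then have "(\<Prod>y\<in>Z-{x}. poly (smult (inverse (x - y)) [:-y, 1:]) x) = 1" by (intro prod.neutral) blast
    then show ?thesis using True by (simp only: lagr_def poly_prod) simp
  qed
  then have "poly (\<Sum>z\<in>Z. smult (poly h z) (lagr Z z)) x = (\<Sum>z\<in>Z. if z = x then poly h x else 0)"
    unfolding poly_sum by (intro sum.cong) auto
  then show "poly h x = poly (\<Sum>z\<in>Z. smult (poly h z) (lagr Z z)) x" using x Z by simp
qed

text \<open>The conjugates of \<open>poly h th\<close> above \<open>t\<close> are values at the
  roots \<open>Z\<close> of the transported minimal polynomial, and interpolation recovers the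
  coefficients of \<open>h\<close> from them. As \<open>Z\<close> lies among the roots of the
  integer polynomial \<open>Q\<close>, the Lagrange coefficients come from a finite list independent
  of \<open>t\<close> and \<open>h\<close>.\<close>

lemma coefficient_interpolation:
  fixes t :: "'a::field_char_0 \<Rightarrow> 'b::{alg_closed_field,field_char_0}"
  assumes L: "is_subfield L" and t: "hom_on L t" and P: "minpol L th P"
    and Q: "poly (map_poly of_int Q) th = 0"
    and h: "h \<in> pol L" "degree h < degree P"
  shows "\<exists>Z. Z \<subseteq> {z. poly (map_poly of_int Q) z = 0} \<and> card Z = degree P \<and>
    (\<forall>k. t (coeff h k) = (\<Sum>z\<in>Z. poly (map_poly t h) z * coeff (lagr Z z) k)) \<and>
    (\<forall>z\<in>Z. \<exists>t'. hom_on (adj L th) t' \<and> t' (poly h th) = poly (map_poly t h) z)"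
proof -
  interpret field_hom L t using L t by unfold_locales
  define Z where "Z = {z. poly (map_poly t P) z = 0}"
  have PL: "P \<in> pol L" "P \<noteq> 0" using P by (auto simp: minpol_def)
  have QL: "map_poly of_int Q \<in> pol L" by (auto simp: pol_def coeff_map_poly)
  have mQ: "map_poly t (map_poly of_int Q) = map_poly of_int Q"
    by (rule poly_eqI) (simp add: coeff_map_poly)
  obtain S where S: "S \<in> pol L" "map_poly of_int Q = P * S" using minpol_dvd[OF P QL Q] by blast
  have "(map_poly of_int Q :: 'b poly) = map_poly t P * map_poly t S"
    using map_mult[OF PL(1) S(1)] S(2) mQ by simp
  then have ZY: "Z \<subseteq> {z. poly (map_poly of_int Q) z = 0}" by (auto simp: Z_def)
  have "degree (map_poly t P) > 0" using minpol_degree_pos[OF P] map_degree[OF PL(1)] by simp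
  then obtain z0 where "poly (map_poly t P) z0 = 0" using alg_closed_imp_poly_has_root by blast
  from minpol_separable[OF image_subfield image_minpol[OF P this]]
  have cZ: "card Z = degree P" using map_degree[OF PL(1)] by (simp add: Z_def)
  have finZ: "finite Z" using cZ minpol_degree_pos[OF P] by (metis card.infinite less_irrefl)
  have "map_poly t h = (\<Sum>z\<in>Z. smult (poly (map_poly t h) z) (lagr Z z))"
    using finZ cZ h map_degree[OF h(1)] by (intro lagrange_interpolation) auto
  then have "coeff (map_poly t h) k = (\<Sum>z\<in>Z. poly (map_poly t h) z * coeff (lagr Z z) k)" for k
    by (metis (no_types, lifting) coeff_smult coeff_sum sum.cong)
  then have 1: "t (coeff h k) = (\<Sum>z\<in>Z. poly (map_poly t h) z * coeff (lagr Z z) k)" for k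
    by (simp add: coeff_map_poly)
  have "\<exists>t'. hom_on (adj L th) t' \<and> t' (poly h th) = poly (map_poly t h) z" if "z \<in> Z" for z
    using extend[OF P, of z] that h(1) by (auto simp: Z_def)
  then show ?thesis using ZY cZ 1 by blast
qed

lemma lagr_algebraic:
  assumes "\<And>y. y \<in> Z \<Longrightarrow> algebraic (y::'a::field_char_0)" "z \<in> Z"
  shows "algebraic (coeff (lagr Z z) k)"
proof -
  interpret A: subfield_of "{x::'a. algebraic x}" using algebraic_subfield by unfold_locales
  have "(\<Prod>y\<in>Y. smult (inverse (z - y)) [:-y, 1:]) \<in> pol {x. algebraic x}" if "Y \<subseteq> Z" for Y
    using that
  proof (induction Y rule: infinite_finite_induct)
    case (insert y Y)
    have "y \<in> {x. algebraic x}" "z \<in> {x. algebraic x}" using insert.prems assms by auto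
    then have "smult (inverse (z - y)) [:-y, 1:] \<in> pol {x. algebraic x}"
      by (intro A.pol_smult A.inv A.diff) (auto simp: pol_def coeff_pCons split: nat.split)
    moreover have "(\<Prod>y\<in>Y. smult (inverse (z - y)) [:-y, 1:]) \<in> pol {x. algebraic x}" using insert by auto
    ultimately show ?case unfolding prod.insert[OF insert.hyps] by (rule A.pol_mult)
  qed auto
  from polD[OF this[of "Z - {z}"], of k] show ?thesis by (simp add: lagr_def)
qed

lemma esum_power_comb:
  assumes "\<And>k. k < d \<Longrightarrow> esum E B (c k)" and d: "B > 0"
  shows "esum ((\<lambda>(e, k). e * th ^ k) ` (E \<times> {..<d})) (d * B) (\<Sum>k<d. c k * th ^ k)"
proof -
  obtain e z where ez: "\<And>k j. k < d \<Longrightarrow> j < B \<Longrightarrow> e k j \<in> E \<and> root_unity (z k j)"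
     "\<And>k. k < d \<Longrightarrow> c k = (\<Sum>j<B. e k j * z k j)"
    using assms unfolding esum_def by metis
  \<comment> \<open>Pairs of indices are flattened to \<open>k * B + j\<close>, undone by
    \<open>div\<close> and \<open>mod\<close>; this needs \<open>B\<close> positive.\<close>
  have bij: "bij_betw (\<lambda>i. (i div B, i mod B)) {..<d * B} ({..<d} \<times> {..<B})"
  proof (rule bij_betw_byWitness[where f' = "\<lambda>(k, j). k * B + j"])
    show "(\<lambda>(k, j). k * B + j) ` ({..<d} \<times> {..<B}) \<subseteq> {..<d * B}"
    proof safe
      fix k j assume "k < d" "j < B"
      then have "k * B + j < Suc k * B" by simp
      also have "\<dots> \<le> d * B" using \<open>k < d\<close> by (intro mult_right_mono) auto
      finally show "k * B + j < d * B" .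
    qed
  qed (use d in \<open>auto simp: less_mult_imp_div_less\<close>)
  have "(\<Sum>k<d. c k * th ^ k) = (\<Sum>k<d. \<Sum>j<B. (e k j * th ^ k) * z k j)"
    by (intro sum.cong refl) (simp add: ez(2) sum_distrib_right sum_distrib_left mult_ac)
  also have "\<dots> = (\<Sum>(k, j)\<in>{..<d} \<times> {..<B}. (e k j * th ^ k) * z k j)" by (simp add: sum.cartesian_product)
  also have "\<dots> = (\<Sum>i<d * B. (e (i div B) (i mod B) * th ^ (i div B)) * z (i div B) (i mod B))"
    using sum.reindex_bij_betw[OF bij, of "\<lambda>(k, j). (e k j * th ^ k) * z k j"] by simp
  finally have 1: "(\<Sum>k<d. c k * th ^ k) = (\<Sum>i<d * B. (e (i div B) (i mod B) * th ^ (i div B)) * z (i div B) (i mod B))" .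
  have 2: "e (i div B) (i mod B) * th ^ (i div B) \<in> (\<lambda>(e, k). e * th ^ k) ` (E \<times> {..<d}) \<and> root_unity (z (i div B) (i mod B))"
    if "i < d * B" for i
    using ez(1)[of "i div B" "i mod B"] d that
    by (auto simp: less_mult_imp_div_less intro!: image_eqI[of _ _ "(e (i div B) (i mod B), i div B)"])
  show ?thesis unfolding esum_def
    by (rule exI[of _ "\<lambda>i. e (i div B) (i mod B) * th ^ (i div B)"], rule exI[of _ "\<lambda>i. z (i div B) (i mod B)"]) (use 1 2 in blast)
qed

text \<open>Provides a positive number of terms, which the flattening of pairs of indices
  requires.\<close>

lemma esum_Suc_bound: "esum E B x \<Longrightarrow> 0 \<in> E \<Longrightarrow> esum E (Suc B) x"
proof -
  assume "esum E B x" "0 \<in> E"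
  then obtain e z where "\<forall>j<B. e j \<in> E \<and> root_unity (z j)" "x = (\<Sum>j<B. e j * z j)" by (auto simp: esum_def)
  then have "(\<forall>j<Suc B. (if j < B then e j else 0) \<in> E \<and> root_unity (if j < B then z j else 1)) \<and>
      x = (\<Sum>j<Suc B. (if j < B then e j else 0) * (if j < B then z j else 1))"
    using \<open>0 \<in> E\<close> by (auto simp: less_Suc_eq root_unity_def intro!: sum.cong)
  then show ?thesis unfolding esum_def by (intro exI)
qed

lemma esum_mono: "esum E B x \<Longrightarrow> E \<subseteq> E' \<Longrightarrow> esum E' B x"
  unfolding esum_def by blast

text \<open>By interpolation the coefficients of a bounded element with respect to powers of
  \<open>th\<close> are again bounded: in absolute value by way of complex embeddings, in
  denominator by way of the identity. Both constants come from the roots of \<open>Q\<close>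
  alone.\<close>

lemma bounded_repr_adj:
  fixes L :: "'a::{alg_closed_field,field_char_0} set"
  assumes L: "is_subfield L" and br: "bounded_repr L" and th: "algebraic th"
  shows "bounded_repr (adj L th)"
  unfolding bounded_repr_def
proof (intro allI impI)
  fix R :: real and m :: nat assume m: "m > 0"
  interpret subfield_of L using L by unfold_locales
  interpret A: subfield_of "adj L th" using adj_subfield by unfold_locales
  obtain Q where Q: "Q \<noteq> 0" "poly (map_poly of_int Q) th = 0" using th by (rule algebraicE')
  have "alg_over L th" using th algebraic_alg_over alg_over_mono[OF Rats_in_subfield[OF L]] by blast
  then obtain P where P: "minpol L th P" using minpol_exists by blast
  define d where "d = degree P"
  have d: "d > 0" using minpol_degree_pos[OF P] by (simp add: d_def)
  define Yc where "Yc = {z::complex. poly (map_poly of_int Q) z = 0}"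
  define Ya where "Ya = {z::'a. poly (map_poly of_int Q) z = 0}"
  have mq: "(map_poly of_int Q :: complex poly) \<noteq> 0" "(map_poly of_int Q :: 'a poly) \<noteq> 0"
    using Q(1) by (auto simp: poly_eq_iff coeff_map_poly)
  have fin: "finite Yc" "finite Ya" unfolding Yc_def Ya_def using mq poly_roots_finite by auto
  \<comment> \<open>All Lagrange coefficients that can occur: \<open>M\<close> bounds their complex
    absolute values and \<open>D\<close> is a common denominator in the ambient field.\<close>
  define \<Xi>c where "\<Xi>c = (\<lambda>(Z, z, k). cmod (coeff (lagr Z z) k)) ` (Pow Yc \<times> Yc \<times> {..<d})"
  define \<Xi>a where "\<Xi>a = (\<lambda>(Z, z, k). coeff (lagr Z z) k) ` (Sigma (Pow Ya) (\<lambda>Z. Z \<times> {..<d}))"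
  have finX: "finite \<Xi>c" "finite \<Xi>a" using fin finite_subset[OF _ fin(2)]
    by (auto simp: \<Xi>c_def \<Xi>a_def intro!: finite_imageI finite_SigmaI)
  define M where "M = Max (insert 0 \<Xi>c)"
  have M: "M \<ge> 0" "\<And>x. x \<in> \<Xi>c \<Longrightarrow> x \<le> M" using finX by (auto simp: M_def)
  have "\<exists>D>0. \<forall>x\<in>X. algebraic_int (of_nat D * x)" if "finite X" "X \<subseteq> \<Xi>a" for X
    using that
  proof (induction X)
    case (insert x X)
    then obtain D where D: "D > 0" "\<forall>x\<in>X. algebraic_int (of_nat D * x)" by auto
    have "x \<in> \<Xi>a" using insert.prems by auto
    then obtain Z z k where Zz: "Z \<subseteq> Ya" "z \<in> Z" "x = coeff (lagr Z z) k" by (auto simp: \<Xi>a_def)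
    have "algebraic y" if "y \<in> Z" for y
      using that Zz mq(2) by (intro algebraicI[of "map_poly of_int Q"]) (auto simp: Ya_def coeff_map_poly)
    then have "algebraic x" using lagr_algebraic Zz by blast
    then obtain D' where D': "D' > 0" "algebraic_int (of_nat D' * x)" using algebraic_int_multiple by blast
    have "algebraic_int (of_nat (D * D') * y)" if "y \<in> insert x X" for y
    proof (cases "y = x")
      case True
      have "algebraic_int (of_nat D * (of_nat D' * x))" using D'(2) by (rule algebraic_int_mult[rotated]) simp
      then show ?thesis using True by (simp add: mult.assoc)
    next
      case False
      then have "algebraic_int (of_nat D * y)" using D that by blast
      then have "algebraic_int (of_nat D' * (of_nat D * y))" by (rule algebraic_int_mult[rotated]) simp
      then show ?thesis by (simp add: mult_ac)
    qed
    then show ?case using D(1) D'(1) by (intro exI[of _ "D * D'"]) auto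
  qed (auto intro: exI[of _ 1])
  from this[OF finX(2)] obtain D where D: "D > 0" "\<And>x. x \<in> \<Xi>a \<Longrightarrow> algebraic_int (of_nat D * x)" by auto
  obtain E B where E: "finite E" "E \<subseteq> L" "\<And>x. x \<in> L \<Longrightarrow> size_bound L (real d * (\<bar>R\<bar> * M)) (D * m) x \<Longrightarrow> esum E B x"
    using br D(1) m unfolding bounded_repr_def by (metis mult_pos_pos nat_0_less_mult_iff)
  define E' where "E' = (\<lambda>(e, k). e * th ^ k) ` (insert 0 E \<times> {..<d})"
  have "esum E' (d * Suc B) x" if x: "x \<in> adj L th" "size_bound (adj L th) R m x" for x
  proof -
    obtain h where h: "h \<in> pol L" "x = poly h th" "degree h < d" using adj_repr[OF P x(1)] by (auto simp: d_def)
    have "esum (insert 0 E) (Suc B) (coeff h k)" if k: "k < d" for k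
    proof -
      have "cmod (t (coeff h k)) \<le> real d * (\<bar>R\<bar> * M)" if t: "hom_on L t" for t :: "'a \<Rightarrow> complex"
      proof -
        from coefficient_interpolation[OF L t P Q(2) h(1) h(3)[unfolded d_def]] obtain Z where
          Z0: "Z \<subseteq> {z. poly (map_poly of_int Q) z = 0}" "card Z = degree P"
          "\<forall>k. t (coeff h k) = (\<Sum>z\<in>Z. poly (map_poly t h) z * coeff (lagr Z z) k)"
          "\<forall>z\<in>Z. \<exists>t'. hom_on (adj L th) t' \<and> t' (poly h th) = poly (map_poly t h) z"
          by (elim exE conjE)
        note Z = Z0(1)[folded Yc_def] Z0(2)[folded d_def] Z0(3)[rule_format, of k] Z0(4)[rule_format]
        have "cmod (poly (map_poly t h) z * coeff (lagr Z z) k) \<le> \<bar>R\<bar> * M" if zZ: "z \<in> Z" for z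
        proof -
          obtain t' where "hom_on (adj L th) t'" "t' x = poly (map_poly t h) z" using Z(4)[OF zZ] h(2) by auto
          then have "cmod (poly (map_poly t h) z) \<le> R" using x(2) by (metis size_bound_def)
          moreover have "cmod (coeff (lagr Z z) k) \<in> \<Xi>c" unfolding \<Xi>c_def using zZ Z(1) k
            by (intro image_eqI[of _ _ "(Z, z, k)"]) auto
          ultimately show ?thesis using M unfolding norm_mult by (intro mult_mono) auto
        qed
        then have "cmod (t (coeff h k)) \<le> (\<Sum>z\<in>Z. \<bar>R\<bar> * M)" unfolding Z(3) by (intro sum_norm_le)
        then show ?thesis by (simp add: Z(2))
      qed
      moreover have "algebraic_int (of_nat (D * m) * coeff h k)"
      proof -
        \<comment> \<open>Interpolation with the identity writes the coefficient through conjugates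
          of \<open>x\<close> in the ambient field, and \<open>m\<close> times each of these is an
          algebraic integer.\<close>
        have id: "hom_on L id" by (simp add: hom_on_def)
        have mid: "map_poly id h = h" by (rule poly_eqI) (simp add: coeff_map_poly)
        from coefficient_interpolation[OF L id P Q(2) h(1) h(3)[unfolded d_def], unfolded mid id_apply] obtain Z where
          Z0: "Z \<subseteq> {z. poly (map_poly of_int Q) z = 0}" "card Z = degree P"
          "\<forall>k. coeff h k = (\<Sum>z\<in>Z. poly h z * coeff (lagr Z z) k)"
          "\<forall>z\<in>Z. \<exists>t'. hom_on (adj L th) t' \<and> t' (poly h th) = poly h z"
          by (elim exE conjE)
        note Z = Z0(1)[folded Ya_def] Z0(2)[folded d_def] Z0(3)[rule_format, of k] Z0(4)[rule_format]
        have "of_nat (D * m) * coeff h k = (\<Sum>z\<in>Z. (of_nat m * poly h z) * (of_nat D * coeff (lagr Z z) k))"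
          unfolding Z(3) sum_distrib_left by (simp add: mult_ac)
        also have "algebraic_int \<dots>"
        proof (rule algebraic_int_sum, rule algebraic_int_mult)
          fix z assume z: "z \<in> Z"
          obtain t' where t': "hom_on (adj L th) t'" "t' x = poly h z" using Z(4)[OF z] h(2) by auto
          interpret T: field_hom "adj L th" t' using t' by unfold_locales
          have "algebraic_int (t' (of_nat m * x))"
            using hom_algebraic_int[OF adj_subfield t'(1)] x by (simp add: size_bound_def A.mult)
          then show "algebraic_int (of_nat m * poly h z)" using T.h_mult[of "of_nat m" x] x(1) t' by simp
          show "algebraic_int (of_nat D * coeff (lagr Z z) k)"
            using z Z(1) k by (intro D(2)) (auto simp: \<Xi>a_def intro!: image_eqI[of _ _ "(Z, z, k)"])
        qed
        finally show ?thesis .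
      qed
      ultimately have "esum E B (coeff h k)" using h(1) by (intro E(3)) (auto simp: size_bound_def polD)
      then show ?thesis using esum_Suc_bound esum_mono by (metis insertI1 subset_insertI)
    qed
    then have "esum E' (d * Suc B) (\<Sum>k<d. coeff h k * th ^ k)" unfolding E'_def by (intro esum_power_comb) auto
    moreover have "x = (\<Sum>k<d. coeff h k * th ^ k)"
      unfolding h(2) poly_altdef by (rule sum.mono_neutral_left) (use h(3) in \<open>auto simp: coeff_eq_0\<close>)
    ultimately show ?thesis by simp
  qed
  moreover have "finite E'" using E(1) by (simp add: E'_def)
  moreover have "E' \<subseteq> adj L th" using E(2) adj_base[of th] adj_elem[of th]
    by (auto simp: E'_def intro!: A.mult A.power)
  ultimately show "\<exists>E B. finite E \<and> E \<subseteq> adj L th \<and> (\<forall>x\<in>adj L th. size_bound (adj L th) R m x \<longrightarrow> esum E B x)"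
    by blast
qed

text \<open>Reaches the cyclotomic closure from \<open>cycl_field\<close> by adjoining the finitely
  many generators of the number field.\<close>

lemma tower_induct:
  fixes B :: "'a::{alg_closed_field,field_char_0} set"
  assumes B: "finite B" "\<And>b. b \<in> B \<Longrightarrow> algebraic b"
    and base: "P cycl_field" and step: "\<And>L b. is_subfield L \<Longrightarrow> cycl_field \<subseteq> L \<Longrightarrow> P L \<Longrightarrow> algebraic b \<Longrightarrow> P (adj L b)"
  shows "P (is_subfield hull (B \<union> {z. root_unity z}))"
  using B
proof (induction B)
  case empty
  then show ?case using base by (simp add: cycl_field_def)
next
  case (insert b B)
  let ?L = "is_subfield hull (B \<union> {z. root_unity z})"
  have "is_subfield hull (insert b B \<union> {z. root_unity z}) = adj ?L b"
  proof (rule antisym)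
    show "is_subfield hull (insert b B \<union> {z. root_unity z}) \<subseteq> adj ?L b"
    proof (rule hull_minimal)
      interpret L: subfield_of ?L using hull_subfield by unfold_locales
      show "is_subfield (adj ?L b)" by (rule L.adj_subfield)
      show "insert b B \<union> {z. root_unity z} \<subseteq> adj ?L b"
        using L.adj_base L.adj_elem hull_subset[of "B \<union> {z. root_unity z}" is_subfield] by blast
    qed
    show "adj ?L b \<subseteq> is_subfield hull (insert b B \<union> {z. root_unity z})"
      unfolding adj_def
      by (rule hull_minimal, use hull_mono[of "B \<union> {z. root_unity z}" "insert b B \<union> {z. root_unity z}" is_subfield]
              hull_subset[of "insert b B \<union> {z. root_unity z}" is_subfield] in auto, rule hull_subfield)
  qed
  moreover have "cycl_field \<subseteq> ?L" unfolding cycl_field_def by (rule hull_mono) auto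
  ultimately show ?case using insert step[OF hull_subfield, of "B \<union> {z. root_unity z}" b] by auto
qed

section \<open>Automorphisms acting on roots of unity\<close>

text \<open>The modulus \<open>M\<close> is the price for fixing \<open>X\<close>: one
  \<open>M\<close> serves all levels \<open>N\<close> divisible by it, so arbitrarily high levels
  are available for the same \<open>X\<close>.\<close>

definition power_autos :: "'a::field set \<Rightarrow> 'a set \<Rightarrow> nat \<Rightarrow> bool" where
  "power_autos L X M \<longleftrightarrow> (\<forall>N s. N > 0 \<longrightarrow> M dvd N \<longrightarrow> coprime s N \<longrightarrow> [s = 1] (mod M) \<longrightarrow>
     (\<exists>aut. hom_on L aut \<and> aut ` L \<subseteq> L \<and> (\<forall>x\<in>X. aut x = x) \<and> (\<forall>z. z ^ N = 1 \<longrightarrow> aut z = z ^ s)))"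

definition cycl_autos :: "'a::field set \<Rightarrow> bool" where
  "cycl_autos L \<longleftrightarrow> (\<forall>X. finite X \<longrightarrow> X \<subseteq> L \<longrightarrow> (\<exists>M>0. power_autos L X M))"

lemma cycl_autosE:
  assumes "cycl_autos L" "finite X" "X \<subseteq> L"
  obtains M where "M > 0" "power_autos L X M"
  using assms unfolding cycl_autos_def by blast

text \<open>The set \<open>X\<close> lies in the field of one root of unity \<open>v\<close> of
  order \<open>M\<close>, which is fixed by exponents congruent to 1 modulo \<open>M\<close>. The
  power map on a primitive \<open>N\<close>-th root of unity extends to \<open>cycl_field\<close>,
  which is stable because roots of unity go to roots of unity.\<close>

lemma cycl_autos_cycl_field: "cycl_autos (cycl_field :: 'a::{alg_closed_field,field_char_0} set)"
  unfolding cycl_autos_def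
proof (intro allI impI)
  let ?F = "cycl_field :: 'a set"
  interpret F: subfield_of ?F using cycl_field_subfield by unfold_locales
  have alg: "alg_over \<rat> x" if "x \<in> ?F" for x using cycl_field_algebraic[OF that] algebraic_alg_over by blast
  fix X assume "finite X" "X \<subseteq> ?F"
  from cycl_field_finite_level[OF this] obtain M v where
    M: "M > 0" "\<forall>k. v ^ k = 1 \<longleftrightarrow> M dvd k" "X \<subseteq> adj \<rat> v" by blast
  have vM: "v ^ M = 1" using M(2)[rule_format, of M] by simp
  have rv: "root_unity v" using M(1) vM unfolding root_unity_def by blast
  show "\<exists>M>0. power_autos ?F X M"
    unfolding power_autos_def
  proof (rule exI[of _ M], intro conjI allI impI)
    show "M > 0" by (rule M)
    fix N s :: nat assume N: "N > 0" "M dvd N" "coprime s N" "[s = 1] (mod M)"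
    obtain w :: 'a where w: "w ^ N = 1" "\<forall>k. w ^ k = 1 \<longleftrightarrow> N dvd k"
      using primitive_root_unity_exists[OF N(1)] by blast
    have rw: "root_unity w" using N(1) w(1) unfolding root_unity_def by blast
    obtain t where t: "hom_on (adj \<rat> w) t" "t w = w ^ s" using root_unity_hom[OF N(1) w(1) N(3)] by blast
    have sub: "adj \<rat> w \<subseteq> ?F"
      using Q.adj_least[OF cycl_field_subfield Rats_in_subfield[OF cycl_field_subfield] root_unity_cycl_field[OF rw]] .
    obtain aut where s: "hom_on ?F aut" "\<forall>y\<in>adj \<rat> w. aut y = t y"
      using hom_extend_alg_closed[OF Q.adj_subfield cycl_field_subfield sub _ t(1)] alg alg_over_mono[OF Q.adj_base] by blast
    interpret S: field_hom ?F aut using s(1) by unfold_locales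
    have sw: "aut w = w ^ s" using s(2) t(2) Q.adj_elem by metis
    have sz: "aut z = z ^ s" if zN: "z ^ N = 1" for z
    proof -
      obtain k where k: "z = w ^ k" using primitive_root_unity_powers[OF N(1) w(2)[rule_format] zN] by blast
      then have "aut z = (w ^ s) ^ k" using S.h_power[OF root_unity_cycl_field[OF rw]] sw by simp
      then show ?thesis by (simp add: k mult.commute flip: power_mult)
    qed
    have "v ^ N = 1" using M(2) N(2) by blast
    then have "aut v = v ^ s" by (rule sz)
    also have "v ^ s = v"
    proof -
      have "v ^ s = v ^ (s mod M)" if "s mod M = 1 mod M"
      proof -
        have "v ^ s = v ^ (M * (s div M) + s mod M)" by simp
        also have "\<dots> = v ^ (s mod M)" unfolding power_add power_mult vM by simp
        finally show ?thesis .
      qed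
      moreover have "v ^ 1 = v ^ (1 mod M)"
      proof (cases "M = 1")
        case True then show ?thesis using vM by simp
      next
        case False then show ?thesis using M(1) by simp
      qed
      ultimately show ?thesis using N(4) unfolding cong_def by simp
    qed
    finally have sv: "aut v = v" .
    have sQ: "aut q = q" if "q \<in> \<rat>" for q
      using that by (elim Rats_cases') (auto simp: S.h_divide)
    obtain P where P: "minpol \<rat> v P" using Q.minpol_exists alg[OF root_unity_cycl_field[OF rv]] by blast
    have "aut x = x" if xX: "x \<in> X" for x
    proof -
      obtain h where h: "h \<in> pol \<rat>" "x = poly h v" using Q.adj_eq[OF P] M(3) xX by blast
      have hF: "h \<in> pol ?F" using h(1) pol_mono[OF Rats_in_subfield[OF cycl_field_subfield]] by blast
      have "map_poly aut h = h" using h(1) sQ by (intro poly_eqI) (simp add: coeff_map_poly pol_def)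
      then show ?thesis using S.map_poly_eval[OF hF root_unity_cycl_field[OF rv]] sv h(2) by simp
    qed
    moreover have "aut ` ?F \<subseteq> ?F"
    proof -
      let ?V = "{x \<in> ?F. aut x \<in> ?F}"
      have "is_subfield ?V"
        unfolding is_subfield_def by (auto simp: S.h_diff S.h_mult S.h_inverse)
      moreover have "{z. root_unity z} \<subseteq> ?V"
      proof safe
        fix z :: 'a assume z: "root_unity z"
        then obtain n where n: "n > 0" "z ^ n = 1" by (auto simp: root_unity_def)
        have "aut z ^ n = 1" using S.h_power[OF root_unity_cycl_field[OF z], of n] n by simp
        then have "root_unity (aut z)" using n unfolding root_unity_def by blast
        then show "aut z \<in> ?F" "z \<in> ?F" using z root_unity_cycl_field by auto
      qed
      ultimately have "is_subfield hull {z::'a. root_unity z} \<subseteq> ?V" by (rule hull_minimal[rotated])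
      then have "?F \<subseteq> ?V" unfolding cycl_field_def[symmetric] .
      then show ?thesis by blast
    qed
    ultimately show "\<exists>aut. hom_on ?F aut \<and> aut ` ?F \<subseteq> ?F \<and> (\<forall>x\<in>X. aut x = x) \<and> (\<forall>z. z ^ N = 1 \<longrightarrow> aut z = z ^ s)"
      using s(1) sz by blast
  qed
qed

text \<open>An automorphism extends with \<open>th\<close> fixed if it fixes the coefficients of the
  minimal polynomial, and it then fixes \<open>X\<close> if it fixes the coefficients of polynomials
  representing \<open>X\<close>. Hence the finite set \<open>Y\<close> handed to the smaller
  field.\<close>

lemma cycl_autos_adj:
  fixes L :: "'a::{alg_closed_field,field_char_0} set"
  assumes L: "is_subfield L" and cL: "cycl_field \<subseteq> L" and G: "cycl_autos L" and th: "algebraic th"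
  shows "cycl_autos (adj L th)"
  unfolding cycl_autos_def
proof (intro allI impI)
  interpret subfield_of L using L by unfold_locales
  interpret A: subfield_of "adj L th" using adj_subfield by unfold_locales
  fix X assume X: "finite X" "X \<subseteq> adj L th"
  have "alg_over L th" using th algebraic_alg_over alg_over_mono[OF Rats_in_subfield[OF L]] by blast
  then obtain P where P: "minpol L th P" using minpol_exists by blast
  have PL: "P \<in> pol L" using P by (simp add: minpol_def)
  have "\<forall>x\<in>X. \<exists>h. h \<in> pol L \<and> x = poly h th" using X(2) adj_eq[OF P] by blast
  from bchoice[OF this] obtain h where h: "\<forall>x\<in>X. h x \<in> pol L \<and> x = poly (h x) th" ..
  define Y where "Y = (\<Union>p\<in>insert P (h ` X). coeff p ` {..degree p})"
  have Y: "finite Y" "Y \<subseteq> L" using X(1) h PL by (auto simp: Y_def pol_def)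
  have fixp: "map_poly aut p = p" if "\<forall>y\<in>Y. aut y = y" "p \<in> insert P (h ` X)" "aut 0 = 0" for aut p
  proof (rule poly_eqI)
    fix i
    show "coeff (map_poly aut p) i = coeff p i"
    proof (cases "i \<le> degree p")
      case True
      then have "coeff p i \<in> Y" using that(2) unfolding Y_def by blast
      then show ?thesis using that by (simp add: coeff_map_poly)
    next
      case False
      then show ?thesis using that(3) by (simp add: coeff_map_poly coeff_eq_0)
    qed
  qed
  obtain M where M: "M > 0" "power_autos L Y M" using cycl_autosE[OF G Y] .
  show "\<exists>M>0. power_autos (adj L th) X M"
    unfolding power_autos_def
  proof (rule exI[of _ M], intro conjI allI impI)
    show "M > 0" by (rule M)
    fix N s :: nat assume N: "N > 0" "M dvd N" "coprime s N" "[s = 1] (mod M)"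
    obtain aut where s: "hom_on L aut" "aut ` L \<subseteq> L" "\<forall>x\<in>Y. aut x = x" "\<forall>z. z ^ N = 1 \<longrightarrow> aut z = z ^ s"
      using M(2)[unfolded power_autos_def, rule_format, OF N] by blast
    interpret S: field_hom L aut using s(1) by unfold_locales
    have "map_poly aut P = P" using fixp[OF s(3)] by simp
    then have "poly (map_poly aut P) th = 0" using P by (simp add: minpol_def)
    from S.extend[OF P this] obtain t where t: "hom_on (adj L th) t"
      "\<forall>h\<in>pol L. t (poly h th) = poly (map_poly aut h) th" by blast
    have "t ` adj L th \<subseteq> adj L th"
    proof (rule image_subsetI)
      fix x assume "x \<in> adj L th"
      then obtain k where k: "k \<in> pol L" "x = poly k th" using adj_eq[OF P] by blast
      have "map_poly aut k \<in> pol L" using k(1) s(2) by (auto simp: pol_def coeff_map_poly)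
      then show "t x \<in> adj L th" using t(2) k adj_eq[OF P] by auto
    qed
    moreover have "t x = x" if xX: "x \<in> X" for x
    proof -
      have hx: "h x \<in> pol L" "x = poly (h x) th" using h xX by auto
      have "t (poly (h x) th) = poly (map_poly aut (h x)) th" using t(2) hx(1) by blast
      also have "map_poly aut (h x) = h x" using fixp[OF s(3)] xX by simp
      finally show ?thesis using hx(2) by metis
    qed
    moreover have "t z = z ^ s" if zN: "z ^ N = 1" for z
    proof -
      have "root_unity z" using zN N(1) unfolding root_unity_def by blast
      then have "z \<in> L" using root_unity_cycl_field cL by blast
      then have "t (poly [:z:] th) = poly (map_poly aut [:z:]) th" using t(2) pol_const by blast
      then show ?thesis using s(4) zN by (simp add: map_poly_pCons)
    qed
    ultimately show "\<exists>aut. hom_on (adj L th) aut \<and> aut ` adj L th \<subseteq> adj L th \<and> (\<forall>x\<in>X. aut x = x) \<and> (\<forall>z. z ^ N = 1 \<longrightarrow> aut z = z ^ s)"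
      using t(1) by blast
  qed
qed

lemma number_field_generators:
  fixes K :: "'a::{alg_closed_field,field_char_0} set"
  assumes "number_field K"
  obtains B where "finite B" "B \<subseteq> K" "\<And>b. b \<in> B \<Longrightarrow> algebraic b" "is_subfield K"
    "K = module.span (\<lambda>(q::rat) x. of_rat q * x) B"
    "cyclotomic_closure K = is_subfield hull (B \<union> {z. root_unity z})"
proof -
  have K: "is_subfield K" using assms by (simp add: number_field_def)
  obtain B where B: "finite B" "K = module.span (\<lambda>(q::rat) x. of_rat q * x) B"
    using assms by (auto simp: number_field_def)
  interpret V: vector_space "\<lambda>(q::rat) (x::'a). of_rat q * x"
    by unfold_locales (auto simp: algebra_simps of_rat_add of_rat_mult)
  interpret K: subfield_of K using K by unfold_locales
  have BK: "B \<subseteq> K" unfolding B(2) by (rule V.span_superset)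
  have alg: "algebraic x" if x: "x \<in> K" for x
  proof -
    \<comment> \<open>more powers of \<open>x\<close> than the dimension are dependent\<close>
    let ?n = "card B"
    show ?thesis
    proof (cases "inj_on (\<lambda>i. x ^ i) {..?n}")
      case False
      then obtain i j where ij: "i < j" "x ^ i = x ^ j"
        unfolding inj_on_def by (metis linorder_neqE_nat)
      have "coeff (monom 1 j - monom 1 i :: 'a poly) j = 1" using ij by simp
      then have "(monom 1 j - monom 1 i :: 'a poly) \<noteq> 0" by (metis coeff_0 zero_neq_one)
      then show ?thesis using ij by (intro algebraicI[of "monom 1 j - monom 1 i"]) (auto simp: poly_monom)
    next
      case True
      have sub: "(\<lambda>i. x ^ i) ` {..?n} \<subseteq> V.span B" using x B(2) K.power by auto
      have "card ((\<lambda>i. x ^ i) ` {..?n}) = Suc ?n" using card_image[OF True] by simp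
      moreover have "card ((\<lambda>i. x ^ i) ` {..?n}) \<le> card B" if "V.independent ((\<lambda>i. x ^ i) ` {..?n})"
        using V.independent_span_bound[OF B(1) that sub] by simp
      ultimately have "V.dependent ((\<lambda>i. x ^ i) ` {..?n})" by fastforce
      then obtain u where u: "\<exists>v\<in>(\<lambda>i. x ^ i) ` {..?n}. u v \<noteq> 0" "(\<Sum>v\<in>(\<lambda>i. x ^ i) ` {..?n}. of_rat (u v) * v) = 0"
        using V.dependent_finite[of "(\<lambda>i. x ^ i) ` {..?n}"] by auto
      define p where "p = (\<Sum>i\<le>?n. monom (of_rat (u (x ^ i)) :: 'a) i)"
      have c: "coeff p i = (if i \<le> ?n then of_rat (u (x ^ i)) else 0)" for i by (simp add: p_def coeff_sum)
      have "poly p x = (\<Sum>i\<le>?n. of_rat (u (x ^ i)) * x ^ i)" by (simp add: p_def poly_sum poly_monom)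
      also have "\<dots> = 0" using u(2) sum.reindex[OF True, of "\<lambda>v. of_rat (u v) * v"] by (simp add: o_def)
      finally have "poly p x = 0" .
      moreover obtain i where "i \<le> ?n" "u (x ^ i) \<noteq> 0" using u(1) by auto
      then have "coeff p i \<noteq> 0" by (simp add: c)
      then have "p \<noteq> 0" by auto
      ultimately show ?thesis by (intro algebraicI'[of p]) (auto simp: c)
    qed
  qed
  have ru: "{\<zeta>. \<exists>n>0. \<zeta> ^ n = 1} = {z::'a. root_unity z}" by (simp add: root_unity_def)
  let ?H = "is_subfield hull (B \<union> {z. root_unity z})"
  interpret H: subfield_of ?H using hull_subfield by unfold_locales
  have "cyclotomic_closure K = ?H"
    unfolding cyclotomic_closure_def ru
  proof (rule antisym)
    show "?H \<subseteq> is_subfield hull (K \<union> {z. root_unity z})" using BK by (intro hull_mono) auto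
    show "is_subfield hull (K \<union> {z. root_unity z}) \<subseteq> ?H"
    proof (rule hull_minimal)
      have "V.span B \<subseteq> ?H"
      proof (rule V.span_minimal)
        show "B \<subseteq> ?H" using hull_subset[of "B \<union> {z. root_unity z}" is_subfield] by blast
        have "of_rat q \<in> ?H" for q
          using Rats_in_subfield[OF hull_subfield, of "B \<union> {z. root_unity z}"] by auto
        then show "V.subspace ?H" unfolding V.subspace_def by (auto intro: H.add H.mult)
      qed
      then show "K \<union> {z. root_unity z} \<subseteq> ?H"
        using B(2) hull_subset[of "B \<union> {z. root_unity z}" is_subfield] by blast
    qed (rule hull_subfield)
  qed
  then show ?thesis using that B BK K alg by blast
qed

lemma cyclotomic_closure_facts:
  fixes K :: "'a::{alg_closed_field,field_char_0} set"
  assumes K: "number_field K"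
  defines "L \<equiv> cyclotomic_closure K"
  shows "is_subfield L" "K \<subseteq> L" "\<And>z. root_unity z \<Longrightarrow> z \<in> L" "\<And>x. x \<in> L \<Longrightarrow> algebraic x"
    "bounded_repr L" "cycl_autos L"
proof -
  obtain B where B: "finite B" "B \<subseteq> K" "\<And>b. b \<in> B \<Longrightarrow> algebraic b" "is_subfield K"
    "cyclotomic_closure K = is_subfield hull (B \<union> {z. root_unity z})"
    using number_field_generators[OF K] by metis
  show "is_subfield L" unfolding L_def B(5) by (rule hull_subfield)
  show "K \<subseteq> L" unfolding L_def cyclotomic_closure_def using hull_subset by fast
  show "z \<in> L" if "root_unity z" for z
    unfolding L_def B(5) using that hull_subset[of "B \<union> {z. root_unity z}" is_subfield] by blast
  have "L \<subseteq> {x. algebraic x}" unfolding L_def B(5)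
    by (rule hull_minimal) (auto simp: algebraic_subfield root_unity_def B(3) algebraic_root_unity)
  then show "algebraic x" if "x \<in> L" for x using that by blast
  show "bounded_repr L" unfolding L_def B(5)
    by (rule tower_induct[OF B(1,3)]) (auto intro: bounded_repr_cycl_field bounded_repr_adj)
  show "cycl_autos L" unfolding L_def B(5)
    by (rule tower_induct[OF B(1,3)]) (auto intro: cycl_autos_cycl_field cycl_autos_adj)
qed

section \<open>Absolute values on fields of algebraic numbers\<close>

text \<open>The device for removing constants from multiplicative inequalities: apply them to powers
  and compare growth.\<close>

lemma le_one_of_power_bound:
  fixes r :: real
  assumes bd: "\<And>n. r ^ n \<le> a * real n + b"
  shows "r \<le> 1"
proof (rule ccontr)
  assume "\<not> r \<le> 1"
  then have r: "r > 1" by simp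
  then have "(\<lambda>n. a * (real n / r ^ n) + b * (1 / r) ^ n) \<longlonglongrightarrow> a * 0 + b * 0"
    by (intro tendsto_intros lim_n_over_pown LIMSEQ_power_zero) auto
  then have "\<forall>\<^sub>F n in sequentially. a * (real n / r ^ n) + b * (1 / r) ^ n < 1" by (rule order_tendstoD) simp
  then obtain n where "a * (real n / r ^ n) + b * (1 / r) ^ n < 1" by (auto simp: eventually_sequentially)
  then have "a * real n + b < r ^ n" using r by (simp add: field_simps power_divide)
  then show False using bd[of n] by simp
qed

locale abs_val = subfield_of L for L :: "'a::field_char_0 set" +
  fixes f :: "'a \<Rightarrow> real"
  assumes av: "f \<in> absolute_values L"
begin

lemma nonneg: "x \<in> L \<Longrightarrow> 0 \<le> f x" and eq_0_iff: "x \<in> L \<Longrightarrow> f x = 0 \<longleftrightarrow> x = 0"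
  and f_mult: "x \<in> L \<Longrightarrow> y \<in> L \<Longrightarrow> f (x * y) = f x * f y"
  and f_triangle: "x \<in> L \<Longrightarrow> y \<in> L \<Longrightarrow> f (x + y) \<le> f x + f y"
  and f_ext: "f \<in> extensional L"
  using av by (auto simp: absolute_values_def)

lemma f_0 [simp]: "f 0 = 0" using eq_0_iff[of 0] by simp

lemma f_pos: "x \<in> L \<Longrightarrow> x \<noteq> 0 \<Longrightarrow> f x > 0"
  using nonneg eq_0_iff by fastforce

lemma f_1 [simp]: "f 1 = 1"
  using f_mult[of 1 1] f_pos[of 1] by simp

lemma f_power: "x \<in> L \<Longrightarrow> f (x ^ n) = f x ^ n"
  by (induction n) (auto simp: f_mult power)

lemma f_inverse: "x \<in> L \<Longrightarrow> f (inverse x) = inverse (f x)"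
  using f_mult[of x "inverse x"] f_pos[of x] by (cases "x = 0") (auto simp: inv field_simps)

lemma f_divide: "x \<in> L \<Longrightarrow> y \<in> L \<Longrightarrow> f (x / y) = f x / f y"
  by (simp add: divide_inverse f_mult f_inverse inv)

lemma f_root_unity: "z \<in> L \<Longrightarrow> n > 0 \<Longrightarrow> z ^ n = 1 \<Longrightarrow> f z = 1"
proof -
  assume z: "z \<in> L" "n > 0" "z ^ n = 1"
  then have "f z ^ n = 1" using f_power[of z n] by simp
  then show ?thesis using z nonneg[of z] power_eq_iff_eq_base[of n "f z" 1] by simp
qed

lemma f_uminus: "x \<in> L \<Longrightarrow> f (- x) = f x"
  using f_mult[of "-1" x] f_root_unity[of "-1" 2] by auto

lemma f_sum: "(\<And>i. i \<in> I \<Longrightarrow> g i \<in> L) \<Longrightarrow> f (sum g I) \<le> (\<Sum>i\<in>I. f (g i))"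
proof (induction I rule: infinite_finite_induct)
  case (insert i I)
  have "f (g i + sum g I) \<le> f (g i) + f (sum g I)" using insert.prems by (intro f_triangle sum) auto
  then show ?case using insert by fastforce
qed auto

lemma f_prod: "(\<And>i. i \<in> I \<Longrightarrow> g i \<in> L) \<Longrightarrow> f (prod g I) = (\<Prod>i\<in>I. f (g i))"
  by (induction I rule: infinite_finite_induct) (auto simp: f_mult prod)

lemma f_of_nat_le: "f (of_nat n) \<le> real n"
proof (induction n)
  case (Suc n)
  then show ?case using f_triangle[of "of_nat n" 1] by (simp add: add.commute)
qed auto

lemma of_rat_in [simp, intro]: "of_rat q \<in> L"
  using Rats_in_subfield[OF sf] by auto

text \<open>If the integers have bounded absolute value, take \<open>n\<close>-th roots in the binomial expansion of
  \<open>(x + y)\<^sup>n\<close>.\<close>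
lemma ultrametric_of_bounded:
  assumes bd: "\<And>n. f (of_nat n) \<le> 1" and xy: "x \<in> L" "y \<in> L"
  shows "f (x + y) \<le> max (f x) (f y)"
proof (rule ccontr)
  define M where "M = max (f x) (f y)"
  assume "\<not> ?thesis"
  then have gt: "f (x + y) > M" unfolding M_def by linarith
  have M0: "M \<ge> 0" unfolding M_def using nonneg[OF xy(1)] by (simp add: le_max_iff_disj)
  have le: "f (x + y) ^ n \<le> real (Suc n) * M ^ n" for n
  proof -
    have "f (x + y) ^ n = f (\<Sum>k\<le>n. of_nat (n choose k) * x ^ k * y ^ (n - k))"
      using xy by (simp add: f_power[symmetric] add binomial_ring)
    also have "\<dots> \<le> (\<Sum>k\<le>n. f (of_nat (n choose k) * x ^ k * y ^ (n - k)))"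
      using xy by (intro f_sum) auto
    also have "\<dots> \<le> (\<Sum>k\<le>n. M ^ n)"
    proof (rule sum_mono)
      fix k assume k: "k \<in> {..n}"
      have "f (of_nat (n choose k) * x ^ k * y ^ (n - k)) = f (of_nat (n choose k)) * (f x ^ k * f y ^ (n - k))"
        using xy by (simp add: f_mult f_power mult power mult.assoc)
      also have "\<dots> \<le> 1 * (M ^ k * M ^ (n - k))"
        using bd nonneg xy M0 by (intro mult_mono power_mono) (auto simp: M_def)
      also have "\<dots> = M ^ n" using k by (simp flip: power_add)
      finally show "f (of_nat (n choose k) * x ^ k * y ^ (n - k)) \<le> M ^ n" .
    qed
    finally show ?thesis by simp
  qed
  have "M > 0"
  proof (rule ccontr)
    assume "\<not> M > 0"
    then have "M = 0" using M0 by simp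
    then show False using le[of 1] gt by simp
  qed
  define r where "r = f (x + y) / M"
  have r: "r > 1" using gt \<open>M > 0\<close> by (simp add: r_def)
  have "r ^ n \<le> real (Suc n)" for n
    using le[of n] \<open>M > 0\<close> by (simp add: r_def power_divide field_simps)
  then have "r \<le> 1" by (intro le_one_of_power_bound[of r 1 1]) (simp add: add.commute)
  then show False using r by simp
qed

lemma ultrametric_sum:
  assumes u: "\<And>x y. x \<in> L \<Longrightarrow> y \<in> L \<Longrightarrow> f (x + y) \<le> max (f x) (f y)"
    and g: "\<And>i. i \<in> I \<Longrightarrow> g i \<in> L \<and> f (g i) \<le> C" and C: "C \<ge> 0"
  shows "f (sum g I) \<le> C"
  using g
proof (induction I rule: infinite_finite_induct)
  case (insert i I)
  then have "f (g i + sum g I) \<le> max (f (g i)) (f (sum g I))" by (intro u) auto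
  moreover have "f (g i) \<le> C" "f (sum g I) \<le> C" using insert by auto
  ultimately show ?case using insert.hyps by simp
qed (use C in auto)

lemma ultrametric_nat:
  assumes u: "\<And>x y. x \<in> L \<Longrightarrow> y \<in> L \<Longrightarrow> f (x + y) \<le> max (f x) (f y)"
  shows "f (of_nat n) \<le> 1"
proof (induction n)
  case (Suc n)
  then show ?case using u[of "of_nat n" 1] by (simp add: add.commute)
qed auto

end

text \<open>Powers of \<open>n\<close> are expanded in base \<open>m\<close>. The number of digits
  produces the exponent \<open>log m n\<close>, and the factor linear in that number disappears on
  passing to high powers.\<close>

lemma Ostrowski_nat:
  assumes "abs_val L (f :: 'a::field_char_0 \<Rightarrow> real)" and m: "m > 1" and n: "n > (1::nat)"
  shows "f (of_nat n) \<le> max 1 (f (of_nat m)) powr log m n"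
proof -
  interpret abs_val L f by fact
  define F where "F = max 1 (f (of_nat m))"
  have F1: "F \<ge> 1" by (simp add: F_def)
  have digits: "f (of_nat k) \<le> real (m * Suc j) * F ^ j" if "k < m ^ Suc j" for k j
    using that
  proof (induction j arbitrary: k)
    case 0
    then have "real k \<le> real m" by simp
    then show ?case using f_of_nat_le[of k] by simp
  next
    case (Suc j)
    have "k div m < m ^ Suc j" using Suc.prems by (metis less_mult_imp_div_less power_Suc2)
    then have IH: "f (of_nat (k div m)) \<le> real (m * Suc j) * F ^ j" by (rule Suc.IH)
    have "k mod m < m" using m by simp
    then have r: "f (of_nat (k mod m)) \<le> real m" using f_of_nat_le[of "k mod m"] by linarith
    have "f (of_nat k) = f (of_nat m * of_nat (k div m) + of_nat (k mod m))"
      by (metis mult_div_mod_eq of_nat_add of_nat_mult)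
    also have "\<dots> \<le> f (of_nat m) * f (of_nat (k div m)) + f (of_nat (k mod m))"
      using f_triangle[of "of_nat m * of_nat (k div m)" "of_nat (k mod m)"] by (simp add: f_mult mult)
    also have "\<dots> \<le> F * (real (m * Suc j) * F ^ j) + real m"
      using IH r F1 nonneg by (intro add_mono mult_mono) (auto simp: F_def)
    also have "real m \<le> real m * F ^ Suc j" using one_le_power[OF F1, of "Suc j"] mult_left_mono[of 1 "F ^ Suc j" "real m"] by simp
    finally show ?case by (simp add: algebra_simps)
  qed
  define l where "l = log (real m) (real n)"
  have l0: "l > 0" using m n by (simp add: l_def)
  have pw: "f (of_nat n) ^ k \<le> real m * (real k * l + 2) * (F powr l) ^ k" for k
  proof (cases "k = 0")
    case True
    have "real m * 2 \<ge> 1" using m by linarith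
    then show ?thesis using True by simp
  next
    case False
    \<comment> \<open>\<open>j + 1\<close> digits suffice for \<open>n ^ k\<close>, since
      \<open>real k * l\<close> is its logarithm to base \<open>m\<close>.\<close>
    define j where "j = nat \<lfloor>real k * l\<rfloor>"
    have jr: "real j \<le> real k * l" "real k * l < real j + 1" using l0 by (auto simp: j_def)
    have "real (n ^ k) = real m powr (real k * l)"
      using m n by (simp add: l_def powr_powr[symmetric] mult.commute[of "real k"] powr_realpow)
    also have "\<dots> < real m powr (real (Suc j))" using m jr by (intro powr_less_mono) auto
    also have "\<dots> = real (m ^ Suc j)" using m by (subst powr_realpow) auto
    finally have "n ^ k < m ^ Suc j" using of_nat_less_iff by blast
    from digits[OF this] have "f (of_nat n) ^ k \<le> real (m * Suc j) * F ^ j" by (simp add: f_power)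
    also have "F ^ j = F powr real j" using F1 by (simp add: powr_realpow)
    also have "real (m * Suc j) * F powr real j \<le> (real m * (real k * l + 2)) * F powr (real k * l)"
    proof (intro mult_mono powr_mono)
      have "real (Suc j) \<le> real k * l + 2" using jr by simp
      then have "real m * real (Suc j) \<le> real m * (real k * l + 2)" by (intro mult_left_mono) auto
      then show "real (m * Suc j) \<le> real m * (real k * l + 2)" by (simp only: of_nat_mult)
    qed (use jr F1 l0 in auto)
    also have "F powr (real k * l) = (F powr l) ^ k" using F1
      by (simp add: mult.commute[of "real k"] powr_powr[symmetric] powr_realpow)
    finally show ?thesis by simp
  qed
  show ?thesis
  proof (rule ccontr)
    assume "\<not> ?thesis"
    then have gt: "f (of_nat n) > F powr l" by (simp add: F_def l_def)
    have Fp: "F powr l > 0" using F1 by simp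
    define r where "r = f (of_nat n) / F powr l"
    have r: "r > 1" using gt Fp by (simp add: r_def)
    have "r ^ k \<le> real m * (real k * l + 2)" for k
      using pw[of k] Fp by (simp add: r_def power_divide field_simps)
    then have "r \<le> 1" by (intro le_one_of_power_bound[of r "real m * l" "real m * 2"]) (simp add: algebra_simps)
    then show False using r by simp
  qed
qed

context abs_val begin

text \<open>The estimate holds in both directions between any two numbers above 1, so the quotient
  of the logarithms of \<open>f n\<close> and \<open>n\<close> is the same for all of them.\<close>

lemma Ostrowski_arch:
  assumes "f (of_nat n0) > 1"
  shows "\<exists>c>0. \<forall>q. f (of_rat q) = \<bar>real_of_rat q\<bar> powr c"
proof -
  have av': "abs_val L f" by unfold_locales
  have n0: "n0 > 1" using assms by (cases "n0 = 0"; cases "n0 = 1") auto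
  have gt1: "f (of_nat m) > 1" if "m > 1" for m
  proof (rule ccontr)
    assume "\<not> ?thesis"
    then have "max 1 (f (of_nat m)) = 1" by simp
    then show False using Ostrowski_nat[OF av' that n0] assms by simp
  qed
  define c where "c = ln (f (of_nat 2)) / ln 2"
  have c: "c > 0" using gt1[of 2] by (simp add: c_def)
  have le: "ln (f (of_nat n)) / ln (real n) \<le> ln (f (of_nat m)) / ln (real m)" if mn: "m > 1" "n > 1" for m n
  proof -
    have "f (of_nat n) \<le> f (of_nat m) powr log m n" using Ostrowski_nat[OF av' mn] gt1[OF mn(1)] by simp
    then have "ln (f (of_nat n)) \<le> ln (f (of_nat m) powr log m n)"
      using gt1[OF mn(2)] gt1[OF mn(1)] by (subst ln_le_cancel_iff) auto
    also have "\<dots> = log m n * ln (f (of_nat m))" using gt1[OF mn(1)] by (simp add: ln_powr)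
    finally show ?thesis using mn by (simp add: log_def field_simps)
  qed
  have nat: "f (of_nat n) = real n powr c" if n: "n > 0" for n
  proof (cases "n = 1")
    case False
    then have n1: "n > 1" using n by simp
    have "ln (f (of_nat n)) / ln (real n) = c" using le[of 2 n] le[of n 2] n1 by (simp add: c_def)
    then have "ln (f (of_nat n)) = c * ln (real n)" using n1 by (simp add: field_simps)
    then have "f (of_nat n) = exp (c * ln (real n))" using gt1[OF n1] by (metis exp_ln less_trans zero_less_one)
    then show ?thesis using n by (simp add: powr_def)
  qed simp
  have int: "f (of_int a) = \<bar>real_of_int a\<bar> powr c" for a
  proof (cases "a = 0")
    case False
    have "f (of_int a) = f (of_nat (nat \<bar>a\<bar>))"
      using f_uminus[OF of_nat, of "nat \<bar>a\<bar>"] by (cases "a \<ge> 0") (auto simp: f_uminus)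
    then show ?thesis using nat[of "nat \<bar>a\<bar>"] False by simp
  qed simp
  have "f (of_rat q) = \<bar>real_of_rat q\<bar> powr c" for q
  proof (cases q)
    case (Fract a b)
    then have "of_rat q = of_int a / (of_int b :: 'a)" "real_of_rat q = of_int a / of_int b" by (auto simp: of_rat_rat)
    then show ?thesis by (simp add: f_divide int powr_divide)
  qed
  with c show ?thesis by blast
qed

lemma f_unit: "x \<in> L \<Longrightarrow> x \<noteq> 0 \<Longrightarrow> f x \<le> 1 \<Longrightarrow> f (inverse x) \<le> 1 \<Longrightarrow> f x = 1"
  using f_pos[of x] f_inverse[of x] by (auto simp: inverse_le_1_iff)

lemma valuation_ring_abs:
  assumes u: "\<And>x y. x \<in> L \<Longrightarrow> y \<in> L \<Longrightarrow> f (x + y) \<le> max (f x) (f y)"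
  shows "valuation_ring L {x \<in> L. f x \<le> 1}"
proof -
  have "f (x - y) \<le> 1" if "x \<in> L" "y \<in> L" "f x \<le> 1" "f y \<le> 1" for x y
    using u[of x "- y"] f_uminus[of y] uminus[of y] that by simp
  moreover have "f (x * y) \<le> 1" if "x \<in> L" "y \<in> L" "f x \<le> 1" "f y \<le> 1" for x y
    using that nonneg by (simp add: f_mult mult_le_one)
  moreover have "f (inverse x) \<le> 1" if "x \<in> L" "\<not> f x \<le> 1" for x
    using that f_inverse[of x] by (simp add: inverse_le_1_iff)
  ultimately show ?thesis by (auto simp: valuation_ring_def is_subring_def)
qed

text \<open>The valuation ring of \<open>f\<close> has its own absolute value \<open>V.vabs\<close>.
  Both are 1 on units, and some power of each nonzero element is a power of \<open>p\<close> up to a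
  unit, so \<open>f\<close> is a power of \<open>V.vabs\<close>.\<close>

lemma Ostrowski_nonarch:
  assumes alg: "\<And>x. x \<in> L \<Longrightarrow> algebraic x"
    and u: "\<And>x y. x \<in> L \<Longrightarrow> y \<in> L \<Longrightarrow> f (x + y) \<le> max (f x) (f y)"
    and nt: "\<exists>x\<in>L. x \<noteq> 0 \<and> f x \<noteq> 1"
  shows "\<exists>p c. prime p \<and> c > 0 \<and> (\<forall>q. f (of_rat q) = padic_abs p q powr c)"
proof -
  define A where "A = {x \<in> L. f x \<le> 1}"
  have A: "valuation_ring L A" unfolding A_def by (rule valuation_ring_abs[OF u])
  obtain x where x: "x \<in> L" "x \<noteq> 0" "f x \<noteq> 1" using nt by blast
  then have "x \<notin> A \<or> inverse x \<notin> A" using f_unit[of x] by (auto simp: A_def)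
  then obtain p where p: "prime p" "inverse (of_nat p) \<notin> A"
    using valuation_ring_prime[OF alg A] x(1) inv by blast
  interpret V: val_ring L A p using A p alg by unfold_locales
  have p1: "real p > 1" using p(1) prime_gt_1_nat by simp
  have fp0: "f (of_nat p) > 0" using p(1) by (intro f_pos) (auto simp: prime_gt_0_nat)
  have "inverse (f (of_nat p)) > 1" using p(2) f_inverse[OF of_nat, of p] inv[OF of_nat, of p] by (simp add: A_def)
  then have fp: "f (of_nat p) < 1" using fp0 by (simp add: field_simps)
  \<comment> \<open>The exponent is read off at \<open>p\<close>, where \<open>f\<close> has to be
    \<open>p powr (- c)\<close>.\<close>
  define c where "c = - ln (f (of_nat p)) / ln (real p)"
  have c: "c > 0" using fp fp0 p1 by (simp add: c_def field_simps)
  have "f y = V.vabs y powr c" if y: "y \<in> L" for y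
  proof (cases "y = 0")
    case False
    have fy: "f y > 0" using f_pos[OF y False] .
    obtain r where r: "V.vrel y r" using V.vrel_exists[OF y False] by blast
    then obtain n k where nk: "n > 0" "V.ut (y ^ n * of_nat p powi k)" "r = of_int k / real n" by (auto simp: V.vrel_def)
    have pk: "f (of_nat p powi k) = f (of_nat p) powr of_int k"
    proof -
      have "f (of_nat p powi k) = f (of_nat p) powi k"
        by (cases k rule: int_cases2) (auto simp: f_power power_int_minus f_inverse power)
      then show ?thesis using fp0 by (simp add: powr_real_of_int')
    qed
    have "f (y ^ n * of_nat p powi k) = 1"
      using nk(2) unfolding V.ut_def by (intro f_unit) (simp_all only: A_def mem_Collect_eq simp_thms)
    then have "f y powr real n * f (of_nat p) powr of_int k = 1"
      using y fy by (simp add: f_mult f_power power powi pk powr_realpow)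
    then have "ln (f y powr real n * f (of_nat p) powr of_int k) = 0" by simp
    then have "real n * ln (f y) + of_int k * ln (f (of_nat p)) = 0"
      using fy fp0 by (simp add: ln_mult ln_powr)
    moreover have "of_int k = r * real n" using nk(1,3) by simp
    ultimately have "real n * (ln (f y) + r * ln (f (of_nat p))) = 0" by (simp add: algebra_simps)
    then have "ln (f y) + r * ln (f (of_nat p)) = 0" using nk(1) by simp
    then have "ln (f y) = - (r * ln (f (of_nat p)))" by linarith
    then have "ln (f y) = c * r * ln (real p)" using p1 by (simp add: c_def)
    then have "f y = real p powr (c * r)" using exp_ln[OF fy] p1 by (simp add: powr_def)
    then show ?thesis using V.vabs_eq[OF y r] by (simp add: powr_powr mult.commute)
  qed simp
  then have "f (of_rat q) = padic_abs p q powr c" for q using V.vabs_rat of_rat_in by metis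
  with p(1) c show ?thesis by blast
qed

end

section \<open>Archimedean absolute values come from complex embeddings\<close>

text \<open>A number \<open>x\<close> is sent to the complex number whose approximations by Gaussian rationals are
  approximations of \<open>x\<close> for \<open>f\<close>.\<close>

locale arch_abs = abs_val L f for L :: "'a::field_char_0 set" and f +
  fixes I :: 'a and c :: real
  assumes I: "I \<in> L" "I * I = - 1" and c: "c > 0" and fQ: "\<And>q. f (of_rat q) = \<bar>real_of_rat q\<bar> powr c"
    and alg: "\<And>x. x \<in> L \<Longrightarrow> algebraic x"
begin

definition gr :: "complex set" where "gr = {Complex (of_rat a) (of_rat b) |a b. True}"

definition emb :: "complex \<Rightarrow> 'a" where
  "emb z = of_rat (THE a. of_rat a = Re z) + of_rat (THE b. of_rat b = Im z) * I"

lemma iota: "emb (Complex (of_rat a) (of_rat b)) = of_rat a + of_rat b * I"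
proof -
  have "(THE a'. real_of_rat a' = of_rat a) = a" for a by (rule the_equality) auto
  then show ?thesis by (simp add: emb_def)
qed

lemma gr_subfield: "is_subfield gr"
proof -
  have [simp]: "Complex (of_rat a) (of_rat b) \<in> gr" for a b by (auto simp: gr_def)
  have m: "x * y \<in> gr" if gxy: "x \<in> gr" "y \<in> gr" for x y
  proof -
    obtain a b a' b' where xy: "x = Complex (of_rat a) (of_rat b)" "y = Complex (of_rat a') (of_rat b')" using gxy by (auto simp: gr_def)
    have "x * y = Complex (of_rat (a * a' - b * b')) (of_rat (a * b' + b * a'))"
      unfolding xy by (simp add: complex_eq_iff of_rat_diff of_rat_add of_rat_mult)
    then show ?thesis by simp
  qed
  have "x - y \<in> gr" if gxy: "x \<in> gr" "y \<in> gr" for x y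
  proof -
    obtain a b a' b' where xy: "x = Complex (of_rat a) (of_rat b)" "y = Complex (of_rat a') (of_rat b')" using gxy by (auto simp: gr_def)
    have "x - y = Complex (of_rat (a - a')) (of_rat (b - b'))" unfolding xy by (simp add: complex_eq_iff of_rat_diff)
    then show ?thesis by simp
  qed
  moreover have "inverse x \<in> gr" if gx: "x \<in> gr" for x
  proof -
    obtain a b where x: "x = Complex (of_rat a) (of_rat b)" using gx by (auto simp: gr_def)
    have "inverse x = Complex (of_rat (a / (a^2 + b^2))) (of_rat (- b / (a^2 + b^2)))"
      unfolding x by (simp add: complex_inverse of_rat_divide of_rat_add of_rat_power of_rat_minus)
    then show ?thesis by simp
  qed
  moreover have "Complex (of_rat 0) (of_rat 0) \<in> gr" "Complex (of_rat 1) (of_rat 0) \<in> gr"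
    unfolding gr_def by blast+
  then have "0 \<in> gr" "1 \<in> gr" by (simp_all add: zero_complex.code one_complex.code)
  ultimately show ?thesis using m by (simp add: is_subfield_def)
qed

sublocale G: subfield_of gr using gr_subfield by unfold_locales

lemma iota_in: "z \<in> gr \<Longrightarrow> emb z \<in> L"
  using I by (auto simp: gr_def iota intro!: add mult)

lemma iota_hom: "hom_on gr emb"
proof -
  have "emb 1 = 1" using iota[of 1 0] by (simp add: one_complex.code[symmetric] Complex_eq_1)
  moreover have "emb (x + y) = emb x + emb y \<and> emb (x * y) = emb x * emb y" if xy': "x \<in> gr" "y \<in> gr" for x y
  proof -
    obtain a b a' b' where xy: "x = Complex (of_rat a) (of_rat b)" "y = Complex (of_rat a') (of_rat b')" using xy' by (auto simp: gr_def)
    have "x + y = Complex (of_rat (a + a')) (of_rat (b + b'))" unfolding xy by (simp add: complex_eq_iff of_rat_add)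
    then have s: "emb (x + y) = of_rat (a + a') + of_rat (b + b') * I" by (simp only: iota)
    have "x * y = Complex (of_rat (a * a' - b * b')) (of_rat (a * b' + b * a'))"
      unfolding xy by (simp add: complex_eq_iff of_rat_diff of_rat_add of_rat_mult)
    then have p: "emb (x * y) = of_rat (a * a' - b * b') + of_rat (a * b' + b * a') * I" by (simp only: iota)
    have ring: "(u + v * I) * (u' + v' * I) = (u * u' - v * v') + (u * v' + v * u') * I" for u v u' v'
    proof -
      have "(u + v * I) * (u' + v' * I) = u * u' + v * v' * (I * I) + (u * v' + v * u') * I" by (simp add: algebra_simps)
      then show ?thesis by (simp add: I(2))
    qed
    have "emb x * emb y = emb (x * y)" unfolding p unfolding xy iota ring by (simp add: of_rat_add of_rat_diff of_rat_mult)
    moreover have "emb x + emb y = emb (x + y)" unfolding s unfolding xy iota by (simp add: of_rat_add algebra_simps)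
    ultimately show ?thesis by simp
  qed
  ultimately show ?thesis unfolding hom_on_def by blast
qed

sublocale IO: field_hom gr emb using iota_hom by unfold_locales

text \<open>The triangle inequality gives an upper bound with a factor 2; applying it to powers
  removes the factor, and applying the result to the inverse gives equality.\<close>

lemma f_iota: "z \<in> gr \<Longrightarrow> f (emb z) = cmod z powr c"
proof -
  have le2: "f (emb z) \<le> 2 * cmod z powr c" if z': "z \<in> gr" for z
  proof -
    obtain a b where z: "z = Complex (of_rat a) (of_rat b)" using z' by (auto simp: gr_def)
    have fI: "f I = 1"
    proof -
      have "I ^ 4 = (I * I) * (I * I)" by (simp add: power4_eq_xxxx mult.assoc)
      then show ?thesis using f_root_unity[of I 4] I by simp
    qed
    have "f (emb z) \<le> f (of_rat a) + f (of_rat b) * f I"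
      unfolding z iota using f_triangle[of "of_rat a" "of_rat b * I"] I by (simp add: f_mult mult)
    also have "\<dots> = \<bar>Re z\<bar> powr c + \<bar>Im z\<bar> powr c" by (simp add: fQ fI z)
    also have "\<dots> \<le> cmod z powr c + cmod z powr c"
      using c abs_Re_le_cmod abs_Im_le_cmod by (intro add_mono powr_mono2) auto
    finally show ?thesis by simp
  qed
  have le: "f (emb z) \<le> cmod z powr c" if z: "z \<in> gr" "z \<noteq> 0" for z
  proof (rule ccontr)
    assume "\<not> ?thesis"
    then have gt: "f (emb z) > cmod z powr c" by simp
    have zp: "cmod z powr c > 0" using z by simp
    define r where "r = f (emb z) / cmod z powr c"
    have r: "r > 1" using gt zp by (simp add: r_def)
    have "r ^ n \<le> 2" for n
    proof -
      have "f (emb z) ^ n = f (emb (z ^ n))" using z by (simp add: IO.h_power f_power iota_in)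
      also have "\<dots> \<le> 2 * cmod (z ^ n) powr c" using z by (intro le2 G.power)
      also have "cmod (z ^ n) powr c = (cmod z powr c) ^ n"
      proof -
        have "cmod (z ^ n) powr c = (cmod z powr real n) powr c" using z by (simp add: norm_power powr_realpow)
        also have "\<dots> = (cmod z powr c) powr real n" by (simp add: powr_powr mult.commute)
        also have "\<dots> = (cmod z powr c) ^ n" using zp by (simp add: powr_realpow)
        finally show ?thesis .
      qed
      finally show ?thesis using zp by (simp add: r_def power_divide field_simps)
    qed
    then have "r \<le> 1" by (intro le_one_of_power_bound[of r 0 2]) simp
    then show False using r by simp
  qed
  assume z: "z \<in> gr"
  show "f (emb z) = cmod z powr c"
  proof (cases "z = 0")
    case False
    have "f (emb (inverse z)) \<le> cmod (inverse z) powr c" using z False by (intro le G.inv) auto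
    then have "inverse (f (emb z)) \<le> inverse (cmod z powr c)"
      using z by (simp add: IO.h_inverse f_inverse iota_in norm_inverse powr_minus inverse_powr)
    moreover have "f (emb z) > 0" using z False by (intro f_pos iota_in) (auto simp: IO.h_eq0_iff)
    ultimately have "cmod z powr c \<le> f (emb z)" using inverse_le_imp_le by blast
    then show ?thesis using le[OF z False] by simp
  qed simp
qed

definition apx :: "'a \<Rightarrow> complex \<Rightarrow> bool" where
  "apx x a \<longleftrightarrow> x \<in> L \<and> (\<exists>u. (\<forall>n. u n \<in> gr) \<and> u \<longlonglongrightarrow> a \<and> (\<lambda>n. f (x - emb (u n))) \<longlonglongrightarrow> 0)"

lemma gr_dense: "\<exists>u. (\<forall>n. u n \<in> gr) \<and> u \<longlonglongrightarrow> a"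
proof -
  have "\<exists>q::rat. \<bar>of_rat q - x\<bar> < e" if e: "e > 0" for x e :: real
  proof -
    obtain q :: rat where "x - e < of_rat q" "of_rat q < x + e" using of_rat_dense[of "x - e" "x + e"] e by auto
    then have "\<bar>of_rat q - x\<bar> < e" by (simp add: abs_less_iff)
    then show ?thesis ..
  qed
  then have "\<exists>q::rat. \<bar>of_rat q - x\<bar> < 1 / real (Suc n)" for x n by simp
  then obtain q :: "real \<Rightarrow> nat \<Rightarrow> rat" where q: "\<And>x n. \<bar>of_rat (q x n) - x\<bar> < 1 / real (Suc n)" by metis
  have lim: "(\<lambda>n. real_of_rat (q x n)) \<longlonglongrightarrow> x" for x
  proof (rule LIMSEQ_I)
    fix e :: real assume "e > 0"
    then obtain N where N: "1 / real (Suc N) < e" using nat_approx_posE by blast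
    have "norm (real_of_rat (q x n) - x) < e" if "n \<ge> N" for n
    proof -
      have "1 / real (Suc n) \<le> 1 / real (Suc N)" using that by (intro divide_left_mono) auto
      then show ?thesis using q[of x n] N by simp
    qed
    then show "\<exists>N. \<forall>n\<ge>N. norm (real_of_rat (q x n) - x) < e" by blast
  qed
  show ?thesis
    by (rule exI[of _ "\<lambda>n. Complex (of_rat (q (Re a) n)) (of_rat (q (Im a) n))"])
       (auto simp: gr_def tendsto_complex_iff lim)
qed

lemma f_diff_le: "x \<in> L \<Longrightarrow> y \<in> L \<Longrightarrow> f (x - y) \<le> f x + f y"
  using f_triangle[of x "- y"] f_uminus[of y] by (auto simp: uminus)

lemma f_iota_tendsto:
  assumes "\<And>n. u n \<in> gr" "u \<longlonglongrightarrow> 0"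
  shows "(\<lambda>n. f (emb (u n))) \<longlonglongrightarrow> 0"
proof -
  have "(\<lambda>n. cmod (u n)) \<longlonglongrightarrow> 0" using assms(2) tendsto_norm_zero by blast
  then have "(\<lambda>n. cmod (u n) powr c) \<longlonglongrightarrow> 0 powr c" using c by (intro tendsto_powr2 tendsto_const) auto
  then show ?thesis using assms(1) c by (simp add: f_iota)
qed

text \<open>\<open>apx\<close> asks for one approximating sequence, but as \<open>emb\<close> keeps
  small numbers small, every sequence with limit \<open>a\<close> will do. Uniqueness and the ring
  operations rest on this freedom.\<close>

lemma apx_all:
  assumes a: "apx x a" and u: "\<And>n. u n \<in> gr" "u \<longlonglongrightarrow> a"
  shows "(\<lambda>n. f (x - emb (u n))) \<longlonglongrightarrow> 0"
proof -
  obtain v where v: "\<And>n. v n \<in> gr" "v \<longlonglongrightarrow> a" "(\<lambda>n. f (x - emb (v n))) \<longlonglongrightarrow> 0" and x: "x \<in> L" using a by (auto simp: apx_def)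
  have "(\<lambda>n. v n - u n) \<longlonglongrightarrow> a - a" using u v by (intro tendsto_diff)
  then have "(\<lambda>n. f (emb (v n - u n))) \<longlonglongrightarrow> 0" using u v by (intro f_iota_tendsto) auto
  then have "(\<lambda>n. f (x - emb (v n)) + f (emb (v n - u n))) \<longlonglongrightarrow> 0 + 0" by (intro tendsto_add v)
  then have t: "(\<lambda>n. f (x - emb (v n)) + f (emb (v n - u n))) \<longlonglongrightarrow> 0" by simp
  have "f (x - emb (u n)) \<le> f (x - emb (v n)) + f (emb (v n - u n))" for n
    using f_triangle[of "x - emb (v n)" "emb (v n - u n)"] x u v by (simp add: IO.h_diff iota_in diff)
  moreover have "0 \<le> f (x - emb (u n))" for n using x u by (intro nonneg diff iota_in)
  ultimately show ?thesis by (intro tendsto_sandwich[OF _ _ tendsto_const t]) auto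
qed

lemma apx_unique: "apx x a \<Longrightarrow> apx x b \<Longrightarrow> a = b"
proof -
  assume ab: "apx x a" "apx x b"
  obtain u v where u: "\<And>n. u n \<in> gr" "u \<longlonglongrightarrow> a" and v: "\<And>n. v n \<in> gr" "v \<longlonglongrightarrow> b" using gr_dense by metis
  have x: "x \<in> L" using ab by (simp add: apx_def)
  have "(\<lambda>n. f (x - emb (u n)) + f (x - emb (v n))) \<longlonglongrightarrow> 0 + 0"
    by (intro tendsto_add apx_all[OF ab(1) u] apx_all[OF ab(2) v])
  then have t: "(\<lambda>n. f (x - emb (u n)) + f (x - emb (v n))) \<longlonglongrightarrow> 0" by simp
  have "cmod (v n - u n) powr c \<le> f (x - emb (u n)) + f (x - emb (v n))" for n
    using f_diff_le[of "x - emb (u n)" "x - emb (v n)"] x u v f_iota[of "v n - u n"] by (simp add: IO.h_diff iota_in diff G.diff)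
  then have "(\<lambda>n. cmod (v n - u n) powr c) \<longlonglongrightarrow> 0" by (intro tendsto_sandwich[OF _ _ tendsto_const t]) auto
  moreover have "(\<lambda>n. cmod (v n - u n) powr c) \<longlonglongrightarrow> cmod (b - a) powr c"
    using c u v by (intro tendsto_powr2 tendsto_norm tendsto_diff tendsto_const) auto
  ultimately have "cmod (b - a) powr c = 0" using LIMSEQ_unique by blast
  then show ?thesis by simp
qed

lemma apxI:
  assumes "x \<in> L" "\<And>n. u n \<in> gr" "u \<longlonglongrightarrow> a" and le: "\<And>n. f (x - emb (u n)) \<le> h n" and h: "h \<longlonglongrightarrow> 0"
  shows "apx x a"
proof -
  have "0 \<le> f (x - emb (u n))" for n using assms by (intro nonneg diff iota_in)
  then have "(\<lambda>n. f (x - emb (u n))) \<longlonglongrightarrow> 0" using le by (intro tendsto_sandwich[OF _ _ tendsto_const h]) auto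
  then show ?thesis unfolding apx_def using assms by blast
qed

lemma apx_add: "apx x a \<Longrightarrow> apx y b \<Longrightarrow> apx (x + y) (a + b)"
  and apx_mult: "apx x a \<Longrightarrow> apx y b \<Longrightarrow> apx (x * y) (a * b)"
proof -
  assume ab: "apx x a" "apx y b"
  obtain u v where u: "\<And>n. u n \<in> gr" "u \<longlonglongrightarrow> a" and v: "\<And>n. v n \<in> gr" "v \<longlonglongrightarrow> b" using gr_dense by metis
  have xy: "x \<in> L" "y \<in> L" using ab by (auto simp: apx_def)
  note lu = apx_all[OF ab(1) u] and lv = apx_all[OF ab(2) v]
  show "apx (x + y) (a + b)"
  proof (rule apxI)
    show "(\<lambda>n. u n + v n) \<longlonglongrightarrow> a + b" by (intro tendsto_add u v)
    show "(\<lambda>n. f (x - emb (u n)) + f (y - emb (v n))) \<longlonglongrightarrow> 0" using tendsto_add[OF lu lv] by simp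
    fix n
    have "x + y - emb (u n + v n) = (x - emb (u n)) + (y - emb (v n))" using u v by (simp add: IO.h_add)
    then show "f (x + y - emb (u n + v n)) \<le> f (x - emb (u n)) + f (y - emb (v n))"
      using f_triangle[OF diff[OF xy(1) iota_in[OF u(1)]] diff[OF xy(2) iota_in[OF v(1)]], of n n] by metis
  qed (use xy u v in auto)
  have cu: "(\<lambda>n. f (emb (u n))) \<longlonglongrightarrow> cmod a powr c"
    using c u by (simp add: f_iota) (intro tendsto_powr2 tendsto_norm tendsto_const, auto)
  show "apx (x * y) (a * b)"
  proof (rule apxI)
    show "(\<lambda>n. u n * v n) \<longlonglongrightarrow> a * b" by (intro tendsto_mult u v)
    have "(\<lambda>n. f (x - emb (u n)) * f y + f (emb (u n)) * f (y - emb (v n))) \<longlonglongrightarrow> 0 * f y + cmod a powr c * 0"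
      by (intro tendsto_add tendsto_mult lu lv cu tendsto_const)
    then show "(\<lambda>n. f (x - emb (u n)) * f y + f (emb (u n)) * f (y - emb (v n))) \<longlonglongrightarrow> 0" by simp
    fix n
    have "x * y - emb (u n * v n) = (x - emb (u n)) * y + emb (u n) * (y - emb (v n))" using u v by (simp add: IO.h_mult algebra_simps)
    then show "f (x * y - emb (u n * v n)) \<le> f (x - emb (u n)) * f y + f (emb (u n)) * f (y - emb (v n))"
      using f_triangle[of "(x - emb (u n)) * y" "emb (u n) * (y - emb (v n))"] xy u v by (simp add: iota_in diff f_mult mult)
  qed (use xy u v in auto)
qed

lemma apx_one: "apx 1 1"
  unfolding apx_def by (intro conjI exI[of _ "\<lambda>_. 1"]) auto

lemma apx_norm: "apx x a \<Longrightarrow> f x = cmod a powr c"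
proof -
  assume a: "apx x a"
  obtain u where u: "\<And>n. u n \<in> gr" "u \<longlonglongrightarrow> a" using gr_dense by metis
  have x: "x \<in> L" using a by (simp add: apx_def)
  have "\<bar>f x - f (emb (u n))\<bar> \<le> f (x - emb (u n))" for n
    using f_triangle[of "x - emb (u n)" "emb (u n)"] f_diff_le[of x "x - emb (u n)"] x u by (simp add: iota_in diff abs_le_iff)
  then have "(\<lambda>n. f x - f (emb (u n))) \<longlonglongrightarrow> 0"
    using apx_all[OF a u] by (intro tendsto_rabs_zero_cancel[OF tendsto_sandwich[OF _ _ tendsto_const apx_all[OF a u]]]) auto
  then have "(\<lambda>n. f x - (f x - f (emb (u n)))) \<longlonglongrightarrow> f x - 0" by (intro tendsto_diff tendsto_const)
  then have "(\<lambda>n. cmod (u n) powr c) \<longlonglongrightarrow> f x" using u by (simp add: f_iota)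
  moreover have "(\<lambda>n. cmod (u n) powr c) \<longlonglongrightarrow> cmod a powr c"
    using c u by (intro tendsto_powr2 tendsto_norm tendsto_const) auto
  ultimately show ?thesis using LIMSEQ_unique by blast
qed

text \<open>If \<open>x\<close> stayed away from approximations of all complex roots of its polynomial, the product of
  the differences would stay away from 0.\<close>
lemma apx_exists:
  assumes x: "x \<in> L"
  shows "\<exists>a. apx x a"
proof -
  obtain P where P: "P \<noteq> 0" "poly (map_poly of_int P) x = 0" using alg[OF x] by (rule algebraicE')
  define PC where "PC = (map_poly of_int P :: complex poly)"
  have PC0: "PC \<noteq> 0" using P(1) by (auto simp: PC_def poly_eq_iff coeff_map_poly)
  obtain A where A: "PC = smult (lead_coeff PC) (\<Prod>a\<in>#A. [:-a, 1:])"
    using alg_closed_imp_factorization[OF PC0] by blast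
  define u where "u = (\<lambda>a. SOME u. (\<forall>n. u n \<in> gr) \<and> u \<longlonglongrightarrow> a)"
  have u: "\<And>n. u a n \<in> gr" "u a \<longlonglongrightarrow> a" for a
    using someI_ex[OF gr_dense[of a]] by (auto simp: u_def)
  define q where "q = (\<lambda>n. \<Prod>a\<in>#A. [:- u a n, 1:])"
  have qgr: "(\<Prod>a\<in>#B. [:- u a n, 1:]) \<in> pol gr" for n B
  proof (induction B)
    case (add a B)
    have "[:- u a n, 1:] \<in> pol gr" using u G.uminus by (auto simp: pol_def coeff_pCons split: nat.split)
    then show ?case using add by (simp add: G.pol_mult del: mult_pCons_left)
  qed (simp add: G.pol_1)
  have lim: "(\<lambda>n. coeff (\<Prod>a\<in>#B. [:- u a n, 1:]) i) \<longlonglongrightarrow> coeff (\<Prod>a\<in>#B. [:- a, 1:]) i" for B i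
  proof (induction B arbitrary: i)
    case (add a B)
    have "(\<lambda>n. coeff [:- u a n, 1:] j) \<longlonglongrightarrow> coeff [:- a, 1:] j" for j
      using u by (auto simp: coeff_pCons split: nat.split intro!: tendsto_minus)
    then have "(\<lambda>n. \<Sum>j\<le>i. coeff [:- u a n, 1:] j * coeff (\<Prod>a\<in>#B. [:- u a n, 1:]) (i - j))
       \<longlonglongrightarrow> (\<Sum>j\<le>i. coeff [:- a, 1:] j * coeff (\<Prod>a\<in>#B. [:- a, 1:]) (i - j))"
      by (intro tendsto_sum tendsto_mult add)
    then show ?case by (simp add: coeff_mult del: mult_pCons_left)
  qed simp
  have deg: "degree (\<Prod>a\<in>#B. [:- h a, 1:]) \<le> size B" for B and h :: "complex \<Rightarrow> complex"
  proof (induction B)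
    case (add a B)
    have "degree ([:- h a, 1:] * (\<Prod>a\<in>#B. [:- h a, 1:])) \<le> 1 + size B"
      by (rule order_trans[OF degree_mult_le]) (use add in auto)
    then show ?case by (simp del: mult_pCons_left)
  qed simp
  define l where "l = lead_coeff P"
  have lc: "lead_coeff PC = of_int l"
    unfolding l_def PC_def by (subst degree_map_poly) (auto simp: coeff_map_poly)
  have l0: "l \<noteq> 0" using P by (simp add: l_def)
  \<comment> \<open>\<open>q n\<close> is a perturbation of the polynomial \<open>P\<close> divided
    by its leading coefficient \<open>l\<close>. As \<open>P\<close> vanishes at \<open>x\<close>,
    only differences of coefficients contribute.\<close>
  have ev: "of_int l * poly (map_poly emb (q n)) x = (\<Sum>i\<le>size A. emb (of_int l * coeff (q n) i - of_int (coeff P i)) * x ^ i)" for n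
  proof -
    have dP: "degree P \<le> size A"
    proof -
      have "degree PC = degree P" unfolding PC_def by (rule degree_map_poly) auto
      moreover have "degree PC \<le> size A" using A deg[of "\<lambda>a. a" A] by (metis degree_smult_le order_trans)
      ultimately show ?thesis by simp
    qed
    have dq: "degree (map_poly emb (q n)) \<le> size A"
      using deg[of "\<lambda>a. u a n" A] IO.map_degree[OF qgr, of n A] by (simp add: q_def)
    have qi: "coeff (q n) i \<in> gr" for i using qgr by (simp add: q_def pol_def)
    have "poly (map_poly emb (q n)) x = (\<Sum>i\<le>size A. coeff (map_poly emb (q n)) i * x ^ i)"
      unfolding poly_altdef by (rule sum.mono_neutral_left) (use dq in \<open>auto simp: coeff_eq_0\<close>)
    also have "\<dots> = (\<Sum>i\<le>size A. emb (coeff (q n) i) * x ^ i)" by (simp add: coeff_map_poly)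
    finally have 1: "poly (map_poly emb (q n)) x = (\<Sum>i\<le>size A. emb (coeff (q n) i) * x ^ i)" .
    have "0 = poly (map_poly of_int P) x" using P by simp
    also have "\<dots> = (\<Sum>i\<le>degree P. of_int (coeff P i) * x ^ i)"
    proof -
      have dm: "degree (map_poly of_int P :: 'a poly) = degree P" by (rule degree_map_poly) auto
      show ?thesis unfolding poly_altdef dm by (simp add: coeff_map_poly)
    qed
    also have "\<dots> = (\<Sum>i\<le>size A. of_int (coeff P i) * x ^ i)"
      by (rule sum.mono_neutral_left) (use dP in \<open>auto simp: coeff_eq_0\<close>)
    finally have 2: "(\<Sum>i\<le>size A. of_int (coeff P i) * x ^ i) = 0" ..
    have "emb (of_int l * coeff (q n) i - of_int (coeff P i)) * x ^ i = of_int l * (emb (coeff (q n) i) * x ^ i) - of_int (coeff P i) * x ^ i" for i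
      using qi by (simp add: IO.h_diff IO.h_mult G.mult algebra_simps)
    then have "(\<Sum>i\<le>size A. emb (of_int l * coeff (q n) i - of_int (coeff P i)) * x ^ i) =
       of_int l * (\<Sum>i\<le>size A. emb (coeff (q n) i) * x ^ i) - (\<Sum>i\<le>size A. of_int (coeff P i) * x ^ i)"
      by (simp add: sum_subtractf sum_distrib_left)
    then show ?thesis using 1 2 by simp
  qed
  have qi: "coeff (q n) i \<in> gr" for n i using qgr by (simp add: q_def pol_def)
  have "(\<lambda>n. \<Sum>i\<le>size A. f (emb (of_int l * coeff (q n) i - of_int (coeff P i))) * f x ^ i) \<longlonglongrightarrow> (\<Sum>i\<le>size A. 0 * f x ^ i)"
  proof (intro tendsto_sum tendsto_mult tendsto_const f_iota_tendsto)
    fix i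
    show "of_int l * coeff (q n) i - of_int (coeff P i) \<in> gr" for n using qi by auto
    have "(\<lambda>n. of_int l * coeff (q n) i - of_int (coeff P i)) \<longlonglongrightarrow> of_int l * coeff (\<Prod>a\<in>#A. [:-a, 1:]) i - of_int (coeff P i)"
      unfolding q_def by (intro tendsto_intros lim)
    moreover have "of_int l * coeff (\<Prod>a\<in>#A. [:-a, 1:]) i = coeff PC i" by (metis A coeff_smult lc)
    ultimately show "(\<lambda>n. of_int l * coeff (q n) i - of_int (coeff P i)) \<longlonglongrightarrow> 0" by (simp add: PC_def coeff_map_poly)
  qed
  then have t: "(\<lambda>n. \<Sum>i\<le>size A. f (emb (of_int l * coeff (q n) i - of_int (coeff P i))) * f x ^ i) \<longlonglongrightarrow> 0" by simp
  have prodx: "poly (map_poly emb (\<Prod>a\<in>#B. [:- u a n, 1:])) x = (\<Prod>a\<in>#B. x - emb (u a n))" for n B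
  proof (induction B)
    case empty then show ?case by (simp add: map_poly_1')
  next
    case (add a B)
    have "[:- u a n, 1:] \<in> pol gr" using u G.uminus by (auto simp: pol_def coeff_pCons split: nat.split)
    then have "map_poly emb ([:- u a n, 1:] * (\<Prod>a\<in>#B. [:- u a n, 1:])) = map_poly emb [:- u a n, 1:] * map_poly emb (\<Prod>a\<in>#B. [:- u a n, 1:])"
      by (intro IO.map_mult qgr)
    then show ?case using add u by (simp add: map_poly_pCons IO.h_uminus del: mult_pCons_left)
  qed
  have fl: "f (of_int l) > 0" using l0 by (intro f_pos) auto
  have "f (of_int l) * (\<Prod>a\<in>#A. f (x - emb (u a n))) \<le> (\<Sum>i\<le>size A. f (emb (of_int l * coeff (q n) i - of_int (coeff P i))) * f x ^ i)" for n
  proof -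
    have pin: "(\<Prod>a\<in>#B. x - emb (u a n)) \<in> L \<and> f (\<Prod>a\<in>#B. x - emb (u a n)) = (\<Prod>a\<in>#B. f (x - emb (u a n)))" for B
      by (induction B) (use x u iota_in in \<open>auto simp: f_mult diff mult\<close>)
    have "f (of_int l) * (\<Prod>a\<in>#A. f (x - emb (u a n))) = f (of_int l * poly (map_poly emb (q n)) x)"
      unfolding q_def prodx using pin[of A] by (simp add: f_mult)
    also have "\<dots> \<le> (\<Sum>i\<le>size A. f (emb (of_int l * coeff (q n) i - of_int (coeff P i)) * x ^ i))"
      unfolding ev by (intro f_sum mult iota_in G.diff G.mult G.of_int power qi x)
    also have "\<dots> = (\<Sum>i\<le>size A. f (emb (of_int l * coeff (q n) i - of_int (coeff P i))) * f x ^ i)"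
      using qi x iota_in by (intro sum.cong refl) (simp add: f_mult f_power power G.diff G.mult)
    finally show ?thesis .
  qed
  moreover have "(\<Prod>a\<in>#B. f (x - emb (u a n))) \<ge> 0" for n B
    by (induction B) (use x u iota_in in \<open>auto simp: nonneg diff\<close>)
  ultimately have t2: "(\<lambda>n. f (of_int l) * (\<Prod>a\<in>#A. f (x - emb (u a n)))) \<longlonglongrightarrow> 0"
    using fl by (intro tendsto_sandwich[OF _ _ tendsto_const t]) auto
  have "\<exists>a\<in>#A. \<forall>e>0. \<exists>\<^sub>F n in sequentially. f (x - emb (u a n)) < e"
  proof (rule ccontr)
    assume "\<not> ?thesis"
    then have "\<forall>a\<in>#A. \<exists>e>0. \<forall>\<^sub>F n in sequentially. f (x - emb (u a n)) \<ge> e"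
      by (simp add: not_frequently not_less)
    then have "\<exists>e>0. \<forall>\<^sub>F n in sequentially. (\<Prod>a\<in>#A. f (x - emb (u a n))) \<ge> e"
    proof (induction A)
      case empty then show ?case by (intro exI[of _ 1]) auto
    next
      case (add a B)
      then obtain e e' where e: "e > 0" "\<forall>\<^sub>F n in sequentially. f (x - emb (u a n)) \<ge> e"
        "e' > 0" "\<forall>\<^sub>F n in sequentially. (\<Prod>a\<in>#B. f (x - emb (u a n))) \<ge> e'" by auto
      have "\<forall>\<^sub>F n in sequentially. f (x - emb (u a n)) * (\<Prod>a\<in>#B. f (x - emb (u a n))) \<ge> e * e'"
        using e(2,4) by eventually_elim (use e(1,3) in \<open>intro mult_mono, auto\<close>)
      then show ?case using e(1,3) by (intro exI[of _ "e * e'"]) auto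
    qed
    then obtain e where e: "e > 0" "\<forall>\<^sub>F n in sequentially. (\<Prod>a\<in>#A. f (x - emb (u a n))) \<ge> e" by blast
    have "\<forall>\<^sub>F n in sequentially. f (of_int l) * (\<Prod>a\<in>#A. f (x - emb (u a n))) < f (of_int l) * e"
      using t2 e fl by (intro order_tendstoD(2)[OF t2]) auto
    with e(2) have "\<forall>\<^sub>F n in sequentially. False" by eventually_elim (use fl in auto)
    then show False by simp
  qed
  then obtain a where a: "\<And>e. e > 0 \<Longrightarrow> \<exists>\<^sub>F n in sequentially. f (x - emb (u a n)) < e" by blast
  \<comment> \<open>Distances that are small infinitely often give a subsequence \<open>r\<close>
    along which they tend to 0.\<close>
  have "\<exists>m\<ge>k. f (x - emb (u a m)) < 1 / real (Suc k)" for k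
    using a[of "1 / real (Suc k)"] by (auto simp: frequently_sequentially)
  then obtain r where r: "\<And>k. r k \<ge> k" "\<And>k. f (x - emb (u a (r k))) < 1 / real (Suc k)" by metis
  have "filterlim r at_top sequentially"
    by (rule filterlim_at_top_mono[OF filterlim_ident]) (use r in auto)
  then have "(\<lambda>k. u a (r k)) \<longlonglongrightarrow> a" using u(2) filterlim_compose by blast
  moreover have "(\<lambda>k. f (x - emb (u a (r k)))) \<longlonglongrightarrow> 0"
  proof -
    have l: "(\<lambda>k. 1 / real (Suc k)) \<longlonglongrightarrow> 0" using LIMSEQ_inverse_real_of_nat by (simp add: inverse_eq_divide)
    have "0 \<le> f (x - emb (u a (r k)))" for k by (intro nonneg diff iota_in x u)
    moreover have "f (x - emb (u a (r k))) \<le> 1 / real (Suc k)" for k using r(2)[of k] by linarith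
    ultimately show ?thesis by (intro tendsto_sandwich[OF _ _ tendsto_const l]) auto
  qed
  ultimately show ?thesis unfolding apx_def using x u
    by (intro exI[of _ a] conjI exI[of _ "\<lambda>k. u a (r k)"]) auto
qed

theorem arch_embedding: "\<exists>t. hom_on L t \<and> (\<forall>x\<in>L. f x = cmod (t x) powr c)"
proof -
  define t where "t = (\<lambda>x. THE a. apx x a)"
  have t: "apx x (t x)" if "x \<in> L" for x
    unfolding t_def using apx_exists[OF that] apx_unique by (auto intro: theI)
  have "hom_on L t" unfolding hom_on_def
  proof (intro conjI ballI)
    show "t 1 = 1" by (rule apx_unique[OF t[OF one] apx_one])
    fix x y assume "x \<in> L" "y \<in> L"
    then show "t (x + y) = t x + t y" "t (x * y) = t x * t y"
      using apx_unique[OF t[OF add] apx_add[OF t t]] apx_unique[OF t[OF mult] apx_mult[OF t t]] by blast+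
  qed
  then show ?thesis using apx_norm t by blast
qed

end

section \<open>Places and their normalized absolute values\<close>

lemma absolute_value_powr:
  assumes L: "is_subfield L" and f: "f \<in> absolute_values L" and c: "c > 0"
    and tri: "\<And>x y. x \<in> L \<Longrightarrow> y \<in> L \<Longrightarrow> f (x + y) powr c \<le> f x powr c + f y powr c"
  shows "restrict (\<lambda>x. f x powr c) L \<in> absolute_values (L :: 'a::field_char_0 set)"
proof -
  interpret abs_val L f using L f by unfold_locales
  show ?thesis unfolding absolute_values_def
    using c tri by (auto simp: eq_0_iff f_mult powr_mult nonneg add mult)
qed

lemma absolute_value_equivI:
  assumes L: "is_subfield (L :: 'a::field_char_0 set)" and f: "f \<in> nontrivial_absolute_values L" and g: "g \<in> absolute_values L" and c: "c > 0"
    and eq: "\<And>x. x \<in> L \<Longrightarrow> g x = f x powr c"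
  shows "g \<in> nontrivial_absolute_values L" "(f, g) \<in> absolute_value_equiv L"
proof -
  obtain x where x: "x \<in> L" "x \<noteq> 0" "f x \<noteq> 1" using f by (auto simp: nontrivial_absolute_values_def)
  interpret abs_val L f using L f by unfold_locales (auto simp: nontrivial_absolute_values_def)
  have "g x \<noteq> 1" using eq[OF x(1)] x c f_pos[OF x(1,2)] by (simp add: powr_eq_one_iff_gen)
  then show 1: "g \<in> nontrivial_absolute_values L" using g x by (auto simp: nontrivial_absolute_values_def)
  show "(f, g) \<in> absolute_value_equiv L" using f 1 c eq by (auto simp: absolute_value_equiv_def)
qed

lemma equiv_absolute_value_equiv:
  assumes L: "is_subfield (L :: 'a::field_char_0 set)"
  shows "equiv (nontrivial_absolute_values L) (absolute_value_equiv L)"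
proof (rule equivI)
  show "absolute_value_equiv L \<subseteq> nontrivial_absolute_values L \<times> nontrivial_absolute_values L"
    by (auto simp: absolute_value_equiv_def)
  have nn: "0 \<le> f x" if "f \<in> nontrivial_absolute_values L" "x \<in> L" for f x
    using that by (auto simp: nontrivial_absolute_values_def absolute_values_def)
  show "refl_on (nontrivial_absolute_values L) (absolute_value_equiv L)"
    using nn by (auto simp: refl_on_def absolute_value_equiv_def intro!: exI[of _ 1])
  show "sym (absolute_value_equiv L)"
  proof (rule symI)
    fix f g assume "(f, g) \<in> absolute_value_equiv L"
    then obtain s where s: "f \<in> nontrivial_absolute_values L" "g \<in> nontrivial_absolute_values L" "s > 0" "\<forall>x\<in>L. g x = f x powr s"
      by (auto simp: absolute_value_equiv_def)
    then have "\<forall>x\<in>L. f x = g x powr (1 / s)" using nn by (auto simp: powr_powr)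
    then show "(g, f) \<in> absolute_value_equiv L" using s
      by (auto simp: absolute_value_equiv_def intro!: exI[of _ "1 / s"])
  qed
  show "trans (absolute_value_equiv L)"
  proof (rule transI)
    fix f g h assume "(f, g) \<in> absolute_value_equiv L" "(g, h) \<in> absolute_value_equiv L"
    then obtain s r where "f \<in> nontrivial_absolute_values L" "h \<in> nontrivial_absolute_values L" "s > 0" "\<forall>x\<in>L. g x = f x powr s"
        "r > 0" "\<forall>x\<in>L. h x = g x powr r"
      by (auto simp: absolute_value_equiv_def)
    then show "(f, h) \<in> absolute_value_equiv L"
      by (auto simp: absolute_value_equiv_def powr_powr intro!: exI[of _ "s * r"])
  qed
qed

lemma padic_abs_prime: "prime p \<Longrightarrow> padic_abs p (of_nat p) = 1 / real p"
  and padic_abs_other: "prime p \<Longrightarrow> prime q \<Longrightarrow> p \<noteq> q \<Longrightarrow> padic_abs p (of_nat q) = 1"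
proof -
  have q: "quotient_of (of_nat n) = (int n, 1)" for n using quotient_of_int[of "int n"] by simp
  show "padic_abs p (of_nat p) = 1 / real p" if p: "prime p"
  proof -
    have "p > 0" "multiplicity (int p) (int p) = 1" using p prime_gt_0_nat[OF p] by (auto intro!: multiplicity_self)
    then show ?thesis by (simp add: padic_abs_def q power_int_minus inverse_eq_divide)
  qed
  show "padic_abs p (of_nat q) = 1" if pq: "prime p" "prime q" "p \<noteq> q"
  proof -
    have "\<not> p dvd q" using pq primes_dvd_imp_eq by blast
    then have "multiplicity (int p) (int q) = 0" by (intro not_dvd_imp_multiplicity_0) simp
    then show ?thesis using prime_gt_0_nat[OF pq(2)] by (simp add: padic_abs_def q)
  qed
qed

lemma normalized_abs_prime:
  fixes h :: "'a::field_char_0 \<Rightarrow> real"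
  assumes h: "normalized_abs h" and r: "prime r"
  shows "\<exists>e\<in>{-1, 0, 1}. h (of_rat (of_nat r)) = real r powr e"
  using h unfolding normalized_abs_def
proof (elim disjE exE conjE)
  assume a: "\<forall>q. h (of_rat q) = \<bar>real_of_rat q\<bar>"
  have "h (of_rat (of_nat r)) = real r" by (subst a[rule_format]) simp
  then show ?thesis using prime_gt_0_nat[OF r] by (intro bexI[of _ 1]) auto
next
  fix p assume p: "prime p" "\<forall>q. h (of_rat q) = padic_abs p q"
  show ?thesis
  proof (cases "r = p")
    case True
    have "h (of_rat (of_nat r)) = 1 / real r" unfolding p(2)[rule_format] True by (rule padic_abs_prime[OF p(1)])
    then show ?thesis using prime_gt_0_nat[OF r] by (intro bexI[of _ "-1"]) (auto simp: powr_minus_divide)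
  next
    case False
    then have "h (of_rat (of_nat r)) = 1" unfolding p(2)[rule_format] using padic_abs_other[OF p(1) r] by simp
    then show ?thesis using prime_gt_0_nat[OF r] by (intro bexI[of _ 0]) auto
  qed
qed

lemma normalized_abs_nontrivial_prime:
  fixes h :: "'a::field_char_0 \<Rightarrow> real"
  assumes "normalized_abs h"
  shows "\<exists>r. prime r \<and> h (of_rat (of_nat r)) \<noteq> 1"
  using assms unfolding normalized_abs_def
proof (elim disjE exE conjE)
  assume a: "\<forall>q. h (of_rat q) = \<bar>real_of_rat q\<bar>"
  have "h (of_rat (of_nat 2)) = 2" by (subst a[rule_format]) simp
  then show ?thesis by (intro exI[of _ 2]) auto
next
  fix p assume p: "prime p" "\<forall>q. h (of_rat q) = padic_abs p q"
  have "h (of_rat (of_nat p)) = 1 / real p" unfolding p(2)[rule_format] by (rule padic_abs_prime[OF p(1)])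
  then show ?thesis using p(1) prime_gt_1_nat[OF p(1)] by (intro exI[of _ p]) auto
qed

text \<open>At a prime a normalized absolute value is that prime to the power -1, 0 or 1. A positive
  factor \<open>s\<close> between two such exponents, the first nonzero, can only be 1.\<close>

lemma normalized_powr_unique:
  fixes f g :: "'a::field_char_0 \<Rightarrow> real"
  assumes f: "normalized_abs f" and g: "normalized_abs g" and eq: "\<And>q. g (of_rat q) = f (of_rat q) powr s"
    and s: "s > 0"
  shows "s = 1"
proof -
  obtain r where r: "prime r" "f (of_rat (of_nat r)) \<noteq> 1" using normalized_abs_nontrivial_prime[OF f] by blast
  obtain e e' where e: "e \<in> {-1, 0, 1}" "f (of_rat (of_nat r)) = real r powr e"
    and e': "e' \<in> {-1, 0, 1}" "g (of_rat (of_nat r)) = real r powr e'"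
    using normalized_abs_prime[OF f r(1)] normalized_abs_prime[OF g r(1)] by blast
  have r1: "real r > 1" using prime_gt_1_nat[OF r(1)] by simp
  have "e \<noteq> 0" using r(2) r1 unfolding e(2) by auto
  have "real r powr e' = real r powr (e * s)" using eq[of "of_nat r"] unfolding e(2) e'(2) powr_powr .
  then have "e' = e * s" using r1 by (subst (asm) powr_inj) auto
  then show ?thesis using e(1) e'(1) s \<open>e \<noteq> 0\<close> by auto
qed

text \<open>Justifies the definite description in \<open>place_abs\<close>: two normalized members
  of a place differ by a power, and its exponent is 1.\<close>

lemma place_abs_eqI:
  assumes L: "is_subfield (L :: 'a::field_char_0 set)" and w: "w \<in> places L" and f: "f \<in> w" "normalized_abs f"
  shows "place_abs w = f"
  unfolding place_abs_def
proof (rule the_equality)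
  fix g assume g: "g \<in> w \<and> normalized_abs g"
  have "(f, g) \<in> absolute_value_equiv L"
    using quotient_eq_iff[OF equiv_absolute_value_equiv[OF L] w[unfolded places_def] w[unfolded places_def] f(1)] g by blast
  then obtain s where s: "f \<in> absolute_values L" "g \<in> absolute_values L" "s > 0" "\<forall>x\<in>L. g x = f x powr s"
    by (auto simp: absolute_value_equiv_def nontrivial_absolute_values_def)
  have rat: "of_rat q \<in> L" for q using Rats_in_subfield[OF L] by auto
  have "s = 1" by (rule normalized_powr_unique[OF f(2) conjunct2[OF g] s(4)[rule_format, OF rat] s(3)])
  then have "g x = f x" if "x \<in> L" for x using s that by (auto simp: absolute_values_def)
  then show "g = f" using s by (intro extensionalityI[of g L f]) (auto simp: absolute_values_def)
qed (use f in simp)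

definition place_of :: "'a::field set \<Rightarrow> ('a \<Rightarrow> real) \<Rightarrow> 'a place" where
  "place_of L f = absolute_value_equiv L `` {f}"

lemma place_of_mem:
  assumes L: "is_subfield (L :: 'a::field_char_0 set)" and f: "f \<in> nontrivial_absolute_values L"
  shows "place_of L f \<in> places L" "f \<in> place_of L f"
  using quotientI[OF f] equiv_class_self[OF equiv_absolute_value_equiv[OF L] f]
  by (auto simp: places_def place_of_def)

lemma restrict_absolute_value:
  assumes "f \<in> absolute_values L" "K \<subseteq> L" "is_subfield (K :: 'a::field_char_0 set)"
  shows "restrict f K \<in> absolute_values K"
proof -
  interpret subfield_of K using assms by unfold_locales
  show ?thesis using assms unfolding absolute_values_def by (auto simp: add mult subset_iff)
qed

lemma normalized_nontrivial:
  assumes L: "is_subfield (L :: 'a::field_char_0 set)" and f: "f \<in> absolute_values L" "normalized_abs f"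
  shows "f \<in> nontrivial_absolute_values L"
proof -
  obtain r where r: "prime r" "f (of_rat (of_nat r)) \<noteq> 1" using normalized_abs_nontrivial_prime[OF f(2)] by blast
  have "(of_rat (of_nat r) :: 'a) \<in> L" by (intro subsetD[OF Rats_in_subfield[OF L]] Rats_of_rat)
  moreover have "of_rat (of_nat r) \<noteq> (0::'a)" using prime_gt_0_nat[OF r(1)] by simp
  ultimately show ?thesis using f(1) r(2) unfolding nontrivial_absolute_values_def by blast
qed

lemma normalized_restrict: "is_subfield (K :: 'a::field_char_0 set) \<Longrightarrow> normalized_abs f \<Longrightarrow> normalized_abs (restrict f K)"
proof -
  assume K: "is_subfield K" and f: "normalized_abs f"
  have "of_rat q \<in> K" for q using Rats_in_subfield[OF K] by auto
  then have "restrict f K (of_rat q) = f (of_rat q)" for q by (simp only: restrict_def if_True)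
  then show ?thesis using f by (simp only: normalized_abs_def)
qed

text \<open>The hypothesis places only \<open>restrict f K\<close> in \<open>v\<close>; equivalent
  absolute values restrict to equivalent ones, so the whole place of \<open>f\<close> lies above
  \<open>v\<close>.\<close>

lemma place_above_normalized:
  assumes K: "is_subfield (K :: 'a::field_char_0 set)" and L: "is_subfield L" and KL: "K \<subseteq> L"
    and f: "f \<in> absolute_values L" "normalized_abs f" and v: "v \<in> places K" "restrict f K \<in> v"
  shows "place_of L f \<in> places_above K L v" "place_abs (place_of L f) = f"
proof -
  have fn: "f \<in> nontrivial_absolute_values L" using normalized_nontrivial[OF L f] .
  note pm = place_of_mem[OF L fn]
  show "place_abs (place_of L f) = f" using place_abs_eqI[OF L pm f(2)] .
  have "restrict g K \<in> v" if g: "g \<in> place_of L f" for g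
  proof -
    have "(f, g) \<in> absolute_value_equiv L" using g by (simp add: place_of_def)
    then obtain s where s: "g \<in> absolute_values L" "s > 0" "\<forall>x\<in>L. g x = f x powr s"
      by (auto simp: absolute_value_equiv_def nontrivial_absolute_values_def)
    have fK: "restrict f K \<in> nontrivial_absolute_values K"
      by (intro normalized_nontrivial K restrict_absolute_value[OF f(1) KL K] normalized_restrict f)
    have "(restrict f K, restrict g K) \<in> absolute_value_equiv K"
      using s KL by (intro absolute_value_equivI(2)[OF K fK restrict_absolute_value[OF s(1) KL K] s(2)]) auto
    then show ?thesis
      using v in_quotient_imp_closed[OF equiv_absolute_value_equiv[OF K]] unfolding places_def by blast
  qed
  then show "place_of L f \<in> places_above K L v" using pm by (auto simp: places_above_def)
qed

lemma place_of_restrict: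
  assumes K: "is_subfield (K :: 'a::field_char_0 set)" and L: "is_subfield L" and KL: "K \<subseteq> L"
    and f: "f \<in> absolute_values L" "normalized_abs f"
  shows "place_of K (restrict f K) \<in> places K" "restrict f K \<in> place_of K (restrict f K)"
    "place_of L f \<in> places_above K L (place_of K (restrict f K))"
proof -
  have fK: "restrict f K \<in> nontrivial_absolute_values K"
    by (intro normalized_nontrivial K restrict_absolute_value[OF f(1) KL K] normalized_restrict f)
  show 1: "place_of K (restrict f K) \<in> places K" "restrict f K \<in> place_of K (restrict f K)" using place_of_mem[OF K fK] .
  then show "place_of L f \<in> places_above K L (place_of K (restrict f K))" using place_above_normalized(1)[OF K L KL f] by blast
qed

text \<open>By the two halves of Ostrowski's theorem a representative \<open>f\<close> has an
  exponent \<open>c\<close> on the rationals, and its \<open>1 / c\<close>-th power is the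
  normalized absolute value. The square root \<open>I\<close> of -1 serves the approximation by
  Gaussian rationals.\<close>

lemma place_normalized_cases:
  fixes L :: "'a::field_char_0 set"
  assumes L: "is_subfield L" and alg: "\<And>x. x \<in> L \<Longrightarrow> algebraic x" and I: "I \<in> L" "I * I = - 1"
    and w: "w \<in> places L"
  shows "place_abs w \<in> w \<and> place_abs w \<in> absolute_values L \<and> normalized_abs (place_abs w) \<and>
    ((\<exists>t. hom_on L t \<and> (\<forall>x\<in>L. place_abs w x = cmod (t x))) \<or>
     ((\<forall>x\<in>L. \<forall>y\<in>L. place_abs w (x + y) \<le> max (place_abs w x) (place_abs w y)) \<and>
      (\<exists>p. prime p \<and> (\<forall>q. place_abs w (of_rat q) = padic_abs p q))))"
proof -
  obtain f where f: "f \<in> nontrivial_absolute_values L" "w = absolute_value_equiv L `` {f}"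
    using w by (auto simp: places_def elim!: quotientE)
  have fa: "f \<in> absolute_values L" using f by (simp add: nontrivial_absolute_values_def)
  interpret abs_val L f using L fa by unfold_locales
  \<comment> \<open>A power of an absolute value can violate the triangle inequality, so
    \<open>tri\<close> is left to the two cases: it follows from the ultrametric inequality or from
    the embedding.\<close>
  have main: ?thesis if c: "c > 0" and nq: "normalized_abs (\<lambda>x. f x powr (1 / c))"
    and tri: "\<And>x y. x \<in> L \<Longrightarrow> y \<in> L \<Longrightarrow> f (x + y) powr (1 / c) \<le> f x powr (1 / c) + f y powr (1 / c)"
    and cs: "(\<exists>t. hom_on L t \<and> (\<forall>x\<in>L. f x powr (1 / c) = cmod (t x))) \<or>
      ((\<forall>x\<in>L. \<forall>y\<in>L. f (x + y) powr (1 / c) \<le> max (f x powr (1 / c)) (f y powr (1 / c))) \<and>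
       (\<exists>p. prime p \<and> (\<forall>q. f (of_rat q) powr (1 / c) = padic_abs p q)))" for c
  proof -
    define g where "g = restrict (\<lambda>x. f x powr (1 / c)) L"
    have gL: "g x = f x powr (1 / c)" if "x \<in> L" for x using that by (simp add: g_def)
    have ga: "g \<in> absolute_values L" unfolding g_def by (rule absolute_value_powr[OF L fa _ tri]) (use c in simp)
    have gn: "normalized_abs g" unfolding g_def by (rule normalized_restrict[OF L nq])
    have "g \<in> w" using absolute_value_equivI(2)[OF L f(1) ga _ gL] c f(2) by simp
    moreover from this have "place_abs w = g" by (rule place_abs_eqI[OF L w _ gn])
    ultimately show ?thesis using ga gn cs by (simp add: gL add)
  qed
  show ?thesis
  proof (cases "\<forall>n. f (of_nat n) \<le> 1")
    case True
    have u: "f (x + y) \<le> max (f x) (f y)" if "x \<in> L" "y \<in> L" for x y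
      using ultrametric_of_bounded True that by blast
    have "\<exists>x\<in>L. x \<noteq> 0 \<and> f x \<noteq> 1" using f(1) by (simp add: nontrivial_absolute_values_def)
    from Ostrowski_nonarch[OF alg u this] obtain p c where
      p: "prime p" "c > 0" "\<forall>q. f (of_rat q) = padic_abs p q powr c" by blast
    have up: "f (x + y) powr (1 / c) \<le> max (f x powr (1 / c)) (f y powr (1 / c))" if "x \<in> L" "y \<in> L" for x y
    proof -
      have "f (x + y) powr (1 / c) \<le> max (f x) (f y) powr (1 / c)"
        using u[OF that] nonneg[OF add[OF that]] p(2) by (intro powr_mono2) auto
      then show ?thesis by (auto simp: max_def split: if_splits)
    qed
    have fq: "f (of_rat q) powr (1 / c) = padic_abs p q" for q
    proof -
      have "padic_abs p q \<ge> 0" by (simp add: padic_abs_def)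
      then show ?thesis using p by (simp add: powr_powr)
    qed
    show ?thesis
    proof (rule main[OF p(2)])
      show "f (x + y) powr (1 / c) \<le> f x powr (1 / c) + f y powr (1 / c)" if "x \<in> L" "y \<in> L" for x y
        using up[OF that] by (rule order_trans) simp
    qed (use p(1) fq up in \<open>auto simp: normalized_abs_def\<close>)
  next
    case False
    then obtain n0 where "f (of_nat n0) > 1" by (auto simp: not_le)
    from Ostrowski_arch[OF this] obtain c where c: "c > 0" and c2: "\<forall>q. f (of_rat q) = \<bar>real_of_rat q\<bar> powr c" by blast
    interpret arch_abs L f I c by unfold_locales (use I c c2 alg in blast)+
    obtain t where t: "hom_on L t" "\<forall>x\<in>L. f x = cmod (t x) powr c" using arch_embedding by blast
    have gt: "f x powr (1 / c) = cmod (t x)" if "x \<in> L" for x using t(2) that c by (simp add: powr_powr)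
    have fq: "f (of_rat q) powr (1 / c) = \<bar>real_of_rat q\<bar>" for q
      unfolding c2[rule_format] powr_powr using c by simp
    show ?thesis
    proof (rule main[OF c])
      show "normalized_abs (\<lambda>x. f x powr (1 / c))" unfolding normalized_abs_def using fq by blast
      show "f (x + y) powr (1 / c) \<le> f x powr (1 / c) + f y powr (1 / c)" if "x \<in> L" "y \<in> L" for x y
        using t(1) that by (simp add: gt add hom_on_def norm_triangle_ineq)
    qed (use gt t(1) in blast)
  qed
qed

lemma embedding_absolute_value:
  assumes L: "is_subfield (L :: 'a::field_char_0 set)" and t: "hom_on L t"
  shows "restrict (\<lambda>x. cmod (t x)) L \<in> absolute_values L" "normalized_abs (restrict (\<lambda>x. cmod (t x)) L)"
proof -
  interpret field_hom L t using L t by unfold_locales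
  show "restrict (\<lambda>x. cmod (t x)) L \<in> absolute_values L"
    unfolding absolute_values_def by (auto simp: h_eq0_iff h_mult h_add add mult norm_mult norm_triangle_ineq)
  have "t (of_rat q) = of_rat q" for q
    by (cases q) (auto simp: of_rat_rat h_divide)
  moreover have "cmod (of_rat q) = \<bar>real_of_rat q\<bar>" for q
    by (cases q) (simp add: of_rat_rat norm_divide)
  moreover have "of_rat q \<in> L" for q using Rats_in_subfield[OF L] by auto
  ultimately have "restrict (\<lambda>x. cmod (t x)) L (of_rat q) = \<bar>real_of_rat q\<bar>" for q by (simp only: restrict_def if_True)
  then show "normalized_abs (restrict (\<lambda>x. cmod (t x)) L)"
    unfolding normalized_abs_def by blast
qed

lemma compose_absolute_value:
  assumes L: "is_subfield (L :: 'a::field_char_0 set)" and s: "hom_on L aut" "aut ` L \<subseteq> L" and f: "f \<in> absolute_values L" "normalized_abs f"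
  shows "restrict (\<lambda>x. f (aut x)) L \<in> absolute_values L" "normalized_abs (restrict (\<lambda>x. f (aut x)) L)"
proof -
  interpret field_hom L aut using L s by unfold_locales
  interpret abs_val L f using f by unfold_locales
  have sL: "aut x \<in> L" if "x \<in> L" for x using s that by auto
  show "restrict (\<lambda>x. f (aut x)) L \<in> absolute_values L"
    unfolding absolute_values_def using sL by (auto simp: h_eq0_iff h_mult h_add add mult nonneg eq_0_iff f_mult f_triangle)
  have "aut (of_rat q) = of_rat q" for q
    by (cases q) (auto simp: of_rat_rat h_divide)
  then have "restrict (\<lambda>x. f (aut x)) L (of_rat q) = f (of_rat q)" for q by (simp only: restrict_def if_True of_rat_in)
  then show "normalized_abs (restrict (\<lambda>x. f (aut x)) L)"
    using f(2) unfolding normalized_abs_def by presburger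
qed

section \<open>Nonarchimedean places\<close>

lemma root_unity_order:
  assumes "root_unity w"
  shows "\<exists>d>0. \<forall>k. w ^ k = 1 \<longleftrightarrow> d dvd k"
proof -
  define d where "d = (LEAST n. n > 0 \<and> w ^ n = 1)"
  have d: "d > 0" "w ^ d = 1" using LeastI_ex[of "\<lambda>n. n > 0 \<and> w ^ n = 1"] assms by (auto simp: d_def root_unity_def)
  have "w ^ k = 1 \<longleftrightarrow> d dvd k" for k
  proof -
    have "w ^ k = (w ^ d) ^ (k div d) * w ^ (k mod d)" by (metis mult_div_mod_eq power_add power_mult)
    then have e: "w ^ k = w ^ (k mod d)" using d by simp
    have "w ^ (k mod d) = 1 \<longleftrightarrow> k mod d = 0"
    proof
      assume "w ^ (k mod d) = 1"
      moreover have "k mod d < d" using d by simp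
      ultimately show "k mod d = 0" using not_less_Least[of "k mod d" "\<lambda>n. n > 0 \<and> w ^ n = 1"] unfolding d_def by auto
    qed (simp only: power_0)
    then show ?thesis unfolding e by (simp add: dvd_eq_mod_eq_0)
  qed
  then show ?thesis using d(1) by blast
qed

locale nonarch_abs = abs_val L f for L :: "'a::field_char_0 set" and f +
  fixes p :: nat
  assumes p: "prime p" and um: "\<And>x y. x \<in> L \<Longrightarrow> y \<in> L \<Longrightarrow> f (x + y) \<le> max (f x) (f y)"
    and fQ: "\<And>q. f (of_rat q) = padic_abs p q"
begin

lemma f_p: "f (of_nat p) = 1 / real p"
  using fQ[of "of_nat p"] padic_abs_prime[OF p] by simp

lemma f_prime: "prime q \<Longrightarrow> f (of_nat q) \<ge> 1 / real p"
  using fQ[of "of_nat q"] padic_abs_other[OF p, of q] f_p prime_gt_0_nat[OF p] by (cases "q = p") (auto simp: field_simps)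

lemma um_diff: "x \<in> L \<Longrightarrow> y \<in> L \<Longrightarrow> f (x - y) \<le> max (f x) (f y)"
  using um[of x "- y"] f_uminus[of y] uminus[of y] by simp

lemma f_one_minus_power:
  assumes z: "z \<in> L" "f z \<le> 1"
  shows "f (1 - z ^ k) \<le> f (1 - z)"
proof -
  have "1 - z ^ k = (1 - z) * (\<Sum>i<k. z ^ i)" by (rule one_diff_power_eq)
  moreover have "f (\<Sum>i<k. z ^ i) \<le> 1"
    using z nonneg[OF z(1)] by (intro ultrametric_sum[OF um]) (auto simp: f_power power power_le_one)
  ultimately show ?thesis
    using z nonneg[of "1 - z"] mult_left_mono[of "f (\<Sum>i<k. z ^ i)" 1 "f (1 - z)"] by (simp add: f_mult diff sum power)
qed

text \<open>In \<open>1 - z ^ p = (1 - z) * (p - (\<Sum>i<p. 1 - z ^ i))\<close> the last factor is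
  at most the maximum of \<open>1 / p\<close> and \<open>f (1 - z)\<close>, so \<open>p\<close>-th
  powers move closer to 1.\<close>

lemma f_one_minus_power_p:
  assumes z: "z \<in> L" "f z \<le> 1"
  shows "f (1 - z ^ p) \<le> f (1 - z) * max (1 / 2) (f (1 - z))"
proof -
  have p2: "real p \<ge> 2" using prime_ge_2_nat[OF p] by simp
  have e: "1 - z ^ p = (1 - z) * (of_nat p - (\<Sum>i<p. 1 - z ^ i))" using one_diff_power_eq[of z p] by (simp add: sum_subtractf)
  have sL: "(\<Sum>i<p. 1 - z ^ i) \<in> L" using z by (intro sum diff one power)
  have "f (\<Sum>i<p. 1 - z ^ i) \<le> f (1 - z)"
    using z f_one_minus_power[OF z] nonneg[of "1 - z"] by (intro ultrametric_sum[OF um]) (auto simp: power diff)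
  then have "f (of_nat p - (\<Sum>i<p. 1 - z ^ i)) \<le> max (1 / real p) (f (1 - z))"
    using um_diff[OF of_nat sL, of p] unfolding f_p by linarith
  also have "\<dots> \<le> max (1 / 2) (f (1 - z))" using p2 by (intro max.mono) (auto simp: field_simps)
  finally show ?thesis
    unfolding e using z sL nonneg[of "1 - z"] by (subst f_mult) (auto simp: diff intro!: mult_left_mono)
qed

text \<open>Some power \<open>w\<close> of \<open>z\<close> has prime order \<open>q\<close>. The
  product of the \<open>1 - w ^ i\<close> is \<open>q\<close>, of absolute value at least
  \<open>1 / p\<close>, while all factors are at most 1 and one is at most
  \<open>f (1 - z)\<close>.\<close>

lemma root_unity_near_1:
  assumes z: "z \<in> L" "root_unity z" "f (1 - z) < 1 / real p"
  shows "z = 1"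
proof (rule ccontr)
  assume z1: "z \<noteq> 1"
  obtain N where N: "N > 0" and zN: "\<And>k. z ^ k = 1 \<longleftrightarrow> N dvd k" using root_unity_order[OF z(2)] by blast
  have Nmin: "z ^ i \<noteq> 1" if "0 < i" "i < N" for i using zN[of i] that by (auto dest: dvd_imp_le)
  have "N \<noteq> 1" using zN[of 1] z1 by auto
  then obtain q where q: "prime q" "q dvd N" using prime_factor_nat by blast
  then obtain k where k: "N = q * k" by (auto elim: dvdE)
  have k0: "k > 0" using k N by (cases k) auto
  define w where "w = z ^ k"
  have fz: "f z = 1" by (rule f_root_unity[OF z(1) N zN[THEN iffD2, OF dvd_refl]])
  have wL: "w \<in> L" using z by (simp add: w_def power)
  have fw: "f w = 1" using z fz by (simp add: w_def f_power)
  have wi: "w ^ i \<noteq> 1" if i: "0 < i" "i < q" for i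
  proof -
    have "k * i < N" using i k0 unfolding k by simp
    then have "z ^ (k * i) \<noteq> 1" using i k0 by (intro Nmin) auto
    then show ?thesis by (simp add: w_def power_mult)
  qed
  have "z ^ (k * q) = 1" using zN[of "k * q"] by (metis k dvd_refl mult.commute)
  then have wq: "w ^ q = 1" unfolding w_def power_mult .
  have q1: "q > 1" using prime_gt_1_nat[OF q(1)] .
  have "(\<Prod>i\<in>{1..<q}. 1 - w ^ i) = of_nat q" using prod_one_minus_root_unity[OF _ wq wi] q1 by simp
  then have "f (of_nat q) = (\<Prod>i\<in>{1..<q}. f (1 - w ^ i))" using f_prod[of "{1..<q}" "\<lambda>i. 1 - w ^ i"] wL by (simp add: diff power)
  also have "\<dots> = f (1 - w ^ 1) * (\<Prod>i\<in>{1..<q} - {1}. f (1 - w ^ i))" using q1 by (intro prod.remove) auto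
  also have "\<dots> \<le> f (1 - z) * 1"
  proof (rule mult_mono)
    show "f (1 - w ^ 1) \<le> f (1 - z)" using f_one_minus_power[of z k] z fz by (simp add: w_def)
    have "f (1 - w ^ i) \<le> 1" for i using um_diff[of 1 "w ^ i"] wL fw by (simp add: f_power power)
    then show "(\<Prod>i\<in>{1..<q} - {1}. f (1 - w ^ i)) \<le> 1" using wL by (intro prod_le_1) (auto simp: nonneg diff power)
  qed (use wL z in \<open>auto intro!: nonneg prod_nonneg simp: diff power\<close>)
  finally show False using f_prime[OF q(1)] z(3) by simp
qed

text \<open>Each \<open>p\<close>-th power shrinks the distance to 1 by the factor
  \<open>max (1 / 2) rh\<close>; after \<open>j\<close> of them it is below
  \<open>1 / p\<close>.\<close>

lemma root_unity_near_1_power: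
  assumes r: "rh < 1" "max (1 / 2) rh ^ j < 1 / real p"
    and z: "z \<in> L" "root_unity z" "f (1 - z) \<le> rh"
  shows "z ^ (p ^ j) = 1"
proof -
  define r where "r = max (1 / 2) rh"
  have r01: "0 \<le> r" "r < 1" using r by (auto simp: r_def)
  have fz: "f z = 1" using z f_root_unity by (auto simp: root_unity_def)
  have "f (1 - z ^ (p ^ i)) \<le> r * r ^ i" for i
  proof (induction i)
    case 0 then show ?case using z by (simp add: r_def)
  next
    case (Suc i)
    define y where "y = z ^ (p ^ i)"
    have y: "y \<in> L" "f y \<le> 1" using z fz by (auto simp: y_def power f_power)
    have IH: "f (1 - y) \<le> r * r ^ i" using Suc by (simp add: y_def)
    have "r * r ^ i \<le> r * 1" using r01 by (intro mult_left_mono power_le_one) auto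
    then have m: "max (1 / 2) (f (1 - y)) \<le> r" using IH by (simp add: r_def)
    have "f (1 - y ^ p) \<le> f (1 - y) * max (1 / 2) (f (1 - y))" by (rule f_one_minus_power_p[OF y])
    also have "\<dots> \<le> (r * r ^ i) * r" using IH m r01 y by (intro mult_mono) (auto intro!: nonneg diff)
    finally show ?case by (simp add: y_def power_mult[symmetric] mult_ac)
  qed
  from this[of j] have "f (1 - z ^ (p ^ j)) \<le> r * r ^ j" .
  also have "\<dots> \<le> 1 * r ^ j" using r01 by (intro mult_right_mono) auto
  finally have "f (1 - z ^ (p ^ j)) < 1 / real p" using r by (simp add: r_def)
  then show ?thesis using z by (intro root_unity_near_1 power root_unity_power)
qed

text \<open>Each step eliminates the terms with \<open>u j = u i\<close>, by passing from \<open>y t\<close> to \<open>y (t + 1) - u i * y t\<close>.\<close>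
lemma vandermonde_bound:
  assumes "finite A" and J: "\<And>j. j \<in> J \<Longrightarrow> b j \<in> L" and u: "\<And>j. j \<in> J \<union> A \<Longrightarrow> u j \<in> L \<and> f (u j) \<le> 1"
    and M: "\<And>t. t \<le> card A \<Longrightarrow> f (\<Sum>j\<in>J. b j * u j ^ t) \<le> M"
  shows "f (\<Sum>j\<in>J. b j * (\<Prod>i\<in>A. u j - u i)) \<le> M"
  using assms
proof (induction A arbitrary: b rule: finite_induct)
  case empty
  then show ?case using empty(3)[of 0] by simp
next
  case (insert a A)
  have uJ: "u j \<in> L" if "j \<in> J" for j using insert.prems(2) that by blast
  have ua: "u a \<in> L" "f (u a) \<le> 1" using insert.prems(2) by auto
  have "f (\<Sum>j\<in>J. (b j * (u j - u a)) * (\<Prod>i\<in>A. u j - u i)) \<le> M"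
  proof (rule insert.IH)
    show "b j * (u j - u a) \<in> L" if "j \<in> J" for j using that insert.prems(1) uJ ua by (intro mult diff) auto
    show "u j \<in> L \<and> f (u j) \<le> 1" if "j \<in> J \<union> A" for j using insert.prems(2) that by blast
    fix t assume t: "t \<le> card A"
    define y where "y = (\<lambda>t. \<Sum>j\<in>J. b j * u j ^ t)"
    have yL: "y t \<in> L" for t unfolding y_def using insert.prems(1) uJ by (intro sum mult power) auto
    have yM: "f (y t) \<le> M" if "t \<le> Suc (card A)" for t using insert.prems(3)[of t] that insert.hyps by (simp add: y_def)
    have "(\<Sum>j\<in>J. b j * (u j - u a) * u j ^ t) = y (Suc t) - u a * y t"
      by (simp add: y_def sum_distrib_left sum_subtractf[symmetric] algebra_simps)
    also have "f \<dots> \<le> max (f (y (Suc t))) (f (u a * y t))" using yL ua by (intro um_diff mult)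
    also have "\<dots> \<le> M"
    proof -
      have "f (u a * y t) \<le> 1 * f (y t)" using mult_right_mono[OF ua(2) nonneg[OF yL, of t]] ua yL by (simp add: f_mult)
      then show ?thesis using yM[of t] yM[of "Suc t"] t by simp
    qed
    finally show "f (\<Sum>j\<in>J. b j * (u j - u a) * u j ^ t) \<le> M" .
  qed
  then show ?case using insert.hyps by (simp add: mult.assoc)
qed

end

lemma finite_nth_roots: "D > 0 \<Longrightarrow> finite {z::'a::field_char_0. z ^ D = 1}"
proof -
  assume D: "D > 0"
  have "{z::'a. z ^ D = 1} = {z. poly (monom 1 D - 1) z = 0}" by (auto simp: poly_monom)
  moreover have "coeff (monom (1::'a) D - 1) D = 1" using D by (simp add: coeff_1)
  then have "monom (1::'a) D - 1 \<noteq> 0" by (metis coeff_0 zero_neq_one)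
  ultimately show ?thesis using poly_roots_finite by metis
qed

text \<open>Two terms of an integer equation for \<open>x\<close> have the same size, which
  determines \<open>f x\<close> as a root of a quotient of \<open>p\<close>-adic absolute values of
  coefficients. Only finitely many pairs of terms exist, whatever \<open>f\<close> is.\<close>

lemma finite_nonarch_values:
  assumes L: "is_subfield L" and alg: "\<And>x. x \<in> L \<Longrightarrow> algebraic x" and x: "x \<in> (L :: 'a::field_char_0 set)"
  shows "finite {f x | f. nonarch_abs L f p}"
proof (cases "x = 0")
  case True
  have "{f x | f. nonarch_abs L f p} \<subseteq> {0}"
    using True abs_val.f_0 nonarch_abs.axioms(1) by fastforce
  then show ?thesis using finite_subset by blast
next
  case False
  obtain P where P: "P \<noteq> 0" "poly (map_poly of_int P) x = 0" using alg[OF x] by (rule algebraicE')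
  define n where "n = degree P"
  define g where "g = (\<lambda>i. padic_abs p (of_int (coeff P i)))"
  have "f x \<in> (\<lambda>(i, j). root (i - j) (g j / g i)) ` ({..n} \<times> {..n})" if "nonarch_abs L f p" for f
  proof -
    interpret nonarch_abs L f p by fact
    have "inverse (of_nat p) \<notin> {x \<in> L. f x \<le> 1}"
      using f_inverse[OF of_nat, of p] f_p prime_gt_1_nat[OF p] by simp
    then interpret V: val_ring L "{x \<in> L. f x \<le> 1}" p
      using valuation_ring_abs[OF um] p alg by unfold_locales
    obtain i j where ij: "j < i" "i \<le> n" "coeff P i \<noteq> 0" "coeff P j \<noteq> 0"
      and u: "V.ut (of_int (coeff P i) * x ^ i / (of_int (coeff P j) * x ^ j))"
      using V.unit_ratio_exists[OF x False P] unfolding n_def by blast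
    have fx: "f x > 0" using f_pos[OF x False] .
    have fP: "f (of_int (coeff P i)) = g i" for i using fQ[of "of_int (coeff P i)"] by (simp add: g_def)
    have g0: "g i \<noteq> 0" "g j \<noteq> 0" using ij eq_0_iff[OF of_int] by (simp_all flip: fP)
    have "f (of_int (coeff P i) * x ^ i / (of_int (coeff P j) * x ^ j)) = 1"
      using u by (intro f_unit) (auto simp: V.ut_def)
    then have "g i * f x ^ i = g j * f x ^ j"
      using x g0 fx by (simp add: f_divide f_mult f_power fP mult power field_simps)
    moreover have "f x ^ i = f x ^ (i - j) * f x ^ j" using ij(1) by (simp flip: power_add)
    ultimately have "f x ^ (i - j) = g j / g i" using fx g0 by (simp add: field_simps)
    then have "f x = root (i - j) (g j / g i)" using fx ij by (metis less_imp_le real_root_power_cancel zero_less_diff)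
    then show ?thesis using ij by (intro image_eqI[of _ _ "(i, j)"]) auto
  qed
  then have "{f x | f. nonarch_abs L f p} \<subseteq> (\<lambda>(i, j). root (i - j) (g j / g i)) ` ({..n} \<times> {..n})" by blast
  then show ?thesis by (rule finite_subset) simp
qed

text \<open>The exponents are \<open>1\<close> modulo \<open>d\<close>, and modulo a prime not dividing \<open>d\<close> they are \<open>(t + 1) d\<close>.\<close>
lemma coprime_progression_exists:
  assumes d: "d > 0" "\<And>t. t < m \<Longrightarrow> Suc t dvd d" and N: "(N::nat) > 0"
  shows "\<exists>s. [s = 1] (mod d) \<and> (\<forall>t<m. coprime (s + t * d) N)"
proof -
  define Q where "Q = {q. prime q \<and> q dvd N \<and> \<not> q dvd d}"
  have fQ: "finite Q" using N by (intro finite_subset[of Q "{..N}"]) (auto simp: Q_def dest: dvd_imp_le)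
  have "coprime (\<Prod>Q) d" by (rule prod_coprime_left) (auto simp: Q_def prime_imp_coprime)
  then have "coprime d (\<Prod>Q)" by (simp add: coprime_commute)
  from binary_chinese_remainder_nat[OF this, of 1 d] obtain s where s: "[s = 1] (mod d)" "[s = d] (mod \<Prod>Q)" by blast
  have "coprime (s + t * d) N" if t: "t < m" for t
  proof (rule ccontr)
    assume "\<not> coprime (s + t * d) N"
    then have "gcd (s + t * d) N \<noteq> 1" by (simp add: coprime_iff_gcd_eq_1)
    then obtain q where "prime q" "q dvd gcd (s + t * d) N" using prime_factor_nat by blast
    then have q: "prime q" "q dvd s + t * d" "q dvd N" by auto
    show False
    proof (cases "q dvd d")
      case True
      then have "[s = 1] (mod q)" using s(1) cong_dvd_modulus_nat by blast
      moreover have "q dvd s" using q(2) True by (metis dvd_add_left_iff dvd_mult)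
      ultimately have "q dvd 1" using cong_dvd_iff by blast
      then show False using q(1) by simp
    next
      case False
      then have "q \<in> Q" using q by (simp add: Q_def)
      then have "q dvd \<Prod>Q" using fQ by (intro dvd_prodI) auto
      then have "[s = d] (mod q)" using s(2) cong_dvd_modulus_nat by blast
      then have "[s + t * d = d + t * d] (mod q)" by (rule cong_add) simp
      then have "q dvd d + t * d" using q(2) cong_dvd_iff by blast
      then have "q dvd Suc t * d" by simp
      then have "q dvd Suc t" using q(1) False prime_dvd_mult_iff by blast
      then show False using d(2)[OF t] False dvd_trans by blast
    qed
  qed
  then show ?thesis using s(1) by blast
qed

lemma finite_common_order:
  assumes "finite J" "\<And>j. j \<in> J \<Longrightarrow> root_unity (z j)"
  shows "\<exists>N>0. \<forall>j\<in>J. z j ^ N = 1"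
  using assms
proof (induction J rule: finite_induct)
  case (insert a J)
  then obtain N where N: "N > 0" "\<forall>j\<in>J. z j ^ N = 1" by auto
  obtain n where n: "n > 0" "z a ^ n = 1" using insert.prems by (auto simp: root_unity_def)
  have "z j ^ (N * n) = 1" if "j \<in> insert a J" for j
    using that N n by (auto simp: power_mult) (metis mult.commute power_mult power_one)
  then show ?case using N n by (intro exI[of _ "N * n"]) auto
qed auto

lemma root_unity_inverse: "root_unity z \<Longrightarrow> root_unity (inverse z)"
  by (auto simp: root_unity_def power_inverse)

lemma root_unity_divide: "root_unity x \<Longrightarrow> root_unity y \<Longrightarrow> root_unity (x / y)"
  by (simp add: divide_inverse root_unity_mult root_unity_inverse)

lemma root_unity_nonzero: "root_unity z \<Longrightarrow> z \<noteq> 0"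
  by (auto simp: root_unity_def zero_power)

lemma infinite_pigeonhole:
  assumes "infinite I" "finite V" "\<And>n. n \<in> I \<Longrightarrow> g n \<in> V"
  shows "\<exists>v\<in>V. infinite {n\<in>I. g n = v}"
proof (rule ccontr)
  assume "\<not> ?thesis"
  then have "finite (\<Union>v\<in>V. {n\<in>I. g n = v})" using assms(2) by auto
  moreover have "I \<subseteq> (\<Union>v\<in>V. {n\<in>I. g n = v})" using assms(3) by auto
  ultimately show False using assms(1) finite_subset by blast
qed

section \<open>Sequences of sums of roots of unity at nonarchimedean places\<close>

definition ratio_free :: "nat set \<Rightarrow> nat set \<Rightarrow> (nat \<Rightarrow> nat \<Rightarrow> 'a::field) \<Rightarrow> bool" where
  "ratio_free I J z \<longleftrightarrow> (\<forall>i\<in>J. \<forall>j\<in>J. i \<noteq> j \<longrightarrow> (\<forall>D>0. finite {n\<in>I. (z n i / z n j) ^ D = 1}))"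

locale cyclotomic_sequence = subfield_of L for L :: "'a::{alg_closed_field,field_char_0} set" +
  fixes I :: "nat set" and B :: nat and c :: "nat \<Rightarrow> 'a" and z :: "nat \<Rightarrow> nat \<Rightarrow> 'a" and xs :: "nat \<Rightarrow> 'a"
  assumes mu: "\<And>z. root_unity z \<Longrightarrow> z \<in> L" and I: "infinite I" and c: "\<And>j. j < B \<Longrightarrow> c j \<in> L"
    and z: "\<And>n j. n \<in> I \<Longrightarrow> j < B \<Longrightarrow> root_unity (z n j)" and xs: "\<And>n. n \<in> I \<Longrightarrow> xs n = (\<Sum>j<B. c j * z n j)"
begin

text \<open>Among all representations on infinite subsets one with fewest terms is taken. If a ratio
  had bounded order infinitely often, it would be constant on an infinite subset and two terms could
  be merged.\<close>

lemma ratio_free_exists: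
  "\<exists>I' J c'. infinite I' \<and> I' \<subseteq> I \<and> finite J \<and> J \<subseteq> {..<B} \<and> (\<forall>j\<in>J. c' j \<in> L) \<and>
    (\<forall>n\<in>I'. xs n = (\<Sum>j\<in>J. c' j * z n j)) \<and> ratio_free I' J z"
proof -
  define Q where "Q = (\<lambda>k I' J c'. infinite I' \<and> I' \<subseteq> I \<and> J \<subseteq> {..<B} \<and> card J = k \<and> (\<forall>j\<in>J. c' j \<in> L) \<and>
    (\<forall>n\<in>I'. xs n = (\<Sum>j\<in>J. c' j * z n j)))"
  have "Q B I {..<B} c" using I c xs by (auto simp: Q_def)
  then have ex: "\<exists>k. \<exists>I' J c'. Q k I' J c'" by blast
  define k where "k = (LEAST k. \<exists>I' J c'. Q k I' J c')"
  obtain I' J c' where q: "Q k I' J c'" using LeastI_ex[OF ex] unfolding k_def by blast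
  have min: "\<not> Q l I' J c'" if "l < k" for l I' J c' using not_less_Least that unfolding k_def by blast
  have fJ: "finite J" "J \<subseteq> {..<B}" using q finite_subset by (auto simp: Q_def)
  have "finite {n\<in>I'. (z n i / z n j) ^ D = 1}" if ij: "i \<in> J" "j \<in> J" "i \<noteq> j" "D > 0" for i j D
  proof (rule ccontr)
    assume "infinite {n\<in>I'. (z n i / z n j) ^ D = 1}"
    from infinite_pigeonhole[OF this finite_nth_roots[OF ij(4)], of "\<lambda>n. z n i / z n j"]
    obtain et where et: "et ^ D = 1" "infinite {n \<in> {n\<in>I'. (z n i / z n j) ^ D = 1}. z n i / z n j = et}" by auto
    define I'' where "I'' = {n \<in> {n\<in>I'. (z n i / z n j) ^ D = 1}. z n i / z n j = et}"
    have I'': "I'' \<subseteq> I'" "I'' \<subseteq> I" using q by (auto simp: I''_def Q_def)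
    have etL: "et \<in> L" using et(1) ij(4) by (intro mu) (auto simp: root_unity_def)
    define c'' where "c'' = c'(j := c' j + c' i * et)"
    have "xs n = (\<Sum>l\<in>J - {i}. c'' l * z n l)" if n: "n \<in> I''" for n
    proof -
      have nI: "n \<in> I" using n I'' by blast
      have zj: "z n j \<noteq> 0" using z[OF nI, of j] fJ ij by (intro root_unity_nonzero) auto
      have "z n i = et * z n j" using n zj by (auto simp: I''_def field_simps)
      then have e: "c' i * z n i = c' i * et * z n j" by simp
      have J': "finite (J - {i})" "j \<in> J - {i}" using ij fJ by auto
      have "xs n = (\<Sum>l\<in>J. c' l * z n l)" using q n I'' by (auto simp: Q_def)
      also have "\<dots> = c' i * z n i + (c' j * z n j + (\<Sum>l\<in>J - {i} - {j}. c' l * z n l))"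
        using sum.remove[OF fJ(1) ij(1), of "\<lambda>l. c' l * z n l"] sum.remove[OF J', of "\<lambda>l. c' l * z n l"] by simp
      also have "\<dots> = c'' j * z n j + (\<Sum>l\<in>J - {i} - {j}. c'' l * z n l)"
        unfolding e by (simp add: c''_def algebra_simps)
      also have "\<dots> = (\<Sum>l\<in>J - {i}. c'' l * z n l)" using sum.remove[OF J', of "\<lambda>l. c'' l * z n l"] by simp
      finally show ?thesis .
    qed
    moreover have "c'' l \<in> L" if "l \<in> J - {i}" for l using that q ij etL by (auto simp: c''_def Q_def intro!: add mult)
    moreover have "card (J - {i}) = k - 1" "k > 0" using q ij fJ by (auto simp: Q_def card_gt_0_iff)
    ultimately have "Q (k - 1) I'' (J - {i}) c''" using et(2) I'' fJ unfolding Q_def I''_def[symmetric] by blast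
    moreover have "k - 1 < k" using \<open>k > 0\<close> by simp
    ultimately show False using min by blast
  qed
  then have "ratio_free I' J z" by (simp add: ratio_free_def)
  then show ?thesis using q fJ by (intro exI[of _ I'] exI[of _ J] exI[of _ c']) (auto simp: Q_def)
qed

text \<open>For large \<open>n\<close> the automorphisms with exponents \<open>s + t * d\<close>,
  \<open>t < m\<close>, turn the conjugates into power sums in the \<open>u j\<close>. The
  Vandermonde bound isolates the term with a large coefficient, up to factors
  \<open>u k - u i\<close>, which stay away from 0 because no ratio has order dividing
  \<open>d * p ^ e\<close>.\<close>

lemma nonarch_no_sequence:
  assumes alg: "\<And>x. x \<in> L \<Longrightarrow> algebraic x" and cy: "cycl_autos L" and X: "finite X" "X \<subseteq> L"
    and f: "\<And>n. n \<in> I \<Longrightarrow> nonarch_abs L (f n) p" and C: "C > 0"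
    and lower: "\<And>n. n \<in> I \<Longrightarrow> f n (xs n) > C"
    and upper: "\<And>n aut. n \<in> I \<Longrightarrow> hom_on L aut \<Longrightarrow> aut ` L \<subseteq> L \<Longrightarrow> (\<forall>x\<in>X. aut x = x) \<Longrightarrow> f n (aut (xs n)) < C + 1 / real (Suc n)"
  shows False
proof -
  obtain I' and J :: "nat set" and c' where I': "infinite I'" "I' \<subseteq> I" and J: "finite J" "J \<subseteq> {..<B}" and c'': "\<forall>j\<in>J. c' j \<in> L"
    and xs'': "\<forall>n\<in>I'. xs n = (\<Sum>j\<in>J. c' j * z n j)" and rf: "ratio_free I' J z"
    by atomize_elim (rule ratio_free_exists)
  note c' = bspec[OF c''] and xs' = bspec[OF xs'']
  have z': "root_unity (z n j)" if "n \<in> I'" "j \<in> J" for n j using z that I' J by blast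
  define m where "m = card J"
  define V where "V = (\<Union>k\<in>J. {g (c' k) | g. nonarch_abs L g p})"
  have fV: "finite V" unfolding V_def using J c' alg by (intro finite_UN_I finite_nonarch_values sf) auto
  have big: "\<exists>k\<in>J. f n (c' k) > C" if n: "n \<in> I'" for n
  proof (rule ccontr)
    assume no: "\<not> ?thesis"
    have nI: "n \<in> I" using n I' by blast
    interpret nonarch_abs L "f n" p using f[OF nI] .
    have fz: "f n (z n j) = 1" "z n j \<in> L" if "j \<in> J" for j
      using z'[OF n that] mu f_root_unity by (auto simp: root_unity_def)
    have "f n (\<Sum>j\<in>J. c' j * z n j) \<le> C"
      using no C c' fz by (intro ultrametric_sum[OF um]) (auto simp: mult f_mult not_less)
    then show False using lower[OF nI] xs'[OF n] by simp
  qed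
  \<comment> \<open>The coefficients have finitely many possible values, so exceeding
    \<open>C\<close> means exceeding it by a fixed amount.\<close>
  have "\<exists>de>C. \<forall>n\<in>I'. \<exists>k\<in>J. f n (c' k) \<ge> de"
  proof (intro exI[of _ "Min (insert (C + 1) {v\<in>V. v > C})"] conjI ballI)
    show "C < Min (insert (C + 1) {v \<in> V. C < v})" using fV by (subst Min_gr_iff) auto
    fix n assume n: "n \<in> I'"
    obtain k where k: "k \<in> J" "f n (c' k) > C" using big[OF n] by blast
    then have "f n (c' k) \<in> V" unfolding V_def using f n I' by blast
    then show "\<exists>k\<in>J. Min (insert (C + 1) {v \<in> V. C < v}) \<le> f n (c' k)" using fV k by (intro bexI[of _ k] Min_le) auto
  qed
  then obtain de where de: "de > C" "\<And>n. n \<in> I' \<Longrightarrow> \<exists>k\<in>J. f n (c' k) \<ge> de" by blast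
  have m0: "m > 0"
  proof -
    obtain n where "n \<in> I'" using I' by (metis finite.emptyI all_not_in_conv)
    then show ?thesis using de(2) J by (auto simp: m_def card_gt_0_iff)
  qed
  \<comment> \<open>At most \<open>m\<close> factors, each at least \<open>rh\<close>, diminish
    \<open>de\<close> no further than to the midpoint of \<open>C\<close> and
    \<open>de\<close>.\<close>
  define rh where "rh = root m ((C + de) / 2 / de)"
  have t01: "0 < (C + de) / 2 / de" "(C + de) / 2 / de < 1" using C de(1) by (auto simp: field_simps)
  have r01: "0 < rh" "rh < 1" unfolding rh_def using t01 m0 by (auto simp: real_root_lt_1_iff)
  have rm: "rh ^ m * de = (C + de) / 2" unfolding rh_def using t01 m0 C de(1) by (subst real_root_pow_pos) auto
  obtain n0 where "n0 \<in> I'" using I' by (metis finite.emptyI all_not_in_conv)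
  then have n0: "nonarch_abs L (f n0) p" using f I' by blast
  have p0: "p > 0" using prime_gt_0_nat[OF nonarch_abs.p[OF n0]] .
  \<comment> \<open>After \<open>e\<close> many \<open>p\<close>-th powers a root of unity within
    \<open>rh\<close> of 1 has become 1.\<close>
  obtain e where e: "max (1 / 2) rh ^ e < 1 / real p" using real_arch_pow_inv[of "1 / real p" "max (1 / 2) rh"] r01 p0 by auto
  have Xc: "finite (X \<union> c' ` J)" "X \<union> c' ` J \<subseteq> L" using X J c' by auto
  obtain M where M: "M > 0" "power_autos L (X \<union> c' ` J) M" using cycl_autosE[OF cy Xc] .
  \<comment> \<open>The factor \<open>M\<close> makes the exponents admissible for automorphisms,
    and \<open>fact m\<close> is divisible by the numbers up to \<open>m\<close>, as the coprime
    progression requires.\<close>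
  define d where "d = M * fact m"
  have d: "d > 0" "M dvd d" using M(1) by (auto simp: d_def)
  have dd: "Suc t dvd d" if "t < m" for t unfolding d_def using that by (intro dvd_mult dvd_fact) auto
  have fin: "finite (\<Union>i\<in>J. \<Union>j\<in>J - {i}. {n\<in>I'. (z n i / z n j) ^ (d * p ^ e) = 1})"
    using rf J d(1) p0 by (auto simp: ratio_free_def)
  obtain n1 where n1: "1 / real (Suc n1) < (de - C) / 2" using de(1) by (metis diff_gt_0_iff_gt half_gt_zero nat_approx_posE)
  let ?T = "I' - (\<Union>i\<in>J. \<Union>j\<in>J - {i}. {n\<in>I'. (z n i / z n j) ^ (d * p ^ e) = 1}) - {..n1}"
  have "infinite ?T" using I'(1) fin by (intro Diff_infinite_finite finite_atMost)
  then have "\<exists>n. n \<in> ?T" unfolding ex_in_conv by (rule infinite_imp_nonempty)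
  then obtain n where n': "n \<in> ?T" ..
  have n: "n \<in> I'" "n > n1" using n' by auto
  have n3: "(z n i / z n j) ^ (d * p ^ e) \<noteq> 1" if "i \<in> J" "j \<in> J" "i \<noteq> j" for i j
    using n' that by blast
  have nI: "n \<in> I" using n I' by blast
  interpret nonarch_abs L "f n" p using f[OF nI] .
  obtain k where k: "k \<in> J" "f n (c' k) \<ge> de" using de(2)[OF n(1)] by blast
  define xi where "xi = z n"
  have xi: "root_unity (xi j)" "xi j \<in> L" "f n (xi j) = 1" "xi j \<noteq> 0" if "j \<in> J" for j
  proof -
    show 1: "root_unity (xi j)" using z'[OF n(1) that] by (simp add: xi_def)
    show "xi j \<in> L" "xi j \<noteq> 0" using mu[OF 1] root_unity_nonzero[OF 1] .
    obtain r where "r > 0" "xi j ^ r = 1" using 1 by (auto simp: root_unity_def)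
    then show "f n (xi j) = 1" by (rule f_root_unity[OF mu[OF 1]])
  qed
  obtain N0 where N0: "N0 > 0" "\<forall>j\<in>J. xi j ^ N0 = 1" using finite_common_order[OF J(1)] xi(1) by blast
  define N where "N = N0 * d"
  have N: "N > 0" "M dvd N" "\<And>j. j \<in> J \<Longrightarrow> xi j ^ N = 1" using N0 d by (auto simp: N_def power_mult)
  obtain s where s: "[s = 1] (mod d)" "\<And>t. t < m \<Longrightarrow> coprime (s + t * d) N"
    using coprime_progression_exists[OF d(1) dd N(1)] by blast
  define b where "b = (\<lambda>j. c' j * xi j ^ s)"
  define u where "u = (\<lambda>j. xi j ^ d)"
  have b: "b j \<in> L" if "j \<in> J" for j using that c' xi by (auto simp: b_def intro!: mult power)
  have u: "u j \<in> L \<and> f n (u j) \<le> 1" if "j \<in> J" for j using that xi by (auto simp: u_def power f_power)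
  have bound: "f n (\<Sum>j\<in>J. b j * u j ^ t) \<le> C + 1 / real (Suc n)" if t: "t \<le> card (J - {k})" for t
  proof -
    have tm: "t < m" using t k(1) J(1) m0 by (simp add: m_def)
    have "[s + t * d = 1 + 0] (mod d)" using s(1) by (intro cong_add) (auto simp: cong_0_iff)
    then have "[s + t * d = 1] (mod M)" using d(2) cong_dvd_modulus_nat by fastforce
    from M(2)[unfolded power_autos_def, rule_format, OF N(1,2) s(2)[OF tm] this] obtain aut where aut: "hom_on L aut" "aut ` L \<subseteq> L"
      "\<forall>x\<in>X \<union> c' ` J. aut x = x" "\<forall>z. z ^ N = 1 \<longrightarrow> aut z = z ^ (s + t * d)" by blast
    interpret H: field_hom L aut using aut by unfold_locales
    have "aut (xs n) = (\<Sum>j\<in>J. aut (c' j * xi j))"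
      unfolding xs'[OF n(1)] using c' xi by (subst H.h_sum) (auto simp: xi_def intro!: mult)
    also have "\<dots> = (\<Sum>j\<in>J. b j * u j ^ t)"
    proof (rule sum.cong[OF refl])
      fix j assume j: "j \<in> J"
      have "aut (c' j * xi j) = aut (c' j) * aut (xi j)" using H.h_mult[OF c'[OF j] xi(2)[OF j]] .
      moreover have "aut (c' j) = c' j" "aut (xi j) = xi j ^ (s + t * d)" using aut(3,4) j N(3)[OF j] by auto
      ultimately show "aut (c' j * xi j) = b j * u j ^ t" by (simp add: b_def u_def power_add power_mult[symmetric] mult.commute[of t])
    qed
    finally show ?thesis using upper[OF nI aut(1,2)] aut(3) by (simp add: less_imp_le)
  qed
  have "f n (\<Sum>j\<in>J. b j * (\<Prod>i\<in>J - {k}. u j - u i)) \<le> C + 1 / real (Suc n)"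
    using J b u k by (intro vandermonde_bound bound) auto
  also have "(\<Sum>j\<in>J. b j * (\<Prod>i\<in>J - {k}. u j - u i)) = b k * (\<Prod>i\<in>J - {k}. u k - u i)"
  proof -
    have "b j * (\<Prod>i\<in>J - {k}. u j - u i) = 0" if "j \<in> J - {k}" for j
      using prod_zero[of "J - {k}" "\<lambda>i. u j - u i"] J that by auto
    then have "(\<Sum>j\<in>J - {k}. b j * (\<Prod>i\<in>J - {k}. u j - u i)) = 0" by (intro sum.neutral ballI)
    then show ?thesis using sum.remove[OF J(1) k(1), of "\<lambda>j. b j * (\<Prod>i\<in>J - {k}. u j - u i)"] by simp
  qed
  also have "f n \<dots> = f n (b k) * (\<Prod>i\<in>J - {k}. f n (u k - u i))"
  proof -
    have uL: "u k - u i \<in> L" if "i \<in> J - {k}" for i using u k that by (intro diff) auto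
    show ?thesis
      using f_mult[OF b[OF k(1)] prod[of "J - {k}" "\<lambda>i. u k - u i", OF uL]] f_prod[of "J - {k}" "\<lambda>i. u k - u i", OF uL] by simp
  qed
  also have "f n (b k) = f n (c' k)" using c' xi k by (simp add: b_def f_mult f_power power)
  finally have fin_le: "f n (c' k) * (\<Prod>i\<in>J - {k}. f n (u k - u i)) \<le> C + 1 / real (Suc n)" .
  \<comment> \<open>Otherwise the \<open>d\<close>-th power of the ratio would be so close to 1 that
    its \<open>p ^ e\<close>-th power is 1, which the choice of \<open>n\<close> excludes.\<close>
  have ge: "f n (u k - u i) \<ge> rh" if i: "i \<in> J - {k}" for i
  proof (rule ccontr)
    assume lt: "\<not> ?thesis"
    have iJ: "i \<in> J" "i \<noteq> k" using i by auto
    define y where "y = (xi i / xi k) ^ d"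
    have yr: "root_unity y" using xi iJ k by (auto simp: y_def intro!: root_unity_power root_unity_divide)
    have "u k - u i = u k * (1 - y)" using xi(4)[OF k(1)] by (simp add: u_def y_def power_divide field_simps)
    moreover have "f n (u k) = 1" using xi k by (simp add: u_def f_power)
    ultimately have "f n (1 - y) \<le> rh" using lt u[OF k(1)] mu[OF yr] by (simp add: f_mult diff)
    from root_unity_near_1_power[OF r01(2) e mu[OF yr] yr this]
    have "(xi i / xi k) ^ (d * p ^ e) = 1" by (simp add: y_def power_mult)
    then show False using n3[OF iJ(1) k(1) iJ(2)] by (simp add: xi_def)
  qed
  have "rh ^ m \<le> rh ^ card (J - {k})" using r01 J by (intro power_decreasing) (auto simp: m_def card_Diff1_le)
  also have "\<dots> = (\<Prod>i\<in>J - {k}. rh)" by simp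
  also have "\<dots> \<le> (\<Prod>i\<in>J - {k}. f n (u k - u i))" using ge r01 by (intro prod_mono) auto
  finally have "de * rh ^ m \<le> f n (c' k) * (\<Prod>i\<in>J - {k}. f n (u k - u i))"
    using k(2) r01 C de(1) by (intro mult_mono) auto
  also note fin_le
  finally have "(C + de) / 2 \<le> C + 1 / real (Suc n)" using rm by (simp add: mult.commute)
  moreover have "1 / real (Suc n) \<le> 1 / real (Suc n1)" using n(2) by (simp add: frac_le)
  moreover have "(C + de) / 2 = C + (de - C) / 2" by (simp add: field_simps)
  ultimately show False using n1 by linarith
qed

end

section \<open>Archimedean places\<close>

text \<open>The exponents at level \<open>N\<close> that act trivially on roots of unity of order
  dividing \<open>M\<close>.\<close>

definition units_cong_1 :: "nat \<Rightarrow> nat \<Rightarrow> nat set" where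
  "units_cong_1 N M = {s \<in> units_mod N. [s = 1] (mod M)}"

lemma units_cong_1_finite [simp, intro]: "finite (units_cong_1 N M)"
  using finite_subset[OF _ units_mod_finite[of N], of "units_cong_1 N M"] by (auto simp: units_cong_1_def)

lemma units_cong_1_card_pos: "N > 0 \<Longrightarrow> M dvd N \<Longrightarrow> card (units_cong_1 N M) > 0"
proof -
  assume N: "N > 0" "M dvd N"
  have "[1 mod N = 1] (mod N)" by (simp add: cong_def)
  then have "[1 mod N = 1] (mod M)" using N(2) cong_dvd_modulus_nat by blast
  then have "1 mod N \<in> units_cong_1 N M" using units_mod_nonempty[OF N(1)] by (simp add: units_cong_1_def)
  then show ?thesis by (auto simp: card_gt_0_iff)
qed

lemma units_cong_1_bij:
  assumes "N > 0" "M dvd N" "coprime u N" "[u = 1] (mod M)"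
  shows "bij_betw (\<lambda>s. (u * s) mod N) (units_cong_1 N M) (units_cong_1 N M)"
proof -
  note b = units_mod_bij[OF assms(1,3)]
  have inj: "inj_on (\<lambda>s. (u * s) mod N) (units_cong_1 N M)"
    using b unfolding bij_betw_def units_cong_1_def by (auto intro: inj_on_subset)
  have "(u * s) mod N \<in> units_cong_1 N M" if s: "s \<in> units_cong_1 N M" for s
  proof -
    have "[(u * s) mod N = u * s] (mod M)" using assms(2) cong_dvd_modulus_nat[of "(u * s) mod N" "u * s" N M] by (simp add: cong_def)
    also have "[u * s = 1 * 1] (mod M)" using s assms(4) by (intro cong_mult) (auto simp: units_cong_1_def)
    finally show ?thesis using s bij_betwE[OF b] by (auto simp: units_cong_1_def)
  qed
  then have "(\<lambda>s. (u * s) mod N) ` units_cong_1 N M \<subseteq> units_cong_1 N M" by blast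
  then show ?thesis using inj endo_inj_surj[OF units_cong_1_finite] unfolding bij_betw_def by blast
qed

text \<open>Choose a prime \<open>q\<close> that divides the order of \<open>w\<close> more often than \<open>M * fact X\<close>. Averaging over the
  multipliers \<open>1 + i * y\<close> with \<open>i < q\<close>, where \<open>w ^ y\<close> has order \<open>q\<close>, makes the sum vanish, except that
  one multiplier may fail to be coprime to \<open>q\<close>; this can only happen if \<open>q > X\<close>.\<close>
lemma root_unity_mean_bound:
  fixes w :: complex
  assumes N: "N > 0" "M dvd N" "w ^ N = 1" and X: "w ^ (M * fact X) \<noteq> 1"
  shows "real X * cmod (\<Sum>s\<in>units_cong_1 N M. w ^ s) \<le> real (card (units_cong_1 N M))"
proof -
  define G where "G = units_cong_1 N M"
  define S where "S = (\<Sum>s\<in>G. w ^ s)"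
  have rw: "root_unity w" using N by (auto simp: root_unity_def)
  obtain d where d: "d > 0" "\<And>k. w ^ k = 1 \<longleftrightarrow> d dvd k" using root_unity_order[OF rw] by blast
  have dN: "d dvd N" using N(3) d(2) by blast
  have cw: "cmod w = 1" using norm_power[of w N] N power_eq_iff_eq_base[of N "cmod w" 1] by simp
  have "\<not> d dvd M * fact X" using X d(2) by blast
  then have "\<exists>q. prime q \<and> \<not> multiplicity q d \<le> multiplicity q (M * fact X)"
    using multiplicity_le_imp_dvd[of d "M * fact X"] d(1) by blast
  then obtain q where q: "prime q" "multiplicity q d > multiplicity q (M * fact X)" by (auto simp: not_le)
  have M0: "M > 0" using N by (auto intro: dvd_pos_nat)
  have pe: "prime_elem q" using q(1) by (rule prime_imp_prime_elem)
  have mm: "multiplicity q (M * fact X) = multiplicity q M + multiplicity q (fact X)"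
    using M0 by (intro prime_elem_multiplicity_mult_distrib pe) auto
  define b where "b = multiplicity q d"
  have b1: "b \<ge> 1" and bM: "multiplicity q M \<le> b - 1" using q(2) mm by (auto simp: b_def)
  have nz: "N \<noteq> 0" "M \<noteq> 0" "d \<noteq> 0" and qu: "\<not> is_unit q" using N(1) M0 d(1) q(1) by auto
  obtain N' where N': "N = q ^ multiplicity q N * N'" "\<not> q dvd N'" by (rule multiplicity_decompose'[OF nz(1) qu])
  obtain M' where M': "M = q ^ multiplicity q M * M'" "\<not> q dvd M'" by (rule multiplicity_decompose'[OF nz(2) qu])
  obtain d' where d': "d = q ^ multiplicity q d * d'" "\<not> q dvd d'" by (rule multiplicity_decompose'[OF nz(3) qu])
  have N'0: "N' > 0" using N'(1) N(1) by (cases N') auto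
  have other: "m dvd N'" if "m dvd N" "\<not> q dvd m" for m
  proof -
    have "coprime m (q ^ multiplicity q N)" using q(1) that(2) prime_imp_coprime by (metis coprime_commute coprime_power_right_iff)
    then show ?thesis using that(1) N'(1) by (metis coprime_dvd_mult_right_iff)
  qed
  have M'N: "M' dvd N'" using M' N(2) by (intro other) (metis dvd_mult_right, simp)
  have d'N: "d' dvd N'" using d' dN by (intro other) (metis dvd_mult_right, simp)
  \<comment> \<open>Divisible by \<open>M\<close>, so that the multipliers \<open>1 + i * y\<close>
    stay in the group, and exactly \<open>b - 1\<close> times divisible by \<open>q\<close>, so that
    \<open>w ^ y\<close> has order \<open>q\<close>.\<close>
  define y where "y = q ^ (b - 1) * N'"
  have My: "M dvd y" unfolding y_def by (subst M'(1)) (intro mult_dvd_mono le_imp_power_dvd bM M'N)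
  have qN: "q dvd N"
  proof -
    have "q ^ b dvd d" unfolding b_def by (rule multiplicity_dvd)
    then have "q dvd d" using b1 by (metis dvd_power dvd_trans not_one_le_zero bot_nat_0.not_eq_extremum)
    then show ?thesis using dN dvd_trans by blast
  qed
  define v where "v = w ^ y"
  have "d dvd q * y"
  proof -
    have "q * y = q ^ b * N'" using b1 by (simp add: y_def flip: power_Suc mult.assoc)
    then show ?thesis using d'(1) d'N by (metis b_def mult_dvd_mono dvd_refl)
  qed
  then have vq: "v ^ q = 1" using d(2) by (simp add: v_def mult.commute flip: power_mult)
  have mult_y: "multiplicity q y = b - 1"
    unfolding y_def using multiplicity_prime_elem_times_other[OF pe N'(2), of "q ^ (b - 1)"] pe
    by (simp add: mult.commute[of _ N'] multiplicity_same_power prime_elem_not_zeroI prime_elem_not_unit)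
  have vs: "v ^ s \<noteq> 1" if s: "\<not> q dvd s" for s
  proof
    assume "v ^ s = 1"
    then have "d dvd y * s" using d(2) by (simp add: v_def flip: power_mult)
    moreover have "q ^ b dvd d" unfolding b_def by (rule multiplicity_dvd)
    ultimately have "q ^ b dvd s * y" by (metis dvd_trans mult.commute)
    moreover have "s * y \<noteq> 0" using s N'0 q(1) by (auto simp: y_def prime_gt_0_nat intro: ccontr)
    ultimately have "b \<le> multiplicity q (s * y)" using q(1) by (intro multiplicity_geI) auto
    also have "\<dots> = b - 1" using multiplicity_prime_elem_times_other[OF pe s, of y] mult_y by simp
    finally show False using b1 by simp
  qed
  \<comment> \<open>The multipliers that fail to be coprime to \<open>N\<close>; only
    \<open>q\<close> can be at fault, since the other primes of \<open>N\<close> divide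
    \<open>y\<close>.\<close>
  define E where "E = {i. i < q \<and> q dvd 1 + i * y}"
  have fE: "finite E" "E \<subseteq> {..<q}" by (auto simp: E_def)
  have geo: "(\<Sum>i<q. v ^ (s * i)) = 0" if "\<not> q dvd s" for s
  proof -
    have "(v ^ s) ^ q = 1" using vq by (metis mult.commute power_mult power_one)
    then show ?thesis using geometric_sum[OF vs[OF that], of q] by (simp add: power_mult)
  qed
  have cop: "coprime (1 + i * y) N" if i: "i \<in> {..<q} - E" for i
  proof (rule ccontr)
    assume "\<not> ?thesis"
    then have "gcd (1 + i * y) N \<noteq> 1" by (simp add: coprime_iff_gcd_eq_1)
    then obtain r where "prime r" "r dvd gcd (1 + i * y) N" using prime_factor_nat by blast
    then have r: "prime r" "r dvd 1 + i * y" "r dvd N" by auto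
    have "r dvd q ^ multiplicity q N * N'" using r(3) N'(1) by metis
    then have "r dvd q \<or> r dvd N'" using r(1) prime_dvd_mult_iff prime_dvd_power by blast
    then show False
    proof
      assume "r dvd q"
      then have "r = q" using r(1) q(1) primes_dvd_imp_eq by blast
      then show False using r(2) i by (auto simp: E_def)
    next
      assume "r dvd N'"
      then have "r dvd i * y" by (simp add: y_def)
      then have "r dvd 1" using r(2) by (metis dvd_add_left_iff)
      then show False using r(1) by simp
    qed
  qed
  have shift: "S = (\<Sum>s\<in>G. w ^ s * v ^ (s * i))" if i: "i \<in> {..<q} - E" for i
  proof -
    have "[1 + i * y = 1 + 0] (mod M)" using My by (intro cong_add) (auto simp: cong_0_iff)
    then have bij: "bij_betw (\<lambda>s. ((1 + i * y) * s) mod N) G G"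
      unfolding G_def using units_cong_1_bij[OF N(1,2) cop[OF i]] by simp
    have wmod: "w ^ (k mod N) = w ^ k" for k
      using N(3) by (metis mult_div_mod_eq power_add power_mult power_one mult_1)
    have "S = (\<Sum>s\<in>G. w ^ (((1 + i * y) * s) mod N))" unfolding S_def by (rule sum.reindex_bij_betw[OF bij, symmetric])
    also have "\<dots> = (\<Sum>s\<in>G. w ^ s * v ^ (s * i))"
      unfolding wmod v_def by (simp add: power_add algebra_simps flip: power_mult)
    finally show ?thesis .
  qed
  have cv: "cmod (v ^ k) = 1" for k using cw by (simp add: v_def norm_power)
  have "of_nat (q - card E) * S = (\<Sum>i\<in>{..<q} - E. S)" using fE by (simp add: card_Diff_subset)
  also have "\<dots> = (\<Sum>i\<in>{..<q} - E. \<Sum>s\<in>G. w ^ s * v ^ (s * i))" by (intro sum.cong refl shift)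
  also have "\<dots> = (\<Sum>s\<in>G. w ^ s * (\<Sum>i\<in>{..<q} - E. v ^ (s * i)))" by (subst sum.swap) (simp add: sum_distrib_left)
  also have "cmod \<dots> \<le> (\<Sum>s\<in>G. real (card E))"
  proof (rule sum_norm_le)
    fix s assume s: "s \<in> G"
    have "coprime s N" using s by (auto simp: G_def units_cong_1_def units_mod_def)
    then have "\<not> q dvd s" using qN q(1) by (metis coprime_common_divisor not_prime_unit)
    then have "(\<Sum>i\<in>{..<q} - E. v ^ (s * i)) = - (\<Sum>i\<in>E. v ^ (s * i))"
      using geo sum_diff[OF _ fE(2), of "\<lambda>i. v ^ (s * i)"] by simp
    then have "cmod (w ^ s * (\<Sum>i\<in>{..<q} - E. v ^ (s * i))) = cmod (\<Sum>i\<in>E. v ^ (s * i))" using cw by (simp add: norm_mult norm_power)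
    also have "\<dots> \<le> (\<Sum>i\<in>E. 1)" by (rule sum_norm_le) (simp add: cv)
    finally show "cmod (w ^ s * (\<Sum>i\<in>{..<q} - E. v ^ (s * i))) \<le> real (card E)" by simp
  qed
  finally have main: "real (q - card E) * cmod S \<le> real (card G) * real (card E)" by (simp add: norm_mult)
  show ?thesis
  \<comment> \<open>For \<open>b >= 2\<close> the prime \<open>q\<close> divides \<open>y\<close>
    and no multiplier is bad. For \<open>b = 1\<close> it does not divide \<open>fact X\<close>, so
    \<open>q > X\<close>, and at most one multiplier is bad.\<close>
  proof (cases "b \<ge> 2")
    case True
    then have "q dvd y" by (simp add: y_def dvd_mult2)
    then have "E = {}" using q(1) by (auto simp: E_def) (metis dvd_add_left_iff dvd_mult not_prime_unit One_nat_def plus_1_eq_Suc)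
    then have "real q * cmod S \<le> 0" using main by simp
    then have "S = 0" using prime_gt_0_nat[OF q(1)] by (simp add: mult_le_0_iff)
    then show ?thesis by (simp add: S_def G_def)
  next
    case False
    then have b: "b = 1" using b1 by simp
    have "multiplicity q (fact X :: nat) = 0" using q(2) mm b by (simp add: b_def)
    then have "\<not> q dvd (fact X :: nat)" using multiplicity_eq_zero_iff[of "fact X" q] qu by simp
    then have qX: "q > X" using prime_dvd_fact_iff[OF q(1)] by simp
    have "card E \<le> 1"
    proof -
      have le: "i = j" if ij: "i \<in> E" "j \<in> E" "i \<le> j" for i j
      proof -
        have "(1 + j * y) = (1 + i * y) + (j - i) * y" using ij(3) by (simp flip: distrib_right)
        then have "q dvd (j - i) * y" using ij(1,2) unfolding E_def by (metis (no_types, lifting) dvd_add_right_iff mem_Collect_eq)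
        moreover have "\<not> q dvd y" using N'(2) b by (simp add: y_def)
        ultimately have "q dvd j - i" using q(1) prime_dvd_mult_iff by blast
        moreover have "j - i < q" using ij(2) by (auto simp: E_def)
        ultimately show "i = j" using ij(3) by (auto dest: dvd_imp_le)
      qed
      have "\<forall>i\<in>E. \<forall>j\<in>E. i = j" using le by (metis nat_le_linear)
      then show ?thesis using fE by (simp add: card_le_Suc0_iff_eq)
    qed
    then have "X \<le> q - card E" using qX by simp
    then have "real X * cmod S \<le> real (q - card E) * cmod S" by (intro mult_right_mono) auto
    also note main
    also have "real (card G) * real (card E) \<le> real (card G) * 1" using \<open>card E \<le> 1\<close> by (intro mult_left_mono) auto
    finally show ?thesis by (simp add: S_def G_def)
  qed
qed

section \<open>Trigonometric polynomials on a torus\<close>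

definition mon :: "nat set \<Rightarrow> (nat \<Rightarrow> 'a::field) \<Rightarrow> (nat \<Rightarrow> int) \<Rightarrow> 'a" where
  "mon R t a = (\<Prod>i\<in>R. t i powi a i)"

lemma mon_0 [simp]: "mon R t (\<lambda>i. 0) = 1" by (simp add: mon_def)

lemma mon_add: "(\<And>i. i \<in> R \<Longrightarrow> t i \<noteq> 0) \<Longrightarrow> mon R t (\<lambda>i. a i + b i) = mon R t a * mon R t b"
  by (simp add: mon_def power_int_add prod.distrib[symmetric] cong: prod.cong)

lemma mon_powi: "mon R t a powi k = mon R t (\<lambda>i. a i * k)"
  unfolding mon_def by (induction R rule: infinite_finite_induct) (auto simp: power_int_mult_distrib power_int_mult)

lemma mon_power: "mon R (\<lambda>i. t i ^ s) a = mon R t a ^ s"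
  unfolding mon_def by (simp add: prod_power_distrib power_int_power power_int_power' mult.commute)

lemma mon_cong: "(\<And>i. i \<in> R \<Longrightarrow> t i = u i \<and> a i = b i) \<Longrightarrow> mon R t a = mon R u b"
  unfolding mon_def by (intro prod.cong refl) auto

lemma cmod_mon: "(\<And>i. i \<in> R \<Longrightarrow> cmod (t i) = 1) \<Longrightarrow> cmod (mon R t a) = 1"
  unfolding mon_def by (simp add: prod_norm[symmetric] norm_power_int)

lemma mon_cnj:
  assumes "\<And>i. i \<in> R \<Longrightarrow> cmod (t i) = 1"
  shows "mon R t a * cnj (mon R t b) = mon R t (\<lambda>i. a i - b i)"
proof -
  have nz: "t i \<noteq> 0" if "i \<in> R" for i using assms[OF that] by auto
  have "mon R t (\<lambda>i. (a i - b i) + b i) = mon R t (\<lambda>i. a i - b i) * mon R t b" by (rule mon_add) (use nz in auto)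
  then have "mon R t a = mon R t (\<lambda>i. a i - b i) * mon R t b" by simp
  moreover have "mon R t b * cnj (mon R t b) = of_real (cmod (mon R t b) ^ 2)" by (rule complex_norm_square[symmetric])
  then have "mon R t b * cnj (mon R t b) = 1" using cmod_mon[of R t b, OF assms] by simp
  ultimately show ?thesis by (simp add: mult.assoc)
qed

text \<open>Exponent vectors vanish outside \<open>R\<close>, so that a vector is determined by its
  entries on \<open>R\<close> and the box is finite.\<close>

definition box :: "nat set \<Rightarrow> nat \<Rightarrow> (nat \<Rightarrow> int) set" where
  "box R m = {a. (\<forall>i. i \<notin> R \<longrightarrow> a i = 0) \<and> (\<forall>i\<in>R. \<bar>a i\<bar> \<le> int m)}"

lemma box_finite_card:
  assumes R: "finite R"
  shows "finite (box R m)" "card (box R m) \<le> (2 * m + 1) ^ card R"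
proof -
  let ?P = "PiE R (\<lambda>_. {- int m..int m})"
  have inj: "inj_on (\<lambda>a. restrict a R) (box R m)"
  proof (rule inj_onI)
    fix a b assume ab: "a \<in> box R m" "b \<in> box R m" "restrict a R = restrict b R"
    have "a i = b i" for i
    proof (cases "i \<in> R")
      case True
      then show ?thesis using fun_cong[OF ab(3), of i] by simp
    next
      case False
      then show ?thesis using ab(1,2) by (simp add: box_def)
    qed
    then show "a = b" by blast
  qed
  have sub: "(\<lambda>a. restrict a R) ` box R m \<subseteq> ?P" by (auto simp: box_def abs_le_iff)
  have fP: "finite ?P" using R by (intro finite_PiE) auto
  have "card {- int m..int m} = 2 * m + 1" by simp
  then have "card ?P = (2 * m + 1) ^ card R" using R by (simp only: card_PiE prod_constant)
  then show "card (box R m) \<le> (2 * m + 1) ^ card R" using card_inj_on_le[OF inj sub fP] by simp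
  show "finite (box R m)" using finite_imageD[OF finite_subset[OF sub fP] inj] .
qed

text \<open>What matters is that the coefficients \<open>d\<close> do not depend on \<open>t\<close>
  and that the frequencies stay in a box growing linearly with \<open>k\<close>.\<close>

lemma trig_power_expansion:
  fixes ga :: "nat \<Rightarrow> complex"
  assumes R: "finite R" and e: "\<And>j. j < B \<Longrightarrow> e j \<in> box R m"
  shows "\<exists>d. \<forall>t. (\<forall>i\<in>R. t i \<noteq> 0) \<longrightarrow> (\<Sum>j<B. ga j * mon R t (e j)) ^ k = (\<Sum>a\<in>box R (m * k). d a * mon R t a)"
proof (induction k)
  case 0
  have "box R (m * 0) = {\<lambda>i. 0}" by (auto simp: box_def)
  then show ?case by (intro exI[of _ "\<lambda>_. 1"]) simp
next
  case (Suc k)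
  then obtain d where d: "\<And>t. \<forall>i\<in>R. t i \<noteq> 0 \<Longrightarrow> (\<Sum>j<B. ga j * mon R t (e j)) ^ k = (\<Sum>a\<in>box R (m * k). d a * mon R t a)" by blast
  let ?A = "{..<B} \<times> box R (m * k)"
  define g where "g = (\<lambda>(j, a) i. e j i + a i :: int)"
  define d' where "d' = (\<lambda>b. \<Sum>x\<in>{x\<in>?A. g x = b}. ga (fst x) * d (snd x))"
  have gA: "g ` ?A \<subseteq> box R (m * Suc k)"
  proof safe
    fix j a assume ja: "j < B" "a \<in> box R (m * k)"
    have "\<bar>e j i + a i\<bar> \<le> int m + int (m * k)" if "i \<in> R" for i
      using e[OF ja(1)] ja(2) that unfolding box_def by (intro order_trans[OF abs_triangle_ineq] add_mono) auto
    then show "g (j, a) \<in> box R (m * Suc k)" using e[OF ja(1)] ja(2) by (auto simp: g_def box_def)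
  qed
  have fin: "finite ?A" "finite (box R (m * Suc k))" using box_finite_card[OF R] by auto
  have "(\<Sum>j<B. ga j * mon R t (e j)) ^ Suc k = (\<Sum>b\<in>box R (m * Suc k). d' b * mon R t b)" if t: "\<forall>i\<in>R. t i \<noteq> 0" for t
  proof -
    have "(\<Sum>j<B. ga j * mon R t (e j)) ^ Suc k = (\<Sum>j<B. ga j * mon R t (e j)) * (\<Sum>a\<in>box R (m * k). d a * mon R t a)"
      using d[OF t] by simp
    also have "\<dots> = (\<Sum>x\<in>?A. ga (fst x) * mon R t (e (fst x)) * (d (snd x) * mon R t (snd x)))"
      by (simp add: sum_product sum.cartesian_product case_prod_unfold)
    also have "\<dots> = (\<Sum>x\<in>?A. ga (fst x) * d (snd x) * mon R t (g x))"
      using t by (intro sum.cong refl) (auto simp: g_def mon_add)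
    also have "\<dots> = (\<Sum>b\<in>box R (m * Suc k). \<Sum>x\<in>{x\<in>?A. g x = b}. ga (fst x) * d (snd x) * mon R t (g x))"
      by (rule sum.group[OF fin gA, symmetric])
    also have "\<dots> = (\<Sum>b\<in>box R (m * Suc k). d' b * mon R t b)"
      unfolding d'_def sum_distrib_right by (intro sum.cong refl) auto
    finally show ?thesis .
  qed
  then show ?case by blast
qed

lemma sum_power2_le: "(\<Sum>a\<in>A. x a) ^ 2 \<le> real (card A) * (\<Sum>a\<in>A. x a ^ 2 :: real)"
proof -
  have "x a * x b \<le> x a ^ 2 / 2 + x b ^ 2 / 2" for a b using sum_squares_bound[of "x a" "x b"] by simp
  then have "(\<Sum>a\<in>A. x a) ^ 2 \<le> (\<Sum>a\<in>A. \<Sum>b\<in>A. x a ^ 2 / 2 + x b ^ 2 / 2)"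
    unfolding power2_eq_square[of "sum x A"] sum_product by (intro sum_mono)
  also have "\<dots> = real (card A) * (\<Sum>a\<in>A. x a ^ 2)"
    by (simp add: sum.distrib sum_distrib_left[symmetric] sum_divide_distrib[symmetric])
  finally show ?thesis .
qed

lemma cmod_root_unity: "root_unity w \<Longrightarrow> cmod w = 1"
proof -
  assume "root_unity w"
  then obtain n where "n > 0" "w ^ n = 1" by (auto simp: root_unity_def)
  then show ?thesis using norm_power[of w n] power_eq_iff_eq_base[of n "cmod w" 1] by simp
qed

text \<open>The hypothesis \<open>free\<close> is Weyl's condition in arithmetic form: no nontrivial
  character equals 1 at infinitely many of the points \<open>t n\<close>.\<close>

locale equidistributed =
  fixes R :: "nat set" and I :: "nat set" and t :: "nat \<Rightarrow> nat \<Rightarrow> complex" and M :: nat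
  assumes R: "finite R" and I: "infinite I" and ru: "\<And>n i. n \<in> I \<Longrightarrow> i \<in> R \<Longrightarrow> root_unity (t n i)"
    and free: "\<And>a. \<exists>i\<in>R. a i \<noteq> 0 \<Longrightarrow> finite {n\<in>I. mon R (t n) a = 1}" and M: "M > 0"
begin

text \<open>The squared absolute value is averaged over the exponents \<open>s\<close>. Diagonal
  terms give the sum of the \<open>cmod (d a) ^ 2\<close>; the others carry means of nontrivial
  characters, which are at most \<open>1 / X\<close> for large \<open>n\<close>.\<close>

lemma moment_bound:
  fixes d :: "(nat \<Rightarrow> int) \<Rightarrow> complex"
  assumes A: "finite A" "\<And>a i. a \<in> A \<Longrightarrow> i \<notin> R \<Longrightarrow> a i = 0" and h: "h \<longlonglongrightarrow> H"
    and bd: "\<And>n N s. n \<in> I \<Longrightarrow> N > 0 \<Longrightarrow> M dvd N \<Longrightarrow> \<forall>i\<in>R. t n i ^ N = 1 \<Longrightarrow> coprime s N \<Longrightarrow> [s = 1] (mod M) \<Longrightarrow>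
      cmod (\<Sum>a\<in>A. d a * mon R (t n) a ^ s) ^ 2 \<le> h n"
  shows "(\<Sum>a\<in>A. cmod (d a) ^ 2) \<le> H"
proof (rule ccontr)
  assume neg: "\<not> ?thesis"
  define D2 where "D2 = (\<Sum>a\<in>A. cmod (d a) ^ 2)"
  define D1 where "D1 = (\<Sum>a\<in>A. cmod (d a))"
  define de where "de = (D2 - H) / 2"
  have de: "de > 0" using neg by (simp add: de_def D2_def)
  \<comment> \<open>Large enough for all off-diagonal terms together to stay below
    \<open>de\<close>, half of the supposed excess.\<close>
  obtain X where X: "real X > D1 ^ 2 / de" using reals_Archimedean2 by blast
  have X0: "real X > 0" using X de by (smt (verit) divide_nonneg_pos zero_le_power2)
  have XD: "D1 ^ 2 / real X < de" using X de X0 by (simp add: field_simps)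
  have "\<forall>\<^sub>F n in sequentially. h n < H + de" using order_tendstoD(2)[OF h, of "H + de"] de by simp
  then obtain n0 where n0: "\<And>n. n \<ge> n0 \<Longrightarrow> h n < H + de" by (auto simp: eventually_sequentially)
  \<comment> \<open>The indices at which some difference of two characters is killed by
    \<open>M * fact X\<close>; outside them \<open>root_unity_mean_bound\<close> applies to every
    pair.\<close>
  let ?Z = "\<Union>a\<in>A. \<Union>b\<in>A - {a}. {n\<in>I. mon R (t n) (\<lambda>i. (a i - b i) * int (M * fact X)) = 1}"
  have "finite ?Z"
  proof (intro finite_UN_I A finite_Diff)
    fix a b assume ab: "a \<in> A" "b \<in> A - {a}"
    then have "a \<noteq> b" by blast
    then have "\<exists>i. a i \<noteq> b i" by (simp add: fun_eq_iff)
    then have "\<exists>i\<in>R. a i \<noteq> b i" using A(2) ab by (metis DiffD1)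
    then show "finite {n\<in>I. mon R (t n) (\<lambda>i. (a i - b i) * int (M * fact X)) = 1}" using M by (intro free) auto
  qed
  then have "infinite (I - ?Z - {..<n0})" using I by (intro Diff_infinite_finite finite_lessThan)
  then have "\<exists>n. n \<in> I - ?Z - {..<n0}" unfolding ex_in_conv by (rule infinite_imp_nonempty)
  then obtain n where n': "n \<in> I - ?Z - {..<n0}" ..
  then have n: "n \<in> I" "n \<ge> n0" by auto
  define m where "m = (\<lambda>a. mon R (t n) a)"
  have ct: "cmod (t n i) = 1" if "i \<in> R" for i using cmod_root_unity ru[OF n(1) that] .
  obtain N0 where N0: "N0 > 0" "\<forall>i\<in>R. t n i ^ N0 = 1" using finite_common_order[of R "t n", OF R ru[OF n(1)]] by blast
  define N where "N = N0 * M"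
  have N: "N > 0" "M dvd N" "\<forall>i\<in>R. t n i ^ N = 1" using N0 M by (auto simp: N_def power_mult)
  define G where "G = units_cong_1 N M"
  have G0: "real (card G) > 0" unfolding G_def using units_cong_1_card_pos[OF N(1,2)] by simp
  have mN: "m a ^ N = 1" for a
    using N(3) unfolding m_def mon_power[symmetric] by (simp add: mon_def)
  have mc: "m a * cnj (m b) = m (\<lambda>i. a i - b i)" for a b unfolding m_def by (rule mon_cnj[OF ct])
  have off: "cmod (\<Sum>s\<in>G. m (\<lambda>i. a i - b i) ^ s) \<le> real (card G) / real X" if ab: "a \<in> A" "b \<in> A" "a \<noteq> b" for a b
  proof -
    have "mon R (t n) (\<lambda>i. (a i - b i) * int (M * fact X)) \<noteq> 1" using n' ab by blast
    then have "m (\<lambda>i. a i - b i) ^ (M * fact X) \<noteq> 1"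
      unfolding m_def by (subst (asm) mon_powi[symmetric]) (simp only: power_int_of_nat, simp)
    from root_unity_mean_bound[OF N(1,2) mN this] show ?thesis using X0 by (simp add: G_def field_simps)
  qed
  define T where "T = (\<lambda>a b. d a * cnj (d b) * (\<Sum>s\<in>G. m (\<lambda>i. a i - b i) ^ s))"
  define F where "F = (\<lambda>s. \<Sum>a\<in>A. d a * m a ^ s)"
  have F2: "complex_of_real (cmod (F s) ^ 2) = (\<Sum>a\<in>A. \<Sum>b\<in>A. d a * cnj (d b) * m (\<lambda>i. a i - b i) ^ s)" for s
  proof -
    have "complex_of_real (cmod (F s) ^ 2) = F s * cnj (F s)" by (rule complex_norm_square)
    also have "\<dots> = (\<Sum>a\<in>A. \<Sum>b\<in>A. (d a * m a ^ s) * cnj (d b * m b ^ s))" by (simp only: F_def cnj_sum sum_product)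
    also have "\<dots> = (\<Sum>a\<in>A. \<Sum>b\<in>A. d a * cnj (d b) * m (\<lambda>i. a i - b i) ^ s)"
      by (intro sum.cong refl) (simp add: mc[symmetric] power_mult_distrib mult_ac)
    finally show ?thesis .
  qed
  have "complex_of_real (\<Sum>s\<in>G. cmod (F s) ^ 2) = (\<Sum>s\<in>G. \<Sum>a\<in>A. \<Sum>b\<in>A. d a * cnj (d b) * m (\<lambda>i. a i - b i) ^ s)"
    unfolding of_real_sum by (intro sum.cong refl F2)
  also have "\<dots> = (\<Sum>a\<in>A. \<Sum>b\<in>A. \<Sum>s\<in>G. d a * cnj (d b) * m (\<lambda>i. a i - b i) ^ s)"
    by (subst sum.swap) (intro sum.cong refl sum.swap)
  also have "\<dots> = (\<Sum>a\<in>A. \<Sum>b\<in>A. T a b)" by (simp add: T_def sum_distrib_left)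
  also have "\<dots> = (\<Sum>a\<in>A. of_real (real (card G) * cmod (d a) ^ 2) + (\<Sum>b\<in>A - {a}. T a b))"
  proof (rule sum.cong[OF refl])
    fix a assume a: "a \<in> A"
    have "T a a = of_real (real (card G) * cmod (d a) ^ 2)"
      by (simp add: T_def m_def complex_norm_square[symmetric])
    then show "(\<Sum>b\<in>A. T a b) =
       of_real (real (card G) * cmod (d a) ^ 2) + (\<Sum>b\<in>A - {a}. T a b)"
      using sum.remove[OF A(1) a, of "T a"] by simp
  qed
  also have "\<dots> = of_real (real (card G) * D2) + (\<Sum>a\<in>A. \<Sum>b\<in>A - {a}. T a b)"
    by (simp only: sum.distrib D2_def sum_distrib_left of_real_sum)
  finally have eq: "of_real (real (card G) * D2) = complex_of_real (\<Sum>s\<in>G. cmod (F s) ^ 2) - (\<Sum>a\<in>A. \<Sum>b\<in>A - {a}. T a b)"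
    by (simp add: algebra_simps)
  have "cmod (\<Sum>a\<in>A. \<Sum>b\<in>A - {a}. T a b) \<le> (\<Sum>a\<in>A. \<Sum>b\<in>A - {a}. cmod (d a) * cmod (d b) * (real (card G) / real X))"
  proof (intro sum_norm_le)
    fix a b assume ab: "a \<in> A" "b \<in> A - {a}"
    then have "cmod (\<Sum>s\<in>G. m (\<lambda>i. a i - b i) ^ s) \<le> real (card G) / real X" by (intro off) auto
    then show "cmod (T a b) \<le> cmod (d a) * cmod (d b) * (real (card G) / real X)"
      unfolding T_def norm_mult complex_mod_cnj by (intro mult_left_mono) auto
  qed
  also have "\<dots> \<le> (\<Sum>a\<in>A. \<Sum>b\<in>A. cmod (d a) * cmod (d b) * (real (card G) / real X))"
    using A(1) by (intro sum_mono sum_mono2) auto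
  also have "\<dots> = (\<Sum>a\<in>A. \<Sum>b\<in>A. cmod (d a) * cmod (d b)) * (real (card G) / real X)" by (simp only: sum_distrib_right)
  also have "(\<Sum>a\<in>A. \<Sum>b\<in>A. cmod (d a) * cmod (d b)) = D1 ^ 2" by (simp only: D1_def power2_eq_square sum_product)
  finally have offs: "cmod (\<Sum>a\<in>A. \<Sum>b\<in>A - {a}. T a b) \<le> D1 ^ 2 * (real (card G) / real X)" .
  have Fs: "cmod (F s) ^ 2 \<le> h n" if "s \<in> G" for s
    unfolding F_def m_def by (rule bd[OF n(1) N]) (use that in \<open>auto simp: G_def units_cong_1_def units_mod_def\<close>)
  have "(\<Sum>s\<in>G. cmod (F s) ^ 2) \<le> real (card G) * h n" using sum_mono[OF Fs, of G] by simp
  moreover have "0 \<le> (\<Sum>s\<in>G. cmod (F s) ^ 2)" by (intro sum_nonneg) auto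
  moreover have "cmod (of_real (real (card G) * D2)) \<le> cmod (complex_of_real (\<Sum>s\<in>G. cmod (F s) ^ 2)) + D1 ^ 2 * (real (card G) / real X)"
    unfolding eq by (rule order_trans[OF norm_triangle_ineq4 add_left_mono[OF offs]])
  ultimately have "real (card G) * D2 \<le> real (card G) * h n + D1 ^ 2 * (real (card G) / real X)"
    unfolding norm_of_real by linarith
  also have "\<dots> = real (card G) * (h n + D1 ^ 2 / real X)" by (simp add: field_simps)
  finally have "D2 \<le> h n + D1 ^ 2 / real X" using G0 by simp
  then show False using n0[OF n(2)] XD by (simp add: de_def field_simps)
qed

text \<open>The Fourier coefficients of \<open>\<phi>\<^sup>k\<close> are bounded by \<open>C\<^sup>k\<close> in square mean and their number grows only
  polynomially in \<open>k\<close>.\<close>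
lemma torus_bound:
  fixes ga :: "nat \<Rightarrow> complex"
  assumes C: "C > 0" and e: "\<And>j i. j < B \<Longrightarrow> i \<notin> R \<Longrightarrow> e j i = 0"
    and bd: "\<And>n N s. n \<in> I \<Longrightarrow> N > 0 \<Longrightarrow> M dvd N \<Longrightarrow> \<forall>i\<in>R. t n i ^ N = 1 \<Longrightarrow> coprime s N \<Longrightarrow> [s = 1] (mod M) \<Longrightarrow>
      cmod (\<Sum>j<B. ga j * mon R (t n) (e j) ^ s) \<le> C + 1 / real (Suc n)"
    and x: "\<And>i. i \<in> R \<Longrightarrow> cmod (x i) = 1"
  shows "cmod (\<Sum>j<B. ga j * mon R x (e j)) \<le> C"
proof (rule ccontr)
  assume neg: "\<not> ?thesis"
  define \<phi> where "\<phi> = (\<lambda>x. \<Sum>j<B. ga j * mon R x (e j))"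
  define q where "q = cmod (\<phi> x) / C"
  have q: "q > 1" using neg C by (simp add: q_def \<phi>_def)
  define E where "E = nat (\<Sum>j<B. \<Sum>i\<in>R. \<bar>e j i\<bar>)"
  have eb: "e j \<in> box R E" if j: "j < B" for j
  proof -
    have "\<bar>e j i\<bar> \<le> int E" if "i \<in> R" for i
    proof -
      have "\<bar>e j i\<bar> \<le> (\<Sum>i\<in>R. \<bar>e j i\<bar>)" using R that by (intro member_le_sum) auto
      also have "\<dots> \<le> (\<Sum>j<B. \<Sum>i\<in>R. \<bar>e j i\<bar>)" using j by (intro member_le_sum[of j "{..<B}" "\<lambda>j. \<Sum>i\<in>R. \<bar>e j i\<bar>"]) (auto intro: sum_nonneg)
      finally have "\<bar>e j i\<bar> \<le> (\<Sum>j<B. \<Sum>i\<in>R. \<bar>e j i\<bar>)" .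
      moreover have "0 \<le> (\<Sum>j<B. \<Sum>i\<in>R. \<bar>e j i\<bar>)" by (intro sum_nonneg) auto
      ultimately show ?thesis unfolding E_def by simp
    qed
    then show ?thesis using e[OF j] by (auto simp: box_def)
  qed
  have growth: "(q ^ k) ^ 2 \<le> real (2 * (E * k) + 1) ^ card R" for k
  proof -
    let ?A = "box R (E * k)"
    obtain d where "\<forall>y. (\<forall>i\<in>R. y i \<noteq> 0) \<longrightarrow> (\<Sum>j<B. ga j * mon R y (e j)) ^ k = (\<Sum>a\<in>?A. d a * mon R y a)"
      by atomize_elim (rule trig_power_expansion[where B = B and e = e, OF R eb])
    then have d: "\<And>y. \<forall>i\<in>R. y i \<noteq> 0 \<Longrightarrow> \<phi> y ^ k = (\<Sum>a\<in>?A. d a * mon R y a)" by (simp add: \<phi>_def)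
    have fA: "finite ?A" and cA: "card ?A \<le> (2 * (E * k) + 1) ^ card R" using box_finite_card[OF R] by auto
    have h: "(\<lambda>n. ((C + 1 / real (Suc n)) ^ k) ^ 2) \<longlonglongrightarrow> ((C + 0) ^ k) ^ 2"
      by (intro tendsto_power tendsto_add tendsto_const) (use LIMSEQ_inverse_real_of_nat in \<open>simp add: inverse_eq_divide\<close>)
    have "(\<Sum>a\<in>?A. cmod (d a) ^ 2) \<le> ((C + 0) ^ k) ^ 2"
    proof (rule moment_bound[OF fA _ h])
      show "a i = 0" if "a \<in> ?A" "i \<notin> R" for a i using that by (simp add: box_def)
      fix n N s assume a: "n \<in> I" "N > 0" "M dvd N" "\<forall>i\<in>R. t n i ^ N = 1" "coprime s N" "[s = 1] (mod M)"
      define y where "y = (\<lambda>i. t n i ^ s)"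
      have "\<forall>i\<in>R. y i \<noteq> 0" using root_unity_nonzero[OF ru[OF a(1)]] by (simp add: y_def)
      from d[OF this] have "(\<Sum>a\<in>?A. d a * mon R (t n) a ^ s) = \<phi> y ^ k" by (simp add: y_def mon_power)
      moreover have "cmod (\<phi> y) \<le> C + 1 / real (Suc n)" using bd[OF a] by (simp add: \<phi>_def y_def mon_power)
      ultimately show "cmod (\<Sum>a\<in>?A. d a * mon R (t n) a ^ s) ^ 2 \<le> ((C + 1 / real (Suc n)) ^ k) ^ 2"
        by (simp only: norm_power) (intro power_mono, auto)
    qed
    then have D2: "(\<Sum>a\<in>?A. cmod (d a) ^ 2) \<le> (C ^ k) ^ 2" by simp
    have "\<forall>i\<in>R. x i \<noteq> 0" using x by fastforce
    from d[OF this] have "cmod (\<phi> x) ^ k = cmod (\<Sum>a\<in>?A. d a * mon R x a)" by (simp add: norm_power[symmetric])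
    also have "\<dots> \<le> (\<Sum>a\<in>?A. cmod (d a))"
      by (rule sum_norm_le) (simp add: norm_mult cmod_mon[OF x])
    finally have "(cmod (\<phi> x) ^ k) ^ 2 \<le> (\<Sum>a\<in>?A. cmod (d a)) ^ 2" by (intro power_mono) auto
    also have "\<dots> \<le> real (card ?A) * (\<Sum>a\<in>?A. cmod (d a) ^ 2)"
      by (rule sum_power2_le)
    also have "\<dots> \<le> real ((2 * (E * k) + 1) ^ card R) * (C ^ k) ^ 2"
      by (intro mult_mono sum_nonneg D2) (simp_all only: of_nat_le_iff cA zero_le_power2 of_nat_0_le_iff)
    finally have "(cmod (\<phi> x) ^ k) ^ 2 / (C ^ k) ^ 2 \<le> real ((2 * (E * k) + 1) ^ card R)" using C by (simp add: field_simps)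
    then show ?thesis by (simp add: q_def power_divide)
  qed
  define r where "r = Suc (card R)"
  \<comment> \<open>The growth is polynomial of degree \<open>card R\<close>; an \<open>r\<close>-th
    root makes it linear, as \<open>le_one_of_power_bound\<close> needs.\<close>
  define y where "y = root r q"
  have "y ^ r = q" unfolding y_def using q by (intro real_root_pow_pos2) (auto simp: r_def)
  moreover have "y > 1" unfolding y_def using q by (subst real_root_gt_1_iff) (auto simp: r_def)
  ultimately have y: "y > 1" "y ^ r = q" by auto
  have le: "y ^ k \<le> real (2 * (E * k) + 1)" for k
  proof -
    have "(y ^ k) ^ r = q ^ k" using y(2) by (metis mult.commute power_mult)
    also have "\<dots> \<le> (q ^ k) ^ 2" using q by (intro self_le_power) auto
    also have "\<dots> \<le> real (2 * (E * k) + 1) ^ card R" by (rule growth)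
    also have "\<dots> \<le> real (2 * (E * k) + 1) ^ r" by (intro power_increasing) (auto simp: r_def)
    finally show ?thesis by (rule power_le_imp_le_base[of _ "card R", folded r_def]) simp
  qed
  then have "y \<le> 1" by (intro le_one_of_power_bound[of y "2 * real E" 1]) (simp add: algebra_simps)
  then show False using y(1) by simp
qed

end

lemma root_unity_powi_root:
  fixes z :: "'a::{alg_closed_field,field_char_0}"
  assumes z: "root_unity z" and A: "A \<noteq> 0"
  shows "\<exists>x. root_unity x \<and> x powi A = z"
proof -
  obtain n where n: "n > 0" "z ^ n = 1" using z by (auto simp: root_unity_def)
  define m where "m = nat \<bar>A\<bar>"
  have m: "m > 0" using A by (simp add: m_def)
  obtain y where y: "y ^ m = z" using nth_root_exists[OF m] by blast
  have ry: "root_unity y" unfolding root_unity_def using n m y by (intro exI[of _ "m * n"]) (auto simp: power_mult)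
  show ?thesis
  proof (cases "A > 0")
    case True
    then have "A = int m" by (simp add: m_def)
    then show ?thesis using y ry by (intro exI[of _ y]) simp
  next
    case False
    then have "A = - int m" by (simp add: m_def)
    then have "inverse y powi A = z" using y by (simp add: power_int_minus power_inverse)
    then show ?thesis using root_unity_inverse[OF ry] by blast
  qed
qed

lemma root_unity_powi: "root_unity z \<Longrightarrow> root_unity (z powi k)"
  by (cases k rule: int_cases2) (auto simp: power_int_minus intro: root_unity_power root_unity_inverse)

lemma root_unity_mon: "(\<And>i. i \<in> R \<Longrightarrow> root_unity (t i)) \<Longrightarrow> root_unity (mon R t a)"
proof (induction R rule: infinite_finite_induct)
  case (insert i R)
  then show ?case by (auto simp: mon_def intro!: root_unity_mult root_unity_powi)
qed (auto simp: mon_def root_unity_def)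

text \<open>A multiplicative relation among the \<open>y n i\<close> that holds for infinitely many \<open>n\<close> allows one
  to eliminate a variable after extracting roots of the others.\<close>
lemma mon_eliminate:
  fixes y :: "nat \<Rightarrow> nat \<Rightarrow> 'a::{alg_closed_field,field_char_0}"
  assumes I: "infinite I" and R: "finite R" "k \<in> R" "a k \<noteq> 0"
    and y: "\<And>n i. n \<in> I \<Longrightarrow> i \<in> R \<Longrightarrow> root_unity (y n i)" and rel: "\<And>n. n \<in> I \<Longrightarrow> mon R (y n) a = 1"
  shows "\<exists>I' v u. infinite I' \<and> I' \<subseteq> I \<and> root_unity v \<and> (\<forall>n\<in>I'. \<forall>i\<in>R - {k}. root_unity (u n i)) \<and>
    (\<forall>n\<in>I'. \<forall>b. mon R (y n) b = v powi b k * mon (R - {k}) (u n) (\<lambda>i. a k * b i - a i * b k))"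
proof -
  define A where "A = a k"
  define R' where "R' = R - {k}"
  define u where "u = (\<lambda>n i. SOME x. root_unity x \<and> x powi A = y n i)"
  have u: "root_unity (u n i)" "u n i powi A = y n i" if "n \<in> I" "i \<in> R'" for n i
    using someI_ex[OF root_unity_powi_root[OF y[OF that(1), of i], of A]] that R by (auto simp: u_def A_def R'_def)
  have split: "mon R (y n) b = y n k powi b k * mon R' (y n) b" for n b
    unfolding mon_def R'_def using R by (intro prod.remove) auto
  have R'y: "mon R' (y n) b = mon R' (u n) (\<lambda>i. A * b i)" if "n \<in> I" for n b
    unfolding mon_def using u[OF that] by (intro prod.cong refl) (simp add: power_int_mult)
  have unz: "u n i \<noteq> 0" if "n \<in> I" "i \<in> R'" for n i using root_unity_nonzero u(1)[OF that] .
  \<comment> \<open>The relation says \<open>v n powi A = 1\<close>, so \<open>v n\<close> has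
    finitely many values and is constant on an infinite set.\<close>
  define v where "v = (\<lambda>n. y n k * mon R' (u n) a)"
  have vA: "v n ^ nat \<bar>A\<bar> = 1" if n: "n \<in> I" for n
  proof -
    have "v n powi A = y n k powi A * mon R' (u n) (\<lambda>i. A * a i)" by (simp add: v_def power_int_mult_distrib mon_powi mult.commute)
    also have "\<dots> = 1" using rel[OF n] split[of n a] R'y[OF n, of a] by (simp add: A_def)
    finally have "v n powi A = 1" .
    then show ?thesis by (cases A rule: int_cases2) (auto simp: power_int_minus)
  qed
  have "nat \<bar>A\<bar> > 0" using R by (simp add: A_def)
  from infinite_pigeonhole[OF I finite_nth_roots[OF this], of v] vA
  obtain v0 where v0: "v0 ^ nat \<bar>A\<bar> = 1" "infinite {n\<in>I. v n = v0}" by blast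
  have r0: "root_unity v0" unfolding root_unity_def using v0(1) \<open>nat \<bar>A\<bar> > 0\<close> by blast
  have main: "mon R (y n) b = v0 powi b k * mon R' (u n) (\<lambda>i. a k * b i - a i * b k)" if n: "n \<in> {n\<in>I. v n = v0}" for n b
  proof -
    have nI: "n \<in> I" and vn: "v n = v0" using n by auto
    have inv: "mon R' (u n) a * mon R' (u n) (\<lambda>i. - a i) = 1"
      using mon_add[of R' "u n" a "\<lambda>i. - a i"] unz[OF nI] by simp
    have yk: "y n k = v0 * mon R' (u n) (\<lambda>i. - a i)"
      unfolding vn[symmetric] v_def mult.assoc inv by simp
    have "mon R (y n) b = (v0 * mon R' (u n) (\<lambda>i. - a i)) powi b k * mon R' (u n) (\<lambda>i. A * b i)"
      unfolding split R'y[OF nI] yk[symmetric] ..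
    also have "\<dots> = v0 powi b k * (mon R' (u n) (\<lambda>i. - a i * b k) * mon R' (u n) (\<lambda>i. A * b i))"
      unfolding power_int_mult_distrib mon_powi by simp
    also have "mon R' (u n) (\<lambda>i. - a i * b k) * mon R' (u n) (\<lambda>i. A * b i) = mon R' (u n) (\<lambda>i. - a i * b k + A * b i)"
      using unz[OF nI] by (intro mon_add[symmetric])
    finally show ?thesis by (simp add: A_def)
  qed
  show ?thesis
    using v0(2) r0 u(1) main unfolding R'_def by (intro exI[of _ "{n\<in>I. v n = v0}"] exI[of _ v0] exI[of _ u]) auto
qed

lemma finite_embedding_values:
  assumes L: "is_subfield (L :: 'a::field_char_0 set)" and x: "x \<in> L" "algebraic x"
  shows "finite {t x :: complex | t. hom_on L t}"
proof -
  obtain P where P: "P \<noteq> 0" "poly (map_poly of_int P) x = 0" using x(2) by (rule algebraicE')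
  have "poly (map_poly of_int P) (t x) = 0" if "hom_on L t" for t :: "'a \<Rightarrow> complex"
  proof -
    interpret field_hom L t using L that by unfold_locales
    have dm: "degree (map_poly of_int P :: 'b::field_char_0 poly) = degree P" for P by (rule degree_map_poly) auto
    have "poly (map_poly of_int P) (t x) = (\<Sum>i\<le>degree P. of_int (coeff P i) * t x ^ i)"
      unfolding poly_altdef dm by (simp add: coeff_map_poly)
    also have "\<dots> = t (\<Sum>i\<le>degree P. of_int (coeff P i) * x ^ i)"
      using x by (subst h_sum) (auto simp: h_mult h_power h_of_int mult power)
    also have "(\<Sum>i\<le>degree P. of_int (coeff P i) * x ^ i) = poly (map_poly of_int P) x"
      unfolding poly_altdef dm by (simp add: coeff_map_poly)
    finally show ?thesis using P(2) by simp
  qed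
  then have "{t x | t. hom_on L t} \<subseteq> {w :: complex. poly (map_poly of_int P) w = 0}" by blast
  moreover have "map_poly of_int P \<noteq> (0 :: complex poly)" using P(1) by (auto simp: poly_eq_iff coeff_map_poly)
  ultimately show ?thesis using poly_roots_finite finite_subset by blast
qed

section \<open>Sequences of sums of roots of unity at archimedean places\<close>

context cyclotomic_sequence begin

text \<open>A representation in the least number of variables is taken; initially the roots of unity
  themselves are the variables. A relation on an infinite subset would eliminate one more variable,
  and the root of unity \<open>v\<close> it leaves behind goes into the coefficients.\<close>

lemma multiplicatively_free_exists:
  "\<exists>I' R c' y e. infinite I' \<and> I' \<subseteq> I \<and> finite R \<and> (\<forall>j<B. c' j \<in> L) \<and> (\<forall>n\<in>I'. \<forall>i\<in>R. root_unity (y n i)) \<and>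
    (\<forall>n\<in>I'. xs n = (\<Sum>j<B. c' j * mon R (y n) (e j))) \<and> (\<forall>a. (\<exists>i\<in>R. a i \<noteq> 0) \<longrightarrow> finite {n\<in>I'. mon R (y n) a = 1})"
proof -
  define Q where "Q = (\<lambda>k I' R c' e y. infinite I' \<and> I' \<subseteq> I \<and> finite R \<and> card R = k \<and> (\<forall>j<B. c' j \<in> L) \<and>
    (\<forall>n\<in>I'. \<forall>i\<in>R. root_unity (y n i)) \<and> (\<forall>n\<in>I'. xs n = (\<Sum>j<B. c' j * mon R (y n) (e j))))"
  have "Q B I {..<B} c (\<lambda>j i. if i = j then 1 else 0) z"
  proof -
    have "mon {..<B} (z n) (\<lambda>i. if i = j then 1 else 0) = z n j" if "j < B" for n j
    proof -
      have "mon {..<B} (z n) (\<lambda>i. if i = j then 1 else 0) = (\<Prod>i<B. if i = j then z n i else 1)"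
        unfolding mon_def by (intro prod.cong refl) auto
      then show ?thesis using that by simp
    qed
    then show ?thesis using I c z xs by (auto simp: Q_def)
  qed
  then have ex: "\<exists>k. \<exists>I' R c' e y. Q k I' R c' e y" by blast
  define k where "k = (LEAST k. \<exists>I' R c' e y. Q k I' R c' e y)"
  obtain I' R c' e y where q: "Q k I' R c' e y" using LeastI_ex[OF ex] unfolding k_def by blast
  have min: "\<not> Q l I' R c' e y" if "l < k" for l I' R c' e y using not_less_Least that unfolding k_def by blast
  have "finite {n\<in>I'. mon R (y n) a = 1}" if a: "i \<in> R" "a i \<noteq> 0" for a i
  proof (rule ccontr)
    assume inf: "infinite {n\<in>I'. mon R (y n) a = 1}"
    have fR: "finite R" using q by (simp add: Q_def)
    have y: "root_unity (y n i)" if "n \<in> {n\<in>I'. mon R (y n) a = 1}" "i \<in> R" for n i using q that by (simp add: Q_def)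
    from mon_eliminate[where y = y and k = i and a = a, OF inf fR a y] obtain I'' v u where u: "infinite I''" "I'' \<subseteq> {n\<in>I'. mon R (y n) a = 1}" "root_unity v"
      "\<forall>n\<in>I''. \<forall>i\<in>R - {i}. root_unity (u n i)"
      "\<forall>n\<in>I''. \<forall>b. mon R (y n) b = v powi b i * mon (R - {i}) (u n) (\<lambda>l. a i * b l - a l * b i)" by blast
    have "Q (k - 1) I'' (R - {i}) (\<lambda>j. c' j * v powi e j i) (\<lambda>j l. a i * e j l - a l * e j i) u"
      unfolding Q_def
    proof (intro conjI)
      show "I'' \<subseteq> I" using u(2) q by (auto simp: Q_def)
      show "card (R - {i}) = k - 1" using q a by (simp add: Q_def)
      show "\<forall>j<B. c' j * v powi e j i \<in> L" using q mu[OF root_unity_powi[OF u(3)]] by (auto simp: Q_def intro!: mult)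
      show "\<forall>n\<in>I''. xs n = (\<Sum>j<B. c' j * v powi e j i * mon (R - {i}) (u n) (\<lambda>l. a i * e j l - a l * e j i))"
      proof
        fix n assume n: "n \<in> I''"
        then have "xs n = (\<Sum>j<B. c' j * mon R (y n) (e j))" using u(2) q by (auto simp: Q_def)
        then show "xs n = (\<Sum>j<B. c' j * v powi e j i * mon (R - {i}) (u n) (\<lambda>l. a i * e j l - a l * e j i))"
          using u(5) n by (simp add: mult.assoc)
      qed
    qed (use u fR in auto)
    moreover have "card R > 0" using a(1) fR by (auto simp: card_gt_0_iff)
    then have "k - 1 < k" using q by (auto simp: Q_def)
    ultimately show False using min by blast
  qed
  then show ?thesis using q unfolding Q_def
    by (intro exI[of _ I'] exI[of _ R] exI[of _ c'] exI[of _ y] exI[of _ e]) blast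
qed

text \<open>On an infinite subset all coefficients have the same images \<open>ga\<close>, so one
  trigonometric polynomial is almost bounded by \<open>C\<close> at the conjugates of all points
  \<open>t n\<close>. The torus bound, used at one of these points, contradicts the lower bound
  there.\<close>

lemma arch_no_sequence:
  fixes tau :: "nat \<Rightarrow> 'a \<Rightarrow> complex"
  assumes alg: "\<And>x. x \<in> L \<Longrightarrow> algebraic x" and cy: "cycl_autos L" and X: "finite X" "X \<subseteq> L"
    and tau: "\<And>n. n \<in> I \<Longrightarrow> hom_on L (tau n)" and C: "C > 0"
    and lower: "\<And>n. n \<in> I \<Longrightarrow> cmod (tau n (xs n)) > C"
    and upper: "\<And>n aut. n \<in> I \<Longrightarrow> hom_on L aut \<Longrightarrow> aut ` L \<subseteq> L \<Longrightarrow> (\<forall>x\<in>X. aut x = x) \<Longrightarrow> cmod (tau n (aut (xs n))) < C + 1 / real (Suc n)"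
  shows False
proof -
  obtain I1 and R :: "nat set" and c' e0 and y :: "nat \<Rightarrow> nat \<Rightarrow> 'a" where I1: "infinite I1" "I1 \<subseteq> I" and R: "finite R"
    and c'0: "\<forall>j<B. c' j \<in> L" and y0: "\<forall>n\<in>I1. \<forall>i\<in>R. root_unity (y n i)"
    and xs0: "\<forall>n\<in>I1. xs n = (\<Sum>j<B. c' j * mon R (y n) (e0 j))"
    and free0: "\<forall>a. (\<exists>i\<in>R. a i \<noteq> 0) \<longrightarrow> finite {n\<in>I1. mon R (y n) a = 1}"
    by atomize_elim (rule multiplicatively_free_exists)
  have c': "c' j \<in> L" if "j < B" for j using c'0 that by blast
  \<comment> \<open>Zero outside \<open>R\<close>, as the exponent boxes demand; the monomials are
    not affected.\<close>
  define e where "e = (\<lambda>j i. if i \<in> R then e0 j i else 0)"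
  define V where "V = PiE {..<B} (\<lambda>j. {t (c' j) | t. hom_on L (t :: 'a \<Rightarrow> complex)})"
  have fV: "finite V" unfolding V_def using c' alg by (intro finite_PiE finite_embedding_values[OF sf]) auto
  have "(\<lambda>j\<in>{..<B}. tau n (c' j)) \<in> V" if "n \<in> I1" for n
    using tau I1 that by (auto simp: V_def)
  from infinite_pigeonhole[where g = "\<lambda>n. \<lambda>j\<in>{..<B}. tau n (c' j)", OF I1(1) fV this] obtain ga where ga: "infinite {n\<in>I1. (\<lambda>j\<in>{..<B}. tau n (c' j)) = ga}" by blast
  define I2 where "I2 = {n\<in>I1. (\<lambda>j\<in>{..<B}. tau n (c' j)) = ga}"
  have I2: "infinite I2" "I2 \<subseteq> I1" "I2 \<subseteq> I" using ga I1 by (auto simp: I2_def)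
  have gac: "tau n (c' j) = ga j" if "n \<in> I2" "j < B" for n j using that by (auto simp: I2_def)
  have y: "root_unity (y n i)" "y n i \<in> L" if "n \<in> I2" "i \<in> R" for n i using y0 mu I2 that by blast+
  have xs': "xs n = (\<Sum>j<B. c' j * mon R (y n) (e j))" if n: "n \<in> I2" for n
  proof -
    have "mon R (y n) (e0 j) = mon R (y n) (e j)" for j by (rule mon_cong) (simp add: e_def)
    then show ?thesis using xs0 n I2 by auto
  qed
  have yL: "mon R (y n) a \<in> L" if "n \<in> I2" for n a using mu[OF root_unity_mon[OF y(1)[OF that]]] .
  have Xc: "finite (X \<union> c' ` {..<B})" "X \<union> c' ` {..<B} \<subseteq> L" using X c' by auto
  obtain M where M0: "M > 0" and Mp: "power_autos L (X \<union> c' ` {..<B}) M" using cycl_autosE[OF cy Xc] .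
  define t where "t = (\<lambda>n i. tau n (y n i))"
  have tau_mon: "tau n (mon R (y n) a) = mon R (t n) a" if n: "n \<in> I2" for n a
  proof -
    have "n \<in> I" using n I2 by blast
    then interpret H: field_hom L "tau n" using tau by unfold_locales
    show ?thesis unfolding mon_def t_def using y[OF n] by (subst H.h_prod) (auto simp: H.h_powi powi)
  qed
  interpret equidistributed R I2 t M
  proof unfold_locales
    show "root_unity (t n i)" if n: "n \<in> I2" "i \<in> R" for n i
    proof -
      have "n \<in> I" using n I2 by blast
      then interpret H: field_hom L "tau n" using tau by unfold_locales
      obtain m where "m > 0" "y n i ^ m = 1" using y(1)[OF n] by (auto simp: root_unity_def)
      then have "t n i ^ m = 1" using H.h_power[OF y(2)[OF n], of m] by (simp add: t_def)
      then show ?thesis using \<open>m > 0\<close> by (auto simp: root_unity_def)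
    qed
    fix a :: "nat \<Rightarrow> int" assume a: "\<exists>i\<in>R. a i \<noteq> 0"
    have "{n\<in>I2. mon R (t n) a = 1} \<subseteq> {n\<in>I1. mon R (y n) a = 1}"
    proof safe
      fix n assume n: "n \<in> I2" "mon R (t n) a = 1"
      show "n \<in> I1" using n I2 by blast
      have "n \<in> I" using n I2 by blast
      then interpret H: field_hom L "tau n" using tau by unfold_locales
      show "mon R (y n) a = 1" using H.h_eq_1_iff[OF yL[OF n(1)], of a] tau_mon[OF n(1)] n(2) by simp
    qed
    then show "finite {n\<in>I2. mon R (t n) a = 1}" using free0 a finite_subset by blast
  qed (use R I2 M0 in auto)
  have tau_sum: "tau n (\<Sum>j<B. c' j * mon R (y n) (e j) ^ s) = (\<Sum>j<B. ga j * mon R (t n) (e j) ^ s)" if n: "n \<in> I2" for n s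
  proof -
    have "n \<in> I" using n I2 by blast
    then interpret H: field_hom L "tau n" using tau by unfold_locales
    have "tau n (\<Sum>j<B. c' j * mon R (y n) (e j) ^ s) = (\<Sum>j<B. tau n (c' j * mon R (y n) (e j) ^ s))"
      using c' yL[OF n] by (intro H.h_sum) (auto intro!: mult power)
    also have "\<dots> = (\<Sum>j<B. ga j * mon R (t n) (e j) ^ s)"
      using c' yL[OF n] gac[OF n] by (intro sum.cong refl) (simp add: H.h_mult H.h_power tau_mon[OF n] power)
    finally show ?thesis .
  qed
  have "\<exists>n. n \<in> I2" unfolding ex_in_conv using I2(1) by (rule infinite_imp_nonempty)
  then obtain n0 where n0: "n0 \<in> I2" ..
  have "cmod (\<Sum>j<B. ga j * mon R (t n0) (e j)) \<le> C"
  proof (rule torus_bound[OF C])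
    show "e j i = 0" if "i \<notin> R" for j i using that by (simp add: e_def)
    show "cmod (t n0 i) = 1" if "i \<in> R" for i using cmod_root_unity ru[OF n0 that] .
    fix n N s assume a: "n \<in> I2" "N > 0" "M dvd N" "\<forall>i\<in>R. t n i ^ N = 1" "coprime s N" "[s = 1] (mod M)"
    have nI: "n \<in> I" using a(1) I2 by blast
    interpret H: field_hom L "tau n" using tau[OF nI] by unfold_locales
    obtain aut where aut: "hom_on L aut" "aut ` L \<subseteq> L"
      "\<forall>x\<in>X \<union> c' ` {..<B}. aut x = x" "\<forall>z. z ^ N = 1 \<longrightarrow> aut z = z ^ s" using Mp[unfolded power_autos_def, rule_format, OF a(2,3,5,6)] by blast
    interpret S: field_hom L aut using aut by unfold_locales
    have yN: "mon R (y n) b ^ N = 1" for b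
    proof -
      have "mon R (t n) b ^ N = 1" using a(4) unfolding mon_power[symmetric] by (simp add: mon_def)
      then have "tau n (mon R (y n) b ^ N) = 1" using yL[OF a(1)] by (simp add: H.h_power tau_mon[OF a(1)])
      then show ?thesis using H.h_eq_1_iff yL[OF a(1)] power by blast
    qed
    have "aut (xs n) = (\<Sum>j<B. aut (c' j * mon R (y n) (e j)))"
      unfolding xs'[OF a(1)] using c' yL[OF a(1)] by (intro S.h_sum) (auto intro!: mult)
    also have "\<dots> = (\<Sum>j<B. c' j * mon R (y n) (e j) ^ s)"
      using c' yL[OF a(1)] aut(3,4) yN by (intro sum.cong refl) (simp add: S.h_mult)
    finally have "tau n (aut (xs n)) = (\<Sum>j<B. ga j * mon R (t n) (e j) ^ s)" using tau_sum[OF a(1)] by simp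
    moreover have "\<forall>x\<in>X. aut x = x" using aut(3) by blast
    ultimately show "cmod (\<Sum>j<B. ga j * mon R (t n) (e j) ^ s) \<le> C + 1 / real (Suc n)"
      using upper[OF nI aut(1,2)] by simp
  qed
  moreover have "tau n0 (xs n0) = (\<Sum>j<B. ga j * mon R (t n0) (e j))" using tau_sum[OF n0, of 1] xs'[OF n0] by simp
  moreover have "n0 \<in> I" using n0 I2 by blast
  ultimately show False using lower[of n0] by simp
qed

end

section \<open>Places of the cyclotomic closure\<close>

lemma same_place_powr:
  assumes "is_subfield (K :: 'a::field_char_0 set)" "v \<in> places K" "f \<in> v" "g \<in> v"
  shows "\<exists>s>0. \<forall>x\<in>K. g x = f x powr s"
proof -
  have "(f, g) \<in> absolute_value_equiv K"
    using in_quotient_imp_in_rel[OF equiv_absolute_value_equiv[OF assms(1)]] assms(2-4) unfolding places_def by blast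
  then show ?thesis by (simp add: absolute_value_equiv_def)
qed

text \<open>\<open>archimedean_place\<close> asks for some representative violating the ultrametric
  inequality, so the inequality has to be passed from \<open>f\<close> to all its powers in the
  place.\<close>

lemma ultrametric_not_archimedean:
  assumes K: "is_subfield (K :: 'a::field_char_0 set)" "v \<in> places K" and f: "f \<in> v"
    and um: "\<And>x y. x \<in> K \<Longrightarrow> y \<in> K \<Longrightarrow> f (x + y) \<le> max (f x) (f y)"
  shows "\<not> archimedean_place K v"
proof
  assume "archimedean_place K v"
  then obtain g x y where g: "g \<in> v" "x \<in> K" "y \<in> K" "g (x + y) > max (g x) (g y)"
    by (auto simp: archimedean_place_def)
  interpret subfield_of K using K by unfold_locales
  obtain s where s: "s > 0" "\<forall>x\<in>K. g x = f x powr s" using same_place_powr[OF K f g(1)] by blast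
  have "f \<in> absolute_values K"
    using in_quotient_imp_subset[OF equiv_absolute_value_equiv[OF K(1)]] K(2) f
    unfolding places_def nontrivial_absolute_values_def by blast
  then have "0 \<le> f (x + y)" using add[OF g(2,3)] by (simp add: absolute_values_def)
  then have "f (x + y) powr s \<le> max (f x) (f y) powr s" using um[OF g(2,3)] s(1) by (intro powr_mono2) auto
  also have "\<dots> \<le> max (f x powr s) (f y powr s)" by (auto simp: max_def)
  finally show False using g s(2) add[OF g(2,3)] by (auto simp: le_max_iff_disj)
qed

text \<open>The residue characteristic. At a place without one the choice is arbitrary, so the
  common denominator built from it tests for primality.\<close>

definition place_prime :: "'a::field place \<Rightarrow> nat" where
  "place_prime v = (SOME r. prime r \<and> (\<exists>g\<in>v. g (of_nat r) < 1))"

lemma place_prime_eq: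
  assumes K: "is_subfield (K :: 'a::field_char_0 set)" "v \<in> places K" and f: "f \<in> v"
    and p: "prime p" "\<And>q. f (of_rat q) = padic_abs p q"
  shows "place_prime v = p"
proof -
  interpret subfield_of K using K by unfold_locales
  have fn: "f (of_nat r) = padic_abs p (of_nat r)" for r using p(2)[of "of_nat r"] by simp
  have "f (of_nat p) < 1" unfolding fn padic_abs_prime[OF p(1)] using prime_gt_1_nat[OF p(1)] by simp
  then have "\<exists>r. prime r \<and> (\<exists>g\<in>v. g (of_nat r) < 1)" using p(1) f by blast
  from someI_ex[OF this] obtain g where g: "prime (place_prime v)" "g \<in> v" "g (of_nat (place_prime v)) < 1"
    unfolding place_prime_def by blast
  obtain s where s: "s > 0" "\<forall>x\<in>K. g x = f x powr s" using same_place_powr[OF K f g(2)] by blast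
  show ?thesis
  proof (rule ccontr)
    assume "place_prime v \<noteq> p"
    then have "f (of_nat (place_prime v)) = 1" unfolding fn using padic_abs_other[OF p(1) g(1)] by simp
    then show False using g(3) s(2) by simp
  qed
qed

lemma hom_fixes_span:
  fixes L :: "'a::field_char_0 set"
  assumes L: "is_subfield L" and s: "hom_on L aut" and B: "B \<subseteq> L" "\<forall>b\<in>B. aut b = b"
    and x: "x \<in> module.span (\<lambda>(q::rat) x. of_rat q * x) B"
  shows "aut x = x"
proof -
  interpret field_hom L aut using L s by unfold_locales
  interpret V: vector_space "\<lambda>(q::rat) (x::'a). of_rat q * x"
    by unfold_locales (auto simp: algebra_simps of_rat_add of_rat_mult)
  have rL: "of_rat q \<in> L" for q using Rats_in_subfield[OF L] by auto
  have rs: "aut (of_rat q) = of_rat q" for q by (cases q) (auto simp: of_rat_rat h_divide h_of_int)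
  have "V.subspace {x\<in>L. aut x = x}"
    by (auto simp: V.subspace_def h_add h_mult rL rs add mult)
  then have "V.span B \<subseteq> {x\<in>L. aut x = x}" using B by (intro V.span_minimal) auto
  then show ?thesis using x by blast
qed

text \<open>Archimedean places all belong to \<open>S\<close>, which bounds every embedding. A
  nonarchimedean place where \<open>xs\<close> may exceed 1 has \<open>C v > 1\<close>, so it is one
  of finitely many, and its residue characteristic divides \<open>m\<close> to a power that
  compensates.\<close>

lemma size_bound_uniform:
  fixes K :: "'a :: {alg_closed_field, field_char_0} set"
  assumes K: "number_field K" and C: "finite {v \<in> places K. C v \<noteq> 1}"
    and S: "S = {v \<in> places K. archimedean_place K v \<or> C v > 1}"
  defines "L \<equiv> cyclotomic_closure K"
  shows "\<exists>R m. m > 0 \<and> (\<forall>xs\<in>L. (\<forall>v\<in>S. \<forall>w\<in>places_above K L v. place_abs w xs < C v + 1) \<longrightarrow>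
    (\<forall>v\<in>places K - S. \<forall>w\<in>places_above K L v. place_abs w xs \<le> 1) \<longrightarrow> size_bound L R m xs)"
proof -
  note L = cyclotomic_closure_facts[OF K, folded L_def]
  have Ks: "is_subfield K" using K by (simp add: number_field_def)
  interpret KS: subfield_of K using Ks by unfold_locales
  define V where "V = {v \<in> places K. C v \<noteq> 1}"
  define R where "R = Max (insert 1 (C ` V)) + 1"
  have CR: "C v + 1 \<le> R" if "v \<in> places K" for v
  proof -
    have "C v \<in> insert 1 (C ` V)" using that by (auto simp: V_def)
    then show ?thesis using C unfolding R_def V_def[symmetric] by (auto intro!: Max_ge)
  qed
  \<comment> \<open>A \<open>k\<close>-th power of any prime has absolute value at most
    \<open>1 / 2 ^ k\<close> at that prime, which outweighs \<open>R\<close>.\<close>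
  obtain k where k: "2 ^ k > R" using real_arch_pow[of 2 R] by auto
  define m where "m = (\<Prod>v\<in>V. if prime (place_prime v) then place_prime v ^ k else 1)"
  have m0: "m > 0" unfolding m_def by (intro prod_pos) (auto simp: prime_gt_0_nat)
  have "size_bound L R m xs" if xs: "xs \<in> L" "\<forall>v\<in>S. \<forall>w\<in>places_above K L v. place_abs w xs < C v + 1"
    "\<forall>v\<in>places K - S. \<forall>w\<in>places_above K L v. place_abs w xs \<le> 1" for xs
    unfolding size_bound_def
  proof (intro conjI allI impI)
    fix t :: "'a \<Rightarrow> complex" assume t: "hom_on L t"
    interpret field_hom L t using L(1) t by unfold_locales
    define f where "f = restrict (\<lambda>x. cmod (t x)) L"
    have f: "f \<in> absolute_values L" "normalized_abs f" unfolding f_def by (rule embedding_absolute_value[OF L(1) t])+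
    note pl = place_of_restrict[OF Ks L(1,2) f]
    let ?v = "place_of K (restrict f K)"
    have pa: "place_abs (place_of L f) = f" using place_above_normalized(2)[OF Ks L(1,2) f pl(1,2)] .
    have "restrict f K (1 + 1) > max (restrict f K 1) (restrict f K 1)"
    proof -
      have "t (1 + 1) = 2" using h_add[OF one one] by simp
      then show ?thesis using KS.add[OF KS.one KS.one] KS.one add[OF one one] by (simp add: f_def)
    qed
    then have "archimedean_place K ?v" unfolding archimedean_place_def using pl(2) KS.one by blast
    then have vS: "?v \<in> S" using pl(1) by (simp add: S)
    then have "f xs < C ?v + 1" using xs(2) pl(3) pa by metis
    then show "cmod (t xs) \<le> R" using CR[OF pl(1)] xs(1) by (simp add: f_def)
  next
    show "algebraic_int (of_nat m * xs)"
    proof (rule ccontr)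
      assume na: "\<not> ?thesis"
      interpret subfield_of L using L(1) by unfold_locales
      have bL: "of_nat m * xs \<in> L" using xs(1) by (intro mult of_nat)
      obtain f p where f: "f \<in> absolute_values L" "\<And>x y. x \<in> L \<Longrightarrow> y \<in> L \<Longrightarrow> f (x + y) \<le> max (f x) (f y)"
        "prime p" "\<And>q. f (of_rat q) = padic_abs p q" "f (of_nat m * xs) > 1"
        using nonintegral_abs[OF L(1) L(4) bL na] by blast
      interpret nonarch_abs L f p using f L(1) by unfold_locales auto
      have nf: "normalized_abs f" using f(3,4) by (auto simp: normalized_abs_def)
      note pl = place_of_restrict[OF Ks L(1,2) f(1) nf]
      let ?v = "place_of K (restrict f K)"
      have pa: "place_abs (place_of L f) = f" using place_above_normalized(2)[OF Ks L(1,2) f(1) nf pl(1,2)] .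
      have fm1: "f (of_nat i) \<le> 1" for i by (rule ultrametric_nat[OF um])
      have fm: "f (of_nat m) * f xs > 1" using f(5) xs(1) by (simp add: f_mult)
      have fxs: "f xs \<ge> 0" using nonneg[OF xs(1)] .
      show False
      proof (cases "?v \<in> S")
        case False
        then have "f xs \<le> 1" using xs(3) pl pa by (metis DiffI)
        then have "f (of_nat m) * f xs \<le> 1" using fm1[of m] fxs nonneg[of "of_nat m"] by (intro mult_le_one) auto
        then show False using fm by simp
      next
        case True
        have "restrict f K (x + y) \<le> max (restrict f K x) (restrict f K y)" if "x \<in> K" "y \<in> K" for x y
          using that KS.add[OF that] um L(2) by auto
        then have "\<not> archimedean_place K ?v" by (rule ultrametric_not_archimedean[OF Ks pl(1,2)])
        then have vV: "?v \<in> V" using True pl(1) by (auto simp: S V_def)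
        have rat: "restrict f K (of_rat q) = padic_abs p q" for q
        proof -
          have "of_rat q \<in> K" using Rats_in_subfield[OF Ks] by auto
          then show ?thesis using f(4) by (simp only: restrict_def if_True)
        qed
        have pp: "place_prime ?v = p" by (rule place_prime_eq[OF Ks pl(1,2) f(3) rat])
        have "p ^ k dvd m"
        proof -
          have "(if prime (place_prime ?v) then place_prime ?v ^ k else 1) dvd m"
            unfolding m_def using vV C by (intro dvd_prodI) (auto simp: V_def)
          then show ?thesis using pp f(3) by simp
        qed
        then obtain i where i: "m = p ^ k * i" by (auto elim: dvdE)
        have "f (of_nat m) = f (of_nat p) ^ k * f (of_nat i)" by (simp add: i f_mult f_power power)
        also have "\<dots> \<le> (1 / 2) ^ k * 1"
          unfolding f_p using fm1[of i] prime_ge_2_nat[OF f(3)] nonneg[of "of_nat i"]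
          by (intro mult_mono power_mono) (auto simp: field_simps)
        finally have m2: "f (of_nat m) \<le> (1 / 2) ^ k" by simp
        have "f xs < C ?v + 1" using xs(2) True pl(3) pa by metis
        then have "f xs \<le> 2 ^ k" using CR[OF pl(1)] k by simp
        then have "f (of_nat m) * f xs \<le> (1 / 2) ^ k * 2 ^ k" using m2 fxs by (intro mult_mono) auto
        also have "\<dots> = 1" by (simp flip: power_mult_distrib)
        finally show False using fm by simp
      qed
    qed
  qed
  then show ?thesis using m0 by blast
qed

lemma SUP_gt_imp_ex:
  fixes g :: "'b \<Rightarrow> real"
  assumes "A \<noteq> {}" "c < (SUP w\<in>A. g w)"
  shows "\<exists>w\<in>A. g w > c"
  using assms cSUP_least[of A g c] by (meson not_le)

theorem theorem5p7:
  fixes K :: "'a :: {alg_closed_field, field_char_0} set"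
    and C :: "'a place \<Rightarrow> real"
    and S :: "'a place set"
  assumes "number_field K"
    and "\<forall>v\<in>places K. C v > 0"
    and "finite {v \<in> places K. C v \<noteq> 1}"
    and "S = {v \<in> places K. archimedean_place K v \<or> C v > 1}"
  shows "\<exists>\<epsilon>>0. \<not> (\<exists>\<alpha>\<in>cyclotomic_closure K.
           (\<exists>v\<^sub>0\<in>S.
              C v\<^sub>0 < (SUP w\<^sub>0\<in>places_above K (cyclotomic_closure K) v\<^sub>0. place_abs w\<^sub>0 \<alpha>) \<and>
              (SUP w\<^sub>0\<in>places_above K (cyclotomic_closure K) v\<^sub>0. place_abs w\<^sub>0 \<alpha>) < C v\<^sub>0 + \<epsilon>) \<and>
           (\<forall>v\<in>S. \<forall>w\<in>places_above K (cyclotomic_closure K) v. place_abs w \<alpha> < C v + \<epsilon>) \<and>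
           (\<forall>v\<in>places K - S. \<forall>w\<in>places_above K (cyclotomic_closure K) v. place_abs w \<alpha> \<le> 1))"
proof (rule ccontr)
  assume neg: "\<not> ?thesis"
  define L where "L = cyclotomic_closure K"
  note L = cyclotomic_closure_facts[OF assms(1), folded L_def]
  have Ks: "is_subfield K" using assms(1) by (simp add: number_field_def)
  interpret SL: subfield_of L using L(1) by unfold_locales
  define sp where "sp = (\<lambda>v xs. SUP w\<in>places_above K L v. place_abs w xs)"
  define bounded where "bounded = (\<lambda>\<epsilon> xs. (\<forall>v\<in>S. \<forall>w\<in>places_above K L v. place_abs w xs < C v + \<epsilon>) \<and>
      (\<forall>v\<in>places K - S. \<forall>w\<in>places_above K L v. place_abs w xs \<le> 1))"
  have "\<exists>xs\<in>L. (\<exists>v\<in>S. C v < sp v xs \<and> sp v xs < C v + 1 / real (Suc n)) \<and> bounded (1 / real (Suc n)) xs" for n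
  proof -
    have "1 / real (Suc n) > 0" by simp
    then show ?thesis using neg unfolding sp_def L_def bounded_def by blast
  qed
  then have "\<forall>n. \<exists>xs v. xs \<in> L \<and> v \<in> S \<and> C v < sp v xs \<and> sp v xs < C v + 1 / real (Suc n) \<and> bounded (1 / real (Suc n)) xs" by blast
  then obtain xs v where xsv: "\<forall>n. xs n \<in> L \<and> v n \<in> S \<and> C (v n) < sp (v n) (xs n) \<and> sp (v n) (xs n) < C (v n) + 1 / real (Suc n) \<and>
      bounded (1 / real (Suc n)) (xs n)" by metis
  then have xsL: "xs n \<in> L" and vS: "v n \<in> S" and lo: "C (v n) < sp (v n) (xs n)"
      and hi: "sp (v n) (xs n) < C (v n) + 1 / real (Suc n)" for n by blast+
  have onS: "\<forall>v\<in>S. \<forall>w\<in>places_above K L v. place_abs w (xs n) < C v + 1 / real (Suc n)"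
      and offS: "\<forall>v\<in>places K - S. \<forall>w\<in>places_above K L v. place_abs w (xs n) \<le> 1" for n
    using xsv unfolding bounded_def by blast+
  have vK: "v n \<in> places K" for n using vS assms(4) by blast
  define V where "V = {v \<in> places K. C v \<noteq> 1}"
  \<comment> \<open>The places \<open>v n\<close> may vary; only the value of \<open>C\<close> at
    them is made constant.\<close>
  have "finite (insert 1 (C ` V))" using assms(3) by (simp add: V_def)
  moreover have "C (v n) \<in> insert 1 (C ` V)" for n using vK by (auto simp: V_def)
  ultimately obtain c0 where "infinite {n\<in>UNIV. C (v n) = c0}"
    using infinite_pigeonhole[OF infinite_UNIV_nat, of "insert 1 (C ` V)" "\<lambda>n. C (v n)"] by blast
  then have I0: "infinite {n. C (v n) = c0}" by simp
  have "\<exists>n. n \<in> {n. C (v n) = c0}" unfolding ex_in_conv using I0 by (rule infinite_imp_nonempty)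
  then have c0: "c0 > 0" using assms(2) vK by auto
  \<comment> \<open>With no place above \<open>v n\<close> the supremum is the fixed real
    \<open>Sup {}\<close>, whatever it is; it can lie strictly between \<open>c0\<close> and
    \<open>c0 + 1 / real (Suc n)\<close> only for finitely many \<open>n\<close>.\<close>
  have fin: "finite {n. C (v n) = c0 \<and> places_above K L (v n) = {}}"
  proof -
    have sub: "c0 < Sup {} \<and> Sup {} < c0 + 1 / real (Suc n)" if "C (v n) = c0" "places_above K L (v n) = {}" for n
      using lo[of n] hi[of n] that by (simp add: sp_def)
    show ?thesis
    proof (cases "c0 < Sup {}")
      case True
      then obtain k where k: "1 / real (Suc k) < Sup {} - c0" using nat_approx_posE[of "Sup {} - c0"] by auto
      have lt: "n < k" if "C (v n) = c0" "places_above K L (v n) = {}" for n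
      proof (rule ccontr)
        assume "\<not> n < k"
        then have "1 / real (Suc n) \<le> 1 / real (Suc k)" by (simp add: frac_le)
        then show False using sub[OF that] k by linarith
      qed
      have "{n. C (v n) = c0 \<and> places_above K L (v n) = {}} \<subseteq> {..<k}" using lt by blast
      then show ?thesis by (rule finite_subset) (rule finite_lessThan)
    next
      case False
      then have "{n. C (v n) = c0 \<and> places_above K L (v n) = {}} = {}" using sub by blast
      then show ?thesis by (metis finite.emptyI)
    qed
  qed
  define I1 where "I1 = {n. C (v n) = c0} - {n. C (v n) = c0 \<and> places_above K L (v n) = {}}"
  have I1: "infinite I1" unfolding I1_def using I0 fin by (intro Diff_infinite_finite)
  have "\<exists>w. w \<in> places_above K L (v n) \<and> place_abs w (xs n) > c0" if "n \<in> I1" for n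
    using SUP_gt_imp_ex[of "places_above K L (v n)" c0 "\<lambda>w. place_abs w (xs n)"] lo[of n] that
    by (auto simp: I1_def sp_def)
  then obtain w where w: "\<And>n. n \<in> I1 \<Longrightarrow> w n \<in> places_above K L (v n)" "\<And>n. n \<in> I1 \<Longrightarrow> place_abs (w n) (xs n) > c0" by metis
  \<comment> \<open>The Gaussian rationals need a square root of -1, which lies in the field as a
    fourth root of unity.\<close>
  obtain i :: 'a where i: "i ^ 2 = - 1" using nth_root_exists[of 2 "- 1"] by auto
  have "i ^ 4 = 1" using i power_mult[of i 2 2] by simp
  then have "root_unity i" unfolding root_unity_def by (intro exI[of _ 4]) simp
  then have iL: "i \<in> L" "i * i = - 1" using L(3) i by (auto simp: power2_eq_square)
  define g where "g = (\<lambda>n. place_abs (w n))"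
  have wL: "w n \<in> places L" if "n \<in> I1" for n using w(1)[OF that] by (simp add: places_above_def)
  have ga: "g n \<in> absolute_values L" "normalized_abs (g n)" "restrict (g n) K \<in> v n" if "n \<in> I1" for n
    using place_normalized_cases[OF L(1,4) iL wL[OF that]] w(1)[OF that]
    by (auto simp: g_def places_above_def)
  \<comment> \<open>\<open>cycl_autos\<close> can prescribe fixed points on finite sets only; fixing
    the spanning set \<open>G\<close> is enough to fix \<open>K\<close>.\<close>
  obtain G where G: "finite G" "G \<subseteq> K" "K = module.span (\<lambda>(q::rat) x. of_rat q * x) G"
    using number_field_generators[OF assms(1)] by metis
  \<comment> \<open>Composition with an automorphism over \<open>K\<close> gives another place above
    the same \<open>v n\<close>, so condition (ii) bounds all conjugates.\<close>
  have upper: "g n (aut (xs n)) < c0 + 1 / real (Suc n)"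
    if n: "n \<in> I1" and aut: "hom_on L aut" "aut ` L \<subseteq> L" "\<forall>x\<in>G. aut x = x" for n aut
  proof -
    define f where "f = restrict (\<lambda>x. g n (aut x)) L"
    have f: "f \<in> absolute_values L" "normalized_abs f"
      unfolding f_def by (rule compose_absolute_value[OF L(1) aut(1,2) ga(1,2)[OF n]])+
    have fixK: "aut x = x" if "x \<in> K" for x
      using hom_fixes_span[OF L(1) aut(1) _ aut(3)] G that L(2) by blast
    have "restrict f K = restrict (g n) K"
    proof
      fix x show "restrict f K x = restrict (g n) K x"
        using L(2) fixK by (cases "x \<in> K") (auto simp: f_def)
    qed
    then have "restrict f K \<in> v n" using ga(3)[OF n] by simp
    note pa = place_above_normalized[OF Ks L(1,2) f vK this]
    have "place_abs (place_of L f) (xs n) < C (v n) + 1 / real (Suc n)" using onS vS pa(1) by blast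
    then show ?thesis using pa(2) xsL n by (simp add: f_def I1_def)
  qed
  obtain R m where m: "m > 0" and sb: "\<forall>xs\<in>L. (\<forall>v\<in>S. \<forall>w\<in>places_above K L v. place_abs w xs < C v + 1) \<longrightarrow>
    (\<forall>v\<in>places K - S. \<forall>w\<in>places_above K L v. place_abs w xs \<le> 1) \<longrightarrow> size_bound L R m xs"
    using size_bound_uniform[OF assms(1,3,4), folded L_def] by blast
  have size: "size_bound L R m (xs n)" for n
  proof -
    have "\<forall>v\<in>S. \<forall>w\<in>places_above K L v. place_abs w (xs n) < C v + 1"
    proof (intro ballI)
      fix u w' assume "u \<in> S" "w' \<in> places_above K L u"
      then have "place_abs w' (xs n) < C u + 1 / real (Suc n)" using onS by blast
      moreover have "1 / real (Suc n) \<le> 1" by simp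
      ultimately show "place_abs w' (xs n) < C u + 1" by linarith
    qed
    then show ?thesis using sb[rule_format, OF xsL, of n] offS[of n] by blast
  qed
  obtain E B where E: "finite E \<and> E \<subseteq> L \<and> (\<forall>x\<in>L. size_bound L R m x \<longrightarrow> esum E B x)"
    by atomize_elim (rule L(5)[unfolded bounded_repr_def, rule_format, OF m])
  note E = E[THEN conjunct1] E[THEN conjunct2, THEN conjunct1] E[THEN conjunct2, THEN conjunct2]
  have "\<forall>n. \<exists>e z. (\<forall>j<B. e j \<in> E \<and> root_unity (z j)) \<and> xs n = (\<Sum>j<B. e j * z j)"
    using E(3) xsL size unfolding esum_def by blast
  then obtain e z where "\<forall>n. (\<forall>j<B. e n j \<in> E \<and> root_unity (z n j)) \<and> xs n = (\<Sum>j<B. e n j * z n j)" by metis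
  then have ez: "\<And>n j. j < B \<Longrightarrow> e n j \<in> E" "\<And>n j. j < B \<Longrightarrow> root_unity (z n j)" "\<And>n. xs n = (\<Sum>j<B. e n j * z n j)" by blast+
  \<comment> \<open>There are finitely many patterns of coefficients, so one of them occurs
    infinitely often.\<close>
  have "finite (PiE {..<B} (\<lambda>_. E))" using E(1) by (intro finite_PiE) auto
  moreover have "(\<lambda>j\<in>{..<B}. e n j) \<in> PiE {..<B} (\<lambda>_. E)" for n using ez(1) by auto
  ultimately obtain c where c: "infinite {n\<in>I1. (\<lambda>j\<in>{..<B}. e n j) = c}"
    using infinite_pigeonhole[OF I1, of "PiE {..<B} (\<lambda>_. E)" "\<lambda>n. \<lambda>j\<in>{..<B}. e n j"] by blast
  define I2 where "I2 = {n\<in>I1. (\<lambda>j\<in>{..<B}. e n j) = c}"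
  have I2: "infinite I2" "I2 \<subseteq> I1" using c by (auto simp: I2_def)
  have ec: "e n j = c j" if "n \<in> I2" "j < B" for n j using that by (auto simp: I2_def)
  have xsc: "xs n = (\<Sum>j<B. c j * z n j)" if "n \<in> I2" for n using ez(3)[of n] ec[OF that] by simp
  have cL: "c j \<in> L" if "j < B" for j
  proof -
    have "\<exists>n. n \<in> I2" unfolding ex_in_conv using I2(1) by (rule infinite_imp_nonempty)
    then show ?thesis using ec[OF _ that] ez(1)[OF that] E(2) by (metis subsetD)
  qed
  define A where "A = {n\<in>I2. \<exists>t. hom_on L t \<and> (\<forall>x\<in>L. g n x = cmod (t x))}"
  have nonarch: "\<exists>p. nonarch_abs L (g n) p" if "n \<in> I2 - A" for n
  proof -
    have nI: "n \<in> I1" using that I2 by blast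
    have "(\<forall>x\<in>L. \<forall>y\<in>L. g n (x + y) \<le> max (g n x) (g n y)) \<and> (\<exists>p. prime p \<and> (\<forall>q. g n (of_rat q) = padic_abs p q))"
      using place_normalized_cases[OF L(1,4) iL wL[OF nI]] that unfolding A_def g_def by blast
    then obtain p where "prime p" "\<forall>q. g n (of_rat q) = padic_abs p q" "\<forall>x\<in>L. \<forall>y\<in>L. g n (x + y) \<le> max (g n x) (g n y)" by blast
    then have "nonarch_abs L (g n) p" using ga(1)[OF nI] by unfold_locales auto
    then show ?thesis ..
  qed
  have GL: "G \<subseteq> L" using G(2) L(2) by blast
  show False
  proof (cases "finite A")
    case False
    have AI: "A \<subseteq> I1" "A \<subseteq> I2" using I2 by (auto simp: A_def)
    have "\<forall>n\<in>A. \<exists>t. hom_on L t \<and> (\<forall>x\<in>L. g n x = cmod (t x))" by (simp add: A_def)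
    then obtain tau where tau: "\<forall>n\<in>A. hom_on L (tau n) \<and> (\<forall>x\<in>L. g n x = cmod (tau n x))" by metis
    interpret A: cyclotomic_sequence L A B c z xs
      using L(3) False cL ez(2) xsc AI by unfold_locales auto
    show False
    proof (rule A.arch_no_sequence[OF L(4,6) G(1) GL])
      show "hom_on L (tau n)" if "n \<in> A" for n using tau that by blast
      show "cmod (tau n (xs n)) > c0" if "n \<in> A" for n using tau that w(2)[of n] AI xsL by (auto simp: g_def)
      show "cmod (tau n (aut (xs n))) < c0 + 1 / real (Suc n)"
        if "n \<in> A" "hom_on L aut" "aut ` L \<subseteq> L" "\<forall>x\<in>G. aut x = x" for n aut
      proof -
        have "aut (xs n) \<in> L" using that(3) xsL by blast
        then show ?thesis using upper[OF _ that(2-4), of n] tau that(1) AI by auto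
      qed
    qed (use c0 in auto)
  next
    case True
    then have inf: "infinite (I2 - A)" using I2(1) by (intro Diff_infinite_finite)
    obtain p where pp: "\<And>n. n \<in> I2 - A \<Longrightarrow> nonarch_abs L (g n) (p n)" using nonarch by metis
    \<comment> \<open>A nonarchimedean place in \<open>S\<close> has \<open>C v > 1\<close>, and
      there are finitely many of those, so only finitely many primes \<open>p n\<close>
      occur.\<close>
    have pV: "p n \<in> place_prime ` V" if n: "n \<in> I2 - A" for n
    proof -
      have nI: "n \<in> I1" using n I2 by blast
      interpret nonarch_abs L "g n" "p n" using pp[OF n] .
      interpret KS: subfield_of K using Ks by unfold_locales
      have "restrict (g n) K (x + y) \<le> max (restrict (g n) K x) (restrict (g n) K y)" if "x \<in> K" "y \<in> K" for x y
        using that KS.add[OF that] um L(2) by auto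
      then have "\<not> archimedean_place K (v n)" by (rule ultrametric_not_archimedean[OF Ks vK ga(3)[OF nI]])
      then have vV: "v n \<in> V" using vS[of n] assms(4) by (auto simp: V_def)
      have rat: "restrict (g n) K (of_rat q) = padic_abs (p n) q" for q
      proof -
        have "of_rat q \<in> K" using Rats_in_subfield[OF Ks] by auto
        then show ?thesis using fQ by (simp only: restrict_def if_True)
      qed
      have "place_prime (v n) = p n"
        by (rule place_prime_eq[OF Ks vK ga(3)[OF nI] nonarch_abs.p[OF pp[OF n]] rat])
      then show ?thesis using vV by force
    qed
    from infinite_pigeonhole[where g = p, OF inf finite_imageI[OF assms(3)[folded V_def]] pV]
    obtain p0 where p0: "infinite {n\<in>I2 - A. p n = p0}" by blast
    define I3 where "I3 = {n\<in>I2 - A. p n = p0}"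
    have I3: "I3 \<subseteq> I2" "I3 \<subseteq> I1" "\<And>n. n \<in> I3 \<Longrightarrow> nonarch_abs L (g n) p0" using pp I2 by (auto simp: I3_def)
    interpret A: cyclotomic_sequence L I3 B c z xs
      using L(3) p0 cL ez(2) xsc I3(1) unfolding I3_def[symmetric] by unfold_locales auto
    show False
    proof (rule A.nonarch_no_sequence[OF L(4,6) G(1) GL])
      show "nonarch_abs L (g n) p0" if "n \<in> I3" for n using I3(3) that .
      show "g n (xs n) > c0" if "n \<in> I3" for n using w(2)[of n] that I3 by (auto simp: g_def)
      show "g n (aut (xs n)) < c0 + 1 / real (Suc n)"
        if "n \<in> I3" "hom_on L aut" "aut ` L \<subseteq> L" "\<forall>x\<in>G. aut x = x" for n aut
        using upper[OF _ that(2-4)] that(1) I3 by blast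
    qed (use c0 in auto)
  qed
qed

end
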